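(* Suppose that $\lambda>\lambda_0=3/2^{2/3}$. Choose $r_1$ with $0<r_1<\frac12$. Let $$\mu=\int_{(1-r_1)\pi}^{(1-\frac{r_1}{2})\pi}\sin s\,ds.$$ Choose $\delta>0$ so that (i) $\delta<\underline U(\frac{r_1}{2}\pi)-\underline U(0)$, and (ii) whenever $\bar U(t)-\delta<u<\bar U(t)$ for some $t$, then $|u^3-\lambda u+\cos t|<\mu$. Let $S_\delta$ denote the set of points $(t,u)$ such that $0\le t\le\pi$, $-b\le u\le b$, and $$-b\le u\le\underline U(t)+\delta\ \text{ if } 0\le t\le r_1\pi,\qquad \bar U(t)-\delta\le u\le b\ \text{ if } (1-r_1)\pi\le t\le\pi.$$ Then for sufficiently small $\varepsilon>0$, $u_p$ is the only $2\pi$-periodic solution of $\varepsilon^2u''=u^3-\lambda u+\cos t$ with $u'(0)=u'(\pi)=0$ whose graph over $[0,\pi]$ lies in $S_\delta$. Further, $u_p|_{[0,\pi]}$ is a stable attractor for the problem $$u_\tau=\varepsilon^2u_{xx}-(u^3-\lambda u+\cos x),\quad 0<x<L,\qquad u_x(0,\tau)=u_x(L,\tau)=0, \qquad (P_L)$$ with $L=\pi$. Also, suppose that $S_\delta$ is extended to $[0,2\pi]$ by the operation $(t,u)\to(2\pi-t,u)$, and then periodically to $[0,\infty)$. Then for any positive integer $k$, $u_p$ is the unique solution of $\varepsilon^2u''=u^3-\lambda u+\cos t$ satisfying $u'(0)=u'(k\pi)=0$ whose graph (over $[0,k\pi]$) lies in the extended set $S_\delta$, and its restriction to $[0,k\pi]$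 is a stable attractor for $(P_L)$ with $L=k\pi$.
   Context: For $\lambda>\lambda_0$, $\bar U(t)>U_0(t)>\underline U(t)$ are the three real roots of $u^3-\lambda u+\cos t=0$. The number $b>0$ is fixed with $b^3-\lambda b-1>0$. For each $\varepsilon>0$, $u_p$ is the unique $2\pi$-periodic solution of $\varepsilon^2u''=u^3-\lambda u+\cos t$ with $u'(0)=0$, $u(\pi/2)=0$ and $u'>0$ on $(0,\pi/2)$. "Stable attractor" means asymptotically stable equilibrium of the parabolic problem (in the usual sense for semilinear parabolic equations). *)

theory Defs
  imports "HOL-Analysis.Analysis"
begin

definition cubic :: "real \<Rightarrow> real \<Rightarrow> real \<Rightarrow> real" where
  "cubic \<Lambda> t u = u ^ 3 - \<Lambda> * u + cos t"

text \<open>\<open>ode_solution_on \<Lambda> \<epsilon> I u u'\<close>: on \<open>I\<close>, \<open>u\<close> solves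
  \<open>\<epsilon>\<^sup>2 u'' = u\<^sup>3 - \<Lambda> u + cos t\<close> and \<open>u'\<close> is its first derivative
  (one-sided at end points belonging to \<open>I\<close>).\<close>

definition ode_solution_on ::
    "real \<Rightarrow> real \<Rightarrow> real set \<Rightarrow> (real \<Rightarrow> real) \<Rightarrow> (real \<Rightarrow> real) \<Rightarrow> bool" where
  "ode_solution_on \<Lambda> \<epsilon> I u u' \<longleftrightarrow>
     (\<forall>t\<in>I. (u has_real_derivative u' t) (at t within I) \<and>
            (\<exists>u''. (u' has_real_derivative u'') (at t within I) \<and>
                   \<epsilon>\<^sup>2 * u'' = cubic \<Lambda> t (u t)))"

definition neumann_solution :: "real \<Rightarrow> real \<Rightarrow> real \<Rightarrow> (real \<Rightarrow> real) \<Rightarrow> bool" where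
  "neumann_solution \<Lambda> \<epsilon> L u \<longleftrightarrow>
     (\<exists>u'. ode_solution_on \<Lambda> \<epsilon> {0..L} u u' \<and> u' 0 = 0 \<and> u' L = 0)"

definition periodic_neumann_solution :: "real \<Rightarrow> real \<Rightarrow> (real \<Rightarrow> real) \<Rightarrow> bool" where
  "periodic_neumann_solution \<Lambda> \<epsilon> u \<longleftrightarrow>
     (\<exists>u'. ode_solution_on \<Lambda> \<epsilon> UNIV u u' \<and> (\<forall>t. u (t + 2 * pi) = u t) \<and>
           u' 0 = 0 \<and> u' pi = 0)"

definition u\<^sub>p :: "real \<Rightarrow> real \<Rightarrow> real \<Rightarrow> real" where
  "u\<^sub>p \<Lambda> \<epsilon> = (THE u. \<exists>u'. ode_solution_on \<Lambda> \<epsilon> UNIV u u' \<and>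
      (\<forall>t. u (t + 2 * pi) = u t) \<and> u' 0 = 0 \<and> u (pi / 2) = 0 \<and>
      (\<forall>t\<in>{0<..<pi / 2}. u' t > 0))"

text \<open>\<open>Ulo\<close> and \<open>Uup\<close> stand for the smallest and the largest root of the cubic.\<close>

definition S\<^sub>\<delta> ::
    "(real \<Rightarrow> real) \<Rightarrow> (real \<Rightarrow> real) \<Rightarrow> real \<Rightarrow> real \<Rightarrow> real \<Rightarrow> (real \<times> real) set" where
  "S\<^sub>\<delta> Ulo Uup b r\<^sub>1 \<delta> =
     {(t, u). 0 \<le> t \<and> t \<le> pi \<and> - b \<le> u \<and> u \<le> b \<and>
        (0 \<le> t \<and> t \<le> r\<^sub>1 * pi \<longrightarrow> - b \<le> u \<and> u \<le> Ulo t + \<delta>) \<and>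
        ((1 - r\<^sub>1) * pi \<le> t \<and> t \<le> pi \<longrightarrow> Uup t - \<delta> \<le> u \<and> u \<le> b)}"

definition extend_set :: "(real \<times> real) set \<Rightarrow> (real \<times> real) set" where
  "extend_set S =
     (\<Union>n::nat. (\<lambda>(t, u). (t + 2 * pi * real n, u)) ` (S \<union> (\<lambda>(t, u). (2 * pi - t, u)) ` S))"

definition graph_in :: "real \<Rightarrow> (real \<Rightarrow> real) \<Rightarrow> (real \<times> real) set \<Rightarrow> bool" where
  "graph_in L u S \<longleftrightarrow> (\<forall>t\<in>{0..L}. (t, u t) \<in> S)"

text \<open>Global classical solutions \<open>v \<tau> x\<close> of
  \<open>v\<^sub>\<tau> = \<epsilon>\<^sup>2 v\<^sub>x\<^sub>x - (v\<^sup>3 - \<Lambda> v + cos x)\<close> on \<open>0 < x < L\<close>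
  with Neumann boundary conditions. The solution is continuous up to \<open>\<tau> = 0\<close>, while equation
  and boundary conditions are imposed for \<open>\<tau> > 0\<close> only, so that every continuous function
  qualifies as initial value.\<close>

definition parabolic_solution ::
    "real \<Rightarrow> real \<Rightarrow> real \<Rightarrow> (real \<Rightarrow> real \<Rightarrow> real) \<Rightarrow> bool" where
  "parabolic_solution \<Lambda> \<epsilon> L v \<longleftrightarrow>
     continuous_on ({0..} \<times> {0..L}) (\<lambda>(\<tau>, x). v \<tau> x) \<and>
     (\<exists>v\<^sub>x. \<forall>\<tau>>0.
        (\<forall>x\<in>{0..L}. (v \<tau> has_real_derivative v\<^sub>x \<tau> x) (at x within {0..L})) \<and>
        v\<^sub>x \<tau> 0 = 0 \<and> v\<^sub>x \<tau> L = 0 \<and>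
        (\<forall>x\<in>{0<..<L}. \<exists>v\<^sub>\<tau> v\<^sub>x\<^sub>x.
            ((\<lambda>s. v s x) has_real_derivative v\<^sub>\<tau>) (at \<tau>) \<and>
            (v\<^sub>x \<tau> has_real_derivative v\<^sub>x\<^sub>x) (at x) \<and>
            v\<^sub>\<tau> = \<epsilon>\<^sup>2 * v\<^sub>x\<^sub>x - cubic \<Lambda> x (v \<tau> x)))"

text \<open>Asymptotic stability of an equilibrium \<open>u\<close>, in the phase space of continuous functions
  on \<open>[0, L]\<close> with the supremum norm: solutions starting near \<open>u\<close> exist for all times
  (first clause after the equilibrium condition), stay near \<open>u\<close>, and converge to \<open>u\<close>.\<close>

definition stable_attractor :: "real \<Rightarrow> real \<Rightarrow> real \<Rightarrow> (real \<Rightarrow> real) \<Rightarrow> bool" where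
  "stable_attractor \<Lambda> \<epsilon> L u \<longleftrightarrow>
     neumann_solution \<Lambda> \<epsilon> L u \<and>
     (\<exists>\<rho>>0. \<forall>v\<^sub>0. continuous_on {0..L} v\<^sub>0 \<and> (\<forall>x\<in>{0..L}. \<bar>v\<^sub>0 x - u x\<bar> < \<rho>) \<longrightarrow>
        (\<exists>v. parabolic_solution \<Lambda> \<epsilon> L v \<and> (\<forall>x\<in>{0..L}. v 0 x = v\<^sub>0 x))) \<and>
     (\<forall>\<eta>>0. \<exists>\<rho>>0. \<forall>v. parabolic_solution \<Lambda> \<epsilon> L v \<and>
        (\<forall>x\<in>{0..L}. \<bar>v 0 x - u x\<bar> < \<rho>) \<longrightarrow> (\<forall>\<tau>\<ge>0. \<forall>x\<in>{0..L}. \<bar>v \<tau> x - u x\<bar> < \<eta>)) \<and>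
     (\<exists>\<rho>>0. \<forall>v. parabolic_solution \<Lambda> \<epsilon> L v \<and>
        (\<forall>x\<in>{0..L}. \<bar>v 0 x - u x\<bar> < \<rho>) \<longrightarrow> uniform_limit {0..L} v u at_top)"

end

theory Submission
  imports Defs "HOL-Probability.Probability" "HOL-Real_Asymp.Real_Asymp"
begin

text \<open>Set \<open>m = sqrt (\<Lambda> / 3)\<close>; the cubic increases in \<open>u\<close> for \<open>|u| > m\<close>. A solution with graph in \<open>S\<^sub>\<delta>\<close>
  satisfies \<open>u < - m\<close> near \<open>0\<close> and \<open>u > m\<close> near \<open>\<pi>\<close>; condition (ii) and the energy identity force it to increase
  strictly in between. Two Neumann solutions that differ at \<open>0\<close> separate at the rate \<open>exp (\<kappa> t / \<epsilon>)\<close> near \<open>0\<close>.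
  Parametrizing the transition layer by \<open>u\<close>, the monotonicity of \<open>cos\<close> makes the leading solution also the faster one,
  so that values and derivatives are still ordered strictly at \<open>\<pi>\<close>, hence at every \<open>k \<pi>\<close>: the second Neumann
  condition fails. The solution \<open>u\<^sub>p\<close> is obtained on a quarter period by monotone iteration and then reflected.

  For stability, \<open>u\<^sub>p'\<close> plus a small multiple of a hyperbolic cosine, continued evenly, is a strict positive
  supersolution \<open>\<Phi>\<close> of the linearization, so solutions starting between \<open>u\<^sub>p \<plusminus> B \<Phi>\<close> stay between
  \<open>u\<^sub>p \<plusminus> B e\<^sup>-\<^sup>\<gamma>\<^sup>\<tau> \<Phi>\<close>. Global solutions come from a fixed point of Duhamel's formula in the cosine basis with truncated
  nonlinearity; the barrier shows that the truncation is never active.\<close>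

section \<open>Comparison and uniqueness for the equation\<close>

text \<open>The coefficient \<open>3 * u\<^sup>2 - \<Lambda>\<close> of the linearization is
  positive only for |u| > m, so two solutions can be compared at equal times near 0 and near \<pi>,
  but not across the layer. At equal heights a comparison survives: d(w^2)/du = 2 (u^3 - \<Lambda> u
  + cos t) / \<epsilon>^2, and in the difference of two solutions everything but the cosines
  cancels. Passing from one kind of comparison to the other requires small \<epsilon>: slopes are
  known only up to a power of 1/\<epsilon>, against which the exponential growth of a gap has to
  win. The point symmetry (t, u) -> (\<pi> - t, -u) transfers every statement about the left region
  to the right one.

  For the parabolic problem it matters that L is a multiple of \<pi>: cos x is then itself a Neumann
  cosine mode, so the cubic nonlinearity maps absolutely summable cosine amplitudes to absolutely
  summable ones. Stability uses no spectral theory; a pointwise barrier, possibly with kinks,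
  handles merely continuous initial values in the sup norm.\<close>

lemma continuous_negI:
  fixes f :: "real \<Rightarrow> real"
  assumes f: "continuous_on {a..b} f" and "f a < 0"
    and step: "\<And>T. a < T \<Longrightarrow> T \<le> b \<Longrightarrow> (\<And>t. a \<le> t \<Longrightarrow> t < T \<Longrightarrow> f t < 0) \<Longrightarrow> f T \<noteq> 0"
    and t: "t \<in> {a..b}"
  shows "f t < 0"
proof (rule ccontr)
  assume neg: "\<not> f t < 0"
  define Z where "Z = {x \<in> {a..t}. f x \<ge> 0}"
  have ct: "continuous_on {a..t} f" using f by (rule continuous_on_subset) (use t in auto)
  have "closed Z" unfolding Z_def
    by (rule continuous_on_closed_Collect_le[OF continuous_on_const ct closed_atLeastAtMost])
  moreover have tZ: "t \<in> Z" using neg t by (auto simp: Z_def)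
  moreover have bb: "bdd_below Z" by (rule bdd_belowI[of _ a]) (auto simp: Z_def)
  ultimately have TZ: "Inf Z \<in> Z" by (intro closed_contains_Inf) auto
  define T where "T = Inf Z"
  have lt: "f x < 0" if "a \<le> x" "x < T" for x
  proof (rule ccontr)
    assume "\<not> f x < 0"
    then have "x \<in> Z" using that TZ by (auto simp: Z_def T_def)
    then have "T \<le> x" unfolding T_def using bb by (rule cInf_lower)
    then show False using that by simp
  qed
  have T: "a \<le> T" "T \<le> t" "f T \<ge> 0" using TZ by (auto simp: Z_def T_def)
  have aT: "a < T" using T \<open>f a < 0\<close> by (cases "a = T") auto
  have "f T \<noteq> 0" using step[OF aT _ lt] T t by auto
  then have "f T > 0" using T by simp
  then obtain x where "a \<le> x" "x \<le> T" "f x = 0"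
    using IVT'[of f a 0 T] \<open>f a < 0\<close> T continuous_on_subset[OF ct] by auto
  then show False using lt[of x] \<open>f T > 0\<close> by (cases "x = T") auto
qed

lemma continuous_on_Icc_bounded:
  fixes f :: "real \<Rightarrow> real"
  assumes "continuous_on {a..b} f"
  obtains M where "M > 0" "\<And>t. t \<in> {a..b} \<Longrightarrow> \<bar>f t\<bar> \<le> M"
proof -
  have "bounded (f ` {a..b})"
    using assms by (intro compact_imp_bounded compact_continuous_image) auto
  then show ?thesis using that unfolding bounded_pos by auto
qed

lemma deriv_within_mono:
  fixes f :: "real \<Rightarrow> real"
  assumes f: "\<And>t. t \<in> {a..b} \<Longrightarrow> (f has_real_derivative f' t) (at t within {a..b})"
    and "a \<le> s" "s \<le> t" "t \<le> b" and "\<And>x. s < x \<Longrightarrow> x < t \<Longrightarrow> f' x \<ge> 0"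
  shows "f s \<le> f t"
proof (rule DERIV_nonneg_imp_increasing_open[where f = f])
  show "continuous_on {s..t} f"
    using assms by (intro DERIV_continuous_on[where D = f'] DERIV_subset[OF f]) auto
  fix x assume "s < x" "x < t"
  then show "\<exists>y. DERIV f x :> y \<and> y \<ge> 0"
    using f[of x] assms by (intro exI[of _ "f' x"]) (auto simp: at_within_Icc_at)
qed (use assms in auto)

lemma deriv_within_strict_mono:
  fixes f :: "real \<Rightarrow> real"
  assumes f: "\<And>t. t \<in> {a..b} \<Longrightarrow> (f has_real_derivative f' t) (at t within {a..b})"
    and "a \<le> s" "s < t" "t \<le> b" and "\<And>x. s < x \<Longrightarrow> x < t \<Longrightarrow> f' x > 0"
  shows "f s < f t"
proof (rule DERIV_pos_imp_increasing_open[where f = f])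
  show "continuous_on {s..t} f"
    using assms by (intro DERIV_continuous_on[where D = f'] DERIV_subset[OF f]) auto
  fix x assume "s < x" "x < t"
  then show "\<exists>y. DERIV f x :> y \<and> y > 0"
    using f[of x] assms by (intro exI[of _ "f' x"]) (auto simp: at_within_Icc_at)
qed (use assms in auto)

lemma deriv_within_mono_le:
  fixes f g :: "real \<Rightarrow> real"
  assumes f: "\<And>t. t \<in> {a..b} \<Longrightarrow> (f has_real_derivative f' t) (at t within {a..b})"
    and g: "\<And>t. t \<in> {a..b} \<Longrightarrow> (g has_real_derivative g' t) (at t within {a..b})"
    and "a \<le> s" "s \<le> t" "t \<le> b" and "\<And>x. s < x \<Longrightarrow> x < t \<Longrightarrow> f' x \<le> g' x"
  shows "f t - f s \<le> g t - g s"
proof -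
  have "(\<lambda>t. g t - f t) s \<le> (\<lambda>t. g t - f t) t"
    by (rule deriv_within_mono[where a=a and b=b and f' = "\<lambda>t. g' t - f' t"])
       (use assms in \<open>auto intro!: derivative_intros\<close>)
  then show ?thesis by simp
qed

lemma deriv_within_right_neg:
  fixes f :: "real \<Rightarrow> real"
  assumes f: "(f has_real_derivative l) (at x within {a..b})" and "a \<le> x" "x < c" "c \<le> b"
    and "\<And>t. x < t \<Longrightarrow> t < c \<Longrightarrow> f t \<le> f x"
  shows "l \<le> 0"
proof (rule ccontr)
  assume "\<not> l \<le> 0"
  then obtain d where d: "d > 0" "\<And>h. 0 < h \<Longrightarrow> x + h \<in> {a..b} \<Longrightarrow> h < d \<Longrightarrow> f x < f (x + h)"
    using has_real_derivative_pos_inc_right[OF f] by auto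
  define h where "h = min d (c - x) / 2"
  have "0 < h" "h < d" "x + h < c" using d assms by (auto simp: h_def min_def field_simps)
  then show False using d(2)[of h] assms(5)[of "x + h"] assms(2-4) by simp
qed

lemma deriv_within_left_pos:
  fixes f :: "real \<Rightarrow> real"
  assumes f: "(f has_real_derivative l) (at x within {a..b})" and "x \<le> b" "c < x" "a \<le> c"
    and "\<And>t. c < t \<Longrightarrow> t < x \<Longrightarrow> f t \<ge> f x"
  shows "l \<le> 0"
proof (rule ccontr)
  assume "\<not> l \<le> 0"
  then obtain d where d: "d > 0" "\<And>h. 0 < h \<Longrightarrow> x - h \<in> {a..b} \<Longrightarrow> h < d \<Longrightarrow> f (x - h) < f x"
    using has_real_derivative_pos_inc_left[OF f] by auto
  define h where "h = min d (x - c) / 2"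
  have "0 < h" "h < d" "c < x - h" using d assms by (auto simp: h_def min_def field_simps)
  then show False using d(2)[of h] assms(5)[of "x - h"] assms(2-4) by simp
qed

text \<open>A second order maximum principle for an initial value problem: adding \<open>\<eta> e\<^sup>K\<^sup>t\<close>
  makes all inequalities strict.\<close>

lemma second_order_comparison:
  fixes y y1 y2 p :: "real \<Rightarrow> real"
  assumes y: "\<And>t. t \<in> {a..b} \<Longrightarrow> (y has_real_derivative y1 t) (at t within {a..b})"
    and y1: "\<And>t. t \<in> {a..b} \<Longrightarrow> (y1 has_real_derivative y2 t) (at t within {a..b})"
    and "y a \<ge> 0" "y1 a \<ge> 0"
    and p: "\<And>t. t \<in> {a..b} \<Longrightarrow> 0 \<le> p t \<and> p t \<le> P"
    and le: "\<And>t. t \<in> {a..b} \<Longrightarrow> p t * y t \<le> y2 t"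
    and t: "t \<in> {a..b}"
  shows "y t \<ge> 0" "y1 t \<ge> 0"
proof -
  \<comment> \<open>K^2 dominates p, so the added term \<eta> e^(K(t - a)) has a second derivative
    at least p times itself, and the perturbed function keeps the differential inequality.\<close>
  define K where "K = \<bar>P\<bar> + 1"
  have K: "K \<ge> 1" "P \<le> K\<^sup>2"
    using mult_mono[of 1 K 1 K] mult_mono[of "\<bar>P\<bar>" K 1 K] by (auto simp: K_def power2_eq_square)
  have main: "y1 t + \<eta> * K * exp (K * (t - a)) > 0 \<and> y t + \<eta> * exp (K * (t - a)) \<ge> 0"
    if "\<eta> > 0" and t: "t \<in> {a..b}" for \<eta> t
  proof -
    let ?E = "\<lambda>t. y t + \<eta> * exp (K * (t - a))"
    let ?E1 = "\<lambda>t. y1 t + \<eta> * K * exp (K * (t - a))"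
    let ?E2 = "\<lambda>t. y2 t + \<eta> * K * K * exp (K * (t - a))"
    have E: "(?E has_real_derivative ?E1 t) (at t within {a..b})" if "t \<in> {a..b}" for t
      using y[OF that] by (auto intro!: derivative_eq_intros)
    have E1: "(?E1 has_real_derivative ?E2 t) (at t within {a..b})" if "t \<in> {a..b}" for t
      using y1[OF that] by (auto intro!: derivative_eq_intros)
    have pos: "- ?E1 t < 0" if "t \<in> {a..b}" for t
    proof (rule continuous_negI[OF _ _ _ that])
      show "continuous_on {a..b} (\<lambda>t. - ?E1 t)"
        by (intro continuous_on_minus DERIV_continuous_on[OF E1])
      show "- ?E1 a < 0" using add_nonneg_pos[OF \<open>y1 a \<ge> 0\<close>, of "\<eta> * K"] \<open>\<eta> > 0\<close> K by simp
      fix T assume T: "a < T" "T \<le> b" and neg: "\<And>t. a \<le> t \<Longrightarrow> t < T \<Longrightarrow> - ?E1 t < 0"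
      have Epos: "?E t \<ge> 0" if "a \<le> t" "t \<le> T" for t
      proof -
        have "?E a \<le> ?E t"
          by (rule deriv_within_mono[OF E]) (use that T in \<open>auto\<close>, smt (verit) neg)
        then show ?thesis using assms \<open>\<eta> > 0\<close> by simp
      qed
      have "?E1 a \<le> ?E1 T"
      proof (rule deriv_within_mono[OF E1])
        fix x assume x: "a < x" "x < T"
        then have xi: "x \<in> {a..b}" using T by auto
        have "0 \<le> p x * ?E x" using p[OF xi] Epos[of x] x by simp
        also have "\<dots> = p x * y x + p x * (\<eta> * exp (K * (x - a)))" by (simp add: algebra_simps)
        also have "\<dots> \<le> y2 x + K\<^sup>2 * (\<eta> * exp (K * (x - a)))"
          using le[OF xi] p[OF xi] K \<open>\<eta> > 0\<close> by (intro add_mono mult_right_mono) auto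
        finally show "0 \<le> ?E2 x" by (simp add: power2_eq_square algebra_simps)
      qed (use T in auto)
      then show "- ?E1 T \<noteq> 0" using \<open>- ?E1 a < 0\<close> by linarith
    qed
    have "?E a \<le> ?E t"
      by (rule deriv_within_mono[OF E]) (use t in auto, smt (verit) pos atLeastAtMost_iff)
    then show ?thesis using pos[OF t] assms \<open>\<eta> > 0\<close> by auto
  qed
  have lim: "(\<lambda>n. c + inverse (real (Suc n)) * d) \<longlonglongrightarrow> c + 0 * d" for c d :: real
    by (intro tendsto_intros LIMSEQ_inverse_real_of_nat)
  have "0 \<le> y t + 0 * exp (K * (t - a))"
    by (rule LIMSEQ_le_const[OF lim]) (use main[OF _ t] in auto)
  then show "y t \<ge> 0" by simp
  have "0 \<le> y1 t + 0 * (K * exp (K * (t - a)))"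
  proof (rule LIMSEQ_le_const[OF lim], intro exI allI impI)
    fix n :: nat
    have "inverse (real (Suc n)) > 0" by simp
    from main[OF this t] show "0 \<le> y1 t + inverse (real (Suc n)) * (K * exp (K * (t - a)))"
      by (simp only: mult.assoc less_imp_le)
  qed
  then show "y1 t \<ge> 0" by simp
qed

lemma ode_solution_on_iff:
  assumes "\<epsilon> \<noteq> 0"
  shows "ode_solution_on \<Lambda> \<epsilon> I u w \<longleftrightarrow>
    (\<forall>t\<in>I. (u has_real_derivative w t) (at t within I) \<and>
           (w has_real_derivative cubic \<Lambda> t (u t) / \<epsilon>\<^sup>2) (at t within I))"
proof -
  have "(\<epsilon>\<^sup>2 * d = c) = (d = c / \<epsilon>\<^sup>2)" for d c :: real
    using assms by (simp add: field_simps)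
  then show ?thesis unfolding ode_solution_on_def by simp
qed

lemma ode_solution_on_subset:
  "ode_solution_on \<Lambda> \<epsilon> I u w \<Longrightarrow> J \<subseteq> I \<Longrightarrow> ode_solution_on \<Lambda> \<epsilon> J u w"
  unfolding ode_solution_on_def by (meson DERIV_subset subsetD)

lemma cubic_solution_deriv:
  assumes "(u has_real_derivative l) (at t within S)"
  shows "((\<lambda>t. cubic \<Lambda> t (u t)) has_real_derivative (3 * (u t)\<^sup>2 - \<Lambda>) * l - sin t) (at t within S)"
  unfolding cubic_def using assms
  by (auto intro!: derivative_eq_intros simp: algebra_simps power2_eq_square)

lemma cubic_diff: "cubic \<Lambda> t u - cubic \<Lambda> t v = (u\<^sup>2 + u * v + v\<^sup>2 - \<Lambda>) * (u - v)"
  unfolding cubic_def by (simp add: power2_eq_square power3_eq_cube algebra_simps)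

lemma cubic_reflect: "cos s = - cos t \<Longrightarrow> cubic \<Lambda> s (- u) = - cubic \<Lambda> t u"
  unfolding cubic_def by (simp add: power3_eq_cube)

lemma cubic_bound:
  assumes "\<bar>u\<bar> \<le> B"
  shows "\<bar>cubic \<Lambda> t u\<bar> \<le> B ^ 3 + \<bar>\<Lambda>\<bar> * B + 1"
proof -
  have "\<bar>u ^ 3\<bar> \<le> B ^ 3" using assms by (simp add: power_abs power_mono)
  moreover have "\<bar>\<Lambda> * u\<bar> \<le> \<bar>\<Lambda>\<bar> * B" using assms by (simp add: abs_mult mult_left_mono)
  ultimately show ?thesis using abs_cos_le_one[of t] unfolding cubic_def by linarith
qed

text \<open>Apart from the cosine the nonlinearity is odd in u, and the equation is autonomous and
  reversible in time. A change t -> \<sigma> t + s that multiplies cos by c is therefore compensated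
  by multiplying u by c. The reflections, translations and signs (-1)^j used below are
  instances.\<close>

lemma ode_transform:
  assumes u: "ode_solution_on \<Lambda> \<epsilon> I u w" and "\<epsilon> \<noteq> 0" and J: "\<And>t. t \<in> J \<Longrightarrow> \<sigma> * t + s \<in> I"
    and c: "c = 1 \<or> c = - 1" and \<sigma>: "\<sigma> = 1 \<or> \<sigma> = - 1" and cos: "\<And>t. cos (\<sigma> * t + s) = c * cos t"
  shows "ode_solution_on \<Lambda> \<epsilon> J (\<lambda>t. c * u (\<sigma> * t + s)) (\<lambda>t. c * \<sigma> * w (\<sigma> * t + s))"
  unfolding ode_solution_on_iff[OF \<open>\<epsilon> \<noteq> 0\<close>]
proof (intro ballI conjI)
  fix t assume t: "t \<in> J"
  have im: "(\<lambda>t. \<sigma> * t + s) ` J \<subseteq> I" using J by auto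
  have d: "((\<lambda>t. \<sigma> * t + s) has_real_derivative \<sigma>) (at t within J)"
    by (auto intro!: derivative_eq_intros)
  note uw = u[unfolded ode_solution_on_iff[OF \<open>\<epsilon> \<noteq> 0\<close>], rule_format, OF J[OF t]]
  from DERIV_image_chain[OF DERIV_subset[OF conjunct1[OF uw] im] d]
  show "((\<lambda>t. c * u (\<sigma> * t + s)) has_real_derivative c * \<sigma> * w (\<sigma> * t + s)) (at t within J)"
    by (auto simp: o_def mult_ac dest: DERIV_cmult[where c = c])
  from DERIV_cmult[OF DERIV_image_chain[OF DERIV_subset[OF conjunct2[OF uw] im] d], of "c * \<sigma>"]
  have "((\<lambda>t. c * \<sigma> * w (\<sigma> * t + s)) has_real_derivative
      c * \<sigma> * (cubic \<Lambda> (\<sigma> * t + s) (u (\<sigma> * t + s)) / \<epsilon>\<^sup>2 * \<sigma>)) (at t within J)" by (simp add: o_def)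
  also have "c * \<sigma> * (cubic \<Lambda> (\<sigma> * t + s) (u (\<sigma> * t + s)) / \<epsilon>\<^sup>2 * \<sigma>) =
      c * cubic \<Lambda> (\<sigma> * t + s) (u (\<sigma> * t + s)) / \<epsilon>\<^sup>2" using \<sigma> by auto
  also have "c * cubic \<Lambda> (\<sigma> * t + s) (u (\<sigma> * t + s)) = cubic \<Lambda> t (c * u (\<sigma> * t + s))"
    using c cos[of t] by (auto simp: cubic_def power3_eq_cube)
  finally show "((\<lambda>t. c * \<sigma> * w (\<sigma> * t + s)) has_real_derivative
      cubic \<Lambda> t (c * u (\<sigma> * t + s)) / \<epsilon>\<^sup>2) (at t within J)" .
qed

text \<open>Gronwall's argument for the energy \<open>D\<^sup>2 + D'\<^sup>2\<close> of the difference \<open>D\<close>.\<close>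

lemma ode_unique_within:
  assumes u: "ode_solution_on \<Lambda> \<epsilon> {a..b} u w" and v: "ode_solution_on \<Lambda> \<epsilon> {a..b} v x"
    and "\<epsilon> \<noteq> 0" and t0: "t0 \<in> {a..b}" and eq: "u t0 = v t0" "w t0 = x t0" and t: "t \<in> {a..b}"
  shows "u t = v t \<and> w t = x t"
proof -
  note uw = u[unfolded ode_solution_on_iff[OF \<open>\<epsilon> \<noteq> 0\<close>], rule_format]
  note vx = v[unfolded ode_solution_on_iff[OF \<open>\<epsilon> \<noteq> 0\<close>], rule_format]
  let ?q = "\<lambda>t. ((u t)\<^sup>2 + u t * v t + (v t)\<^sup>2 - \<Lambda>) / \<epsilon>\<^sup>2"
  have "continuous_on {a..b} u" "continuous_on {a..b} v"
    using uw vx by (meson DERIV_continuous_on)+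
  then have "continuous_on {a..b} ?q" by (intro continuous_intros) (use \<open>\<epsilon> \<noteq> 0\<close> in auto)
  then obtain M where M: "\<And>t. t \<in> {a..b} \<Longrightarrow> \<bar>?q t\<bar> \<le> M"
    using continuous_on_Icc_bounded by blast
  define D where "D t = u t - v t" for t
  define D1 where "D1 t = w t - x t" for t
  define E where "E t = (D t)\<^sup>2 + (D1 t)\<^sup>2" for t
  define K where "K = 1 + M"
  let ?E' = "\<lambda>t. 2 * (1 + ?q t) * (D t * D1 t)"
  have dD1: "(D1 has_real_derivative ?q t * D t) (at t within {a..b})" if "t \<in> {a..b}" for t
  proof -
    have "(D1 has_real_derivative cubic \<Lambda> t (u t) / \<epsilon>\<^sup>2 - cubic \<Lambda> t (v t) / \<epsilon>\<^sup>2) (at t within {a..b})"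
      unfolding D1_def using uw[OF that] vx[OF that] by (auto intro!: derivative_intros)
    also have "cubic \<Lambda> t (u t) / \<epsilon>\<^sup>2 - cubic \<Lambda> t (v t) / \<epsilon>\<^sup>2 = ?q t * D t"
      by (simp add: diff_divide_distrib[symmetric] cubic_diff D_def)
    finally show ?thesis .
  qed
  have dD: "(D has_real_derivative D1 t) (at t within {a..b})" if "t \<in> {a..b}" for t
    unfolding D_def D1_def using uw[OF that] vx[OF that] by (auto intro!: derivative_intros)
  have dE: "(E has_real_derivative ?E' t) (at t within {a..b})" if "t \<in> {a..b}" for t
    unfolding E_def using dD[OF that] dD1[OF that]
    by (auto intro!: derivative_eq_intros simp: algebra_simps)
  have bE: "\<bar>?E' t\<bar> \<le> K * E t" if "t \<in> {a..b}" for t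
  proof -
    have 1: "2 * \<bar>D t * D1 t\<bar> \<le> E t"
      using sum_squares_bound[of "\<bar>D t\<bar>" "\<bar>D1 t\<bar>"] by (simp add: E_def abs_mult)
    have "\<bar>?E' t\<bar> = \<bar>1 + ?q t\<bar> * (2 * \<bar>D t * D1 t\<bar>)"
      by (simp only: abs_mult) simp
    also have "\<dots> \<le> K * E t"
    proof (rule mult_mono)
      show "\<bar>1 + ?q t\<bar> \<le> K" "0 \<le> K" using M[OF that] unfolding K_def by linarith+
    qed (use 1 in auto)
    finally show ?thesis .
  qed
  have E0: "E t0 = 0" using eq by (simp add: E_def D_def D1_def)
  \<comment> \<open>The point t0 may be interior: E e^(-Kt) does not increase to its right, and E
    e^(Kt) does not decrease to its left.\<close>
  have "E t \<le> 0"
  proof (cases "t0 \<le> t")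
    case True
    have "- (E t0 * exp (- K * t0)) \<le> - (E t * exp (- K * t))"
    proof (rule deriv_within_mono[where f' = "\<lambda>t. - (?E' t * exp (- K * t) + E t * (exp (- K * t) * - K))"
          and f = "\<lambda>t. - (E t * exp (- K * t))" and a = a and b = b])
      fix t assume "t \<in> {a..b}"
      from dE[OF this] show "((\<lambda>t. - (E t * exp (- K * t))) has_real_derivative
          - (?E' t * exp (- K * t) + E t * (exp (- K * t) * - K))) (at t within {a..b})"
        by (auto intro!: derivative_eq_intros)
    next
      fix x assume "t0 < x" "x < t"
      then have "?E' x \<le> K * E x" using bE[of x] t t0 by auto
      then have "?E' x * exp (- K * x) \<le> K * E x * exp (- K * x)" by (intro mult_right_mono) auto
      then show "0 \<le> - (?E' x * exp (- K * x) + E x * (exp (- K * x) * - K))" by (simp add: algebra_simps)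
    qed (use t t0 True in auto)
    then show ?thesis using E0 by (simp add: mult_le_0_iff)
  next
    case False
    have "E t * exp (K * t) \<le> E t0 * exp (K * t0)"
    proof (rule deriv_within_mono[where f' = "\<lambda>t. ?E' t * exp (K * t) + E t * (exp (K * t) * K)"
          and f = "\<lambda>t. E t * exp (K * t)" and a = a and b = b])
      fix t assume "t \<in> {a..b}"
      from dE[OF this] show "((\<lambda>t. E t * exp (K * t)) has_real_derivative
          ?E' t * exp (K * t) + E t * (exp (K * t) * K)) (at t within {a..b})"
        by (auto intro!: derivative_eq_intros)
    next
      fix x assume "t < x" "x < t0"
      then have "- (K * E x) \<le> ?E' x" using bE[of x] t t0 by auto
      then have "- (K * E x) * exp (K * x) \<le> ?E' x * exp (K * x)" by (intro mult_right_mono) auto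
      then show "0 \<le> ?E' x * exp (K * x) + E x * (exp (K * x) * K)" by (simp add: algebra_simps)
    qed (use t t0 False in auto)
    then show ?thesis using E0 by (simp add: mult_le_0_iff)
  qed
  then have "(D t)\<^sup>2 \<le> 0 \<and> (D1 t)\<^sup>2 \<le> 0"
    unfolding E_def using zero_le_power2[of "D t"] zero_le_power2[of "D1 t"] by linarith
  then show ?thesis by (simp add: D_def D1_def)
qed

lemma ode_unique:
  assumes u: "ode_solution_on \<Lambda> \<epsilon> UNIV u w" and v: "ode_solution_on \<Lambda> \<epsilon> UNIV v x"
    and "\<epsilon> \<noteq> 0" and "u t0 = v t0" "w t0 = x t0"
  shows "u = v"
proof
  fix t
  show "u t = v t"
    using ode_unique_within[OF ode_solution_on_subset[OF u] ode_solution_on_subset[OF v],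
        of "min t t0" "max t t0" t0 t] assms by auto
qed

section \<open>The roots of the cubic\<close>

locale bistable =
  fixes \<Lambda> b r \<delta> :: real and Ulo Umid Uup :: "real \<Rightarrow> real"
  assumes lam: "\<Lambda> > 3 / 2 powr (2 / 3)"
    and order: "\<And>t. Ulo t < Umid t" "\<And>t. Umid t < Uup t"
    and roots: "\<And>t. cubic \<Lambda> t (Ulo t) = 0" "\<And>t. cubic \<Lambda> t (Umid t) = 0"
      "\<And>t. cubic \<Lambda> t (Uup t) = 0"
    and b: "b > 0" "b ^ 3 - \<Lambda> * b - 1 > 0"
    and r: "0 < r" "r < 1 / 2"
    and \<delta>_pos: "\<delta> > 0"
    and \<delta>_lo: "\<delta> < Ulo (r / 2 * pi) - Ulo 0"
    and \<delta>_up: "\<And>t u. Uup t - \<delta> < u \<Longrightarrow> u < Uup t \<Longrightarrow>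
      \<bar>cubic \<Lambda> t u\<bar> < integral {(1 - r) * pi .. (1 - r / 2) * pi} sin"
begin

definition m :: real where "m = sqrt (\<Lambda> / 3)"

lemma \<Lambda>_pos: "\<Lambda> > 0"
  using lam by (smt (verit) divide_pos_pos powr_gt_zero)

lemma m_pos: "m > 0"
  using \<Lambda>_pos by (simp add: m_def)

lemma m_sq: "3 * m\<^sup>2 = \<Lambda>"
  using \<Lambda>_pos by (simp add: m_def)

text \<open>The threshold for \<open>\<Lambda>\<close> in the form used below: u^3 - \<Lambda> u has
  the local minimum -2 m^3 at u = m, and this lies below -1 precisely beyond the threshold.\<close>

lemma m_cube: "2 * m ^ 3 > 1"
proof -
  have "(3 / 2 powr (2 / 3)) ^ 3 < \<Lambda> ^ 3"
    using lam by (intro power_strict_mono) auto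
  moreover have "(2 powr (2 / 3)) ^ 3 = (4::real)"
    by (simp add: powr_realpow[symmetric] powr_powr)
  moreover have "(3 * m\<^sup>2) ^ 3 = 27 * (m ^ 3)\<^sup>2" by (simp add: power_mult_distrib flip: power_mult)
  ultimately have "27 / 4 < 27 * (m ^ 3)\<^sup>2" by (simp add: power_divide m_sq)
  then have "1 < (2 * m ^ 3)\<^sup>2" by (simp add: power_mult_distrib)
  then show ?thesis using m_pos by (metis one_power2 power2_less_imp_less less_imp_le zero_less_power mult_pos_pos zero_less_numeral)
qed

text \<open>The cubic has no quadratic term: subtracting the difference-quotient equations of two
  pairs of roots and cancelling a difference of roots leaves the sum of the roots.\<close>

lemma vieta: "Ulo t + Umid t + Uup t = 0"
  "cubic \<Lambda> t u = (u - Ulo t) * (u - Umid t) * (u - Uup t)"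
proof -
  let ?x = "Ulo t" and ?y = "Umid t" and ?z = "Uup t"
  have "?x\<^sup>2 + ?x * ?y + ?y\<^sup>2 - \<Lambda> = 0" "?x\<^sup>2 + ?x * ?z + ?z\<^sup>2 - \<Lambda> = 0"
    using cubic_diff[of \<Lambda> t ?x ?y] cubic_diff[of \<Lambda> t ?x ?z] roots[of t] order[of t] by auto
  then have "(?y - ?z) * (?x + ?y + ?z) = 0" and xy: "\<Lambda> = ?x\<^sup>2 + ?x * ?y + ?y\<^sup>2"
    by (auto simp: algebra_simps power2_eq_square)
  then show s: "?x + ?y + ?z = 0" using order[of t] by auto
  then have z: "?z = - ?x - ?y" by simp
  have "cubic \<Lambda> t u = cubic \<Lambda> t u - cubic \<Lambda> t ?x" using roots by simp
  also have "\<dots> = (u\<^sup>2 + u * ?x + ?x\<^sup>2 - \<Lambda>) * (u - ?x)" by (rule cubic_diff)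
  also have "\<dots> = (u - ?x) * (u - ?y) * (u - ?z)"
    unfolding z xy by (simp add: algebra_simps power2_eq_square)
  finally show "cubic \<Lambda> t u = (u - ?x) * (u - ?y) * (u - ?z)" .
qed

lemma prod_roots: "Ulo t * Umid t * Uup t = - cos t"
  using vieta(2)[of t 0] by (simp add: cubic_def)

text \<open>At a root the derivative of the cubic is the product of the differences to the other two
  roots, so its sign is decided by the order of the roots.\<close>

lemma deriv_roots: "3 * (Ulo t)\<^sup>2 > \<Lambda>" "3 * (Umid t)\<^sup>2 < \<Lambda>" "3 * (Uup t)\<^sup>2 > \<Lambda>"
proof -
  let ?x = "Ulo t" and ?y = "Umid t" and ?z = "Uup t"
  have "?x\<^sup>2 + ?x * ?y + ?y\<^sup>2 - \<Lambda> = 0"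
    using cubic_diff[of \<Lambda> t ?x ?y] roots[of t] order[of t] by auto
  then have l: "\<Lambda> = ?x\<^sup>2 + ?x * ?y + ?y\<^sup>2" by simp
  have y: "?y = - ?x - ?z" using vieta(1)[of t] by simp
  have "3 * ?x\<^sup>2 - \<Lambda> = (?y - ?x) * (?z - ?x)" "3 * ?y\<^sup>2 - \<Lambda> = - ((?y - ?x) * (?z - ?y))"
    "3 * ?z\<^sup>2 - \<Lambda> = (?z - ?x) * (?z - ?y)"
    unfolding l y by (simp_all add: algebra_simps power2_eq_square)
  moreover have "(?y - ?x) * (?z - ?x) > 0" "(?y - ?x) * (?z - ?y) > 0" "(?z - ?x) * (?z - ?y) > 0"
    using order[of t] by simp_all
  ultimately show "3 * (Ulo t)\<^sup>2 > \<Lambda>" "3 * (Umid t)\<^sup>2 < \<Lambda>" "3 * (Uup t)\<^sup>2 > \<Lambda>" by linarith+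
qed

lemma Ulo_lt: "Ulo t < - m" and Uup_gt: "m < Uup t"
proof -
  have "Ulo t < 0" "0 < Uup t" using vieta(1)[of t] order[of t] by linarith+
  moreover have "m\<^sup>2 < (Ulo t)\<^sup>2" "m\<^sup>2 < (Uup t)\<^sup>2" using deriv_roots[of t] m_sq by auto
  ultimately show "Ulo t < - m" "m < Uup t"
    using power2_less_imp_less[of m "- Ulo t"] power2_less_imp_less[of m "Uup t"] by auto
qed

lemma Umid_gt: "- m < Umid t"
  using power2_less_imp_less[of "\<bar>Umid t\<bar>" m] deriv_roots(2)[of t] m_sq m_pos by auto

lemma cubic_neg: "u < Ulo t \<Longrightarrow> cubic \<Lambda> t u < 0"
  using order[of t] by (simp add: vieta(2) mult_less_0_iff zero_less_mult_iff)

lemma cubic_pos: "Ulo t < u \<Longrightarrow> u < Umid t \<Longrightarrow> cubic \<Lambda> t u > 0"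
  using order[of t] by (simp add: vieta(2) mult_less_0_iff zero_less_mult_iff)

text \<open>A smaller cosine lowers the graph and moves its first upward crossing to the right.
  Formally, if Ulo t exceeded Ulo s, it would lie between Ulo s and Umid s, because Ulo t < -m <
  Umid s, and there the cubic at time s is positive.\<close>

lemma Ulo_mono_cos:
  assumes "cos s \<le> cos t"
  shows "Ulo t \<le> Ulo s"
proof (rule ccontr)
  assume "\<not> Ulo t \<le> Ulo s"
  then have "cubic \<Lambda> s (Ulo t) > 0" using cubic_pos[of s "Ulo t"] Ulo_lt[of t] Umid_gt[of s] by auto
  moreover have "cubic \<Lambda> s (Ulo t) = cubic \<Lambda> t (Ulo t) + cos s - cos t" by (simp add: cubic_def)
  ultimately show False using roots[of t] assms by simp
qed

lemma Ulo_mono: "0 \<le> t \<Longrightarrow> t \<le> s \<Longrightarrow> s \<le> pi \<Longrightarrow> Ulo t \<le> Ulo s"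
  by (intro Ulo_mono_cos) (simp add: cos_monotone_0_pi_le)

lemma Uup_eq:
  assumes "cos s = - cos t"
  shows "Uup s = - Ulo t"
proof -
  have "cubic \<Lambda> s (- Ulo t) = 0" using cubic_reflect[OF assms] roots by simp
  then have "- Ulo t = Ulo s \<or> - Ulo t = Umid s \<or> - Ulo t = Uup s" by (auto simp: vieta(2))
  moreover have "- Ulo t > m" using Ulo_lt[of t] by simp
  moreover have "Umid s < m"
    using power2_less_imp_less[of "\<bar>Umid s\<bar>" m] deriv_roots(2)[of s] m_sq m_pos by auto
  ultimately show ?thesis using Ulo_lt[of s] m_pos by auto
qed

text \<open>The condition on b makes the cubic negative at -b for every t and forces b > m; together
  these place -b to the left of the smallest root.\<close>

lemma Ulo_gt: "- b < Ulo t"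
proof -
  have "cubic \<Lambda> t (- b) < 0" 
  proof -
    have "(- b) ^ 3 = - (b ^ 3)" by (simp add: power3_eq_cube)
    then show ?thesis using b(2) cos_le_one[of t] unfolding cubic_def by linarith
  qed
  moreover have "- b < - m"
  proof -
    have "b * (b\<^sup>2 - \<Lambda>) = b ^ 3 - \<Lambda> * b" by (simp add: algebra_simps power2_eq_square power3_eq_cube)
    then have "0 < b * (b\<^sup>2 - \<Lambda>)" using b by linarith
    then have "b\<^sup>2 - \<Lambda> > 0" by (rule zero_less_mult_pos) (rule b)
    then have "m\<^sup>2 < b\<^sup>2" using m_sq zero_less_power[OF m_pos, of 2] by linarith
    then show ?thesis using power2_less_imp_less[of m b] b by simp
  qed
  ultimately show ?thesis
    using cubic_pos[of t "- b"] roots(1)[of t] Umid_gt[of t] by (cases "- b" "Ulo t" rule: linorder_cases) auto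
qed

lemma pi_r: "r * pi < pi / 2" "0 < r * pi"
  using r pi_gt_zero by auto

text \<open>This is where condition (ii) enters. Its bound equals cos((1 - r)\<pi>) - cos((1 -
  r/2)\<pi>), which is at most 1, whereas at time (1 - r)\<pi> the cubic is below -1 at u = m. A
  \<delta>-band under \<open>Uup\<close> reaching down to m would contain values violating (ii).
  Hence the bands of \<open>S\<^sub>\<delta>\<close> stay where the cubic increases in u.\<close>

lemma Ulo_\<delta>: "Ulo (r * pi) + \<delta> < - m"
proof (rule ccontr)
  assume neg: "\<not> ?thesis"
  let ?t = "(1 - r) * pi"
  have up: "Uup ?t = - Ulo (r * pi)"
    by (rule Uup_eq) (simp add: algebra_simps cos_diff)
  have "cubic \<Lambda> ?t m = - (2 * m ^ 3) + cos ?t"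
  proof -
    have "m ^ 3 - 3 * m\<^sup>2 * m = - (2 * m ^ 3)" by (simp add: power2_eq_square power3_eq_cube)
    then show ?thesis unfolding cubic_def m_sq by simp
  qed
  moreover have ct: "cos ?t = - cos (r * pi)" by (simp add: algebra_simps cos_diff)
  moreover have "cos (r * pi) > 0" using pi_r by (intro cos_gt_zero) auto
  ultimately have "cubic \<Lambda> ?t m < - 1" using m_cube by linarith
  \<comment> \<open>Condition (ii) concerns the open band, whose lower edge may be m itself, so a
    point slightly above m is taken.\<close>
  moreover have "isCont (cubic \<Lambda> ?t) m" unfolding cubic_def by (intro continuous_intros)
  ultimately have "eventually (\<lambda>u. cubic \<Lambda> ?t u < - 1) (at m)"
    unfolding isCont_def by (blast intro: order_tendstoD(2))
  then have "eventually (\<lambda>u. cubic \<Lambda> ?t u < - 1) (at_right m)"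
    by (simp add: eventually_at_split)
  moreover have "eventually (\<lambda>u. u \<in> {m<..<Uup ?t}) (at_right m)"
    using Uup_gt by (rule eventually_at_right_real)
  ultimately have "eventually (\<lambda>u. cubic \<Lambda> ?t u < - 1 \<and> u \<in> {m<..<Uup ?t}) (at_right m)"
    by eventually_elim simp
  then obtain u where u: "cubic \<Lambda> ?t u < - 1" "m < u" "u < Uup ?t"
    using eventually_happens'[OF trivial_limit_at_right_real] by (metis (no_types, lifting) greaterThanLessThan_iff)
  have le: "?t \<le> (1 - r / 2) * pi" using r by (intro mult_right_mono) auto
  have "(sin has_integral - cos ((1 - r / 2) * pi) - - cos ?t) {?t..(1 - r / 2) * pi}"
    by (rule fundamental_theorem_of_calculus[OF le])
       (auto intro!: derivative_eq_intros simp: has_real_derivative_iff_has_vector_derivative[symmetric])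
  then have "integral {?t..(1 - r / 2) * pi} sin = - cos ((1 - r / 2) * pi) + cos ?t"
    by (simp add: integral_unique)
  also have "\<dots> \<le> 1"
    using ct \<open>cos (r * pi) > 0\<close> cos_ge_minus_one[of "(1 - r / 2) * pi"] by linarith
  finally show False using \<delta>_up[of ?t u] u up neg by auto
qed

text \<open>A level strictly beyond m, reached at the time r \<pi> where \<open>Ulo\<close> is
  largest on the left region; the gap between m and m' is what produces a positive exponential
  rate.\<close>

definition m' :: real where "m' = - (Ulo (r * pi) + \<delta>)"

lemma m': "m < m'" "0 < m'" using Ulo_\<delta> m_pos by (auto simp: m'_def)

lemma Ulo_\<delta>_le: "0 \<le> t \<Longrightarrow> t \<le> r * pi \<Longrightarrow> Ulo t + \<delta> \<le> - m'"
  using Ulo_mono[of t "r * pi"] pi_r by (auto simp: m'_def)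

text \<open>F is the potential of the cubic frozen at time t. It is even up to the term u cos t, so
  for cos t > 0 the left well is the deeper one: a positive u loses against -u. On u <= 0 the only
  critical point is Ulo t, because the product of the roots is -cos t < 0, which makes Umid t
  positive.\<close>

lemma potential_min:
  assumes "cos t > 0" and ne: "u \<noteq> Ulo t"
  defines "F \<equiv> \<lambda>u. u ^ 4 / 4 - \<Lambda> * u\<^sup>2 / 2 + u * cos t"
  shows "F (Ulo t) < F u"
proof -
  have "Ulo t * Uup t < 0" using Ulo_lt[of t] Uup_gt[of t] m_pos by (intro mult_neg_pos) auto
  moreover have "(Ulo t * Uup t) * Umid t < 0" using prod_roots[of t] assms by (simp add: mult_ac)
  ultimately have mid: "Umid t > 0" by (meson mult_less_0_iff order_less_asym)
  have dF: "(F has_real_derivative cubic \<Lambda> t u) (at u within S)" for u S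
    unfolding F_def cubic_def
    by (auto intro!: derivative_eq_intros simp: power2_eq_square power3_eq_cube algebra_simps)
  have less: "F (Ulo t) < F v" if "v \<noteq> Ulo t" "v \<le> 0" for v
  proof (cases "v < Ulo t")
    case True
    have "(\<lambda>v. - F v) v < (\<lambda>v. - F v) (Ulo t)"
      by (rule deriv_within_strict_mono[where a = v and b = "Ulo t" and f' = "\<lambda>u. - cubic \<Lambda> t u"])
         (use True cubic_neg in \<open>auto intro!: derivative_intros dF\<close>)
    then show ?thesis by simp
  next
    case False
    show ?thesis
      by (rule deriv_within_strict_mono[where f = F and a = "Ulo t" and b = v and f' = "cubic \<Lambda> t"])
         (use False that mid cubic_pos in \<open>auto intro!: dF\<close>)
  qed
  show ?thesis
  proof (cases "u \<le> 0")
    case True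
    then show ?thesis using less ne by blast
  next
    case False
    have "F (Ulo t) \<le> F (- u)" using less[of "- u"] False by (cases "- u = Ulo t") auto
    also have "\<dots> < F u"
      using False mult_pos_pos[of u "cos t"] assms by (simp add: F_def)
    finally show ?thesis .
  qed
qed

end

section \<open>Solutions with graph in \<open>S\<^sub>\<delta>\<close>\<close>

lemma second_derivative_max:
  fixes f :: "real \<Rightarrow> real"
  assumes f: "\<And>x. x \<in> {a<..<b} \<Longrightarrow> (f has_real_derivative f1 x) (at x)"
    and c: "c \<in> {a<..<b}" and f1: "(f1 has_real_derivative l) (at c)"
    and max: "\<And>x. x \<in> {a<..<b} \<Longrightarrow> f x \<le> f c"
  shows "f1 c = 0" "l \<le> 0"
proof -
  have "0 < min (c - a) (b - c)" using c by auto
  then show 0: "f1 c = 0"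
    by (rule DERIV_local_max[OF f[OF c]]) (use max in \<open>auto simp: abs_less_iff\<close>)
  show "l \<le> 0"
  proof (rule ccontr)
    assume "\<not> l \<le> 0"
    then obtain d where d: "d > 0" "\<And>h. 0 < h \<Longrightarrow> h < d \<Longrightarrow> f1 c < f1 (c + h)"
      using DERIV_pos_inc_right[OF f1] by auto
    define e where "e = c + min d (b - c) / 2"
    have e: "c < e" "e < c + d" "e < b" using d c by (auto simp: e_def min_def field_simps)
    have "f c < f e"
    proof (rule deriv_within_strict_mono[where a = c and b = e and f = f and f' = f1])
      fix x assume "c < x" "x < e"
      then show "f1 x > 0" using d(2)[of "x - c"] e 0 by auto
    qed (use e c f in \<open>auto intro: has_field_derivative_at_within\<close>)
    then show False using max[of e] e c by auto
  qed
qed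

text \<open>Zero can only be crossed upwards: a first return to zero from positive values would need
  a nonpositive derivative there.\<close>

lemma positive_forward:
  fixes w :: "real \<Rightarrow> real"
  assumes dw: "\<And>x. x \<in> {a..b} \<Longrightarrow> (w has_real_derivative w1 x) (at x within {a..b})"
    and st: "a \<le> s" "s < t" "t \<le> b" and ws: "w s \<ge> 0"
    and pos: "\<And>x. s \<le> x \<Longrightarrow> x \<le> t \<Longrightarrow> w x \<le> 0 \<Longrightarrow> w1 x > 0"
  shows "w t > 0"
proof -
  obtain s' where s': "s \<le> s'" "s' < t" "w s' > 0"
  proof (cases "w s = 0")
    case True
    then have "w1 s > 0" using pos[of s] st by auto
    then obtain d where d: "d > 0" "\<And>h. 0 < h \<Longrightarrow> s + h \<in> {a..b} \<Longrightarrow> h < d \<Longrightarrow> w s < w (s + h)"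
      using has_real_derivative_pos_inc_right[OF dw, of s] st by auto
    define h where "h = min d (t - s) / 2"
    have "0 < h" "h < d" "s + h < t" using d st by (auto simp: h_def min_def field_simps)
    then show ?thesis using d(2)[of h] st True that[of "s + h"] by auto
  qed (use ws st that[of s] in auto)
  have "- w t < 0"
  proof (rule continuous_negI[where a = s' and b = t and f = "\<lambda>t. - w t"])
    have "continuous_on {a..b} w" by (rule DERIV_continuous_on[OF dw])
    then show "continuous_on {s'..t} (\<lambda>t. - w t)"
      using s' st by (intro continuous_on_minus) (auto intro: continuous_on_subset)
    fix T assume T: "s' < T" "T \<le> t" and neg: "\<And>t. s' \<le> t \<Longrightarrow> t < T \<Longrightarrow> - w t < 0"
    show "- w T \<noteq> 0"
    proof
      assume eq: "- w T = 0"
      have "w1 T \<le> 0"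
      proof (rule deriv_within_left_pos[OF dw, of T s'])
        fix x assume "s' < x" "x < T"
        then show "w T \<le> w x" using neg[of x] eq by simp
      qed (use T s' st in auto)
      then show False using pos[of T] eq T s' by auto
    qed
  qed (use s' in auto)
  then show ?thesis by simp
qed

context bistable
begin

definition \<rho> :: real where "\<rho> = r * pi"

lemma \<rho>: "\<rho> < pi / 2" "0 < \<rho>" "\<rho> < pi"
  using pi_r by (auto simp: \<rho>_def)

lemma \<delta>_lo': "\<delta> < Ulo (\<rho> / 2) - Ulo 0"
  using \<delta>_lo by (simp add: \<rho>_def)

lemma q_nonneg: "u \<le> - m \<Longrightarrow> 0 \<le> 3 * u\<^sup>2 - \<Lambda>"
  using power_mono[of m "- u" 2] m_pos m_sq by auto

text \<open>A trap. Differentiating the equation gives \<epsilon>^2 w'' = (3u^2 - \<Lambda>) w - sin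
  t. While u <= -m the coefficient is nonnegative, and on [0, \<pi>] so is the sine; hence w <= 0
  persists once w and w' start nonpositive. Then u does not increase and stays below -m, which
  closes the argument.\<close>

lemma ode_descent:
  assumes ode: "ode_solution_on \<Lambda> \<epsilon> {s..e} u w" and "\<epsilon> > 0" "0 \<le> s" "e \<le> pi"
    and us: "u s < - m" and "w s \<le> 0" "cubic \<Lambda> s (u s) \<le> 0" and t: "t \<in> {s..e}"
  shows "u t < - m"
proof -
  note uw = ode[unfolded ode_solution_on_iff[OF less_imp_neq[OF \<open>\<epsilon> > 0\<close>, symmetric]], rule_format]
  have cu: "continuous_on {s..e} u" using uw by (meson DERIV_continuous_on)
  then obtain B where B: "\<And>t. t \<in> {s..e} \<Longrightarrow> \<bar>u t\<bar> \<le> B"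
    using continuous_on_Icc_bounded by blast
  have "u t + m < 0"
  proof (rule continuous_negI[OF _ _ _ t])
    show "continuous_on {s..e} (\<lambda>t. u t + m)" by (intro continuous_intros cu)
    show "u s + m < 0" using us by simp
    fix T assume T: "s < T" "T \<le> e" and neg: "\<And>t. s \<le> t \<Longrightarrow> t < T \<Longrightarrow> u t + m < 0"
    show "u T + m \<noteq> 0"
    proof
      assume eq: "u T + m = 0"
      have um: "u t \<le> - m" if "t \<in> {s..T}" for t
        using neg[of t] that eq by (cases "t = T") (auto simp: less_imp_le)
      have sub: "{s..T} \<subseteq> {s..e}" using T by auto
      have w: "- w t \<ge> 0" if tT: "t \<in> {s..T}" for t
      proof (rule second_order_comparison(1)[where y = "\<lambda>t. - w t" and a = s and b = T
            and ?y1.0 = "\<lambda>t. - cubic \<Lambda> t (u t) / \<epsilon>\<^sup>2"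
            and ?y2.0 = "\<lambda>t. - ((3 * (u t)\<^sup>2 - \<Lambda>) * w t - sin t) / \<epsilon>\<^sup>2"
            and p = "\<lambda>t. (3 * (u t)\<^sup>2 - \<Lambda>) / \<epsilon>\<^sup>2" and P = "3 * B\<^sup>2 / \<epsilon>\<^sup>2", OF _ _ _ _ _ _ tT])
        fix t assume t: "t \<in> {s..T}"
        then have te: "t \<in> {s..e}" using T by auto
        show "((\<lambda>t. - w t) has_real_derivative - cubic \<Lambda> t (u t) / \<epsilon>\<^sup>2) (at t within {s..T})"
          using DERIV_minus[OF DERIV_subset[OF conjunct2[OF uw[OF te]] sub]] by simp
        have "((\<lambda>t. cubic \<Lambda> t (u t)) has_real_derivative (3 * (u t)\<^sup>2 - \<Lambda>) * w t - sin t) (at t within {s..T})"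
          by (rule cubic_solution_deriv[OF DERIV_subset[OF conjunct1[OF uw[OF te]] sub]])
        from DERIV_cdivide[OF DERIV_minus[OF this]]
        show "((\<lambda>t. - cubic \<Lambda> t (u t) / \<epsilon>\<^sup>2) has_real_derivative
            - ((3 * (u t)\<^sup>2 - \<Lambda>) * w t - sin t) / \<epsilon>\<^sup>2) (at t within {s..T})" .
        have "(u t)\<^sup>2 \<le> B\<^sup>2" using B[OF te] abs_le_square_iff[of "u t" B] by simp
        then have "3 * (u t)\<^sup>2 - \<Lambda> \<le> 3 * B\<^sup>2" using \<Lambda>_pos by simp
        then show "0 \<le> (3 * (u t)\<^sup>2 - \<Lambda>) / \<epsilon>\<^sup>2 \<and> (3 * (u t)\<^sup>2 - \<Lambda>) / \<epsilon>\<^sup>2 \<le> 3 * B\<^sup>2 / \<epsilon>\<^sup>2"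
          using q_nonneg[OF um[OF t]] by (intro conjI divide_right_mono divide_nonneg_nonneg) auto
        have "0 \<le> sin t" using t T assms by (intro sin_ge_zero) auto
        then have "(3 * (u t)\<^sup>2 - \<Lambda>) * - w t \<le> - ((3 * (u t)\<^sup>2 - \<Lambda>) * w t - sin t)" by simp
        from divide_right_mono[OF this, of "\<epsilon>\<^sup>2"]
        show "(3 * (u t)\<^sup>2 - \<Lambda>) / \<epsilon>\<^sup>2 * - w t \<le> - ((3 * (u t)\<^sup>2 - \<Lambda>) * w t - sin t) / \<epsilon>\<^sup>2" by simp
      qed (use assms in \<open>auto intro: divide_nonpos_nonneg\<close>)
      have "- u s \<le> - u T"
      proof (rule deriv_within_mono[where a = s and b = e and f = "\<lambda>t. - u t" and f' = "\<lambda>t. - w t"])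
        fix t assume "t \<in> {s..e}"
        then show "((\<lambda>t. - u t) has_real_derivative - w t) (at t within {s..e})"
          using uw by (blast intro: DERIV_minus)
      qed (use T w in auto)
      then show False using eq us by simp
    qed
  qed
  then show ?thesis by simp
qed

lemma graph_in_S_iff:
  "graph_in pi u (S\<^sub>\<delta> Ulo Uup b r \<delta>) \<longleftrightarrow> (\<forall>t\<in>{0..pi}. - b \<le> u t \<and> u t \<le> b \<and>
     (t \<le> \<rho> \<longrightarrow> u t \<le> Ulo t + \<delta>) \<and> (pi - \<rho> \<le> t \<longrightarrow> Uup t - \<delta> \<le> u t))"
  by (auto simp: graph_in_def S\<^sub>\<delta>_def \<rho>_def algebra_simps)

lemma S_reflect: "(pi - t, u) \<in> S\<^sub>\<delta> Ulo Uup b r \<delta> \<Longrightarrow> (t, - u) \<in> S\<^sub>\<delta> Ulo Uup b r \<delta>"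
proof -
  have "Uup (pi - t) = - Ulo t" "Uup t = - Ulo (pi - t)" by (rule Uup_eq; simp)+
  then show "(pi - t, u) \<in> S\<^sub>\<delta> Ulo Uup b r \<delta> \<Longrightarrow> (t, - u) \<in> S\<^sub>\<delta> Ulo Uup b r \<delta>"
    by (auto simp: S\<^sub>\<delta>_def algebra_simps)
qed

lemma graph_in_S_reflect:
  assumes "graph_in pi u (S\<^sub>\<delta> Ulo Uup b r \<delta>)"
  shows "graph_in pi (\<lambda>t. - u (pi - t)) (S\<^sub>\<delta> Ulo Uup b r \<delta>)"
  using assms unfolding graph_in_def by (auto intro!: S_reflect)

end

section \<open>Strict monotonicity of a single solution with graph in the strip\<close>

locale layer = bistable +
  fixes \<epsilon> :: real and u w :: "real \<Rightarrow> real"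
  assumes \<epsilon>: "\<epsilon> > 0"
    and ode: "ode_solution_on \<Lambda> \<epsilon> {0..pi} u w"
    and graph: "graph_in pi u (S\<^sub>\<delta> Ulo Uup b r \<delta>)"
begin

lemma reflect: "layer \<Lambda> b r \<delta> Ulo Umid Uup \<epsilon> (\<lambda>t. - u (pi - t)) (\<lambda>t. w (pi - t))"
proof (rule layer.intro[OF bistable_axioms], rule layer_axioms.intro)
  show "ode_solution_on \<Lambda> \<epsilon> {0..pi} (\<lambda>t. - u (pi - t)) (\<lambda>t. w (pi - t))"
    using ode_transform[OF ode, of "{0..pi}" "- 1" pi "- 1"] \<epsilon> by (simp add: cos_diff)
qed (rule \<epsilon> graph_in_S_reflect[OF graph])+

lemma du: "t \<in> {0..pi} \<Longrightarrow> (u has_real_derivative w t) (at t within {0..pi})"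
  and dw: "t \<in> {0..pi} \<Longrightarrow> (w has_real_derivative cubic \<Lambda> t (u t) / \<epsilon>\<^sup>2) (at t within {0..pi})"
  using ode[unfolded ode_solution_on_iff[OF less_imp_neq[OF \<epsilon>, symmetric]]] by blast+

lemma dz: "t \<in> {0..pi} \<Longrightarrow> ((\<lambda>t. cubic \<Lambda> t (u t)) has_real_derivative
    (3 * (u t)\<^sup>2 - \<Lambda>) * w t - sin t) (at t within {0..pi})"
  by (rule cubic_solution_deriv[OF du])

lemma cont_u: "continuous_on {0..pi} u" and cont_w: "continuous_on {0..pi} w"
  by (rule DERIV_continuous_on[OF du] DERIV_continuous_on[OF dw], assumption)+

lemma bounds: "t \<in> {0..pi} \<Longrightarrow> \<bar>u t\<bar> \<le> b"
  and left: "0 \<le> t \<Longrightarrow> t \<le> \<rho> \<Longrightarrow> u t \<le> Ulo t + \<delta>"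
  and left': "0 \<le> t \<Longrightarrow> t \<le> \<rho> \<Longrightarrow> u t \<le> - m'"
proof -
  show "\<bar>u t\<bar> \<le> b" if "t \<in> {0..pi}"
  proof -
    have "- b \<le> u t \<and> u t \<le> b" using graph that unfolding graph_in_S_iff by blast
    then show ?thesis by linarith
  qed
  show "u t \<le> Ulo t + \<delta>" if "0 \<le> t" "t \<le> \<rho>"
  proof -
    have "t \<in> {0..pi}" using that \<rho> by simp
    then show ?thesis using graph that unfolding graph_in_S_iff by blast
  qed
  then show "u t \<le> - m'" if "0 \<le> t" "t \<le> \<rho>"
    using Ulo_\<delta>_le[of t] that unfolding \<rho>_def by (meson order_trans)
qed

lemma right': "pi - \<rho> \<le> t \<Longrightarrow> t \<le> pi \<Longrightarrow> m' \<le> u t"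
  using layer.left'[OF reflect, of "pi - t"] by simp

text \<open>Otherwise \<open>ode_descent\<close> would keep u below -m up to time \<pi>, where the
  graph has to be above m'. In the left region a nonpositive slope therefore forces w' > 0.\<close>

lemma no_descent:
  assumes "0 \<le> t" "t < pi" "u t < - m" "w t \<le> 0"
  shows "cubic \<Lambda> t (u t) > 0"
proof (rule ccontr)
  assume "\<not> ?thesis"
  have "u pi < - m"
    by (rule ode_descent[OF ode_solution_on_subset[OF ode], of t pi])
       (use assms \<epsilon> \<open>\<not> cubic \<Lambda> t (u t) > 0\<close> in auto)
  then show False using right'[of pi] m' m_pos \<rho> by linarith
qed

lemma pos_forward:
  assumes "0 \<le> s" "s < t" "t \<le> \<rho>" "w s \<ge> 0"
  shows "w t > 0"
proof (rule positive_forward[OF dw])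
  fix x assume "s \<le> x" "x \<le> t" "w x \<le> 0"
  then show "cubic \<Lambda> x (u x) / \<epsilon>\<^sup>2 > 0"
    using no_descent[of x] left'[of x] m' assms \<rho> \<epsilon> by simp
qed (use assms \<rho> in auto)

text \<open>The reason for condition (i). By \<open>pos_forward\<close>, a nonpositive slope at t
  forces negative slopes on (0, t), hence u t <= u 0 <= Ulo 0 + \<delta> < Ulo (\<rho>/2) <= Ulo t.
  But \<open>no_descent\<close> makes the cubic positive at u t, which needs u t > Ulo t.\<close>

lemma w_pos_left:
  assumes "\<rho> / 2 \<le> t" "t \<le> \<rho>"
  shows "w t > 0"
proof (rule ccontr)
  assume neg: "\<not> w t > 0"
  have t0: "0 < t" "t < pi" using assms \<rho> by auto
  have z: "cubic \<Lambda> t (u t) > 0" using no_descent[of t] left'[of t] m' neg assms t0 by auto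
  then have "Ulo t < u t" using cubic_neg[of "u t" t] roots(1)[of t] by (cases "u t" "Ulo t" rule: linorder_cases) auto
  have "- u 0 \<le> - u t"
  proof (rule deriv_within_mono[where a = 0 and b = pi and f = "\<lambda>t. - u t" and f' = "\<lambda>t. - w t"])
    fix x assume "0 < x" "x < t"
    then have "\<not> w x \<ge> 0" using pos_forward[of x t] neg assms by auto
    then show "0 \<le> - w x" by simp
  qed (use t0 in \<open>auto intro!: DERIV_minus du\<close>)
  moreover have "Ulo (\<rho> / 2) \<le> Ulo t" using assms \<rho> by (intro Ulo_mono) auto
  ultimately show False using left[of 0] \<rho> \<delta>_lo' \<open>Ulo t < u t\<close> by simp
qed

text \<open>At a first zero T of w one has w' <= 0, so the cubic is nonpositive, while
  \<open>no_descent\<close> gives u T > Ulo T. The energy with the potential frozen at time T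
  changes at rate w (cos t - cos T), which is nonnegative on the way up. Starting where u crosses
  Ulo T, the strict minimum of that potential, it cannot reach zero slope at another height.\<close>

lemma w_pos_half:
  assumes t: "\<rho> / 2 \<le> t" "t < pi / 2"
  shows "w t > 0"
proof -
  let ?l = "\<rho> / 2"
  have "- w t < 0"
  proof (rule continuous_negI[where a = ?l and b = t and f = "\<lambda>t. - w t"])
    show "continuous_on {?l..t} (\<lambda>t. - w t)"
      using t \<rho> by (intro continuous_on_minus continuous_on_subset[OF cont_w]) auto
    show "- w ?l < 0" using w_pos_left[of ?l] \<rho> by simp
    fix T assume T: "?l < T" "T \<le> t" and neg: "\<And>t. ?l \<le> t \<Longrightarrow> t < T \<Longrightarrow> - w t < 0"
    show "- w T \<noteq> 0"
    proof
      assume eq: "- w T = 0"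
      have Tb: "0 < T" "T < pi / 2" "T < pi" using T t \<rho> by auto
      have cosT: "cos T > 0" using Tb by (intro cos_gt_zero) auto
      have z: "cubic \<Lambda> T (u T) / \<epsilon>\<^sup>2 \<le> 0"
      proof (rule deriv_within_left_pos[OF dw, of T ?l])
        fix x assume "?l < x" "x < T"
        then show "w T \<le> w x" using neg[of x] eq by simp
      qed (use T Tb \<rho> in auto)
      then have zT: "cubic \<Lambda> T (u T) \<le> 0" using \<epsilon> by (auto simp: divide_le_0_iff)
      have high: "Ulo T < u T"
      proof (rule ccontr)
        assume "\<not> Ulo T < u T"
        then have "u T < - m" using Ulo_lt[of T] by simp
        then show False using no_descent[of T] zT eq Tb by auto
      qed
      \<comment> \<open>u may decrease at first. From its minimum t0 over [0, \<rho>/2] onwards it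
        no longer does, and by condition (i) u t0 is below Ulo T, so that level is crossed after
        t0.\<close>
      have "compact {0..?l}" "{0..?l} \<noteq> {}" "continuous_on {0..?l} u"
        using \<rho> by (auto intro!: continuous_on_subset[OF cont_u])
      then obtain t0 where t0: "t0 \<in> {0..?l}" "\<And>x. x \<in> {0..?l} \<Longrightarrow> u t0 \<le> u x"
        using continuous_attains_inf by metis
      have wnn: "w x \<ge> 0" if x: "t0 < x" "x < T" for x
      proof (rule ccontr)
        assume n: "\<not> w x \<ge> 0"
        then have xl: "x < ?l" using neg[of x] x by force
        have "- u t0 < - u x"
        proof (rule deriv_within_strict_mono[where a = 0 and b = pi and f = "\<lambda>t. - u t" and f' = "\<lambda>t. - w t"])
          fix y assume "t0 < y" "y < x"
          then have "\<not> w y \<ge> 0" using pos_forward[of y x] n xl t0(1) \<rho> by auto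
          then show "0 < - w y" by simp
        qed (use t0 x xl \<rho> in \<open>auto intro!: DERIV_minus du\<close>)
        then show False using t0(2)[of x] x xl t0(1) by auto
      qed
      have "u t0 \<le> u 0" using t0(2)[of 0] \<rho> by auto
      also have "\<dots> < Ulo ?l" using left[of 0] \<delta>_lo' \<rho> by simp
      also have "\<dots> \<le> Ulo T" using T Tb \<rho> by (intro Ulo_mono) auto
      finally have low: "u t0 \<le> Ulo T" by simp
      have "t0 \<le> T" using t0 T by auto
      moreover have "continuous_on {t0..T} u" using t0 Tb by (intro continuous_on_subset[OF cont_u]) auto
      ultimately obtain tc where tc: "t0 \<le> tc" "tc \<le> T" "u tc = Ulo T"
        using IVT'[of u t0 "Ulo T" T] low less_imp_le[OF high] by blast
      let ?F = "\<lambda>v. v ^ 4 / 4 - \<Lambda> * v\<^sup>2 / 2 + v * cos T"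
      let ?e = "\<lambda>t. \<epsilon>\<^sup>2 * (w t)\<^sup>2 / 2 - ?F (u t)"
      have "?e tc \<le> ?e T"
      proof (rule deriv_within_mono[where a = 0 and b = pi and f = ?e and f' = "\<lambda>t. w t * (cos t - cos T)"])
        fix t assume t: "t \<in> {0..pi}"
        show "(?e has_real_derivative w t * (cos t - cos T)) (at t within {0..pi})"
        proof -
          have "(?F has_real_derivative cubic \<Lambda> T v) (at v)" for v
            unfolding cubic_def
            by (auto intro!: derivative_eq_intros simp: power2_eq_square power3_eq_cube algebra_simps)
          note F = DERIV_chain2[OF this du[OF t]]
          have "((\<lambda>t. \<epsilon>\<^sup>2 * (w t)\<^sup>2 / 2) has_real_derivative
              \<epsilon>\<^sup>2 * (2 * w t * (cubic \<Lambda> t (u t) / \<epsilon>\<^sup>2)) / 2) (at t within {0..pi})"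
            using dw[OF t] by (auto intro!: derivative_eq_intros)
          from DERIV_diff[OF this F]
          have "(?e has_real_derivative \<epsilon>\<^sup>2 * (2 * w t * (cubic \<Lambda> t (u t) / \<epsilon>\<^sup>2)) / 2 - cubic \<Lambda> T (u t) * w t)
              (at t within {0..pi})" .
          also have "\<epsilon>\<^sup>2 * (2 * w t * (cubic \<Lambda> t (u t) / \<epsilon>\<^sup>2)) / 2 - cubic \<Lambda> T (u t) * w t =
              w t * (cubic \<Lambda> t (u t) - cubic \<Lambda> T (u t))"
            using \<epsilon> by (simp add: algebra_simps)
          also have "cubic \<Lambda> t (u t) - cubic \<Lambda> T (u t) = cos t - cos T" by (simp add: cubic_def)
          finally show ?thesis .
        qed
      next
        fix x assume "tc < x" "x < T"
        moreover from this have "cos T \<le> cos x" using tc t0 Tb by (intro cos_monotone_0_pi_le) auto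
        ultimately show "0 \<le> w x * (cos x - cos T)" using wnn[of x] tc by simp
      qed (use tc t0 Tb in auto)
      moreover have "0 \<le> \<epsilon>\<^sup>2 * (w tc)\<^sup>2 / 2" "\<epsilon>\<^sup>2 * (w T)\<^sup>2 / 2 = 0" using eq by simp_all
      ultimately have "?F (u T) \<le> ?F (Ulo T)" unfolding tc(3) by linarith
      moreover have "?F (Ulo T) < ?F (u T)" by (rule potential_min[OF cosT]) (use high in simp)
      ultimately show False by linarith
    qed
  qed (use t in auto)
  then show ?thesis by simp
qed

text \<open>Reflection gives the right half; only \<pi>/2 remains, where cos vanishes and the two
  wells are equally deep. A zero of w there would be a minimum of w, so the cubic would vanish too.
  With w = 0 its time derivative is -sin(\<pi>/2) = -1, so w would be increasing just before its
  zero, although it is positive there.\<close>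

lemma w_pos:
  assumes t: "\<rho> / 2 \<le> t" "t \<le> pi - \<rho> / 2"
  shows "w t > 0"
proof -
  have right: "w t > 0" if "pi / 2 < t" "t \<le> pi - \<rho> / 2" for t
    using layer.w_pos_half[OF reflect, of "pi - t"] that by simp
  have mid: "w (pi / 2) > 0"
  proof (rule ccontr)
    assume neg: "\<not> w (pi / 2) > 0"
    define l where "l = \<rho> / 2"
    have l: "0 < l" "l < pi / 2" "l \<le> \<rho>" "\<rho> / 2 \<le> l" using \<rho> by (auto simp: l_def)
    have w0: "w (pi / 2) = 0"
    proof (rule ccontr)
      assume "w (pi / 2) \<noteq> 0"
      then have "w (pi / 2) < 0" using neg by simp
      moreover have "continuous_on {l..pi / 2} w" using l by (intro continuous_on_subset[OF cont_w]) auto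
      ultimately obtain x where "l \<le> x" "x \<le> pi / 2" "w x = 0"
        using IVT2'[of w "pi / 2" 0 l] w_pos_left[of l] l \<rho> by auto
      moreover have "w x > 0" if "x \<noteq> pi / 2"
        using w_pos_half[of x] that l \<open>l \<le> x\<close> \<open>x \<le> pi / 2\<close> by linarith
      ultimately show False using \<open>w (pi / 2) < 0\<close> by fastforce
    qed
    have p2: "pi / 2 \<in> {0..pi}" by auto
    have "cubic \<Lambda> (pi / 2) (u (pi / 2)) / \<epsilon>\<^sup>2 \<le> 0"
      by (rule deriv_within_left_pos[OF dw[OF p2], of l]) (use l w0 w_pos_half in \<open>auto simp: less_imp_le\<close>)
    moreover have "- (cubic \<Lambda> (pi / 2) (u (pi / 2)) / \<epsilon>\<^sup>2) \<le> 0"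
      by (rule deriv_within_right_neg[OF DERIV_minus[OF dw[OF p2]], of "pi - l"])
         (use l w0 right in \<open>auto simp: less_imp_le\<close>)
    ultimately have "cubic \<Lambda> (pi / 2) (u (pi / 2)) / \<epsilon>\<^sup>2 = 0" by linarith
    then have z0: "cubic \<Lambda> (pi / 2) (u (pi / 2)) = 0" using \<epsilon> by simp
    have "((\<lambda>t. cubic \<Lambda> t (u t)) has_real_derivative - 1) (at (pi / 2) within {0..pi})"
      using dz[OF p2] w0 by simp
    then obtain d where d: "d > 0"
      "\<And>h. 0 < h \<Longrightarrow> pi / 2 - h \<in> {0..pi} \<Longrightarrow> h < d \<Longrightarrow> 0 < cubic \<Lambda> (pi / 2 - h) (u (pi / 2 - h))"
      using has_real_derivative_neg_dec_left[of "\<lambda>t. cubic \<Lambda> t (u t)" "- 1" "pi / 2" "{0..pi}"] z0 by auto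
    define c where "c = pi / 2 - min d (pi / 2 - l) / 2"
    have c: "l < c" "c < pi / 2" "pi / 2 - c < d" using d l by (auto simp: c_def min_def field_simps)
    have "w c < w (pi / 2)"
    proof (rule deriv_within_strict_mono[where a = 0 and b = pi and f = w, OF dw])
      fix x assume "c < x" "x < pi / 2"
      then show "0 < cubic \<Lambda> x (u x) / \<epsilon>\<^sup>2" using d(2)[of "pi / 2 - x"] c l \<epsilon> by auto
    qed (use c l in auto)
    moreover have "w c > 0" using w_pos_half[of c] c l by linarith
    ultimately show False using w0 by simp
  qed
  show ?thesis
  proof (cases t "pi / 2" rule: linorder_cases)
    case equal
    then show ?thesis using mid by (simp only:)
  qed (use right[of t] w_pos_half[of t] t in auto)
qed

end

section \<open>Slope bounds explicit in \<epsilon>, and the height as independent variable\<close>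

lemma sin_ge_sin_of_mid:
  assumes "0 \<le> l" "l \<le> t" "t \<le> pi - l"
  shows "sin l \<le> sin t"
proof (cases "t \<le> pi / 2")
  case True
  then show ?thesis using assms by (intro sin_monotone_2pi_le) auto
next
  case False
  have "sin l \<le> sin (pi - t)" using assms False by (intro sin_monotone_2pi_le) auto
  then show ?thesis by simp
qed

lemma exp_inverse_dominates:
  fixes c C :: real
  assumes "c > 0"
  shows "eventually (\<lambda>\<epsilon>. C / \<epsilon> ^ n < exp (c / \<epsilon>)) (at_right 0)"
proof -
  have "((\<lambda>x::real. x ^ n / exp x) \<longlongrightarrow> 0) at_top" by (rule tendsto_power_div_exp_0)
  moreover have "filterlim (\<lambda>\<epsilon>. c / \<epsilon>) at_top (at_right 0)" using assms by real_asymp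
  ultimately have "((\<lambda>\<epsilon>. (c / \<epsilon>) ^ n / exp (c / \<epsilon>)) \<longlongrightarrow> 0) (at_right 0)"
    by (rule filterlim_compose)
  then have "eventually (\<lambda>\<epsilon>. (c / \<epsilon>) ^ n / exp (c / \<epsilon>) < c ^ n / (\<bar>C\<bar> + 1)) (at_right 0)"
    using assms by (intro order_tendstoD(2)) auto
  moreover have "eventually (\<lambda>\<epsilon>. \<epsilon> > (0::real)) (at_right 0)" by (rule eventually_at_right_less)
  ultimately show ?thesis
  proof eventually_elim
    case (elim \<epsilon>)
    have "c ^ n * ((\<bar>C\<bar> + 1) / \<epsilon> ^ n) < c ^ n * exp (c / \<epsilon>)"
      using elim assms by (simp add: field_simps power_divide)
    then have "(\<bar>C\<bar> + 1) / \<epsilon> ^ n < exp (c / \<epsilon>)"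
      by (rule mult_left_less_imp_less) (use assms in simp)
    moreover have "C / \<epsilon> ^ n \<le> (\<bar>C\<bar> + 1) / \<epsilon> ^ n" using elim by (intro divide_right_mono) auto
    ultimately show ?case by linarith
  qed
qed

context bistable
begin

text \<open>Halfway between \<rho>/2 and \<rho>. The distance \<rho>/4 to \<rho>/2 makes the lower
  slope bound \<open>wlow\<close> positive, and the distance \<rho>/4 to \<rho> is the stretch on
  which differences of solutions grow.\<close>

definition a\<^sub>0 :: real where "a\<^sub>0 = 3 * \<rho> / 4"
definition wlow :: real where "wlow = sin (\<rho> / 2) / (3 * b\<^sup>2 * pi\<^sup>2 + 2) * (\<rho> / 4)\<^sup>2"
definition K :: real where "K = b ^ 3 + \<bar>\<Lambda>\<bar> * b + 1"
definition wup :: real where "wup = 2 * b / pi + pi * K"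
definition \<kappa> :: real where "\<kappa> = sqrt (3 * m'\<^sup>2 - \<Lambda>)"

lemma a\<^sub>0: "\<rho> / 2 < a\<^sub>0" "a\<^sub>0 < \<rho>" "0 < a\<^sub>0" "\<rho> - a\<^sub>0 = \<rho> / 4" "a\<^sub>0 < pi - a\<^sub>0"
  using \<rho> by (auto simp: a\<^sub>0_def)

lemma wlow: "wlow > 0"
proof -
  have "sin (\<rho> / 2) > 0" using \<rho> by (intro sin_gt_zero) auto
  moreover have "3 * b\<^sup>2 * pi\<^sup>2 + 2 > 0" by (intro add_nonneg_pos) auto
  ultimately show ?thesis using \<rho> by (simp add: wlow_def)
qed

lemma \<kappa>: "\<kappa> > 0" "\<kappa>\<^sup>2 = 3 * m'\<^sup>2 - \<Lambda>"
proof -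
  have "m\<^sup>2 < m'\<^sup>2" using m' m_pos by (intro power_strict_mono) auto
  then have "3 * m'\<^sup>2 - \<Lambda> > 0" using m_sq by linarith
  then show "\<kappa> > 0" "\<kappa>\<^sup>2 = 3 * m'\<^sup>2 - \<Lambda>" by (simp_all add: \<kappa>_def)
qed

lemma K: "K > 0"
  using b(1) \<Lambda>_pos by (auto simp: K_def intro!: add_nonneg_pos)

lemma wup: "wup > 0"
proof -
  have "2 * b / pi > 0" "pi * K > 0" using b(1) K by simp_all
  then show ?thesis unfolding wup_def by linarith
qed

lemma quotient_le_b: "\<bar>u\<bar> \<le> b \<Longrightarrow> \<bar>v\<bar> \<le> b \<Longrightarrow> u\<^sup>2 + u * v + v\<^sup>2 - \<Lambda> \<le> 3 * b\<^sup>2"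
proof -
  assume *: "\<bar>u\<bar> \<le> b" "\<bar>v\<bar> \<le> b"
  have "\<bar>u\<bar> * \<bar>v\<bar> \<le> b * b" "\<bar>u\<bar> * \<bar>u\<bar> \<le> b * b" "\<bar>v\<bar> * \<bar>v\<bar> \<le> b * b"
    using * by (auto intro!: mult_mono simp del: abs_mult_self_eq)
  moreover have "u * v \<le> \<bar>u\<bar> * \<bar>v\<bar>" by (metis abs_ge_self abs_mult)
  ultimately show ?thesis using \<Lambda>_pos by (simp add: power2_eq_square)
qed

text \<open>With both arguments beyond m' on the same side, the difference quotient of the cubic is
  at least its derivative at m'. This fixes the exponential rate \<kappa>/\<epsilon>.\<close>

lemma quotient_ge:
  assumes "(u \<le> - m' \<and> v \<le> - m') \<or> (m' \<le> u \<and> m' \<le> v)"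
  shows "\<kappa>\<^sup>2 \<le> u\<^sup>2 + u * v + v\<^sup>2 - \<Lambda>"
proof -
  have *: "m' * m' \<le> x * y" if "(x \<le> - m' \<and> y \<le> - m') \<or> (m' \<le> x \<and> m' \<le> y)" for x y
    using that mult_mono[of m' x m' y] mult_mono[of m' "- x" m' "- y"] m' by auto
  have "m' * m' \<le> u * u" "m' * m' \<le> v * v" using assms by (auto intro!: *)
  then show ?thesis using *[OF assms] \<kappa>(2) unfolding power2_eq_square by linarith
qed

end

context layer
begin

text \<open>A lower barrier independent of \<epsilon>, driven by the term -sin t in the equation for
  w''. Where w falls furthest below the parabola, w < c \<pi>^2 and w'' >= -2c, which for \<epsilon>
  <= 1 gives sin(\<rho>/2) < 3 b^2 c \<pi>^2 + 2c; the constant c is the one for which both sides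
  are equal.\<close>

lemma w_ge_bump:
  assumes "\<epsilon> \<le> 1" and t: "\<rho> / 2 \<le> t" "t \<le> pi - \<rho> / 2"
  defines "c \<equiv> sin (\<rho> / 2) / (3 * b\<^sup>2 * pi\<^sup>2 + 2)"
  shows "w t \<ge> c * ((t - \<rho> / 2) * (pi - \<rho> / 2 - t))"
proof -
  define l where "l = \<rho> / 2"
  have l: "0 < l" "l < pi / 2" using \<rho> by (auto simp: l_def)
  have "sin l > 0" using l by (intro sin_gt_zero) auto
  have pos: "3 * b\<^sup>2 * pi\<^sup>2 + 2 > 0" by (intro add_nonneg_pos) auto
  have c: "c > 0" "c * (3 * b\<^sup>2 * pi\<^sup>2 + 2) = sin l"
    using \<open>sin l > 0\<close> pos by (simp_all add: c_def l_def)
  let ?y = "\<lambda>t. w t - c * ((t - l) * (pi - l - t))"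
  have cy: "continuous_on {l..pi - l} ?y"
    using l by (intro continuous_intros continuous_on_subset[OF cont_w]) auto
  have "{l..pi - l} \<noteq> {}" using l by simp
  then obtain x where x: "x \<in> {l..pi - l}" "\<And>s. s \<in> {l..pi - l} \<Longrightarrow> ?y x \<le> ?y s"
    using continuous_attains_inf[OF compact_Icc _ cy] by auto
  have "?y x \<ge> 0"
  proof (rule ccontr)
    assume neg: "\<not> ?y x \<ge> 0"
    have wpos: "w s > 0" if "s \<in> {l..pi - l}" for s using w_pos[of s] that by (auto simp: l_def)
    have "x \<noteq> l" "x \<noteq> pi - l" using neg wpos[OF x(1)] by auto
    then have xi: "x \<in> {l<..<pi - l}" using x(1) by auto
    have in0: "s \<in> {0<..<pi}" "s \<in> {0..pi}" if "s \<in> {l<..<pi - l}" for s using that l by auto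
    let ?f1 = "\<lambda>t. c * (pi - 2 * t) - cubic \<Lambda> t (u t) / \<epsilon>\<^sup>2"
    have f: "((\<lambda>t. - ?y t) has_real_derivative ?f1 s) (at s)" if "s \<in> {l<..<pi - l}" for s
      using dw[OF in0(2)[OF that]] in0(1)[OF that]
      by (auto intro!: derivative_eq_intros simp: at_within_Icc_at algebra_simps)
    have f1: "(?f1 has_real_derivative c * - 2 - ((3 * (u x)\<^sup>2 - \<Lambda>) * w x - sin x) / \<epsilon>\<^sup>2) (at x)"
      using DERIV_cdivide[OF dz[OF in0(2)[OF xi]], of "\<epsilon>\<^sup>2"] in0(1)[OF xi]
      by (intro derivative_intros) (auto intro!: derivative_eq_intros simp: at_within_Icc_at)
    have "c * - 2 - ((3 * (u x)\<^sup>2 - \<Lambda>) * w x - sin x) / \<epsilon>\<^sup>2 \<le> 0"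
    proof (rule second_derivative_max(2)[OF f xi f1])
      fix s assume "s \<in> {l<..<pi - l}"
      then show "- ?y s \<le> - ?y x" using x(2)[of s] by simp
    qed
    then have "(sin x - (3 * (u x)\<^sup>2 - \<Lambda>) * w x) / \<epsilon>\<^sup>2 \<le> 2 * c"
      by (simp add: diff_divide_distrib)
    then have h1: "sin x - (3 * (u x)\<^sup>2 - \<Lambda>) * w x \<le> 2 * c * \<epsilon>\<^sup>2"
      using \<epsilon> by (simp add: pos_divide_le_eq)
    have h2: "(3 * (u x)\<^sup>2 - \<Lambda>) * w x \<le> 3 * b\<^sup>2 * w x"
      using quotient_le_b[of "u x" "u x"] bounds[OF in0(2)[OF xi]] wpos[OF x(1)]
      by (intro mult_right_mono) (auto simp: power2_eq_square)
    have h3: "2 * c * \<epsilon>\<^sup>2 \<le> 2 * c * 1"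
      using c \<epsilon> \<open>\<epsilon> \<le> 1\<close> by (intro mult_left_mono) (auto simp: power_le_one)
    have "3 * b\<^sup>2 * w x < 3 * b\<^sup>2 * (c * pi\<^sup>2)"
    proof (rule mult_strict_left_mono)
      have "(x - l) * (pi - l - x) \<le> pi * pi" using x(1) l by (intro mult_mono) auto
      then have "c * ((x - l) * (pi - l - x)) \<le> c * pi\<^sup>2"
        using c by (intro mult_left_mono) (auto simp: power2_eq_square)
      then show "w x < c * pi\<^sup>2" using neg by linarith
    qed (use b in simp)
    moreover have "sin l \<le> sin x" using x(1) l by (intro sin_ge_sin_of_mid) auto
    moreover have "c * (3 * b\<^sup>2 * pi\<^sup>2 + 2) = 3 * b\<^sup>2 * (c * pi\<^sup>2) + 2 * c" by (simp add: algebra_simps)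
    ultimately show False using h1 h2 h3 c(2) by linarith
  qed
  then show ?thesis using x(2)[of t] t by (simp add: l_def)
qed

lemma w_ge:
  assumes "\<epsilon> \<le> 1" and t: "a\<^sub>0 \<le> t" "t \<le> pi - a\<^sub>0"
  shows "w t \<ge> wlow"
proof -
  define c where "c = sin (\<rho> / 2) / (3 * b\<^sup>2 * pi\<^sup>2 + 2)"
  have "wlow = c * (\<rho> / 4)\<^sup>2" by (simp add: wlow_def c_def)
  then have "c > 0" using wlow \<rho> by (simp add: zero_less_mult_iff)
  have "\<rho> / 4 * (\<rho> / 4) \<le> (t - \<rho> / 2) * (pi - \<rho> / 2 - t)"
    using t \<rho> by (intro mult_mono) (auto simp: a\<^sub>0_def)
  then have "wlow \<le> c * ((t - \<rho> / 2) * (pi - \<rho> / 2 - t))"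
    unfolding \<open>wlow = _\<close> using \<open>c > 0\<close> by (intro mult_left_mono) (auto simp: power2_eq_square)
  also have "\<dots> \<le> w t" unfolding c_def using w_ge_bump[OF \<open>\<epsilon> \<le> 1\<close>, of t] t a\<^sub>0 by simp
  finally show ?thesis .
qed

lemma u_lower:
  assumes "\<epsilon> \<le> 1" and "a\<^sub>0 \<le> s" "s \<le> t" "t \<le> pi - a\<^sub>0"
  shows "wlow * (t - s) \<le> u t - u s"
proof -
  have "wlow * t - wlow * s \<le> u t - u s"
    by (rule deriv_within_mono_le[where a = 0 and b = pi and f = "\<lambda>t. wlow * t" and f' = "\<lambda>_. wlow", OF _ du])
       (use assms w_ge a\<^sub>0 in \<open>auto intro!: derivative_eq_intros\<close>)
  then show ?thesis by (simp add: algebra_simps)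
qed

text \<open>The mean value theorem supplies a point where |w| <= 2b/\<pi>, and |w'| <=
  K/\<epsilon>^2 does the rest. The loss of \<epsilon>^-2 is harmless, since the bound is later
  compared with an exponential.\<close>

lemma w_le:
  assumes "\<epsilon> \<le> 1" and t: "t \<in> {0..pi}"
  shows "\<bar>w t\<bar> \<le> wup / \<epsilon>\<^sup>2"
proof -
  have "\<exists>x\<in>{0<..<pi}. u pi - u 0 = (\<lambda>h. w x * h) (pi - 0)"
    by (rule mvt_simple) (use du in \<open>auto simp: has_field_derivative_def\<close>)
  then obtain x where "x \<in> {0<..<pi}" and x2: "u pi - u 0 = w x * pi" by auto
  then have x: "x \<in> {0..pi}" "u pi - u 0 = w x * pi" by auto
  have "\<bar>w x * pi\<bar> \<le> 2 * b" using bounds[of 0] bounds[of pi] x(2) by auto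
  then have "\<bar>w x\<bar> \<le> 2 * b / pi" by (simp add: abs_mult field_simps)
  also have "\<dots> \<le> 2 * b / pi / \<epsilon>\<^sup>2"
    using \<epsilon> \<open>\<epsilon> \<le> 1\<close> b by (simp add: le_divide_eq mult_right_le_one_le power_le_one)
  finally have 1: "\<bar>w x\<bar> \<le> 2 * b / pi / \<epsilon>\<^sup>2" .
  have "\<bar>w t - w x\<bar> \<le> K / \<epsilon>\<^sup>2 * \<bar>t - x\<bar>"
  proof (rule field_differentiable_bound[of "{0..pi}" w "\<lambda>t. cubic \<Lambda> t (u t) / \<epsilon>\<^sup>2" "K / \<epsilon>\<^sup>2" t x, unfolded real_norm_def])
    fix s assume "s \<in> {0..pi}"
    then show "\<bar>cubic \<Lambda> s (u s) / \<epsilon>\<^sup>2\<bar> \<le> K / \<epsilon>\<^sup>2"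
      using cubic_bound[OF bounds] by (simp add: K_def divide_right_mono)
  qed (use dw x t in auto)
  also have "\<dots> \<le> K / \<epsilon>\<^sup>2 * pi" using x t K by (intro mult_left_mono) auto
  finally have 2: "\<bar>w t - w x\<bar> \<le> pi * K / \<epsilon>\<^sup>2" by (simp add: mult.commute)
  have "wup / \<epsilon>\<^sup>2 = 2 * b / pi / \<epsilon>\<^sup>2 + pi * K / \<epsilon>\<^sup>2" by (simp add: wup_def add_divide_distrib)
  then show ?thesis using 1 2 by linarith
qed

lemma u_upper:
  assumes "\<epsilon> \<le> 1" and "0 \<le> s" "s \<le> t" "t \<le> pi"
  shows "u t - u s \<le> wup / \<epsilon>\<^sup>2 * (t - s)"
proof -
  have "u t - u s \<le> wup / \<epsilon>\<^sup>2 * t - wup / \<epsilon>\<^sup>2 * s"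
  proof (rule deriv_within_mono_le[where a = 0 and b = pi, OF du])
    fix x assume "s < x" "x < t"
    then have "x \<in> {0..pi}" using assms by simp
    then show "w x \<le> wup / \<epsilon>\<^sup>2" using w_le[OF \<open>\<epsilon> \<le> 1\<close>, of x] by linarith
  next
    fix t show "((\<lambda>t. wup / \<epsilon>\<^sup>2 * t) has_real_derivative wup / \<epsilon>\<^sup>2) (at t within {0..pi})"
      using DERIV_cmult[OF DERIV_ident, of "wup / \<epsilon>\<^sup>2"] by simp
  qed (use assms in auto)
  then show ?thesis by (simp only: right_diff_distrib)
qed

lemma u_strict_mono:
  assumes "\<rho> / 2 \<le> s" "s < t" "t \<le> pi - \<rho> / 2"
  shows "u s < u t"
proof (rule deriv_within_strict_mono[where a = 0 and b = pi and f = u, OF du])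
  fix x assume "s < x" "x < t"
  then show "w x > 0" using w_pos[of x] assms by simp
qed (use assms \<rho> in auto)

lemma u_le_iff:
  assumes "s \<in> {\<rho> / 2..pi - \<rho> / 2}" "t \<in> {\<rho> / 2..pi - \<rho> / 2}"
  shows "u s \<le> u t \<longleftrightarrow> s \<le> t" "u s < u t \<longleftrightarrow> s < t"
  using u_strict_mono[of s t] u_strict_mono[of t s] assms by (cases s t rule: linorder_cases; auto)+

text \<open>The time at which the solution reaches a given height on the strictly increasing part of
  its graph; with \<open>dT\<close> the height becomes the independent variable.\<close>

definition T :: "real \<Rightarrow> real" where "T = the_inv_into {\<rho> / 2..pi - \<rho> / 2} u"

lemma T_u: "t \<in> {\<rho> / 2..pi - \<rho> / 2} \<Longrightarrow> T (u t) = t"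
  unfolding T_def
proof (rule the_inv_into_f_f)
  show "inj_on u {\<rho> / 2..pi - \<rho> / 2}"
    using u_le_iff(1) by (intro inj_onI) (metis order_antisym order_refl)
qed

lemma image_u: "u ` {\<rho> / 2..pi - \<rho> / 2} = {u (\<rho> / 2)..u (pi - \<rho> / 2)}"
proof -
  have l: "\<rho> / 2 \<le> pi - \<rho> / 2" using \<rho> by simp
  show ?thesis
  proof safe
    fix t assume "t \<in> {\<rho> / 2..pi - \<rho> / 2}"
    then show "u t \<in> {u (\<rho> / 2)..u (pi - \<rho> / 2)}"
      using u_le_iff(1)[of "\<rho> / 2" t] u_le_iff(1)[of t "pi - \<rho> / 2"] l by auto
  next
    fix y assume y: "y \<in> {u (\<rho> / 2)..u (pi - \<rho> / 2)}"
    have "continuous_on {\<rho> / 2..pi - \<rho> / 2} u" using \<rho> by (intro continuous_on_subset[OF cont_u]) auto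
    then show "y \<in> u ` {\<rho> / 2..pi - \<rho> / 2}" using IVT'[of u "\<rho> / 2" y "pi - \<rho> / 2"] y l by auto
  qed
qed

lemma u_T: "y \<in> {u (\<rho> / 2)..u (pi - \<rho> / 2)} \<Longrightarrow> u (T y) = y"
  and T_in: "y \<in> {u (\<rho> / 2)..u (pi - \<rho> / 2)} \<Longrightarrow> T y \<in> {\<rho> / 2..pi - \<rho> / 2}"
  unfolding image_u[symmetric] using T_u by auto

lemma dT:
  assumes y: "u (\<rho> / 2) < y" "y < u (pi - \<rho> / 2)"
  shows "(T has_real_derivative inverse (w (T y))) (at y)"
proof (rule DERIV_inverse_function[where f = u and a = "u (\<rho> / 2)" and b = "u (pi - \<rho> / 2)"])
  have Ty: "T y \<in> {\<rho> / 2..pi - \<rho> / 2}" and uTy: "u (T y) = y" using T_in[of y] u_T[of y] y by auto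
  then have "T y \<in> {0<..<pi}" using \<rho> by auto
  then show "(u has_real_derivative w (T y)) (at (T y))"
    using du[of "T y"] by (simp add: at_within_Icc_at)
  show "w (T y) \<noteq> 0" using w_pos[of "T y"] Ty by auto
  have "continuous_on (u ` {\<rho> / 2..pi - \<rho> / 2}) T"
    by (rule continuous_on_inv[OF continuous_on_subset[OF cont_u]]) (use \<rho> T_u in auto)
  then have "continuous_on {u (\<rho> / 2)..u (pi - \<rho> / 2)} T" unfolding image_u .
  then show "isCont T y" by (rule continuous_on_interior) (use y in simp)
qed (use y u_T in auto)

end

section \<open>Uniqueness\<close>

context bistable
begin

text \<open>The last clause is the contradiction aimed at in \<open>faster_somewhere\<close>: the
  smallest slope, times the growth of a gap over a stretch \<rho>/4, beats the largest
  slope.\<close>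

definition eps_small :: "real \<Rightarrow> bool" where
  "eps_small \<epsilon> \<longleftrightarrow> 0 < \<epsilon> \<and> \<epsilon> \<le> 1 \<and> wup / \<epsilon>\<^sup>2 < wlow * cosh (\<kappa> / \<epsilon> * (\<rho> / 4))"

lemma eventually_eps_small: "eventually eps_small (at_right 0)"
proof -
  have "eventually (\<lambda>\<epsilon>. 2 * wup / wlow / \<epsilon> ^ 2 < exp (\<kappa> * (\<rho> / 4) / \<epsilon>)) (at_right 0)"
    using \<kappa> \<rho> by (intro exp_inverse_dominates) auto
  moreover have "eventually (\<lambda>\<epsilon>. \<epsilon> \<in> {0<..<1::real}) (at_right 0)"
    by (rule eventually_at_right_real) simp
  ultimately show ?thesis
  proof eventually_elim
    case (elim \<epsilon>)
    have "exp x \<le> 2 * cosh x" for x :: real by (simp add: cosh_def)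
    from this[of "\<kappa> / \<epsilon> * (\<rho> / 4)"]
    have "exp (\<kappa> * (\<rho> / 4) / \<epsilon>) \<le> 2 * cosh (\<kappa> / \<epsilon> * (\<rho> / 4))"
      by (simp only: times_divide_eq_left)
    with elim have "2 * wup / wlow / \<epsilon>\<^sup>2 < 2 * cosh (\<kappa> / \<epsilon> * (\<rho> / 4))" by linarith
    then have "2 * wup / wlow / \<epsilon>\<^sup>2 * wlow < 2 * cosh (\<kappa> / \<epsilon> * (\<rho> / 4)) * wlow"
      using wlow by (intro mult_strict_right_mono)
    then have "wup / \<epsilon>\<^sup>2 < wlow * cosh (\<kappa> / \<epsilon> * (\<rho> / 4))"
      using wlow by (simp add: mult.commute)
    then show ?case using elim by (simp add: eps_small_def)
  qed
qed

text \<open>The difference D of the solutions satisfies \<epsilon>^2 D'' = Q D with Q >= \<kappa>^2.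
  A first comparison keeps D and D' nonnegative. The second is with D(s) cosh(\<kappa>(t -
  s)/\<epsilon>), the comparison function with slope zero at s, because nothing better than D'(s) >=
  0 is known.\<close>

lemma difference_growth:
  assumes l1: "layer \<Lambda> b r \<delta> Ulo Umid Uup \<epsilon> u1 w1" and l2: "layer \<Lambda> b r \<delta> Ulo Umid Uup \<epsilon> u2 w2"
    and se: "0 \<le> s" "s \<le> e" "e \<le> pi"
    and q: "\<And>t. s \<le> t \<Longrightarrow> t \<le> e \<Longrightarrow> \<kappa>\<^sup>2 \<le> (u1 t)\<^sup>2 + u1 t * u2 t + (u2 t)\<^sup>2 - \<Lambda>"
    and D: "u1 s \<ge> u2 s" "w1 s \<ge> w2 s"
  shows "u1 e - u2 e \<ge> (u1 s - u2 s) * cosh (\<kappa> / \<epsilon> * (e - s))" "w1 e - w2 e \<ge> w1 s - w2 s"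
    "u1 e - u2 e \<ge> u1 s - u2 s" "\<And>t. s \<le> t \<Longrightarrow> t \<le> e \<Longrightarrow> u1 t - u2 t \<ge> u1 s - u2 s"
proof -
  interpret l1: layer \<Lambda> b r \<delta> Ulo Umid Uup \<epsilon> u1 w1 by (rule l1)
  interpret l2: layer \<Lambda> b r \<delta> Ulo Umid Uup \<epsilon> u2 w2 by (rule l2)
  define Q where "Q t = (u1 t)\<^sup>2 + u1 t * u2 t + (u2 t)\<^sup>2 - \<Lambda>" for t
  define D where "D t = u1 t - u2 t" for t
  define D1 where "D1 t = w1 t - w2 t" for t
  have sub: "{s..e} \<subseteq> {0..pi}" using se by auto
  have dD: "(D has_real_derivative D1 t) (at t within {s..e})" if "t \<in> {s..e}" for t
    unfolding D_def D1_def
    using that sub l1.du[of t] l2.du[of t] by (intro DERIV_diff) (auto intro: DERIV_subset)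
  have dD1: "(D1 has_real_derivative Q t / \<epsilon>\<^sup>2 * D t) (at t within {s..e})" if "t \<in> {s..e}" for t
  proof -
    have "t \<in> {0..pi}" using that sub by blast
    then have "(D1 has_real_derivative cubic \<Lambda> t (u1 t) / \<epsilon>\<^sup>2 - cubic \<Lambda> t (u2 t) / \<epsilon>\<^sup>2) (at t within {s..e})"
      unfolding D1_def by (intro DERIV_diff DERIV_subset[OF l1.dw sub] DERIV_subset[OF l2.dw sub])
    also have "cubic \<Lambda> t (u1 t) / \<epsilon>\<^sup>2 - cubic \<Lambda> t (u2 t) / \<epsilon>\<^sup>2 = Q t / \<epsilon>\<^sup>2 * D t"
      by (simp add: diff_divide_distrib[symmetric] cubic_diff Q_def D_def)
    finally show ?thesis .
  qed
  have Q: "0 \<le> Q t / \<epsilon>\<^sup>2 \<and> Q t / \<epsilon>\<^sup>2 \<le> 3 * b\<^sup>2 / \<epsilon>\<^sup>2" "\<kappa>\<^sup>2 \<le> Q t" if "t \<in> {s..e}" for t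
  proof -
    have t: "t \<in> {0..pi}" using that sub by blast
    show k: "\<kappa>\<^sup>2 \<le> Q t" unfolding Q_def using q[of t] that by simp
    have "Q t \<le> 3 * b\<^sup>2" unfolding Q_def by (rule quotient_le_b[OF l1.bounds[OF t] l2.bounds[OF t]])
    moreover have "0 \<le> Q t" using k zero_le_power2[of \<kappa>] by linarith
    ultimately show "0 \<le> Q t / \<epsilon>\<^sup>2 \<and> Q t / \<epsilon>\<^sup>2 \<le> 3 * b\<^sup>2 / \<epsilon>\<^sup>2"
      by (auto intro!: divide_right_mono)
  qed
  have Ds: "D s \<ge> 0" "D1 s \<ge> 0" using assms by (auto simp: D_def D1_def)
  have pos: "D t \<ge> 0 \<and> D1 t \<ge> 0" if "t \<in> {s..e}" for t
    using second_order_comparison[OF dD dD1 Ds Q(1) order_refl that] by auto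
  show "\<And>t. s \<le> t \<Longrightarrow> t \<le> e \<Longrightarrow> u1 t - u2 t \<ge> u1 s - u2 s"
  proof -
    fix t assume t: "s \<le> t" "t \<le> e"
    have "D s \<le> D t" by (rule deriv_within_mono[OF dD]) (use t pos in auto)
    then show "u1 t - u2 t \<ge> u1 s - u2 s" by (simp add: D_def)
  qed
  then show "u1 e - u2 e \<ge> u1 s - u2 s" using se by simp
  have "D1 s \<le> D1 e"
  proof (rule deriv_within_mono[OF dD1])
    fix x assume "s < x" "x < e"
    then show "0 \<le> Q x / \<epsilon>\<^sup>2 * D x" using Q(1)[of x] pos[of x] by (intro mult_nonneg_nonneg) auto
  qed (use se in auto)
  then show "w1 e - w2 e \<ge> w1 s - w2 s" by (simp add: D1_def)
  define k where "k = \<kappa> / \<epsilon>"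
  have "D e - D s * cosh (k * (e - s)) \<ge> 0"
  proof (rule second_order_comparison(1)[where y = "\<lambda>t. D t - D s * cosh (k * (t - s))"
        and ?y1.0 = "\<lambda>t. D1 t - D s * (k * sinh (k * (t - s)))"
        and ?y2.0 = "\<lambda>t. Q t / \<epsilon>\<^sup>2 * D t - D s * (k * (k * cosh (k * (t - s))))"
        and p = "\<lambda>_. k\<^sup>2" and P = "k\<^sup>2" and a = s and b = e])
    fix t assume t: "t \<in> {s..e}"
    show "((\<lambda>t. D t - D s * cosh (k * (t - s))) has_real_derivative
        D1 t - D s * (k * sinh (k * (t - s)))) (at t within {s..e})"
      by (rule DERIV_diff[OF dD[OF t]]) (auto intro!: derivative_eq_intros)
    show "((\<lambda>t. D1 t - D s * (k * sinh (k * (t - s)))) has_real_derivative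
        Q t / \<epsilon>\<^sup>2 * D t - D s * (k * (k * cosh (k * (t - s))))) (at t within {s..e})"
      by (rule DERIV_diff[OF dD1[OF t]]) (auto intro!: derivative_eq_intros)
    have "k\<^sup>2 * D t \<le> Q t / \<epsilon>\<^sup>2 * D t"
      using Q(2)[OF t] pos[OF t] by (auto simp: k_def power_divide intro!: mult_right_mono divide_right_mono)
    then show "k\<^sup>2 * (D t - D s * cosh (k * (t - s))) \<le>
        Q t / \<epsilon>\<^sup>2 * D t - D s * (k * (k * cosh (k * (t - s))))"
      by (simp add: power2_eq_square right_diff_distrib mult_ac)
  qed (use Ds se in auto)
  then show "u1 e - u2 e \<ge> (u1 s - u2 s) * cosh (\<kappa> / \<epsilon> * (e - s))"
    by (simp add: D_def k_def)
qed

text \<open>If \<open>u1\<close> were slower than \<open>u2\<close> at all common levels of the left region, its lead in time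
  would decrease there; but the lead in height grows by a factor exponential in \<open>1/\<epsilon>\<close>.\<close>

lemma faster_somewhere:
  assumes l1: "layer \<Lambda> b r \<delta> Ulo Umid Uup \<epsilon> u1 w1" and l2: "layer \<Lambda> b r \<delta> Ulo Umid Uup \<epsilon> u2 w2"
    and small: "eps_small \<epsilon>" and D: "u2 a\<^sub>0 < u1 a\<^sub>0" "w2 a\<^sub>0 \<le> w1 a\<^sub>0"
  shows "\<exists>t s. a\<^sub>0 \<le> t \<and> t \<le> \<rho> \<and> t < s \<and> s \<le> pi - a\<^sub>0 \<and> u1 t = u2 s \<and> w2 s \<le> w1 t"
proof (rule ccontr)
  assume neg: "\<not> ?thesis"
  interpret l1: layer \<Lambda> b r \<delta> Ulo Umid Uup \<epsilon> u1 w1 by (rule l1)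
  interpret l2: layer \<Lambda> b r \<delta> Ulo Umid Uup \<epsilon> u2 w2 by (rule l2)
  have \<epsilon>: "0 < \<epsilon>" "\<epsilon> \<le> 1" "wup / \<epsilon>\<^sup>2 < wlow * cosh (\<kappa> / \<epsilon> * (\<rho> / 4))"
    using small by (auto simp: eps_small_def)
  have q: "\<kappa>\<^sup>2 \<le> (u1 t)\<^sup>2 + u1 t * u2 t + (u2 t)\<^sup>2 - \<Lambda>" if "a\<^sub>0 \<le> t" "t \<le> \<rho>" for t
    using l1.left'[of t] l2.left'[of t] that a\<^sub>0 by (intro quotient_ge) auto
  note growth = difference_growth[OF l1 l2 less_imp_le[OF a\<^sub>0(3)] less_imp_le[OF a\<^sub>0(2)] less_imp_le[OF \<rho>(3)] q
      less_imp_le[OF D(1)] D(2)]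
  define y0 where "y0 = u1 a\<^sub>0"
  define y1 where "y1 = u1 \<rho>"
  have le: "y0 < y1" unfolding y0_def y1_def using a\<^sub>0 \<rho> by (intro l1.u_strict_mono) auto
  \<comment> \<open>The heights in question lie in the range of both inverse functions: u2 is lower
    at the start, and it has to pass the level m' before \<pi> - \<open>a\<^sub>0\<close>.\<close>
  have lev: "u1 (\<rho> / 2) < y \<and> y < u1 (pi - \<rho> / 2) \<and> u2 (\<rho> / 2) < y \<and> y < u2 (pi - \<rho> / 2) \<and>
      a\<^sub>0 \<le> l1.T y \<and> l1.T y \<le> \<rho> \<and> l1.T y < l2.T y \<and> l2.T y \<le> pi - a\<^sub>0 \<and>
      u1 (l1.T y) = y \<and> u2 (l2.T y) = y" if y: "y0 \<le> y" "y \<le> y1" for y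
  proof -
    have "y1 \<le> - m'" unfolding y1_def using l1.left'[of \<rho>] \<rho> by simp
    moreover have "m' \<le> u2 (pi - \<rho>)" using l2.right'[of "pi - \<rho>"] \<rho> by simp
    moreover have s: "u1 (\<rho> / 2) < u1 a\<^sub>0" "u2 (\<rho> / 2) < u2 a\<^sub>0" "u2 (pi - \<rho>) < u2 (pi - a\<^sub>0)"
      "u2 (pi - a\<^sub>0) < u2 (pi - \<rho> / 2)" "u1 \<rho> < u1 (pi - \<rho> / 2)"
      using a\<^sub>0 \<rho> by (auto intro!: l1.u_strict_mono l2.u_strict_mono)
    ultimately have b: "u1 (\<rho> / 2) < y" "y < u1 (pi - \<rho> / 2)" "u2 (\<rho> / 2) < y" "y < u2 (pi - \<rho> / 2)"
      "y < u2 (pi - a\<^sub>0)"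
      using y D m' unfolding y0_def y1_def by linarith+
    have T1: "l1.T y \<in> {\<rho> / 2..pi - \<rho> / 2}" "u1 (l1.T y) = y"
      using l1.T_in[of y] l1.u_T[of y] b by auto
    have T2: "l2.T y \<in> {\<rho> / 2..pi - \<rho> / 2}" "u2 (l2.T y) = y"
      using l2.T_in[of y] l2.u_T[of y] b by auto
    have t: "a\<^sub>0 \<le> l1.T y" "l1.T y \<le> \<rho>"
      using l1.u_le_iff(1)[of a\<^sub>0 "l1.T y"] l1.u_le_iff(1)[of "l1.T y" \<rho>] T1 y a\<^sub>0 \<rho>
      by (auto simp: y0_def y1_def)
    have "u2 (l1.T y) < u1 (l1.T y)" using growth(4)[of "l1.T y"] t D by auto
    then have "l1.T y < l2.T y" using l2.u_le_iff(2)[of "l1.T y" "l2.T y"] T1 T2 by auto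
    moreover have "l2.T y \<le> pi - a\<^sub>0"
      using l2.u_le_iff(1)[of "l2.T y" "pi - a\<^sub>0"] T2 b(5) a\<^sub>0 by auto
    ultimately show ?thesis using b t T1 T2 by auto
  qed
  have "l2.T y1 - l1.T y1 \<le> l2.T y0 - l1.T y0"
  proof -
    have "- (l2.T y0 - l1.T y0) \<le> - (l2.T y1 - l1.T y1)"
    proof (rule deriv_within_mono[where f = "\<lambda>y. - (l2.T y - l1.T y)" and a = y0 and b = y1
          and f' = "\<lambda>y. - (inverse (w2 (l2.T y)) - inverse (w1 (l1.T y)))"])
      fix y assume "y \<in> {y0..y1}"
      then show "((\<lambda>y. - (l2.T y - l1.T y)) has_real_derivative
          - (inverse (w2 (l2.T y)) - inverse (w1 (l1.T y)))) (at y within {y0..y1})"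
        using lev[of y] by (intro DERIV_minus DERIV_diff has_field_derivative_at_within[OF l1.dT]
            has_field_derivative_at_within[OF l2.dT]) auto
    next
      fix y assume y: "y0 < y" "y < y1"
      then have "w1 (l1.T y) < w2 (l2.T y)" using neg lev[of y] by (metis less_imp_le not_le)
      moreover have "w1 (l1.T y) > 0" using lev[of y] y a\<^sub>0 \<rho> by (intro l1.w_pos) auto
      ultimately show "0 \<le> - (inverse (w2 (l2.T y)) - inverse (w1 (l1.T y)))"
        using le_imp_inverse_le[of "w1 (l1.T y)" "w2 (l2.T y)"] by simp
    qed (use le in auto)
    then show ?thesis by simp
  qed
  moreover have T1: "l1.T y0 = a\<^sub>0" "l1.T y1 = \<rho>" unfolding y0_def y1_def using a\<^sub>0 \<rho> by (auto intro!: l1.T_u)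
  ultimately have lag: "l2.T y1 - \<rho> \<le> l2.T y0 - a\<^sub>0" by simp
  \<comment> \<open>A gap in height is a lag in time weighted by slopes of u2: at \<rho> it is at
    most the largest slope times the lag, at \<open>a\<^sub>0\<close> at least the smallest slope
    times the lag. In between the lag has not grown, but the gap has, by the factor cosh.\<close>
  have "u1 \<rho> - u2 \<rho> = u2 (l2.T y1) - u2 \<rho>" using lev[of y1] le by (simp add: y1_def)
  also have "\<dots> \<le> wup / \<epsilon>\<^sup>2 * (l2.T y1 - \<rho>)"
    using lev[of y1] le T1 a\<^sub>0 \<rho> \<epsilon> by (intro l2.u_upper) auto
  also have "\<dots> \<le> wup / \<epsilon>\<^sup>2 * (l2.T y0 - a\<^sub>0)" using lag wup by (intro mult_left_mono) auto
  also have "\<dots> < wlow * cosh (\<kappa> / \<epsilon> * (\<rho> / 4)) * (l2.T y0 - a\<^sub>0)"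
    using \<epsilon>(3) lev[of y0] le T1 by (intro mult_strict_right_mono) auto
  also have "\<dots> = wlow * (l2.T y0 - a\<^sub>0) * cosh (\<kappa> / \<epsilon> * (\<rho> / 4))" by simp
  also have "\<dots> \<le> (u2 (l2.T y0) - u2 a\<^sub>0) * cosh (\<kappa> / \<epsilon> * (\<rho> / 4))"
    using lev[of y0] le T1 \<epsilon> by (intro mult_right_mono l2.u_lower) (auto simp: cosh_real_nonneg)
  also have "\<dots> = (u1 a\<^sub>0 - u2 a\<^sub>0) * cosh (\<kappa> / \<epsilon> * (\<rho> - a\<^sub>0))"
    using lev[of y0] le unfolding a\<^sub>0(4) by (simp add: y0_def)
  also have "\<dots> \<le> u1 \<rho> - u2 \<rho>" by (rule growth(1))
  finally show False by simp
qed

text \<open>Where \<open>u1\<close> is ahead in time and at least as fast, \<open>d(w1\<^sup>2 - w2\<^sup>2)/du\<close> is positive because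
  \<open>cos\<close> decreases; so \<open>u1\<close> remains ahead and faster up to the right region.\<close>

lemma propagation:
  assumes l1: "layer \<Lambda> b r \<delta> Ulo Umid Uup \<epsilon> u1 w1" and l2: "layer \<Lambda> b r \<delta> Ulo Umid Uup \<epsilon> u2 w2"
    and small: "eps_small \<epsilon>" and D0: "u2 0 < u1 0" "w2 0 \<le> w1 0"
  shows "u2 pi < u1 pi" "w2 pi < w1 pi"
proof -
  interpret l1: layer \<Lambda> b r \<delta> Ulo Umid Uup \<epsilon> u1 w1 by (rule l1)
  interpret l2: layer \<Lambda> b r \<delta> Ulo Umid Uup \<epsilon> u2 w2 by (rule l2)
  have \<epsilon>: "0 < \<epsilon>" "\<epsilon> \<le> 1" using small by (auto simp: eps_small_def)
  have q: "\<kappa>\<^sup>2 \<le> (u1 t)\<^sup>2 + u1 t * u2 t + (u2 t)\<^sup>2 - \<Lambda>" if "0 \<le> t" "t \<le> a\<^sub>0" for t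
    using l1.left'[of t] l2.left'[of t] that a\<^sub>0 by (intro quotient_ge) auto
  note g0 = difference_growth[OF l1 l2 order_refl less_imp_le[OF a\<^sub>0(3)] _ q less_imp_le[OF D0(1)] D0(2)]
  have Da: "u2 a\<^sub>0 < u1 a\<^sub>0" "w2 a\<^sub>0 \<le> w1 a\<^sub>0" using g0(2,3) D0 a\<^sub>0 \<rho> by fastforce+
  obtain t s where ts: "a\<^sub>0 \<le> t" "t \<le> \<rho>" "t < s" "s \<le> pi - a\<^sub>0" "u1 t = u2 s" "w2 s \<le> w1 t"
    using faster_somewhere[OF l1 l2 small Da] by blast
  define y0 where "y0 = u1 t"
  \<comment> \<open>The smaller of the two end heights, so that both inverse functions are available
    up to it. Which of the two it is gets decided in \<open>Dr\<close>.\<close>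
  define y1 where "y1 = min (u1 (pi - a\<^sub>0)) (u2 (pi - a\<^sub>0))"
  have y0m: "y0 \<le> - m'" unfolding y0_def using l1.left'[of t] ts a\<^sub>0 by simp
  have mono: "u1 (pi - \<rho>) < u1 (pi - a\<^sub>0)" "u2 (pi - \<rho>) < u2 (pi - a\<^sub>0)"
    "u1 (pi - a\<^sub>0) < u1 (pi - \<rho> / 2)" "u2 (pi - a\<^sub>0) < u2 (pi - \<rho> / 2)"
    using a\<^sub>0 \<rho> by (auto intro!: l1.u_strict_mono l2.u_strict_mono)
  have "m' \<le> u1 (pi - \<rho>)" "m' \<le> u2 (pi - \<rho>)"
    using l1.right'[of "pi - \<rho>"] l2.right'[of "pi - \<rho>"] \<rho> by simp_all
  then have le: "y0 < y1" using y0m mono m' unfolding y1_def by linarith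
  have low: "u1 (\<rho> / 2) < y0" "u2 (\<rho> / 2) < y0"
  proof -
    show "u1 (\<rho> / 2) < y0" unfolding y0_def using ts a\<^sub>0 by (intro l1.u_strict_mono) auto
    show "u2 (\<rho> / 2) < y0" unfolding y0_def ts(5) using ts a\<^sub>0 by (intro l2.u_strict_mono) auto
  qed
  have lev: "u1 (\<rho> / 2) < y \<and> y < u1 (pi - \<rho> / 2) \<and> u2 (\<rho> / 2) < y \<and> y < u2 (pi - \<rho> / 2) \<and>
      l1.T y \<in> {\<rho> / 2..pi - \<rho> / 2} \<and> l2.T y \<in> {\<rho> / 2..pi - \<rho> / 2} \<and>
      u1 (l1.T y) = y \<and> u2 (l2.T y) = y" if y: "y0 \<le> y" "y \<le> y1" for y
  proof -
    have b: "u1 (\<rho> / 2) < y" "y < u1 (pi - \<rho> / 2)" "u2 (\<rho> / 2) < y" "y < u2 (pi - \<rho> / 2)"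
      using y low mono unfolding y1_def by linarith+
    then show ?thesis using l1.T_in[of y] l1.u_T[of y] l2.T_in[of y] l2.u_T[of y] by auto
  qed
  define d where "d y = l2.T y - l1.T y" for y
  define Y where "Y y = (w1 (l1.T y))\<^sup>2 - (w2 (l2.T y))\<^sup>2" for y
  have dd: "(d has_real_derivative inverse (w2 (l2.T y)) - inverse (w1 (l1.T y))) (at y within {y0..y1})"
    if "y \<in> {y0..y1}" for y
    unfolding d_def using lev[of y] that
    by (intro DERIV_diff has_field_derivative_at_within[OF l1.dT] has_field_derivative_at_within[OF l2.dT]) auto
  have wpos: "w1 (l1.T y) > 0" "w2 (l2.T y) > 0" if "y \<in> {y0..y1}" for y
    using lev[of y] that by (auto intro!: l1.w_pos l2.w_pos)
  have dY: "(Y has_real_derivative 2 / \<epsilon>\<^sup>2 * (cos (l1.T y) - cos (l2.T y))) (at y within {y0..y1})"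
    if y: "y \<in> {y0..y1}" for y
  proof -
    have sq: "((\<lambda>y. (w (T y))\<^sup>2) has_real_derivative 2 * cubic \<Lambda> (T y) y / \<epsilon>\<^sup>2) (at y)"
      if T: "(T has_real_derivative inverse (w (T y))) (at y)" "T y \<in> {0<..<pi}" "w (T y) > 0"
        and w: "\<And>t. t \<in> {0..pi} \<Longrightarrow> (w has_real_derivative cubic \<Lambda> t (u t) / \<epsilon>\<^sup>2) (at t within {0..pi})"
        and u: "u (T y) = y" for w T u
    proof -
      have "(w has_real_derivative cubic \<Lambda> (T y) y / \<epsilon>\<^sup>2) (at (T y))"
        using w[of "T y"] T(2) u by (simp add: at_within_Icc_at)
      from DERIV_chain2[OF this T(1)]
      have "((\<lambda>y. (w (T y))\<^sup>2) has_real_derivative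
          2 * w (T y) * (cubic \<Lambda> (T y) y / \<epsilon>\<^sup>2 * inverse (w (T y)))) (at y)"
        by (auto intro!: derivative_eq_intros)
      then show ?thesis using T(3) by (simp add: field_simps)
    qed
    have "l1.T y \<in> {0<..<pi}" "l2.T y \<in> {0<..<pi}" using lev[of y] y \<rho> by auto
    then have "(Y has_real_derivative 2 * cubic \<Lambda> (l1.T y) y / \<epsilon>\<^sup>2 - 2 * cubic \<Lambda> (l2.T y) y / \<epsilon>\<^sup>2) (at y)"
      unfolding Y_def using lev[of y] y wpos[OF y]
      by (intro DERIV_diff sq[OF l1.dT _ _ l1.dw] sq[OF l2.dT _ _ l2.dw]) auto
    moreover have "2 * cubic \<Lambda> (l1.T y) y / \<epsilon>\<^sup>2 - 2 * cubic \<Lambda> (l2.T y) y / \<epsilon>\<^sup>2 =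
        2 / \<epsilon>\<^sup>2 * (cos (l1.T y) - cos (l2.T y))"
      by (simp add: cubic_def diff_divide_distrib add_divide_distrib right_diff_distrib)
    ultimately show ?thesis by (simp add: has_field_derivative_at_within)
  qed
  have cosd: "0 < 2 / \<epsilon>\<^sup>2 * (cos (l1.T y) - cos (l2.T y))" if "y \<in> {y0..y1}" "d y > 0" for y
  proof (rule mult_pos_pos)
    show "0 < 2 / \<epsilon>\<^sup>2" using \<epsilon> by simp
    have "cos (l2.T y) < cos (l1.T y)"
      using lev[of y] that \<rho> by (intro cos_monotone_0_pi) (auto simp: d_def)
    then show "0 < cos (l1.T y) - cos (l2.T y)" by simp
  qed
  have start: "l1.T y0 = t" "l2.T y0 = s"
  proof -
    show "l1.T y0 = t" unfolding y0_def using ts a\<^sub>0 \<rho> by (intro l1.T_u) auto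
    show "l2.T y0 = s" unfolding y0_def ts(5) using ts a\<^sub>0 \<rho> by (intro l2.T_u) auto
  qed
  have Y0: "Y y0 \<ge> 0" "d y0 > 0"
    using ts wpos[of y0] le unfolding Y_def d_def start by (auto intro!: power_mono)
  \<comment> \<open>A loop to be closed by continuation: a positive lead d makes Y increase, Y >= 0
    means that u1 is at least as fast, and this keeps d from decreasing.\<close>
  have dmono: "d y0 \<le> d y \<and> Y y0 \<le> Y y" if y: "y \<in> {y0..y1}" and pos: "\<And>x. y0 < x \<Longrightarrow> x < y \<Longrightarrow> d x > 0" for y
  proof -
    have Y: "Y y0 \<le> Y x" if "y0 \<le> x" "x \<le> y" for x
      by (rule deriv_within_mono[OF dY]) (use that y pos cosd in \<open>auto intro!: less_imp_le\<close>)
    have "d y0 \<le> d y"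
    proof (rule deriv_within_mono[OF dd])
      fix x assume x: "y0 < x" "x < y"
      then have xi: "x \<in> {y0..y1}" using y by auto
      have "(w2 (l2.T x))\<^sup>2 \<le> (w1 (l1.T x))\<^sup>2" using Y[of x] Y0 x unfolding Y_def by linarith
      then have "w2 (l2.T x) \<le> w1 (l1.T x)" using power2_le_imp_le less_imp_le[OF wpos(1)[OF xi]] by blast
      then show "0 \<le> inverse (w2 (l2.T x)) - inverse (w1 (l1.T x))"
        using le_imp_inverse_le[OF _ wpos(2)[OF xi]] by simp
    qed (use y in auto)
    then show ?thesis using Y[of y] y by simp
  qed
  have dpos: "d y > 0" if "y \<in> {y0..y1}" for y
  proof -
    have "- d y < 0"
    proof (rule continuous_negI[OF _ _ _ that])
      show "continuous_on {y0..y1} (\<lambda>y. - d y)"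
        by (intro continuous_on_minus DERIV_continuous_on[OF dd])
      fix x assume x: "y0 < x" "x \<le> y1" and neg: "\<And>t. y0 \<le> t \<Longrightarrow> t < x \<Longrightarrow> - d t < 0"
      have "d y0 \<le> d x" using dmono[of x] x neg by force
      then show "- d x \<noteq> 0" using Y0 by simp
    qed (use Y0 in simp)
    then show ?thesis by simp
  qed
  have Ypos: "Y y > 0" if "y0 < y" "y \<le> y1" for y
  proof -
    have "Y y0 < Y y" by (rule deriv_within_strict_mono[OF dY]) (use that dpos cosd in auto)
    then show ?thesis using Y0 by simp
  qed
  have Dr: "u2 (pi - a\<^sub>0) < u1 (pi - a\<^sub>0)"
  proof (rule ccontr)
    assume "\<not> ?thesis"
    then have y1: "y1 = u1 (pi - a\<^sub>0)" "u2 (l2.T y1) \<le> u2 (pi - a\<^sub>0)"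
      using lev[of y1] le by (auto simp: y1_def)
    then have "l1.T y1 = pi - a\<^sub>0" using a\<^sub>0 by (auto intro!: l1.T_u)
    moreover have "l2.T y1 \<le> pi - a\<^sub>0"
      using y1(2) lev[of y1] le a\<^sub>0 by (subst (asm) l2.u_le_iff) auto
    ultimately show False using dpos[of y1] le by (simp add: d_def)
  qed
  then have y1: "y1 = u2 (pi - a\<^sub>0)" by (simp add: y1_def)
  \<comment> \<open>Y compares slopes at equal heights, not at equal times. If the slopes at \<pi> -
    \<open>a\<^sub>0\<close> were in the wrong order, the reflected pair with roles exchanged would
    satisfy the premises of \<open>faster_somewhere\<close>; this gives a height in the right region
    at which w1 <= w2, against \<open>Ypos\<close>.\<close>
  have Dr': "w2 (pi - a\<^sub>0) < w1 (pi - a\<^sub>0)"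
  proof (rule ccontr)
    assume "\<not> ?thesis"
    then obtain t' s' where ts': "a\<^sub>0 \<le> t'" "t' \<le> \<rho>" "t' < s'" "s' \<le> pi - a\<^sub>0"
      "u2 (pi - t') = u1 (pi - s')" "w1 (pi - s') \<le> w2 (pi - t')"
      using faster_somewhere[OF l2.reflect l1.reflect small] Dr by auto
    define y where "y = u2 (pi - t')"
    have "m' \<le> y" unfolding y_def using l2.right'[of "pi - t'"] ts' a\<^sub>0 by simp
    then have "y0 < y" using y0m m' by simp
    moreover have "y \<le> y1" unfolding y_def y1 using ts' a\<^sub>0 \<rho> by (subst l2.u_le_iff) auto
    moreover have "l2.T y = pi - t'" unfolding y_def using ts' a\<^sub>0 \<rho> by (intro l2.T_u) auto
    moreover have "l1.T y = pi - s'" unfolding y_def ts'(5) using ts' a\<^sub>0 \<rho> by (intro l1.T_u) auto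
    moreover have "w1 (pi - s') > 0" using ts' a\<^sub>0 \<rho> by (intro l1.w_pos) auto
    ultimately show False
      using Ypos[of y] power_mono[OF ts'(6), of 2] by (simp add: Y_def)
  qed
  have q': "\<kappa>\<^sup>2 \<le> (u1 t)\<^sup>2 + u1 t * u2 t + (u2 t)\<^sup>2 - \<Lambda>" if "pi - a\<^sub>0 \<le> t" "t \<le> pi" for t
    using l1.right'[of t] l2.right'[of t] that a\<^sub>0 by (intro quotient_ge) auto
  have pa: "0 \<le> pi - a\<^sub>0" "pi - a\<^sub>0 \<le> pi" using a\<^sub>0 by auto
  note g1 = difference_growth[OF l1 l2 pa order_refl q' less_imp_le[OF Dr] less_imp_le[OF Dr']]
  show "u2 pi < u1 pi" using g1(3) Dr by linarith
  show "w2 pi < w1 pi" using g1(2) Dr' by linarith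
qed

end

section \<open>Chains of half periods, and the identification of \<open>u\<^sub>p\<close>\<close>

lemma cos_add_npi: "cos (t + real n * pi) = (- 1) ^ n * cos t"
proof (induction n)
  case (Suc n)
  have "cos (t + real (Suc n) * pi) = cos ((t + real n * pi) + pi)" by (simp add: algebra_simps)
  then show ?case using Suc by simp
qed simp

lemma abs_cos_diff_le: "\<bar>cos x - cos y\<bar> \<le> \<bar>x - y\<bar>" for x y :: real
  using field_differentiable_bound[of UNIV cos "\<lambda>z. - sin z" 1 x y]
  by (auto intro!: derivative_eq_intros)

context bistable
begin

text \<open>Time is folded to [0, \<pi>] through the cosine, which is injective there and takes the
  same value on all copies; this avoids tracking which copy contains the point. On odd half periods
  the strip appears mirrored, and \<open>S_reflect\<close> turns the mirror image into a change of
  sign.\<close>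

lemma extend_set_reduce:
  assumes "(t + real j * pi, v) \<in> extend_set (S\<^sub>\<delta> Ulo Uup b r \<delta>)" and t: "t \<in> {0..pi}"
  shows "(t, (- 1) ^ j * v) \<in> S\<^sub>\<delta> Ulo Uup b r \<delta>"
proof -
  let ?S = "S\<^sub>\<delta> Ulo Uup b r \<delta>"
  from assms(1) obtain n :: nat and X where X: "(X, v) \<in> ?S"
    "t + real j * pi = X + 2 * pi * real n \<or> t + real j * pi = 2 * pi - X + 2 * pi * real n"
    unfolding extend_set_def by auto
  have per: "cos (x + 2 * pi * real n) = cos x" for x
    using cos_add_npi[of x "2 * n"] by (simp add: mult_ac)
  have "cos (2 * pi - X) = cos X" by (simp add: cos_diff)
  then have "cos X = cos (t + real j * pi)" using X(2) per by auto
  then have cX: "cos X = (- 1) ^ j * cos t" by (simp add: cos_add_npi)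
  have X0: "0 \<le> X" "X \<le> pi" using X(1) by (auto simp: S\<^sub>\<delta>_def)
  show ?thesis
  proof (cases "even j")
    case True
    then have "X = t" using cX cos_inj_pi[of X t] X0 t by auto
    then show ?thesis using X(1) True by simp
  next
    case False
    then have "cos X = cos (pi - t)" using cX by simp
    then have "X = pi - t" by (rule cos_inj_pi[rotated 4]) (use X0 t in auto)
    then show ?thesis using S_reflect[of t v] X(1) False by simp
  qed
qed

text \<open>Since cos (t + j \<pi>) = (-1)^j cos t, the solution on the j-th half period, multiplied
  by (-1)^j, solves the original problem on [0, \<pi>].\<close>

lemma layer_piece:
  assumes ode: "ode_solution_on \<Lambda> \<epsilon> {0..real k * pi} u w" and "\<epsilon> > 0"
    and gr: "graph_in (real k * pi) u (extend_set (S\<^sub>\<delta> Ulo Uup b r \<delta>))" and "j < k"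
  shows "layer \<Lambda> b r \<delta> Ulo Umid Uup \<epsilon> (\<lambda>t. (- 1) ^ j * u (t + real j * pi)) (\<lambda>t. (- 1) ^ j * w (t + real j * pi))"
proof (rule layer.intro[OF bistable_axioms], rule layer_axioms.intro)
  have "real (Suc j) * pi \<le> real k * pi" using \<open>j < k\<close> by (intro mult_right_mono) auto
  then have im: "t + real j * pi \<in> {0..real k * pi}" if "t \<in> {0..pi}" for t
    using that by (auto simp: algebra_simps)
  have c: "(- 1) ^ j = (1::real) \<or> (- 1) ^ j = (- 1::real)" by (cases "even j") auto
  show "ode_solution_on \<Lambda> \<epsilon> {0..pi} (\<lambda>t. (- 1) ^ j * u (t + real j * pi)) (\<lambda>t. (- 1) ^ j * w (t + real j * pi))"
    using ode_transform[OF ode, of "{0..pi}" 1 "real j * pi" "(- 1) ^ j"] \<open>\<epsilon> > 0\<close> im c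
    by (simp add: cos_add_npi)
  show "graph_in pi (\<lambda>t. (- 1) ^ j * u (t + real j * pi)) (S\<^sub>\<delta> Ulo Uup b r \<delta>)"
    unfolding graph_in_def using gr im by (auto simp: graph_in_def intro!: extend_set_reduce)
qed (rule \<open>\<epsilon> > 0\<close>)

lemma propagation_chain:
  assumes ode: "ode_solution_on \<Lambda> \<epsilon> {0..real k * pi} u1 w1" "ode_solution_on \<Lambda> \<epsilon> {0..real k * pi} u2 w2"
    and small: "eps_small \<epsilon>"
    and gr: "graph_in (real k * pi) u1 (extend_set (S\<^sub>\<delta> Ulo Uup b r \<delta>))"
      "graph_in (real k * pi) u2 (extend_set (S\<^sub>\<delta> Ulo Uup b r \<delta>))"
    and D: "u2 0 < u1 0" "w2 0 = w1 0" and j: "0 < j" "j \<le> k"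
  shows "u2 (real j * pi) < u1 (real j * pi) \<and> w2 (real j * pi) < w1 (real j * pi)"
proof -
  have \<epsilon>: "\<epsilon> > 0" using small by (simp add: eps_small_def)
  have step: "u2 (real (Suc j) * pi) < u1 (real (Suc j) * pi) \<and> w2 (real (Suc j) * pi) < w1 (real (Suc j) * pi)"
    if "j < k" and D: "u2 (real j * pi) < u1 (real j * pi)" "w2 (real j * pi) \<le> w1 (real j * pi)" for j
  proof -
    note l1 = layer_piece[OF ode(1) \<epsilon> gr(1) \<open>j < k\<close>]
    note l2 = layer_piece[OF ode(2) \<epsilon> gr(2) \<open>j < k\<close>]
    have eq: "pi + real j * pi = real (Suc j) * pi" by (simp add: algebra_simps)
    \<comment> \<open>For odd j the sign exchanges the roles of the two solutions, at both ends
      alike.\<close>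
    show ?thesis
      using propagation[OF l1 l2 small] propagation[OF l2 l1 small] D
      unfolding eq by (cases "even j") simp_all
  qed
  show ?thesis using j
  proof (induction j)
    case (Suc j)
    then show ?case using step[of j] D by (cases "j = 0") auto
  qed simp
qed

text \<open>Different initial heights would lead to different slopes at k \<pi>; with equal initial
  heights all initial data agree.\<close>

lemma neumann_unique:
  assumes ode: "ode_solution_on \<Lambda> \<epsilon> {0..real k * pi} u1 w1" "ode_solution_on \<Lambda> \<epsilon> {0..real k * pi} u2 w2"
    and small: "eps_small \<epsilon>" and "k > 0"
    and gr: "graph_in (real k * pi) u1 (extend_set (S\<^sub>\<delta> Ulo Uup b r \<delta>))"
      "graph_in (real k * pi) u2 (extend_set (S\<^sub>\<delta> Ulo Uup b r \<delta>))"
    and N: "w1 0 = 0" "w2 0 = 0" "w1 (real k * pi) = 0" "w2 (real k * pi) = 0"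
    and t: "t \<in> {0..real k * pi}"
  shows "u1 t = u2 t"
proof -
  have \<epsilon>: "\<epsilon> \<noteq> 0" using small by (simp add: eps_small_def)
  have "u1 0 = u2 0"
    using propagation_chain[OF ode small gr, of k] propagation_chain[OF ode(2,1) small gr(2,1), of k] N \<open>k > 0\<close>
    by (cases "u1 0" "u2 0" rule: linorder_cases) auto
  then show ?thesis using ode_unique_within[OF ode \<epsilon>, of 0 t] N t by auto
qed

lemma extend_setI:
  assumes "(X, v) \<in> S\<^sub>\<delta> Ulo Uup b r \<delta>" "s = X + 2 * pi * real n \<or> s = 2 * pi - X + 2 * pi * real n"
  shows "(s, v) \<in> extend_set (S\<^sub>\<delta> Ulo Uup b r \<delta>)"
proof -
  obtain X' where X': "(X', v) \<in> S\<^sub>\<delta> Ulo Uup b r \<delta> \<union> (\<lambda>(t, u). (2 * pi - t, u)) ` S\<^sub>\<delta> Ulo Uup b r \<delta>"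
    "s = X' + 2 * pi * real n"
  proof (cases "s = X + 2 * pi * real n")
    case False
    have "(2 * pi - X, v) \<in> (\<lambda>(t, u). (2 * pi - t, u)) ` S\<^sub>\<delta> Ulo Uup b r \<delta>"
      using assms(1) by (intro image_eqI[of _ _ "(X, v)"]) auto
    then show ?thesis using that[of "2 * pi - X"] assms(2) False by blast
  qed (use that[of X] assms in blast)
  then have "(s, v) \<in> (\<lambda>(t, u). (t + 2 * pi * real n, u)) ` (S\<^sub>\<delta> Ulo Uup b r \<delta> \<union> (\<lambda>(t, u). (2 * pi - t, u)) ` S\<^sub>\<delta> Ulo Uup b r \<delta>)"
    by (intro image_eqI[of _ _ "(X', v)"]) auto
  then show ?thesis unfolding extend_set_def by blast
qed

definition up_profile :: "real \<Rightarrow> (real \<Rightarrow> real) \<Rightarrow> (real \<Rightarrow> real) \<Rightarrow> bool" where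
  "up_profile \<epsilon> u u' \<longleftrightarrow> ode_solution_on \<Lambda> \<epsilon> UNIV u u' \<and>
      (\<forall>t. u (t + 2 * pi) = u t) \<and> u' 0 = 0 \<and> u (pi / 2) = 0 \<and> (\<forall>t\<in>{0<..<pi / 2}. u' t > 0)"

text \<open>\<open>c\<^sub>1\<close> bounds the cubic from below on [0, \<rho>] at nonpositive
  heights at least \<delta> above \<open>Ulo\<close>, and \<open>h\<^sub>1\<close> is a time span in
  which the change of cos costs at most half of this bound. \<open>up_small\<close> says that a
  parabola with second derivative \<open>c\<^sub>1\<close> / (2 \<epsilon>^2) rises by more than b
  within that span.\<close>

definition c\<^sub>1 :: real where "c\<^sub>1 = \<delta> * cos \<rho> / b"
definition h\<^sub>1 :: real where "h\<^sub>1 = min (c\<^sub>1 / 2) (pi / 2 - \<rho>)"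

definition up_small :: "real \<Rightarrow> bool" where
  "up_small \<epsilon> \<longleftrightarrow> 0 < \<epsilon> \<and> 4 * b * \<epsilon>\<^sup>2 < c\<^sub>1 * h\<^sub>1\<^sup>2"

lemma c\<^sub>1: "c\<^sub>1 > 0" "h\<^sub>1 > 0" "h\<^sub>1 \<le> c\<^sub>1 / 2" "\<rho> + h\<^sub>1 \<le> pi / 2"
proof -
  have "cos \<rho> > 0" using \<rho> by (intro cos_gt_zero) auto
  then show "c\<^sub>1 > 0" using \<delta>_pos b by (simp add: c\<^sub>1_def)
  then show "h\<^sub>1 > 0" "h\<^sub>1 \<le> c\<^sub>1 / 2" "\<rho> + h\<^sub>1 \<le> pi / 2" unfolding h\<^sub>1_def using \<rho> by linarith+
qed

lemma eventually_up_small: "eventually up_small (at_right 0)"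
proof -
  have "((\<lambda>\<epsilon>. 4 * b * \<epsilon>\<^sup>2) \<longlongrightarrow> 4 * b * 0\<^sup>2) (at_right 0)" by (intro tendsto_intros)
  then have "eventually (\<lambda>\<epsilon>. 4 * b * \<epsilon>\<^sup>2 < c\<^sub>1 * h\<^sub>1\<^sup>2) (at_right 0)"
    using c\<^sub>1 by (intro order_tendstoD(2)) auto
  then show ?thesis
    using eventually_at_right_less[of "0::real"] by eventually_elim (simp add: up_small_def)
qed

text \<open>In the factorized cubic the first factor is at least \<delta>, and for v <= 0 the
  product of the other two is at least Umid t Uup t = cos t / (- Ulo t) >= cos \<rho> / b.\<close>

lemma cubic_ge_c\<^sub>1:
  assumes "0 \<le> t" "t \<le> \<rho>" "Ulo t + \<delta> \<le> v" "v \<le> 0"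
  shows "cubic \<Lambda> t v \<ge> c\<^sub>1"
proof -
  have ct: "cos \<rho> \<le> cos t" "cos \<rho> > 0"
    using assms \<rho> by (auto intro!: cos_monotone_0_pi_le cos_gt_zero)
  have p: "- Ulo t * (Umid t * Uup t) = cos t" using prod_roots[of t] by simp
  have lo: "0 < - Ulo t" "- Ulo t \<le> b" using Ulo_lt[of t] m_pos Ulo_gt[of t] by auto
  have up: "0 < Uup t" using Uup_gt[of t] m_pos by simp
  have "0 < - Ulo t * (Umid t * Uup t)" using p ct by simp
  then have mu: "0 < Umid t * Uup t" by (rule zero_less_mult_pos[OF _ lo(1)])
  then have mid: "0 < Umid t" by (rule zero_less_mult_pos2[OF _ up])
  have "cos \<rho> \<le> b * (Umid t * Uup t)"
    using ct p mult_right_mono[OF lo(2), of "Umid t * Uup t"] mu by linarith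
  then have "cos \<rho> / b \<le> Umid t * Uup t" using b by (simp add: field_simps)
  also have "\<dots> \<le> (Umid t - v) * (Uup t - v)" using mid up assms by (intro mult_mono) auto
  finally have "\<delta> * (cos \<rho> / b) \<le> (v - Ulo t) * ((Umid t - v) * (Uup t - v))"
    using assms \<delta>_pos ct b by (intro mult_mono) auto
  also have "\<dots> = cubic \<Lambda> t v" by (simp add: vieta(2) algebra_simps)
  finally show ?thesis by (simp add: c\<^sub>1_def)
qed

text \<open>u(-t) has the data of u at 0 because w 0 = 0, and -u(\<pi> - t) has the data of u at
  \<pi>/2 because u vanishes there; uniqueness of the initial value problem does the rest.\<close>

lemma up_profile_symmetries:
  assumes "up_profile \<epsilon> u w" and "\<epsilon> > 0"
  shows "u (- t) = u t" "u (pi - t) = - u t" "w (pi - t) = w t" "w (- t) = - w t" "w (t + 2 * pi) = w t"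
proof -
  have ode: "ode_solution_on \<Lambda> \<epsilon> UNIV u w" and per: "\<And>t. u (t + 2 * pi) = u t"
    and w0: "w 0 = 0" and u2: "u (pi / 2) = 0"
    using assms by (auto simp: up_profile_def)
  have \<epsilon>: "\<epsilon> \<noteq> 0" using assms by simp
  have du: "(u has_real_derivative w t) (at t)" for t
    using ode unfolding ode_solution_on_def by auto
  have 1: "ode_solution_on \<Lambda> \<epsilon> UNIV (\<lambda>t. u (- t)) (\<lambda>t. - w (- t))"
    using ode_transform[OF ode \<epsilon>, of UNIV "- 1" 0 1] by simp
  have e: "(\<lambda>t. u (- t)) = u" by (rule ode_unique[OF 1 ode \<epsilon>, of 0]) (simp_all add: w0)
  then show "u (- t) = u t" by metis
  have 2: "ode_solution_on \<Lambda> \<epsilon> UNIV (\<lambda>t. - u (pi - t)) (\<lambda>t. w (pi - t))"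
    using ode_transform[OF ode \<epsilon>, of UNIV "- 1" pi "- 1"] by (simp add: cos_diff)
  have o: "(\<lambda>t. - u (pi - t)) = u" by (rule ode_unique[OF 2 ode \<epsilon>, of "pi / 2"]) (simp_all add: u2)
  then show "u (pi - t) = - u t" by (metis minus_minus)
  have der: "x t = w t" if "ode_solution_on \<Lambda> \<epsilon> UNIV u x" for x t
    using that du[of t] unfolding ode_solution_on_def by (auto intro: DERIV_unique)
  show "w (pi - t) = w t" using der[OF 2[unfolded o]] .
  show "w (- t) = - w t" using der[OF 1[unfolded e], of t] by simp
  have 3: "ode_solution_on \<Lambda> \<epsilon> UNIV u (\<lambda>t. w (t + 2 * pi))"
    using ode_transform[OF ode \<epsilon>, of UNIV 1 "2 * pi" 1] per by simp
  show "w (t + 2 * pi) = w t" using der[OF 3] .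
qed

text \<open>If the profile were above Ulo + \<delta> at some s <= \<rho>, its second derivative
  would be at least \<open>c\<^sub>1\<close> / (2 \<epsilon>^2) for a time \<open>h\<^sub>1\<close>
  and it would rise by more than b, although it stays between -b and 0 up to \<pi>/2. The right half
  follows by point symmetry.\<close>

lemma up_profile_layer:
  assumes up: "up_profile \<epsilon> u w" and small: "up_small \<epsilon>"
  shows "layer \<Lambda> b r \<delta> Ulo Umid Uup \<epsilon> u w"
proof (rule layer.intro[OF bistable_axioms], rule layer_axioms.intro)
  show \<epsilon>: "\<epsilon> > 0" using small by (simp add: up_small_def)
  have ode: "ode_solution_on \<Lambda> \<epsilon> UNIV u w"
    and w0: "w 0 = 0" and u2: "u (pi / 2) = 0" and wpos: "\<And>t. 0 < t \<Longrightarrow> t < pi / 2 \<Longrightarrow> w t > 0"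
    using up by (auto simp: up_profile_def)
  show "ode_solution_on \<Lambda> \<epsilon> {0..pi} u w" by (rule ode_solution_on_subset[OF ode]) simp
  have du: "(u has_real_derivative w t) (at t within S)"
    and dw: "(w has_real_derivative cubic \<Lambda> t (u t) / \<epsilon>\<^sup>2) (at t within S)" for t S
    using ode ode_solution_on_iff[of \<epsilon> \<Lambda> UNIV u w] \<epsilon> by (auto intro: has_field_derivative_at_within)
  note sym = up_profile_symmetries[OF up \<epsilon>]
  have mono: "u s \<le> u t" if "0 \<le> s" "s \<le> t" "t \<le> pi / 2" for s t
    by (rule deriv_within_mono[where f = u and f' = w and a = 0 and b = "pi / 2", OF du]) (use that wpos in \<open>auto intro!: less_imp_le\<close>)
  have le0: "u t \<le> 0" if "0 \<le> t" "t \<le> pi / 2" for t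
    using mono[of t "pi / 2"] that u2 by simp
  have "u 0 < u (pi / 2)"
    by (rule deriv_within_strict_mono[where f = u and f' = w and a = 0 and b = "pi / 2", OF du]) (use wpos in auto)
  then have u0: "u 0 < 0" using u2 by simp
  \<comment> \<open>w is positive just after w 0 = 0, so its derivative at 0 is nonnegative; this
    keeps u 0 at or above Ulo 0 and thus above -b.\<close>
  have "- (cubic \<Lambda> 0 (u 0) / \<epsilon>\<^sup>2) \<le> 0"
    by (rule deriv_within_right_neg[OF DERIV_minus[OF dw[of 0 "{0..pi / 2}"]], of "pi / 2"])
       (use w0 wpos in \<open>auto intro!: less_imp_le\<close>)
  then have "cubic \<Lambda> 0 (u 0) \<ge> 0" using \<epsilon> by (simp add: zero_le_divide_iff)
  then have "Ulo 0 \<le> u 0" using cubic_neg[of "u 0" 0] by linarith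
  then have gb: "- b \<le> u t" if "0 \<le> t" "t \<le> pi / 2" for t
    using mono[of 0 t] that Ulo_gt[of 0] by linarith
  have left: "u s \<le> Ulo s + \<delta>" if s: "0 \<le> s" "s \<le> \<rho>" for s
  proof (rule ccontr)
    assume neg: "\<not> ?thesis"
    have se: "s + h\<^sub>1 \<le> pi / 2" using s c\<^sub>1 by simp
    have z: "c\<^sub>1 / 2 \<le> cubic \<Lambda> t (u t)" if t: "s \<le> t" "t \<le> s + h\<^sub>1" for t
    proof -
      \<comment> \<open>The time in the cubic is frozen at s <= \<rho>, since t itself may exceed
        \<rho>.\<close>
      have "c\<^sub>1 \<le> cubic \<Lambda> s (u t)"
        using neg s t se mono[of s t] le0[of t] by (intro cubic_ge_c\<^sub>1) auto
      moreover have "cubic \<Lambda> t (u t) = cubic \<Lambda> s (u t) + (cos t - cos s)" by (simp add: cubic_def)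
      moreover have "\<bar>cos t - cos s\<bar> \<le> h\<^sub>1" using abs_cos_diff_le[of t s] t by linarith
      ultimately show ?thesis using c\<^sub>1 by linarith
    qed
    define c where "c = c\<^sub>1 / (2 * \<epsilon>\<^sup>2)"
    have c: "c > 0" using c\<^sub>1 \<epsilon> by (simp add: c_def)
    have ws: "w s \<ge> 0" using wpos[of s] w0 s \<rho> by (cases "s = 0") auto
    have wt: "c * (t - s) \<le> w t" if t: "s \<le> t" "t \<le> s + h\<^sub>1" for t
    proof -
      have "c * t - c * s \<le> w t - w s"
      proof (rule deriv_within_mono_le[where a = s and b = "s + h\<^sub>1", OF _ dw])
        fix t show "((\<lambda>t. c * t) has_real_derivative c) (at t within {s..s + h\<^sub>1})"
          using DERIV_cmult[OF DERIV_ident, of c] by simp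
      next
        fix x assume "s < x" "x < t"
        then have "c\<^sub>1 / 2 / \<epsilon>\<^sup>2 \<le> cubic \<Lambda> x (u x) / \<epsilon>\<^sup>2" using z[of x] t by (intro divide_right_mono) auto
        then show "c \<le> cubic \<Lambda> x (u x) / \<epsilon>\<^sup>2" by (simp add: c_def)
      qed (use t in auto)
      then show ?thesis using ws by (simp only: right_diff_distrib) 
    qed
    have "c * (s + h\<^sub>1 - s)\<^sup>2 / 2 - c * (s - s)\<^sup>2 / 2 \<le> u (s + h\<^sub>1) - u s"
    proof (rule deriv_within_mono_le[where a = s and b = "s + h\<^sub>1" and f' = "\<lambda>t. c * (t - s)"
          and f = "\<lambda>t. c * (t - s)\<^sup>2 / 2", OF _ du])
      fix t show "((\<lambda>t. c * (t - s)\<^sup>2 / 2) has_real_derivative c * (t - s)) (at t within {s..s + h\<^sub>1})"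
        by (rule derivative_eq_intros refl | simp)+
    qed (use wt c\<^sub>1 in auto)
    then have "c\<^sub>1 * h\<^sub>1\<^sup>2 / (4 * \<epsilon>\<^sup>2) \<le> u (s + h\<^sub>1) - u s" by (simp add: c_def)
    moreover have "b < c\<^sub>1 * h\<^sub>1\<^sup>2 / (4 * \<epsilon>\<^sup>2)"
      using small \<epsilon> by (simp add: up_small_def pos_less_divide_eq mult_ac)
    ultimately show False using le0[of "s + h\<^sub>1"] gb[of s] s se c\<^sub>1 \<rho> by linarith
  qed
  show "graph_in pi u (S\<^sub>\<delta> Ulo Uup b r \<delta>)"
    unfolding graph_in_S_iff
  proof (intro ballI conjI impI)
    fix t assume t: "t \<in> {0..pi}"
    have "- b \<le> u t \<and> u t \<le> b"
    proof (cases "t \<le> pi / 2")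
      case True
      then show ?thesis using gb[of t] le0[of t] t b by auto
    next
      case False
      then show ?thesis using gb[of "pi - t"] le0[of "pi - t"] sym(2)[of t] t b by auto
    qed
    then show "- b \<le> u t" "u t \<le> b" by auto
    show "t \<le> \<rho> \<Longrightarrow> u t \<le> Ulo t + \<delta>" using left t by simp
    assume "pi - \<rho> \<le> t"
    then have "u (pi - t) \<le> Ulo (pi - t) + \<delta>" using left[of "pi - t"] t by simp
    moreover have "Uup t = - Ulo (pi - t)" by (rule Uup_eq) simp
    ultimately show "Uup t - \<delta> \<le> u t" using sym(2)[of t] by simp
  qed
qed

lemma periodic_nat:
  fixes f :: "real \<Rightarrow> real"
  assumes "\<And>t. f (t + 2 * pi) = f t"
  shows "f (t + 2 * pi * real n) = f t"
proof (induction n)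
  case (Suc n)
  have "t + 2 * pi * real (Suc n) = (t + 2 * pi * real n) + 2 * pi" by (simp add: algebra_simps)
  then show ?case using assms[of "t + 2 * pi * real n"] Suc by (simp only:)
qed simp

lemma up_profile_extended:
  assumes up: "up_profile \<epsilon> u w" and small: "up_small \<epsilon>"
  shows "graph_in (real k * pi) u (extend_set (S\<^sub>\<delta> Ulo Uup b r \<delta>))" "w (real k * pi) = 0"
proof -
  have \<epsilon>: "\<epsilon> > 0" using small by (simp add: up_small_def)
  have per: "u (t + 2 * pi) = u t" for t using up by (simp add: up_profile_def)
  note sym = up_profile_symmetries[OF up \<epsilon>]
  interpret layer \<Lambda> b r \<delta> Ulo Umid Uup \<epsilon> u w by (rule up_profile_layer[OF up small])
  show "graph_in (real k * pi) u (extend_set (S\<^sub>\<delta> Ulo Uup b r \<delta>))"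
    unfolding graph_in_def
  proof
    fix s assume s: "s \<in> {0..real k * pi}"
    define n where "n = nat \<lfloor>s / (2 * pi)\<rfloor>"
    define X where "X = s - 2 * pi * real n"
    have "real n = \<lfloor>s / (2 * pi)\<rfloor>" using s by (simp add: n_def)
    then have "real n \<le> s / (2 * pi)" "s / (2 * pi) < real n + 1" by linarith+
    then have X: "0 \<le> X" "X < 2 * pi" by (simp_all add: X_def field_simps)
    have uX: "u s = u X" using periodic_nat[of u X n, OF per] by (simp add: X_def)
    show "(s, u s) \<in> extend_set (S\<^sub>\<delta> Ulo Uup b r \<delta>)"
    proof (cases "X \<le> pi")
      case True
      then have "(X, u s) \<in> S\<^sub>\<delta> Ulo Uup b r \<delta>" using graph X uX by (auto simp: graph_in_def)
      then show ?thesis by (rule extend_setI[of _ _ _ n]) (simp add: X_def)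
    next
      case False
      have "u (2 * pi - X) = u X" using per[of "- X"] sym(1)[of X] by simp
      moreover have "2 * pi - X \<in> {0..pi}" using False X by auto
      ultimately have "(2 * pi - X, u s) \<in> S\<^sub>\<delta> Ulo Uup b r \<delta>" using graph uX by (metis graph_in_def)
      then show ?thesis by (rule extend_setI[of _ _ _ n]) (simp add: X_def)
    qed
  qed
  have w0: "w 0 = 0" using up by (simp add: up_profile_def)
  have wpi: "w pi = 0" using sym(3)[of 0] w0 by simp
  show "w (real k * pi) = 0"
  proof (cases "even k")
    case True
    then obtain n where "k = 2 * n" by blast
    then show ?thesis using periodic_nat[of w 0 n, OF sym(5)] w0 by (simp add: mult_ac)
  next
    case False
    then obtain n where "k = 2 * n + 1" by (elim oddE)
    then have "real k * pi = pi + 2 * pi * real n" by (simp add: algebra_simps)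
    then show ?thesis using periodic_nat[of w pi n, OF sym(5)] wpi by simp
  qed
qed

lemma layer_extended:
  assumes "layer \<Lambda> b r \<delta> Ulo Umid Uup \<epsilon> u w"
  shows "graph_in (real 1 * pi) u (extend_set (S\<^sub>\<delta> Ulo Uup b r \<delta>))"
    "ode_solution_on \<Lambda> \<epsilon> {0..real 1 * pi} u w"
proof -
  have "(t, u t) \<in> extend_set (S\<^sub>\<delta> Ulo Uup b r \<delta>)" if "(t, u t) \<in> S\<^sub>\<delta> Ulo Uup b r \<delta>" for t
    by (rule extend_setI[OF that, of _ 0]) simp
  then show "graph_in (real 1 * pi) u (extend_set (S\<^sub>\<delta> Ulo Uup b r \<delta>))"
    using layer.graph[OF assms] by (simp add: graph_in_def)
  show "ode_solution_on \<Lambda> \<epsilon> {0..real 1 * pi} u w" using layer.ode[OF assms] by simp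
qed

lemma up_eqI:
  assumes small: "eps_small \<epsilon>" "up_small \<epsilon>" and up: "up_profile \<epsilon> u w"
    and v: "ode_solution_on \<Lambda> \<epsilon> UNIV v x" "graph_in pi v (S\<^sub>\<delta> Ulo Uup b r \<delta>)" "x 0 = 0" "x pi = 0"
  shows "v = u"
proof -
  have \<epsilon>: "\<epsilon> > 0" using small by (simp add: up_small_def)
  have ode: "ode_solution_on \<Lambda> \<epsilon> UNIV u w" "w 0 = 0" using up by (auto simp: up_profile_def)
  have "layer \<Lambda> b r \<delta> Ulo Umid Uup \<epsilon> v x"
    using v \<epsilon> by (intro layer.intro[OF bistable_axioms] layer_axioms.intro ode_solution_on_subset[OF v(1)]) auto
  note lv = layer_extended[OF this] and lu = layer_extended[OF up_profile_layer[OF up small(2)]]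
  have "v t = u t" if "t \<in> {0..real 1 * pi}" for t
    by (rule neumann_unique[OF lv(2) lu(2) small(1) _ lv(1) lu(1)])
       (use v ode that up_profile_extended(2)[OF up small(2), of 1] in auto)
  then have "v 0 = u 0" by simp
  then show "v = u" using ode_unique[OF v(1) ode(1), of 0] \<epsilon> v ode by simp
qed

lemma up_profile_unique:
  assumes small: "eps_small \<epsilon>" "up_small \<epsilon>" and "up_profile \<epsilon> u w" "up_profile \<epsilon> v x"
  shows "v = u"
proof (rule up_eqI[OF small assms(3)])
  show "ode_solution_on \<Lambda> \<epsilon> UNIV v x" "x 0 = 0" using assms(4) by (auto simp: up_profile_def)
  show "graph_in pi v (S\<^sub>\<delta> Ulo Uup b r \<delta>)"
    using layer.graph[OF up_profile_layer[OF assms(4) small(2)]] .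
  show "x pi = 0" using up_profile_extended(2)[OF assms(4) small(2), of 1] by simp
qed

lemma u\<^sub>p_profile:
  assumes small: "eps_small \<epsilon>" "up_small \<epsilon>" and ex: "up_profile \<epsilon> u w"
  shows "up_profile \<epsilon> (u\<^sub>p \<Lambda> \<epsilon>) w"
proof -
  have "u\<^sub>p \<Lambda> \<epsilon> = (THE u. \<exists>u'. up_profile \<epsilon> u u')" by (simp add: u\<^sub>p_def up_profile_def)
  also have "\<dots> = u" by (rule the_equality) (use ex up_profile_unique[OF small ex] in blast)+
  finally show ?thesis using ex by simp
qed

end

section \<open>Existence of \<open>u\<^sub>p\<close>\<close>

text \<open>At a negative minimum x the slope is nonpositive, for x = 0 by the boundary condition.
  From x on, -y satisfies an initial value inequality with nonnegative data, so y does not rise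
  again and cannot reach y e >= 0.\<close>

lemma mixed_bvp_max_principle:
  fixes y y1 y2 :: "real \<Rightarrow> real"
  assumes y: "\<And>t. t \<in> {0..e} \<Longrightarrow> (y has_real_derivative y1 t) (at t within {0..e})"
    and y1: "\<And>t. t \<in> {0..e} \<Longrightarrow> (y1 has_real_derivative y2 t) (at t within {0..e})"
    and "y1 0 \<le> 0" "y e \<ge> 0" and M: "M \<ge> 0"
    and le: "\<And>t. t \<in> {0..e} \<Longrightarrow> y2 t \<le> M * y t"
    and t: "t \<in> {0..e}"
  shows "y t \<ge> 0"
proof (rule ccontr)
  assume neg: "\<not> y t \<ge> 0"
  have cy: "continuous_on {0..e} y" by (rule DERIV_continuous_on[OF y])
  obtain x where x: "x \<in> {0..e}" "\<And>s. s \<in> {0..e} \<Longrightarrow> y x \<le> y s"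
    using continuous_attains_inf[OF compact_Icc _ cy] t by auto
  have yx: "y x < 0" using x(2)[OF t] neg by simp
  then have xe: "x < e" using x(1) \<open>y e \<ge> 0\<close> by (cases "x = e") auto
  have "y1 x \<le> 0"
  proof (cases "x = 0")
    case False
    show ?thesis
      by (rule deriv_within_left_pos[OF y[OF x(1)], of 0]) (use x False in auto)
  qed (use assms in simp)
  have sub: "{x..e} \<subseteq> {0..e}" using x by auto
  have "- y1 s \<ge> 0" if s: "s \<in> {x..e}" for s
  proof (rule second_order_comparison(2)[where y = "\<lambda>t. - y t" and ?y1.0 = "\<lambda>t. - y1 t"
        and ?y2.0 = "\<lambda>t. - y2 t" and p = "\<lambda>_. M" and P = M and a = x and b = e, OF _ _ _ _ _ _ s])
    fix t assume "t \<in> {x..e}"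
    then have t: "t \<in> {0..e}" using sub by auto
    show "((\<lambda>t. - y t) has_real_derivative - y1 t) (at t within {x..e})"
      "((\<lambda>t. - y1 t) has_real_derivative - y2 t) (at t within {x..e})"
      by (intro DERIV_minus DERIV_subset[OF y[OF t] sub] DERIV_subset[OF y1[OF t] sub])+
    show "M * - y t \<le> - y2 t" using le[OF t] by simp
  qed (use yx \<open>y1 x \<le> 0\<close> M in auto)
  then have "- y x \<le> - y e"
    by (intro deriv_within_mono[where f = "\<lambda>t. - y t" and f' = "\<lambda>t. - y1 t" and a = x and b = e])
       (use xe sub in \<open>auto intro!: DERIV_minus DERIV_subset[OF y sub]\<close>)
  then show False using yx \<open>y e \<ge> 0\<close> by simp
qed

text \<open>Variation of constants for \<open>- \<epsilon>\<^sup>2 v'' + M v = g\<close>, \<open>v'(0) = 0\<close>, \<open>v(e) = 0\<close>, with \<open>\<kappa> = sqrt M / \<epsilon>\<close>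
  and \<open>d = 1 / (\<kappa> \<epsilon>\<^sup>2)\<close>.\<close>

definition green_part :: "real \<Rightarrow> (real \<Rightarrow> real) \<Rightarrow> real \<Rightarrow> real" where
  "green_part k g t = sinh (k * t) * integral {0..t} (\<lambda>s. cosh (k * s) * g s)
     - cosh (k * t) * integral {0..t} (\<lambda>s. sinh (k * s) * g s)"

definition green :: "real \<Rightarrow> real \<Rightarrow> real \<Rightarrow> (real \<Rightarrow> real) \<Rightarrow> real \<Rightarrow> real" where
  "green k d e g t = d * green_part k g e / cosh (k * e) * cosh (k * t) - d * green_part k g t"

definition green_deriv :: "real \<Rightarrow> real \<Rightarrow> real \<Rightarrow> (real \<Rightarrow> real) \<Rightarrow> real \<Rightarrow> real" where
  "green_deriv k d e g t = k * (d * green_part k g e / cosh (k * e) * sinh (k * t)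
     - d * (cosh (k * t) * integral {0..t} (\<lambda>s. cosh (k * s) * g s)
     - sinh (k * t) * integral {0..t} (\<lambda>s. sinh (k * s) * g s)))"

lemma green_boundary: "green k d e g e = 0" "green_deriv k d e g 0 = 0"
  by (simp_all add: green_def green_deriv_def)

lemma green_solves:
  assumes g: "continuous_on {0..e} g" and t: "t \<in> {0..e}"
  shows "(green k d e g has_real_derivative green_deriv k d e g t) (at t within {0..e})"
    "(green_deriv k d e g has_real_derivative k * (k * green k d e g t) - k * (d * g t)) (at t within {0..e})"
proof -
  have C: "((\<lambda>t. integral {0..t} (\<lambda>s. cosh (k * s) * g s)) has_real_derivative cosh (k * t) * g t) (at t within {0..e})"
    and S: "((\<lambda>t. integral {0..t} (\<lambda>s. sinh (k * s) * g s)) has_real_derivative sinh (k * t) * g t) (at t within {0..e})"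
    using g t by (auto intro!: integral_has_real_derivative continuous_intros)
  have 1: "cosh (k * t) * (cosh (k * t) * g t) = (1 + (sinh (k * t))\<^sup>2) * g t"
    using hyperbolic_pythagoras[of "k * t"] by (simp add: power2_eq_square algebra_simps)
  show "(green k d e g has_real_derivative green_deriv k d e g t) (at t within {0..e})"
    unfolding green_def[abs_def] green_part_def[of k g t for t] green_deriv_def
    by (rule derivative_eq_intros C S refl | simp)+ (simp add: green_part_def algebra_simps)
  show "(green_deriv k d e g has_real_derivative k * (k * green k d e g t) - k * (d * g t)) (at t within {0..e})"
    unfolding green_deriv_def[abs_def] green_def green_part_def[of k g t for t]
    by (rule derivative_eq_intros C S refl | simp)+
      (use 1 in \<open>simp add: green_part_def algebra_simps power2_eq_square\<close>)
qed

text \<open>Monotone iteration delivers only pointwise convergence, so the limit is taken under the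
  integrals by dominated convergence. The limit function g need not be known to be continuous; its
  image is, as it is built from indefinite integrals.\<close>

lemma green_limit:
  assumes f: "\<And>n. continuous_on {0..e} (f n)" and lim: "\<And>t. t \<in> {0..e} \<Longrightarrow> (\<lambda>n. f n t) \<longlonglongrightarrow> g t"
    and B: "\<And>n t. t \<in> {0..e} \<Longrightarrow> \<bar>f n t\<bar> \<le> B" and t: "t \<in> {0..e}"
  shows "(\<lambda>n. green k d e (f n) t) \<longlonglongrightarrow> green k d e g t"
    and "continuous_on {0..e} (green k d e g)"
proof -
  have aux: "(\<lambda>s. p s * g s) integrable_on {0..t} \<and>
      (\<lambda>n. integral {0..t} (\<lambda>s. p s * f n s)) \<longlonglongrightarrow> integral {0..t} (\<lambda>s. p s * g s)"
    if t: "t \<in> {0..e}" and p: "continuous_on {0..e} p" for t and p :: "real \<Rightarrow> real"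
  proof -
    have sub: "{0..t} \<subseteq> {0..e}" using t by auto
    have c: "continuous_on {0..t} (\<lambda>s. p s * f n s)" for n
      by (intro continuous_intros continuous_on_subset[OF _ sub] p f)
    have ci: "continuous_on {0..t} (\<lambda>s. \<bar>p s\<bar> * B)"
      by (intro continuous_intros continuous_on_subset[OF _ sub] p)
    have nb: "norm (p s * f n s) \<le> \<bar>p s\<bar> * B" if "s \<in> {0..t}" for n s
      using B[of s n] that sub by (auto simp: abs_mult intro!: mult_left_mono)
    have l: "(\<lambda>n. p s * f n s) \<longlonglongrightarrow> p s * g s" if "s \<in> {0..t}" for s
      using lim[of s] that sub by (intro tendsto_intros) auto
    show ?thesis
      using dominated_convergence[OF integrable_continuous_real[OF c] integrable_continuous_real[OF ci] nb l] by blast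
  qed
  have cc: "continuous_on {0..e} (\<lambda>s. cosh (k * s))" "continuous_on {0..e} (\<lambda>s. sinh (k * s))"
    by (intro continuous_intros)+
  have e: "e \<in> {0..e}" using t by simp
  have part: "(\<lambda>n. green_part k (f n) s) \<longlonglongrightarrow> green_part k g s" if "s \<in> {0..e}" for s
    unfolding green_part_def using aux[OF that cc(1)] aux[OF that cc(2)] by (intro tendsto_intros) auto
  show "(\<lambda>n. green k d e (f n) t) \<longlonglongrightarrow> green k d e g t"
    unfolding green_def by (intro tendsto_intros part t e) simp
  show "continuous_on {0..e} (green k d e g)"
    unfolding green_def[abs_def] green_part_def[of k g t for t]
    using aux[OF e cc(1)] aux[OF e cc(2)]
    by (intro continuous_intros indefinite_integral_continuous_1) auto
qed

context bistable
begin

text \<open>The shift 3 b^2 bounds the difference quotients of the cubic on [-b, b], which makes the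
  right-hand side of the iteration order preserving.\<close>

lemma cubic_shift_mono:
  assumes "u \<le> v" "\<bar>u\<bar> \<le> b" "\<bar>v\<bar> \<le> b"
  shows "3 * b\<^sup>2 * u - cubic \<Lambda> t u \<le> 3 * b\<^sup>2 * v - cubic \<Lambda> t v"
proof -
  have "(v\<^sup>2 + v * u + u\<^sup>2 - \<Lambda>) * (v - u) \<le> 3 * b\<^sup>2 * (v - u)"
    using assms quotient_le_b[of v u] by (intro mult_right_mono) auto
  then show ?thesis using cubic_diff[of \<Lambda> t v u] by (simp add: right_diff_distrib)
qed

text \<open>Monotone iteration from the supersolution \<open>0\<close>, with \<open>- b\<close> as a subsolution.\<close>

lemma quarter_solution:
  assumes \<epsilon>: "\<epsilon> > 0"
  obtains u w where "ode_solution_on \<Lambda> \<epsilon> {0..pi / 2} u w" "w 0 = 0" "u (pi / 2) = 0"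
    "\<And>t. t \<in> {0..pi / 2} \<Longrightarrow> - b \<le> u t \<and> u t \<le> 0"
proof -
  define e where "e = pi / 2"
  define M where "M = 3 * b\<^sup>2"
  define k where "k = sqrt M / \<epsilon>"
  define d where "d = 1 / (k * \<epsilon>\<^sup>2)"
  have M: "M > 0" using b by (simp add: M_def)
  have k: "k > 0" "k * k = M / \<epsilon>\<^sup>2" using M \<epsilon> by (simp_all add: k_def power2_eq_square)
  have kd: "k * d = 1 / \<epsilon>\<^sup>2" using k by (simp add: d_def)
  \<comment> \<open>The equation is rewritten as - \<epsilon>^2 u'' + M u = G u, and F solves for
    the u on the left.\<close>
  define G where "G u t = M * u t - cubic \<Lambda> t (u t)" for u :: "real \<Rightarrow> real" and t
  define F where "F u = green k d e (G u)" for u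
  define v where "v n = (F ^^ n) (\<lambda>_. 0)" for n
  have v0: "v 0 = (\<lambda>_. 0)" and vS: "v (Suc n) = F (v n)" for n by (simp_all add: v_def)
  have cG: "continuous_on {0..e} (G u)" if "continuous_on {0..e} u" for u
    unfolding G_def cubic_def by (intro continuous_intros that)
  have dF: "(F u has_real_derivative green_deriv k d e (G u) t) (at t within {0..e})"
    "(green_deriv k d e (G u) has_real_derivative (M * F u t - G u t) / \<epsilon>\<^sup>2) (at t within {0..e})"
    if "continuous_on {0..e} u" "t \<in> {0..e}" for u t
  proof -
    show "(F u has_real_derivative green_deriv k d e (G u) t) (at t within {0..e})"
      unfolding F_def by (rule green_solves(1)[OF cG[OF that(1)] that(2)])
    have "k * (k * F u t) - k * (d * G u t) = (k * k) * F u t - (k * d) * G u t" by (simp add: mult.assoc)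
    also have "\<dots> = (M * F u t - G u t) / \<epsilon>\<^sup>2" unfolding k(2) kd by (simp add: diff_divide_distrib)
    finally show "(green_deriv k d e (G u) has_real_derivative (M * F u t - G u t) / \<epsilon>\<^sup>2) (at t within {0..e})"
      using green_solves(2)[OF cG[OF that(1)] that(2), of k d] by (simp only: F_def)
  qed
  have F_bnd: "F u e = 0" "green_deriv k d e (G u) 0 = 0" for u
    by (simp_all add: F_def green_boundary)
  have cF: "continuous_on {0..e} (F u)" if "continuous_on {0..e} u" for u
    by (rule DERIV_continuous_on[OF dF(1)[OF that]])
  have cv: "continuous_on {0..e} (v n)" for n
    by (induction n) (auto simp: v0 vS intro: cF)
  have Fmono: "F u t \<le> F x t"
    if "continuous_on {0..e} u" "continuous_on {0..e} x" "\<And>t. t \<in> {0..e} \<Longrightarrow> G u t \<le> G x t" "t \<in> {0..e}" for u x t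
  proof -
    have "F x t - F u t \<ge> 0"
    proof (rule mixed_bvp_max_principle[where M = "M / \<epsilon>\<^sup>2" and e = e,
          OF DERIV_diff[OF dF(1)[OF that(2)] dF(1)[OF that(1)]] DERIV_diff[OF dF(2)[OF that(2)] dF(2)[OF that(1)]]])
      fix t assume "t \<in> {0..e}"
      then have "(M * F x t - G x t) - (M * F u t - G u t) \<le> M * (F x t - F u t)"
        using that(3)[of t] by (simp add: right_diff_distrib)
      from divide_right_mono[OF this, of "\<epsilon>\<^sup>2"]
      show "(M * F x t - G x t) / \<epsilon>\<^sup>2 - (M * F u t - G u t) / \<epsilon>\<^sup>2 \<le> M / \<epsilon>\<^sup>2 * (F x t - F u t)"
        by (simp add: diff_divide_distrib)
    qed (use that M in \<open>simp_all add: F_bnd\<close>)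
    then show ?thesis by simp
  qed
  have ct: "cos t \<ge> 0" if "t \<in> {0..e}" for t
    using that by (intro cos_ge_zero) (auto simp: e_def)
  have F_lo: "- b \<le> F u t" if "continuous_on {0..e} u" "\<And>t. t \<in> {0..e} \<Longrightarrow> - b \<le> u t \<and> u t \<le> 0" "t \<in> {0..e}" for u t
  proof -
    have "F u t + b \<ge> 0"
    proof (rule mixed_bvp_max_principle[where y = "\<lambda>t. F u t + b" and M = "M / \<epsilon>\<^sup>2" and e = e and ?y1.0 = "green_deriv k d e (G u)"
          and ?y2.0 = "\<lambda>t. (M * F u t - G u t) / \<epsilon>\<^sup>2"])
      fix t assume t: "t \<in> {0..e}"
      show "((\<lambda>t. F u t + b) has_real_derivative green_deriv k d e (G u) t) (at t within {0..e})"
        using dF(1)[OF that(1) t] by (auto intro!: derivative_eq_intros)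
      show "(green_deriv k d e (G u) has_real_derivative (M * F u t - G u t) / \<epsilon>\<^sup>2) (at t within {0..e})"
        by (rule dF(2)[OF that(1) t])
      have "cubic \<Lambda> t (- b) < 0" using Ulo_gt[of t] by (rule cubic_neg)
      moreover have "3 * b\<^sup>2 * (- b) - cubic \<Lambda> t (- b) \<le> G u t"
        unfolding G_def M_def using that(2)[OF t] b by (intro cubic_shift_mono) auto
      ultimately have "M * F u t - G u t \<le> M * (F u t + b)" by (simp add: M_def distrib_left)
      from divide_right_mono[OF this, of "\<epsilon>\<^sup>2"]
      show "(M * F u t - G u t) / \<epsilon>\<^sup>2 \<le> M / \<epsilon>\<^sup>2 * (F u t + b)" by simp
    qed (use that M b in \<open>simp_all add: F_bnd\<close>)
    then show ?thesis by simp
  qed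
  have v_bd: "(\<forall>t\<in>{0..e}. - b \<le> v n t \<and> v n t \<le> 0) \<and> (\<forall>t\<in>{0..e}. v (Suc n) t \<le> v n t)" for n
  proof (induction n)
    \<comment> \<open>The constant 0 is a supersolution because the cubic at 0 equals cos t, which
      is nonnegative on the quarter period.\<close>
    case 0
    have c0: "continuous_on {0..e} (\<lambda>_::real. 0::real)" by simp
    have "F (\<lambda>_. 0) t \<le> 0" if t: "t \<in> {0..e}" for t
    proof -
      have "- F (\<lambda>_. 0) t \<ge> 0"
      proof (rule mixed_bvp_max_principle[where M = "M / \<epsilon>\<^sup>2" and e = e,
            OF DERIV_minus[OF dF(1)[OF c0]] DERIV_minus[OF dF(2)[OF c0]]])
        fix t assume t: "t \<in> {0..e}"
        have "- (M * F (\<lambda>_. 0) t - G (\<lambda>_. 0) t) \<le> M * - F (\<lambda>_. 0) t"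
          using ct[OF t] by (simp add: G_def cubic_def)
        from divide_right_mono[OF this, of "\<epsilon>\<^sup>2"]
        show "- ((M * F (\<lambda>_. 0) t - G (\<lambda>_. 0) t) / \<epsilon>\<^sup>2) \<le> M / \<epsilon>\<^sup>2 * - F (\<lambda>_. 0) t"
          by (simp add: diff_divide_distrib)
      qed (use t M in \<open>simp_all add: F_bnd\<close>)
      then show ?thesis by simp
    qed
    then show ?case using b by (simp add: v0 vS)
  next
    case (Suc n)
    have lo: "- b \<le> v (Suc n) t" if "t \<in> {0..e}" for t
      unfolding vS by (rule F_lo[OF cv _ that]) (use Suc in blast)
    have bd: "- b \<le> v (Suc n) t \<and> v (Suc n) t \<le> v n t \<and> v n t \<le> 0" if "t \<in> {0..e}" for t
      using lo[OF that] Suc that by blast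
    have "v (Suc (Suc n)) t \<le> v (Suc n) t" if t: "t \<in> {0..e}" for t
      unfolding vS[of "Suc n"] vS[of n]
    proof (rule Fmono[OF _ cv _ t])
      show "continuous_on {0..e} (F (v n))" using cv[of "Suc n"] by (simp only: vS)
      fix t assume "t \<in> {0..e}"
      from bd[OF this] show "G (F (v n)) t \<le> G (v n) t"
        unfolding G_def M_def vS by (intro cubic_shift_mono) auto
    qed
    then show ?case using bd by force
  qed
  define u where "u t = lim (\<lambda>n. v n t)" for t
  have lim: "(\<lambda>n. v n t) \<longlonglongrightarrow> u t" if "t \<in> {0..e}" for t
  proof -
    have "decseq (\<lambda>n. v n t)" using v_bd that by (intro decseq_SucI) blast
    moreover have "- b \<le> v n t" for n using v_bd that by blast
    ultimately obtain L where "(\<lambda>n. v n t) \<longlonglongrightarrow> L" using decseq_convergent by blast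
    then show ?thesis unfolding u_def using limI by auto
  qed
  have u_bd: "- b \<le> u t \<and> u t \<le> 0" if "t \<in> {0..e}" for t
    using LIMSEQ_le_const[OF lim[OF that], of "- b"] LIMSEQ_le_const2[OF lim[OF that], of 0] v_bd that by blast
  have Glim: "(\<lambda>n. G (v n) t) \<longlonglongrightarrow> G u t" if "t \<in> {0..e}" for t
    unfolding G_def cubic_def by (intro tendsto_intros lim that)
  have GB: "\<bar>G (v n) t\<bar> \<le> M * b + K" if "t \<in> {0..e}" for n t
  proof -
    have "\<bar>v n t\<bar> \<le> b" using v_bd[of n] that by (auto simp: abs_le_iff) (meson atLeastAtMost_iff minus_le_iff)
    then have "\<bar>cubic \<Lambda> t (v n t)\<bar> \<le> K" "\<bar>M * v n t\<bar> \<le> M * b"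
      using cubic_bound[of "v n t" b] M by (auto simp: K_def abs_mult)
    then show ?thesis unfolding G_def by linarith
  qed
  have eq: "u t = F u t" if t: "t \<in> {0..e}" for t
  proof -
    have "(\<lambda>n. v (Suc n) t) \<longlonglongrightarrow> F u t"
      unfolding vS F_def by (rule green_limit(1)[OF cG[OF cv] Glim GB t])
    moreover have "(\<lambda>n. v (Suc n) t) \<longlonglongrightarrow> u t" using lim[OF t] by (rule LIMSEQ_Suc)
    ultimately show ?thesis by (rule LIMSEQ_unique[symmetric])
  qed
  have e0: "0 \<in> {0..e}" by (simp add: e_def)
  have "continuous_on {0..e} (F u)"
    unfolding F_def by (rule green_limit(2)[OF cG[OF cv] Glim GB e0])
  then have cu: "continuous_on {0..e} u" using eq continuous_on_cong by metis
  \<comment> \<open>u and F u are known to agree only on [0, e]; F u comes with an explicit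
    derivative, so it is the function returned.\<close>
  have "ode_solution_on \<Lambda> \<epsilon> {0..e} (F u) (green_deriv k d e (G u))"
    unfolding ode_solution_on_iff[OF less_imp_neq[OF \<epsilon>, symmetric]]
  proof (intro ballI conjI dF(1)[OF cu])
    fix t assume t: "t \<in> {0..e}"
    have "M * F u t - G u t = cubic \<Lambda> t (F u t)" unfolding G_def eq[OF t, symmetric] by simp
    then show "(green_deriv k d e (G u) has_real_derivative cubic \<Lambda> t (F u t) / \<epsilon>\<^sup>2) (at t within {0..e})"
      using dF(2)[OF cu t] by (simp only:)
  qed
  then show ?thesis
    using F_bnd[of u] u_bd eq that[of "F u" "green_deriv k d e (G u)"] unfolding e_def by auto
qed

end

section \<open>Gluing and periodic continuation of solutions\<close>

lemma deriv_within_glue: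
  fixes f :: "real \<Rightarrow> real"
  assumes "t \<in> {a..b}" "a \<le> c" "c \<le> b"
    and l: "t \<in> {a..c} \<Longrightarrow> (f has_real_derivative D) (at t within {a..c})"
    and r: "t \<in> {c..b} \<Longrightarrow> (f has_real_derivative D) (at t within {c..b})"
  shows "(f has_real_derivative D) (at t within {a..b})"
proof -
  \<comment> \<open>If t lies outside one of the closed pieces, the derivative along that piece is
    vacuous, so both pieces can be treated alike.\<close>
  have bot: "at t within S = bot" if "t \<notin> S" "closed S" for S
    using that closure_subset[of "S - {t}"] by (simp add: at_within_eq_bot_iff)
  have "(f has_real_derivative D) (at t within {a..c})"
    using l bot[of "{a..c}"] by (cases "t \<in> {a..c}") (simp_all add: has_field_derivative_iff)
  moreover have "(f has_real_derivative D) (at t within {c..b})"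
    using r bot[of "{c..b}"] by (cases "t \<in> {c..b}") (simp_all add: has_field_derivative_iff)
  moreover have "{a..b} = {a..c} \<union> {c..b}" using assms by auto
  ultimately show ?thesis
    unfolding has_field_derivative_iff by (simp add: at_within_union filterlim_sup)
qed

lemma ode_solution_on_glue:
  assumes "ode_solution_on \<Lambda> \<epsilon> {a..c} u w" "ode_solution_on \<Lambda> \<epsilon> {c..b} u w" "a \<le> c" "c \<le> b" "\<epsilon> \<noteq> 0"
  shows "ode_solution_on \<Lambda> \<epsilon> {a..b} u w"
  using assms unfolding ode_solution_on_iff[OF \<open>\<epsilon> \<noteq> 0\<close>] by (blast intro: deriv_within_glue)

lemma ode_solution_on_cong:
  assumes ode: "ode_solution_on \<Lambda> \<epsilon> I u w" and eq: "\<And>t. t \<in> I \<Longrightarrow> v t = u t" "\<And>t. t \<in> I \<Longrightarrow> x t = w t"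
  shows "ode_solution_on \<Lambda> \<epsilon> I v x"
proof -
  have tr: "(g has_real_derivative D) (at t within I)"
    if "(f has_real_derivative D) (at t within I)" "t \<in> I" "\<And>t. t \<in> I \<Longrightarrow> g t = f t" for f g D t
    using that has_derivative_transform unfolding has_field_derivative_def by blast
  show ?thesis
    using ode unfolding ode_solution_on_def by (metis eq tr)
qed

lemma periodic_extension:
  assumes ode: "ode_solution_on \<Lambda> \<epsilon> {0..2 * pi} v x" and "\<epsilon> \<noteq> 0"
    and per: "v 0 = v (2 * pi)" "x 0 = x (2 * pi)"
  obtains u w where "ode_solution_on \<Lambda> \<epsilon> UNIV u w" "\<And>t. u (t + 2 * pi) = u t"
    "\<And>t. t \<in> {0..2 * pi} \<Longrightarrow> u t = v t \<and> w t = x t"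
proof -
  define P where "P = 2 * pi"
  have P: "P > 0" by (simp add: P_def)
  define s where "s t = t - P * of_int \<lfloor>t / P\<rfloor>" for t
  define u where "u t = v (s t)" for t
  define w where "w t = x (s t)" for t
  have s_eq: "s t = t - P * of_int n" if "P * of_int n \<le> t" "t < P * (of_int n + 1)" for t n
  proof -
    have "\<lfloor>t / P\<rfloor> = n" using that P by (intro floor_unique) (simp_all add: field_simps)
    then show ?thesis by (simp add: s_def)
  qed
  \<comment> \<open>Stated on closed cells: at the right end point, where the floor has already
    jumped, the matching boundary data are used. Adjacent cells can then be glued.\<close>
  have eq: "u t = v (t - P * of_int n) \<and> w t = x (t - P * of_int n)"
    if t: "t \<in> {P * of_int n..P * (of_int n + 1)}" for t n
  proof (cases "t = P * (of_int n + 1)")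
    case True
    have "s t = 0" using s_eq[of "n + 1" t] True P by (simp add: algebra_simps)
    moreover have "t - P * of_int n = P" using True by (simp add: algebra_simps)
    ultimately show ?thesis using per by (simp add: u_def w_def P_def)
  qed (use s_eq[of n t] t in \<open>simp add: u_def w_def\<close>)
  have piece: "ode_solution_on \<Lambda> \<epsilon> {P * of_int n..P * (of_int n + 1)} u w" for n
  proof (rule ode_solution_on_cong)
    have "cos (t - P * of_int n) = cos t" for t
      by (simp add: P_def cos_diff)
    then show "ode_solution_on \<Lambda> \<epsilon> {P * of_int n..P * (of_int n + 1)}
        (\<lambda>t. v (t - P * of_int n)) (\<lambda>t. x (t - P * of_int n))"
      using ode_transform[OF ode \<open>\<epsilon> \<noteq> 0\<close>, of "{P * of_int n..P * (of_int n + 1)}" 1 "- P * of_int n" 1]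
      by (simp add: P_def algebra_simps)
  qed (use eq in blast)+
  have "ode_solution_on \<Lambda> \<epsilon> UNIV u w"
    unfolding ode_solution_on_iff[OF \<open>\<epsilon> \<noteq> 0\<close>]
  proof
    fix t :: real
    define n where "n = \<lfloor>t / P\<rfloor>"
    have "of_int n \<le> t / P" "t / P < of_int n + 1" by (auto simp: n_def)
    then have t: "P * of_int n \<le> t" "t < P * (of_int n + 1)" using P by (simp_all add: field_simps)
    have "ode_solution_on \<Lambda> \<epsilon> {P * of_int (n - 1)..P * of_int n} u w" using piece[of "n - 1"] by simp
    then have "ode_solution_on \<Lambda> \<epsilon> {P * of_int (n - 1)..P * (of_int n + 1)} u w"
      by (rule ode_solution_on_glue[OF _ piece]) (use P \<open>\<epsilon> \<noteq> 0\<close> in auto)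
    moreover have "P * of_int (n - 1) < t" using t P by (simp add: algebra_simps)
    ultimately show "(u has_real_derivative w t) (at t within UNIV) \<and>
        (w has_real_derivative cubic \<Lambda> t (u t) / \<epsilon>\<^sup>2) (at t within UNIV)"
      using t at_within_Icc_at[of "P * of_int (n - 1)" t "P * (of_int n + 1)"]
      unfolding ode_solution_on_iff[OF \<open>\<epsilon> \<noteq> 0\<close>] by (metis atLeastAtMost_iff less_imp_le)
  qed
  moreover have "u (t + 2 * pi) = u t" for t
  proof -
    have "(t + P) / P = t / P + 1" using P by (simp add: field_simps)
    then have "s (t + P) = s t" by (simp add: s_def algebra_simps)
    then show ?thesis by (simp add: u_def P_def)
  qed
  moreover have "u t = v t \<and> w t = x t" if "t \<in> {0..2 * pi}" for t
    using eq[of t 0] that by (simp add: P_def)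
  ultimately show thesis using that by blast
qed

context bistable
begin

text \<open>The quarter solution is continued oddly about \<pi>/2, where it vanishes, and then
  evenly about \<pi>, where its slope vanishes, so that values and slopes match at every
  seam.\<close>

lemma up_profile_exists:
  assumes \<epsilon>: "\<epsilon> > 0"
  obtains u w where "up_profile \<epsilon> u w"
proof -
  obtain u w where ode: "ode_solution_on \<Lambda> \<epsilon> {0..pi / 2} u w" and bc: "w 0 = 0" "u (pi / 2) = 0"
    and bd: "\<And>t. t \<in> {0..pi / 2} \<Longrightarrow> - b \<le> u t \<and> u t \<le> 0"
    using quarter_solution[OF \<epsilon>] by blast
  have \<epsilon>0: "\<epsilon> \<noteq> 0" using \<epsilon> by simp
  have dw: "(w has_real_derivative cubic \<Lambda> t (u t) / \<epsilon>\<^sup>2) (at t within {0..pi / 2})" if "t \<in> {0..pi / 2}" for t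
    using ode that unfolding ode_solution_on_iff[OF \<epsilon>0] by blast
  \<comment> \<open>The iteration gives no monotonicity in t. If both w and the cubic were
    nonpositive at x, then u x <= Ulo x, because u x <= 0 < Umid x; \<open>ode_descent\<close> would
    then keep u below -m, against u (\<pi>/2) = 0.\<close>
  have wpos: "w t > 0" if t: "0 < t" "t < pi / 2" for t
  proof (rule positive_forward[OF dw, of 0 t])
    fix x assume x: "0 \<le> x" "x \<le> t" "w x \<le> 0"
    have "cubic \<Lambda> x (u x) > 0"
    proof (rule ccontr)
      assume neg: "\<not> cubic \<Lambda> x (u x) > 0"
      have "cos x > 0" using x t by (intro cos_gt_zero_pi) auto
      then have "- Ulo x * Uup x * Umid x > 0" using prod_roots[of x] by (simp add: mult_ac)
      moreover have "- Ulo x * Uup x > 0" using Ulo_lt[of x] Uup_gt[of x] m_pos by (intro mult_pos_pos) auto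
      ultimately have "Umid x > 0" by (rule zero_less_mult_pos)
      then have "u x \<le> Ulo x" using bd[of x] x t cubic_pos[of x "u x"] neg by force
      then have ux: "u x < - m" using Ulo_lt[of x] by simp
      have "u (pi / 2) < - m"
        by (rule ode_descent[OF ode_solution_on_subset[OF ode] \<epsilon>, where s = x and e = "pi / 2"])
           (use x t neg ux in auto)
      then show False using bc m_pos by simp
    qed
    then show "cubic \<Lambda> x (u x) / \<epsilon>\<^sup>2 > 0" using \<epsilon> by simp
  qed (use t bc in auto)
  define v where "v t = (if t \<le> pi / 2 then u t else - u (pi - t))" for t
  define x where "x t = (if t \<le> pi / 2 then w t else w (pi - t))" for t
  have "ode_solution_on \<Lambda> \<epsilon> {0..pi} v x"
  proof (rule ode_solution_on_glue[where c = "pi / 2"])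
    show "ode_solution_on \<Lambda> \<epsilon> {0..pi / 2} v x"
      by (rule ode_solution_on_cong[OF ode]) (auto simp: v_def x_def)
    have "ode_solution_on \<Lambda> \<epsilon> {pi / 2..pi} (\<lambda>t. - u (pi - t)) (\<lambda>t. w (pi - t))"
      using ode_transform[OF ode \<epsilon>0, of "{pi / 2..pi}" "- 1" pi "- 1"] by (simp add: cos_diff)
    then show "ode_solution_on \<Lambda> \<epsilon> {pi / 2..pi} v x"
    proof (rule ode_solution_on_cong)
      fix t assume t: "t \<in> {pi / 2..pi}"
      have "v t = - u (pi - t) \<and> x t = w (pi - t)"
      proof (cases "t = pi / 2")
        case True
        show ?thesis unfolding True using bc by (simp add: v_def x_def)
      next
        case False
        then have "\<not> t \<le> pi / 2" using t by simp
        then show ?thesis by (simp add: v_def x_def)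
      qed
      then show "v t = - u (pi - t)" "x t = w (pi - t)" by auto
    qed
  qed (use \<epsilon> in auto)
  note odev = this
  define y where "y t = (if t \<le> pi then v t else v (2 * pi - t))" for t
  define z where "z t = (if t \<le> pi then x t else - x (2 * pi - t))" for t
  have xpi: "x pi = 0" using bc by (simp add: x_def)
  have "ode_solution_on \<Lambda> \<epsilon> {0..2 * pi} y z"
  proof (rule ode_solution_on_glue[where c = pi])
    show "ode_solution_on \<Lambda> \<epsilon> {0..pi} y z"
      by (rule ode_solution_on_cong[OF odev]) (auto simp: y_def z_def)
    have "ode_solution_on \<Lambda> \<epsilon> {pi..2 * pi} (\<lambda>t. v (2 * pi - t)) (\<lambda>t. - x (2 * pi - t))"
      using ode_transform[OF odev \<epsilon>0, of "{pi..2 * pi}" "- 1" "2 * pi" 1] by (simp add: cos_diff)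
    then show "ode_solution_on \<Lambda> \<epsilon> {pi..2 * pi} y z"
      by (rule ode_solution_on_cong) (use xpi in \<open>auto simp: y_def z_def\<close>)
  qed (use \<epsilon> in auto)
  then obtain U W where U: "ode_solution_on \<Lambda> \<epsilon> UNIV U W" "\<And>t. U (t + 2 * pi) = U t"
    "\<And>t. t \<in> {0..2 * pi} \<Longrightarrow> U t = y t \<and> W t = z t"
  proof (rule periodic_extension[OF _ \<epsilon>0])
    show "y 0 = y (2 * pi)" "z 0 = z (2 * pi)" using bc by (simp_all add: y_def z_def v_def x_def)
  qed blast
  have UW: "U t = u t \<and> W t = w t" if "t \<in> {0..pi / 2}" for t
    using U(3)[of t] that by (simp add: y_def z_def v_def x_def)
  have "up_profile \<epsilon> U W"
    unfolding up_profile_def using U UW bc wpos by (auto simp: UW)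
  then show thesis by (rule that)
qed

end

section \<open>Cosine series and the heat equation\<close>

definition cosb :: "real \<Rightarrow> nat \<Rightarrow> real \<Rightarrow> real" where
  "cosb L n x = cos (real n * (pi / L) * x)"

text \<open>Kept without the normalization of \<open>fcoef\<close>, so that the product rule for
  cosine modes needs no special case for mode 0.\<close>

definition fint :: "real \<Rightarrow> (real \<Rightarrow> real) \<Rightarrow> nat \<Rightarrow> real" where
  "fint L h n = integral {0..L} (\<lambda>x. h x * cosb L n x)"

definition fcoef :: "real \<Rightarrow> (real \<Rightarrow> real) \<Rightarrow> nat \<Rightarrow> real" where
  "fcoef L h n = (if n = 0 then 1 else 2) / L * fint L h n"

definition nat_dist :: "nat \<Rightarrow> nat \<Rightarrow> nat" where
  "nat_dist m n = (m - n) + (n - m)"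

lemma cosb_0 [simp]: "cosb L 0 x = 1"
  by (simp add: cosb_def)

lemma abs_cosb_le: "\<bar>cosb L n x\<bar> \<le> 1"
  by (simp add: cosb_def)

lemma continuous_on_cosb [continuous_intros]: "continuous_on S (cosb L n)"
  unfolding cosb_def by (intro continuous_intros)

lemma cosb_mult: "cosb L m x * cosb L n x = (cosb L (m + n) x + cosb L (nat_dist m n) x) / 2"
proof -
  let ?q = "pi / L * x"
  have "cosb L m x * cosb L n x = (cos (real m * ?q - real n * ?q) + cos (real m * ?q + real n * ?q)) / 2"
    unfolding cosb_def cos_times_cos[symmetric] by (simp add: mult_ac)
  also have "cos (real m * ?q + real n * ?q) = cosb L (m + n) x"
    by (simp add: cosb_def algebra_simps)
  also have "cos (real m * ?q - real n * ?q) = cosb L (nat_dist m n) x"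
  proof (cases "m \<le> n")
    case True
    then have "real (nat_dist m n) = real n - real m" by (simp add: nat_dist_def of_nat_diff)
    then have "real (nat_dist m n) * ?q = - (real m * ?q - real n * ?q)"
      by (simp only: left_diff_distrib minus_diff_eq)
    then show ?thesis unfolding cosb_def mult.assoc by (simp only: cos_minus)
  next
    case False
    then have "real (nat_dist m n) = real m - real n" by (simp add: nat_dist_def of_nat_diff)
    then have "real (nat_dist m n) * ?q = real m * ?q - real n * ?q"
      by (simp only: left_diff_distrib)
    then show ?thesis unfolding cosb_def mult.assoc by (simp only:)
  qed
  finally show ?thesis by simp
qed

lemma integral_cosb:
  assumes "L > 0"
  shows "integral {0..L} (cosb L n) = (if n = 0 then L else 0)"
proof (cases "n = 0")
  case False
  define k where "k = real n * (pi / L)"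
  have k: "k \<noteq> 0" "k * L = real n * pi" using False assms by (auto simp: k_def)
  have "((\<lambda>x. cos (k * x)) has_integral sin (k * L) / k - sin (k * 0) / k) {0..L}"
    using assms k
    by (intro fundamental_theorem_of_calculus)
       (auto intro!: derivative_eq_intros simp flip: has_real_derivative_iff_has_vector_derivative)
  moreover have "cosb L n = (\<lambda>x. cos (k * x))" by (simp add: cosb_def k_def fun_eq_iff)
  ultimately show ?thesis using False k by (simp add: integral_unique)
next
  case True
  have "cosb L 0 = (\<lambda>_. 1)" by (simp add: fun_eq_iff)
  then show ?thesis using True assms by simp
qed

lemma fint_cosb:
  assumes "L > 0"
  shows "fint L (cosb L j) n = (if j = n then (if n = 0 then L else L / 2) else 0)"
proof -
  have "fint L (cosb L j) n = integral {0..L} (\<lambda>x. (cosb L (j + n) x + cosb L (nat_dist j n) x) / 2)"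
    by (simp add: fint_def cosb_mult)
  also have "\<dots> = (integral {0..L} (cosb L (j + n)) + integral {0..L} (cosb L (nat_dist j n))) / 2"
    by (subst integral_divide, subst integral_add) (auto intro!: integrable_continuous_real continuous_intros)
  also have "\<dots> = (if j = n then (if n = 0 then L else L / 2) else 0)"
    using assms by (auto simp: integral_cosb nat_dist_def)
  finally show ?thesis .
qed

lemma fcoef_cosb: "L > 0 \<Longrightarrow> fcoef L (cosb L j) n = (if j = n then 1 else 0)"
  by (simp add: fcoef_def fint_cosb)

lemma fint_add:
  assumes "continuous_on {0..L} f" "continuous_on {0..L} h"
  shows "fint L (\<lambda>x. f x + h x) n = fint L f n + fint L h n"
  unfolding fint_def distrib_right
  by (intro integral_add integrable_continuous_real continuous_intros assms)

lemma fint_cmult: "fint L (\<lambda>x. c * f x) n = c * fint L f n"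
  by (simp add: fint_def mult.assoc)

lemma fcoef_add:
  assumes "continuous_on {0..L} f" "continuous_on {0..L} h"
  shows "fcoef L (\<lambda>x. f x + h x) n = fcoef L f n + fcoef L h n"
  by (simp add: fcoef_def fint_add[OF assms] distrib_left)

lemma fcoef_cmult: "fcoef L (\<lambda>x. c * f x) n = c * fcoef L f n"
  by (simp add: fcoef_def fint_cmult)

lemma fint_bound:
  assumes "L > 0" and h: "continuous_on {0..L} h" and B: "\<And>x. x \<in> {0..L} \<Longrightarrow> \<bar>h x\<bar> \<le> B"
  shows "\<bar>fint L h n\<bar> \<le> B * L"
proof -
  have "norm (integral {0..L} (\<lambda>x. h x * cosb L n x)) \<le> B * (L - 0)"
  proof (rule integral_bound)
    fix x assume "x \<in> {0..L}"
    then have "\<bar>h x\<bar> * \<bar>cosb L n x\<bar> \<le> B * 1"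
      using B[of x] abs_cosb_le[of L n x] by (intro mult_mono) auto
    then show "norm (h x * cosb L n x) \<le> B" by (simp add: abs_mult)
  qed (use assms in \<open>auto intro!: continuous_intros\<close>)
  then show ?thesis by (simp add: fint_def)
qed

lemma fcoef_bound:
  assumes "L > 0" "continuous_on {0..L} h" and B: "\<And>x. x \<in> {0..L} \<Longrightarrow> \<bar>h x\<bar> \<le> B"
  shows "\<bar>fcoef L h n\<bar> \<le> 2 * B"
proof -
  have B0: "B \<ge> 0" using B[of 0] assms(1) by simp
  have "\<bar>fcoef L h n\<bar> = (if n = 0 then 1 else 2) / L * \<bar>fint L h n\<bar>"
    using assms(1) by (simp add: fcoef_def abs_mult)
  also have "\<dots> \<le> 2 / L * (B * L)"
    using fint_bound[OF assms, of n] assms(1) B0 by (intro mult_mono divide_right_mono) auto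
  finally show ?thesis using assms(1) by simp
qed

lemma fcoef_le_fint: "L > 0 \<Longrightarrow> \<bar>fcoef L h n\<bar> \<le> 2 / L * \<bar>fint L h n\<bar>"
  by (auto simp: fcoef_def abs_mult intro!: mult_right_mono divide_right_mono)

definition conv_bound :: "(nat \<Rightarrow> real) \<Rightarrow> (nat \<Rightarrow> real) \<Rightarrow> nat \<Rightarrow> real" where
  "conv_bound A B n = (\<Sum>m. A m * ((B (m + n) + B (nat_dist m n)) / 2))"

lemma summable_conv_terms:
  fixes A B :: "nat \<Rightarrow> real"
  assumes A: "summable A" "\<And>n. A n \<ge> 0" and B: "summable B" "\<And>n. B n \<ge> 0"
  shows "summable (\<lambda>m. A m * ((B (m + n) + B (nat_dist m n)) / 2))"
proof (rule summable_comparison_test')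
  show "summable (\<lambda>m. A m * suminf B)" using A by (intro summable_mult2)
  fix m
  have "B j \<le> suminf B" for j
    using sum_le_suminf[OF B(1), of "{j}"] B(2) by simp
  from this[of "m + n"] this[of "nat_dist m n"]
  have "(B (m + n) + B (nat_dist m n)) / 2 \<le> suminf B" using add_mono by fastforce
  then have "A m * ((B (m + n) + B (nat_dist m n)) / 2) \<le> A m * suminf B"
    using A(2) by (intro mult_left_mono)
  moreover have "0 \<le> A m * ((B (m + n) + B (nat_dist m n)) / 2)" using A(2) B(2) by simp
  ultimately show "norm (A m * ((B (m + n) + B (nat_dist m n)) / 2)) \<le> A m * suminf B"
    by (simp only: real_norm_def abs_of_nonneg)
qed

text \<open>Absolutely convergent cosine series form an algebra: for fixed m, the index m + n takes
  each value at most once and |m - n| at most twice, whence the generous factor 3.\<close>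

lemma summable_conv_bound:
  fixes A B :: "nat \<Rightarrow> real"
  assumes A: "summable A" "\<And>n. A n \<ge> 0" and B: "summable B" "\<And>n. B n \<ge> 0"
  shows "summable (conv_bound A B)" "\<And>n. conv_bound A B n \<ge> 0"
proof -
  show nn: "conv_bound A B n \<ge> 0" for n
    unfolding conv_bound_def by (intro suminf_nonneg summable_conv_terms assms) (simp add: A B)
  have inner: "(\<Sum>n<N. (B (m + n) + B (nat_dist m n)) / 2) \<le> 3 * suminf B" for m N
  proof -
    have s: "sum B S \<le> suminf B" if "finite S" for S
      using that B by (intro sum_le_suminf) auto
    have "(\<Sum>n<N. B (m + n)) = sum B ((+) m ` {..<N})"
      by (subst sum.reindex) (auto simp: inj_on_def o_def)
    then have 1: "(\<Sum>n<N. B (m + n)) \<le> suminf B" using s by simp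
    have "(\<Sum>n<N. B (nat_dist m n)) \<le> (\<Sum>n\<in>{..m} \<union> {m..m + N}. B (nat_dist m n))"
      using B by (intro sum_mono2) auto
    also have "\<dots> \<le> (\<Sum>n\<in>{..m}. B (nat_dist m n)) + (\<Sum>n\<in>{m..m + N}. B (nat_dist m n))"
      using B by (simp add: sum_Un_nat sum.union_inter[symmetric] sum_nonneg add_increasing2)
    also have "(\<Sum>n\<in>{..m}. B (nat_dist m n)) = sum B ((\<lambda>n. m - n) ` {..m})"
      by (subst sum.reindex) (auto simp: inj_on_def nat_dist_def intro!: sum.cong)
    also have "(\<Sum>n\<in>{m..m + N}. B (nat_dist m n)) = sum B ((\<lambda>n. n - m) ` {m..m + N})"
      by (subst sum.reindex) (auto simp: inj_on_def nat_dist_def intro!: sum.cong)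
    also have "sum B ((\<lambda>n. m - n) ` {..m}) + sum B ((\<lambda>n. n - m) ` {m..m + N}) \<le> suminf B + suminf B"
      by (intro add_mono s) auto
    finally have 2: "(\<Sum>n<N. B (nat_dist m n)) \<le> 2 * suminf B" by simp
    have "0 \<le> suminf B" using s[of "{}"] by simp
    with 1 2 show ?thesis
      by (simp add: sum.distrib add_divide_distrib flip: sum_divide_distrib)
  qed
  show "summable (conv_bound A B)"
  proof (rule summableI_nonneg_bounded[OF nn])
    fix N
    have "sum (conv_bound A B) {..<N} = (\<Sum>m. \<Sum>n<N. A m * ((B (m + n) + B (nat_dist m n)) / 2))"
      unfolding conv_bound_def by (rule suminf_sum[symmetric]) (intro summable_conv_terms assms)
    also have "\<dots> = (\<Sum>m. A m * (\<Sum>n<N. (B (m + n) + B (nat_dist m n)) / 2))"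
      by (simp add: sum_distrib_left)
    also have "\<dots> \<le> (\<Sum>m. A m * (3 * suminf B))"
    proof (rule suminf_le)
      show "summable (\<lambda>m. A m * (\<Sum>n<N. (B (m + n) + B (nat_dist m n)) / 2))"
        unfolding sum_distrib_left by (intro summable_sum summable_conv_terms assms)
    qed (use A inner in \<open>auto intro!: mult_left_mono summable_mult2\<close>)
    finally show "sum (conv_bound A B) {..<N} \<le> (\<Sum>m. A m * (3 * suminf B))" .
  qed
qed

lemma sums_integral_series:
  fixes f :: "nat \<Rightarrow> real \<Rightarrow> real"
  assumes f: "\<And>n. continuous_on {a..b} (f n)" and le: "\<And>n x. x \<in> {a..b} \<Longrightarrow> \<bar>f n x\<bar> \<le> A n"
    and A: "summable A"
  shows "(\<lambda>n. integral {a..b} (f n)) sums integral {a..b} (\<lambda>x. \<Sum>n. f n x)"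
proof -
  have u: "uniform_limit {a..b} (\<lambda>N x. \<Sum>n<N. f n x) (\<lambda>x. \<Sum>n. f n x) sequentially"
    by (rule Weierstrass_m_test[OF _ A]) (use le in auto)
  have c: "continuous_on {a..b} (\<lambda>x. \<Sum>n<N. f n x)" for N by (intro continuous_intros f)
  obtain I J where IJ: "\<And>N. ((\<lambda>x. \<Sum>n<N. f n x) has_integral I N) {a..b}"
    "((\<lambda>x. \<Sum>n. f n x) has_integral J) {a..b}" "I \<longlonglongrightarrow> J"
    using uniform_limit_integral[OF u c sequentially_bot] by blast
  have "I N = (\<Sum>n<N. integral {a..b} (f n))" for N
    using integral_unique[OF IJ(1)[of N]] by (subst (asm) integral_sum) (auto intro!: integrable_continuous_real f)
  then have "I = (\<lambda>N. \<Sum>n<N. integral {a..b} (f n))" by blast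
  then show ?thesis using IJ(3) integral_unique[OF IJ(2)] by (simp add: sums_def)
qed

text \<open>Multiplying the cosine integrals of a function by an absolutely convergent cosine series:
  \<open>c\<^sub>m c\<^sub>n = (c\<^bsub>m+n\<^esub> + c\<^bsub>|m-n|\<^esub>) / 2\<close>.\<close>

lemma fint_mult_bound:
  assumes "L > 0" and h: "continuous_on {0..L} h" and B: "summable B" "\<And>n. \<bar>fint L h n\<bar> \<le> B n"
    and A: "summable A" "\<And>n. \<bar>\<phi> n\<bar> \<le> A n"
    and f: "\<And>x. x \<in> {0..L} \<Longrightarrow> (\<lambda>n. \<phi> n * cosb L n x) sums f x"
  shows "\<bar>fint L (\<lambda>x. f x * h x) n\<bar> \<le> conv_bound A B n"
proof -
  obtain H where H: "\<And>x. x \<in> {0..L} \<Longrightarrow> \<bar>h x\<bar> \<le> H"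
    using continuous_on_Icc_bounded[OF h] by blast
  have B0: "B n \<ge> 0" and A0: "A n \<ge> 0" for n using B(2)[of n] A(2)[of n] by linarith+
  have "(\<lambda>m. integral {0..L} (\<lambda>x. \<phi> m * (cosb L m x * (h x * cosb L n x)))) sums
      integral {0..L} (\<lambda>x. \<Sum>m. \<phi> m * (cosb L m x * (h x * cosb L n x)))"
  proof (rule sums_integral_series)
    show "summable (\<lambda>m. A m * H)" using A by (intro summable_mult2)
    fix m x assume x: "x \<in> {0..L}"
    have "\<bar>cosb L m x\<bar> * (\<bar>h x\<bar> * \<bar>cosb L n x\<bar>) \<le> 1 * (H * 1)"
      using H[OF x] abs_cosb_le by (intro mult_mono) auto
    then have "\<bar>\<phi> m\<bar> * (\<bar>cosb L m x\<bar> * (\<bar>h x\<bar> * \<bar>cosb L n x\<bar>)) \<le> A m * H"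
      using A(2)[of m] A0[of m] H[OF x] by (intro mult_mono) auto
    then show "\<bar>\<phi> m * (cosb L m x * (h x * cosb L n x))\<bar> \<le> A m * H" by (simp add: abs_mult)
  qed (intro continuous_intros h)
  also have "integral {0..L} (\<lambda>x. \<Sum>m. \<phi> m * (cosb L m x * (h x * cosb L n x))) = fint L (\<lambda>x. f x * h x) n"
    unfolding fint_def
  proof (rule integral_cong)
    fix x assume "x \<in> {0..L}"
    from sums_mult2[OF f[OF this], of "h x * cosb L n x"]
    show "(\<Sum>m. \<phi> m * (cosb L m x * (h x * cosb L n x))) = f x * h x * cosb L n x"
      by (simp add: sums_iff mult.assoc)
  qed
  also have "(\<lambda>m. integral {0..L} (\<lambda>x. \<phi> m * (cosb L m x * (h x * cosb L n x)))) =
      (\<lambda>m. \<phi> m * ((fint L h (m + n) + fint L h (nat_dist m n)) / 2))"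
  proof
    fix m
    have "integral {0..L} (\<lambda>x. \<phi> m * (cosb L m x * (h x * cosb L n x))) =
        \<phi> m * integral {0..L} (\<lambda>x. (h x * cosb L (m + n) x + h x * cosb L (nat_dist m n) x) / 2)"
    proof -
      have "cosb L m x * (h x * cosb L n x) = (h x * cosb L (m + n) x + h x * cosb L (nat_dist m n) x) / 2" for x
      proof -
        have "cosb L m x * (h x * cosb L n x) = h x * (cosb L m x * cosb L n x)" by simp
        then show ?thesis unfolding cosb_mult by (simp add: distrib_left)
      qed
      then show ?thesis by (simp only: integral_mult_right)
    qed
    also have "integral {0..L} (\<lambda>x. (h x * cosb L (m + n) x + h x * cosb L (nat_dist m n) x) / 2) =
        (fint L h (m + n) + fint L h (nat_dist m n)) / 2"
      unfolding fint_def
      by (subst integral_divide, subst integral_add) (auto intro!: integrable_continuous_real continuous_intros h)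
    finally show "integral {0..L} (\<lambda>x. \<phi> m * (cosb L m x * (h x * cosb L n x))) =
        \<phi> m * ((fint L h (m + n) + fint L h (nat_dist m n)) / 2)" .
  qed
  finally have s: "(\<lambda>m. \<phi> m * ((fint L h (m + n) + fint L h (nat_dist m n)) / 2)) sums fint L (\<lambda>x. f x * h x) n" .
  have le: "\<bar>\<phi> m * ((fint L h (m + n) + fint L h (nat_dist m n)) / 2)\<bar> \<le> A m * ((B (m + n) + B (nat_dist m n)) / 2)" for m
  proof -
    have "\<bar>fint L h (m + n) + fint L h (nat_dist m n)\<bar> \<le> B (m + n) + B (nat_dist m n)"
      using B(2)[of "m + n"] B(2)[of "nat_dist m n"] by linarith
    then show ?thesis unfolding abs_mult using A(2)[of m] A0[of m] B0 by (intro mult_mono) auto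
  qed
  have "\<bar>fint L (\<lambda>x. f x * h x) n\<bar> = \<bar>\<Sum>m. \<phi> m * ((fint L h (m + n) + fint L h (nat_dist m n)) / 2)\<bar>"
    using s by (simp add: sums_iff)
  also have "\<dots> \<le> conv_bound A B n"
    unfolding conv_bound_def real_norm_def[symmetric]
  proof (rule norm_suminf_le)
    show "summable (\<lambda>m. A m * ((B (m + n) + B (nat_dist m n)) / 2))"
      by (rule summable_conv_terms) (use A B A0 B0 in auto)
  qed (use le in simp)
  finally show ?thesis .
qed

lemma fcoef_0_1: "L > 0 \<Longrightarrow> fint L (\<lambda>_. 1) n = (if n = 0 then L else 0)"
  using integral_cosb[of L n] by (simp add: fint_def)

section \<open>The Neumann heat flow\<close>

definition even_ext :: "real \<Rightarrow> (real \<Rightarrow> real) \<Rightarrow> real \<Rightarrow> real" where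
  "even_ext L f x = f (L / pi * arccos (cos (pi / L * x)))"

text \<open>The Gaussian average of the even \<open>2 L\<close>-periodic extension solves the heat equation
  \<open>v\<^sub>\<tau> = \<epsilon>\<^sup>2 v\<^sub>x\<^sub>x\<close> with Neumann conditions on \<open>[0, L]\<close>.\<close>

definition heat :: "real \<Rightarrow> real \<Rightarrow> (real \<Rightarrow> real) \<Rightarrow> real \<Rightarrow> real \<Rightarrow> real" where
  "heat \<epsilon> L f \<tau> x = (LINT z|std_normal_distribution. even_ext L f (x + \<epsilon> * sqrt (2 * \<tau>) * z))"

definition freq :: "real \<Rightarrow> real \<Rightarrow> nat \<Rightarrow> real" where
  "freq \<epsilon> L n = \<epsilon>\<^sup>2 * (real n * (pi / L))\<^sup>2"

text \<open>The cosine polynomials, on which the heat flow is computed mode by mode; the inductive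
  form lets identities linear in f be proved by rule induction.\<close>

inductive cos_span :: "real \<Rightarrow> (real \<Rightarrow> real) \<Rightarrow> bool" for L where
  base: "cos_span L (cosb L n)"
| add: "cos_span L f \<Longrightarrow> cos_span L g \<Longrightarrow> cos_span L (\<lambda>x. f x + g x)"
| cmult: "cos_span L f \<Longrightarrow> cos_span L (\<lambda>x. c * f x)"

lemma cos_span_mult_cos:
  assumes "cos_span L f"
  shows "cos_span L (\<lambda>x. cos (pi / L * x) * f x)"
  using assms
proof induction
  case (base n)
  have "cos (pi / L * x) = cosb L 1 x" for x by (simp add: cosb_def)
  then have "(\<lambda>x. cos (pi / L * x) * cosb L n x) = (\<lambda>x. 1 / 2 * (cosb L (1 + n) x + cosb L (nat_dist 1 n) x))"
    by (simp only: cosb_mult) (simp add: fun_eq_iff)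
  then show ?case
    using cos_span.cmult[OF cos_span.add[OF cos_span.base[of L "1 + n"] cos_span.base[of L "nat_dist 1 n"]], of "1 / 2"]
    by (simp only:)
next
  case (add f g)
  then show ?case using cos_span.add[OF add.IH] by (simp add: distrib_left)
next
  case (cmult f c)
  then show ?case using cos_span.cmult[OF cmult.IH, of c] by (simp add: mult.left_commute)
qed

lemma cos_span_poly: "cos_span L (\<lambda>x. \<Sum>i\<le>N. a i * cos (pi / L * x) ^ i)"
proof -
  have p: "cos_span L (\<lambda>x. cos (pi / L * x) ^ i)" for i
  proof (induction i)
    case 0
    have "cosb L 0 = (\<lambda>_. 1)" by (simp add: fun_eq_iff)
    then show ?case using cos_span.base[of L 0] by simp
  next
    case (Suc i)
    then show ?case using cos_span_mult_cos by fastforce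
  qed
  show ?thesis
  proof (induction N)
    case 0
    then show ?case using cos_span.cmult[OF p[of 0], of "a 0"] by simp
  next
    case (Suc N)
    then show ?case using cos_span.add[OF Suc cos_span.cmult[OF p[of "Suc N"], of "a (Suc N)"]] by simp
  qed
qed

text \<open>By the Chebyshev recurrence, cos (n y) is a function of cos y alone.\<close>

lemma cos_nat_mult_cong:
  fixes y z :: real
  assumes "cos y = cos z"
  shows "cos (real n * y) = cos (real n * z)"
proof -
  have step: "cos (real (Suc (Suc n)) * y) = 2 * cos (real (Suc n) * y) * cos y - cos (real n * y)" for n and y :: real
  proof -
    have "cos (real (Suc n) * y + y) + cos (real (Suc n) * y - y) = 2 * cos (real (Suc n) * y) * cos y"
      by (simp only: cos_add cos_diff)
    moreover have "real (Suc n) * y + y = real (Suc (Suc n)) * y" "real (Suc n) * y - y = real n * y"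
      by (simp_all add: algebra_simps)
    ultimately show ?thesis by (simp only:)
  qed
  have "cos (real n * y) = cos (real n * z) \<and> cos (real (Suc n) * y) = cos (real (Suc n) * z)"
  proof (induction n)
    case (Suc n)
    then show ?case using step[of n y] step[of n z] assms by (simp only:)
  qed (use assms in simp)
  then show ?thesis by blast
qed

lemma cos_span_even_ext:
  assumes "cos_span L f" "L > 0"
  shows "even_ext L f x = f x"
  using assms(1)
proof induction
  case (base n)
  have c: "cos (real n * y) = cos (real n * arccos (cos y))" for y
    by (rule cos_nat_mult_cong) simp
  show ?case using c[of "pi / L * x"] \<open>L > 0\<close> by (simp add: even_ext_def cosb_def mult.assoc)
qed (simp_all add: even_ext_def)

lemma cos_span_continuous: "cos_span L f \<Longrightarrow> continuous_on S f"
  by (induction rule: cos_span.induct) (auto intro!: continuous_intros)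

lemma cos_span_bounded: "cos_span L f \<Longrightarrow> \<exists>B. \<forall>x. \<bar>f x\<bar> \<le> B"
proof (induction rule: cos_span.induct)
  case (base n)
  then show ?case using abs_cosb_le by blast
next
  case (add f g)
  then obtain B C where BC: "\<And>x. \<bar>f x\<bar> \<le> B" "\<And>x. \<bar>g x\<bar> \<le> C" by blast
  have "\<bar>f x + g x\<bar> \<le> B + C" for x using BC(1)[of x] BC(2)[of x] by linarith
  then show ?case by blast
next
  case (cmult f c)
  then obtain B where B: "\<And>x. \<bar>f x\<bar> \<le> B" by blast
  have "\<bar>c * f x\<bar> \<le> \<bar>c\<bar> * B" for x using B[of x] by (simp add: abs_mult mult_left_mono)
  then show ?case by blast
qed

lemma even_ext_in: "L > 0 \<Longrightarrow> L / pi * arccos (cos (pi / L * x)) \<in> {0..L}"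
  using arccos_bounded[of "cos (pi / L * x)"] by (auto simp: field_simps)

lemma even_ext_eq:
  assumes "L > 0" "x \<in> {0..L}"
  shows "even_ext L f x = f x"
proof -
  have "pi / L * x \<le> pi" using assms by (simp add: field_simps)
  then have "arccos (cos (pi / L * x)) = pi / L * x" using assms by (intro arccos_cos) auto
  then show ?thesis using assms by (simp add: even_ext_def)
qed

lemma continuous_even_ext:
  assumes "L > 0" and f: "continuous_on {0..L} f"
  shows "continuous_on UNIV (even_ext L f)"
  unfolding even_ext_def
  by (rule continuous_on_compose2[OF f]) (use even_ext_in[OF \<open>L > 0\<close>] \<open>L > 0\<close> in \<open>auto intro!: continuous_intros\<close>)

interpretation gauss: prob_space std_normal_distribution
  using real_dist_normal_dist real_distribution_def by blast

lemma gauss_UNIV: "measure std_normal_distribution UNIV = 1"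
  using gauss.prob_space by simp

lemma gauss_cos_sin:
  "(LINT z|std_normal_distribution. cos (t * z)) = exp (- (t\<^sup>2) / 2)"
  "(LINT z|std_normal_distribution. sin (t * z)) = 0"
proof -
  have i: "integrable std_normal_distribution (\<lambda>z. iexp (t * z))"
    by (rule gauss.integrable_const_bound[where B = 1]) auto
  have c: "(CLINT z|std_normal_distribution. iexp (t * z)) = complex_of_real (exp (- (t\<^sup>2) / 2))"
    using char_std_normal_distribution by (simp add: char_def fun_eq_iff)
  have "(LINT z|std_normal_distribution. Re (iexp (t * z))) = exp (- (t\<^sup>2) / 2)"
    by (subst integral_Re[OF i]) (simp only: c Re_complex_of_real)
  then show "(LINT z|std_normal_distribution. cos (t * z)) = exp (- (t\<^sup>2) / 2)"
    by (simp add: Re_exp)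
  have "(LINT z|std_normal_distribution. Im (iexp (t * z))) = 0"
    by (subst integral_Im[OF i]) (simp only: c Im_complex_of_real)
  then show "(LINT z|std_normal_distribution. sin (t * z)) = 0"
    by (simp add: Im_exp)
qed

lemma gauss_integrable:
  fixes f :: "real \<Rightarrow> real"
  assumes "continuous_on UNIV f" "\<And>x. \<bar>f x\<bar> \<le> B"
  shows "integrable std_normal_distribution f"
proof (rule gauss.integrable_const_bound[where B = B])
  have "f \<in> borel_measurable borel" by (rule borel_measurable_continuous_onI) (rule assms)
  then show "f \<in> borel_measurable std_normal_distribution" by simp
qed (use assms in auto)

lemma gauss_abs_le:
  fixes f :: "real \<Rightarrow> real"
  assumes "\<And>x. \<bar>f x\<bar> \<le> B"
  shows "\<bar>LINT z|std_normal_distribution. f z\<bar> \<le> B"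
proof (cases "integrable std_normal_distribution f")
  case True
  have "\<bar>LINT z|std_normal_distribution. f z\<bar> \<le> (LINT z|std_normal_distribution. \<bar>f z\<bar>)"
    by (rule integral_abs_bound)
  also have "\<dots> \<le> (LINT z|std_normal_distribution. B)"
    using assms True by (intro integral_mono) auto
  finally show ?thesis by (simp add: gauss_UNIV)
\<comment> \<open>A non-integrable f has integral 0 by convention, which is covered by B >=
  0.\<close>
qed (use assms[of 0] in \<open>simp add: not_integrable_integral_eq\<close>)

lemma heat_abs_le:
  assumes "L > 0" "\<And>x. x \<in> {0..L} \<Longrightarrow> \<bar>f x\<bar> \<le> B"
  shows "\<bar>heat \<epsilon> L f \<tau> x\<bar> \<le> B"
  unfolding heat_def
  by (rule gauss_abs_le) (use assms(2)[OF even_ext_in[OF assms(1)]] in \<open>simp add: even_ext_def\<close>)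

lemma heat_integrable:
  assumes "L > 0" and f: "continuous_on {0..L} f"
  shows "integrable std_normal_distribution (\<lambda>z. even_ext L f (x + c * z))"
proof -
  obtain B where "\<And>x. x \<in> {0..L} \<Longrightarrow> \<bar>f x\<bar> \<le> B" using continuous_on_Icc_bounded[OF f] by blast
  then show ?thesis
    using even_ext_in[OF \<open>L > 0\<close>]
    by (intro gauss_integrable[where B = B] continuous_on_compose2[OF continuous_even_ext[OF assms]])
       (auto simp: even_ext_def intro!: continuous_intros)
qed

lemma heat_add:
  assumes "L > 0" "continuous_on {0..L} f" "continuous_on {0..L} g"
  shows "heat \<epsilon> L (\<lambda>x. f x + g x) \<tau> x = heat \<epsilon> L f \<tau> x + heat \<epsilon> L g \<tau> x"
  unfolding heat_def using heat_integrable[OF assms(1,2)] heat_integrable[OF assms(1,3)]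
  by (subst Bochner_Integration.integral_add[symmetric]) (auto simp: even_ext_def)

lemma heat_cmult: "heat \<epsilon> L (\<lambda>x. c * f x) \<tau> x = c * heat \<epsilon> L f \<tau> x"
  unfolding heat_def even_ext_def by simp

lemma heat_0: "L > 0 \<Longrightarrow> heat \<epsilon> L f 0 x = even_ext L f x"
  by (simp add: heat_def gauss_UNIV)

text \<open>Joint continuity down to \<tau> = 0 is what the Gaussian average offers over the cosine
  series, which represents it only for \<tau> > 0. The cut-off max 0 extends the statement to the
  whole plane.\<close>

lemma heat_continuous:
  assumes "L > 0" and f: "continuous_on {0..L} f"
  shows "continuous_on UNIV (\<lambda>(\<tau>, x). heat \<epsilon> L f (max 0 \<tau>) x)"
  unfolding continuous_on_sequentially
proof (intro allI ballI impI, elim conjE)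
  fix s :: "nat \<Rightarrow> real \<times> real" and p
  assume s: "s \<longlonglongrightarrow> p"
  obtain B where B: "\<And>x. x \<in> {0..L} \<Longrightarrow> \<bar>f x\<bar> \<le> B" using continuous_on_Icc_bounded[OF f] by blast
  note ce = continuous_even_ext[OF assms]
  let ?g = "\<lambda>p z. even_ext L f (snd p + \<epsilon> * sqrt (2 * max 0 (fst p)) * z)"
  have "(\<lambda>n. LINT z|std_normal_distribution. ?g (s n) z) \<longlonglongrightarrow> (LINT z|std_normal_distribution. ?g p z)"
  proof (rule integral_dominated_convergence[where w = "\<lambda>_. B"])
    show "?g p \<in> borel_measurable std_normal_distribution"
      using heat_integrable[OF assms] by (intro borel_measurable_integrable)
    show "?g (s n) \<in> borel_measurable std_normal_distribution" for n
      using heat_integrable[OF assms] by (intro borel_measurable_integrable)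
    have "(\<lambda>n. ?g (s n) z) \<longlonglongrightarrow> ?g p z" for z
      by (intro isCont_tendsto_compose[where g = "even_ext L f"] tendsto_intros tendsto_max s)
         (use ce in \<open>auto simp: continuous_on_eq_continuous_at\<close>)
    then show "AE z in std_normal_distribution. (\<lambda>n. ?g (s n) z) \<longlonglongrightarrow> ?g p z" by simp
    show "AE z in std_normal_distribution. norm (?g (s n) z) \<le> B" for n
      using B[OF even_ext_in[OF \<open>L > 0\<close>]] by (simp add: even_ext_def)
  qed simp
  then show "((\<lambda>(\<tau>, x). heat \<epsilon> L f (max 0 \<tau>) x) \<circ> s) \<longlonglongrightarrow> (case p of (\<tau>, x) \<Rightarrow> heat \<epsilon> L f (max 0 \<tau>) x)"
    by (simp add: heat_def o_def case_prod_unfold)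
qed

lemma summable_exp_freq:
  assumes "\<epsilon> > 0" "L > 0" "\<tau> > 0"
  shows "summable (\<lambda>n. exp (- freq \<epsilon> L n * \<tau>))"
proof (rule summable_comparison_test')
  define c where "c = exp (- (\<epsilon>\<^sup>2 * (pi / L)\<^sup>2 * \<tau>))"
  have "\<epsilon>\<^sup>2 * (pi / L)\<^sup>2 * \<tau> > 0" using assms by simp
  then show "summable (\<lambda>n. c ^ n)" by (intro summable_geometric) (simp add: c_def)
  fix n :: nat
  have "real n * 1 \<le> real n * real n" by (cases n) (auto intro!: mult_left_mono)
  then have "real n * (\<epsilon>\<^sup>2 * (pi / L)\<^sup>2 * \<tau>) \<le> (real n)\<^sup>2 * (\<epsilon>\<^sup>2 * (pi / L)\<^sup>2 * \<tau>)"
    using assms by (intro mult_right_mono) (auto simp: power2_eq_square)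
  also have "\<dots> = freq \<epsilon> L n * \<tau>" by (simp add: freq_def power_mult_distrib power_divide)
  finally show "norm (exp (- freq \<epsilon> L n * \<tau>)) \<le> c ^ n"
    by (simp add: c_def exp_of_nat_mult[symmetric])
qed

lemma summable_series_terms:
  fixes E a :: "nat \<Rightarrow> real"
  assumes "summable E" "\<And>n. \<bar>a n\<bar> \<le> C" "\<And>n. E n \<ge> 0"
  shows "summable (\<lambda>n. E n * a n * cosb L n x)"
proof (rule summable_comparison_test')
  show "summable (\<lambda>n. E n * C)" using assms by (intro summable_mult2)
  fix n
  have "\<bar>a n\<bar> * \<bar>cosb L n x\<bar> \<le> C * 1"
    using assms(2)[of n] abs_cosb_le[of L n x] by (intro mult_mono) auto
  then show "norm (E n * a n * cosb L n x) \<le> E n * C"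
    using assms(3)[of n] by (simp add: abs_mult mult.assoc mult_left_mono)
qed

lemma heat_cosb:
  assumes "\<epsilon> > 0" "L > 0" "\<tau> \<ge> 0"
  shows "heat \<epsilon> L (cosb L n) \<tau> x = exp (- freq \<epsilon> L n * \<tau>) * cosb L n x"
proof -
  let ?t = "real n * (pi / L) * (\<epsilon> * sqrt (2 * \<tau>))"
  let ?y = "real n * (pi / L) * x"
  have "integrable std_normal_distribution (\<lambda>z. cos (t * z))" "integrable std_normal_distribution (\<lambda>z. sin (t * z))" for t
    by (rule gauss_integrable[where B = 1]; auto intro!: continuous_intros)+
  note i = this[of ?t]
  have "heat \<epsilon> L (cosb L n) \<tau> x = (LINT z|std_normal_distribution. cos ?y * cos (?t * z) - sin ?y * sin (?t * z))"
    unfolding heat_def cos_span_even_ext[OF cos_span.base \<open>L > 0\<close>]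
    by (simp add: cosb_def cos_add[symmetric] distrib_left mult_ac)
  also have "\<dots> = cos ?y * (LINT z|std_normal_distribution. cos (?t * z)) - sin ?y * (LINT z|std_normal_distribution. sin (?t * z))"
    using i by simp
  also have "\<dots> = exp (- (?t\<^sup>2) / 2) * cosb L n x" by (simp only: gauss_cos_sin cosb_def) simp
  also have "?t\<^sup>2 / 2 = freq \<epsilon> L n * \<tau>"
    using assms by (simp add: freq_def power_mult_distrib power_divide)
  then have "exp (- (?t\<^sup>2) / 2) = exp (- freq \<epsilon> L n * \<tau>)" by simp
  finally show ?thesis .
qed

lemma heat_cos_span:
  assumes "cos_span L f" "\<epsilon> > 0" "L > 0" "\<tau> > 0"
  shows "heat \<epsilon> L f \<tau> x = (\<Sum>n. exp (- freq \<epsilon> L n * \<tau>) * fcoef L f n * cosb L n x)"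
proof -
  have s: "summable (\<lambda>n. exp (- freq \<epsilon> L n * \<tau>) * fcoef L f n * cosb L n x)" if f: "cos_span L f" for f
  proof -
    obtain B where "\<forall>x. \<bar>f x\<bar> \<le> B" using cos_span_bounded[OF f] by blast
    then have "\<bar>fcoef L f n\<bar> \<le> 2 * B" for n
      using \<open>L > 0\<close> cos_span_continuous[OF f] by (intro fcoef_bound) auto
    then show ?thesis by (intro summable_series_terms summable_exp_freq assms) auto
  qed
  show ?thesis using assms(1)
  proof induction
    case (base n)
    have "(\<lambda>k. exp (- freq \<epsilon> L k * \<tau>) * fcoef L (cosb L n) k * cosb L k x) =
        (\<lambda>k. if k = n then exp (- freq \<epsilon> L n * \<tau>) * cosb L n x else 0)"
      using \<open>L > 0\<close> by (auto simp: fcoef_cosb)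
    then show ?case using sums_single[of n "\<lambda>_. exp (- freq \<epsilon> L n * \<tau>) * cosb L n x"] assms
      by (simp only: heat_cosb[OF assms(2,3) less_imp_le[OF assms(4)]] sums_iff)
  next
    case (add f g)
    note c = cos_span_continuous[OF add.hyps(1), of "{0..L}"] cos_span_continuous[OF add.hyps(2), of "{0..L}"]
    have "heat \<epsilon> L (\<lambda>x. f x + g x) \<tau> x = (\<Sum>n. exp (- freq \<epsilon> L n * \<tau>) * fcoef L f n * cosb L n x) +
        (\<Sum>n. exp (- freq \<epsilon> L n * \<tau>) * fcoef L g n * cosb L n x)"
      using heat_add[OF \<open>L > 0\<close> c] add.IH by (simp only:)
    also have "\<dots> = (\<Sum>n. exp (- freq \<epsilon> L n * \<tau>) * fcoef L f n * cosb L n x +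
        exp (- freq \<epsilon> L n * \<tau>) * fcoef L g n * cosb L n x)"
      by (rule suminf_add[OF s[OF add.hyps(1)] s[OF add.hyps(2)]])
    also have "\<dots> = (\<Sum>n. exp (- freq \<epsilon> L n * \<tau>) * fcoef L (\<lambda>x. f x + g x) n * cosb L n x)"
      by (simp only: fcoef_add[OF c] distrib_left distrib_right)
    finally show ?case .
  next
    case (cmult f c)
    have "heat \<epsilon> L (\<lambda>x. c * f x) \<tau> x = (\<Sum>n. c * (exp (- freq \<epsilon> L n * \<tau>) * fcoef L f n * cosb L n x))"
      using suminf_mult[OF s[OF cmult.hyps(1)], of c] cmult.IH by (simp only: heat_cmult)
    also have "\<dots> = (\<Sum>n. exp (- freq \<epsilon> L n * \<tau>) * fcoef L (\<lambda>x. c * f x) n * cosb L n x)"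
      by (simp only: fcoef_cmult mult_ac)
    finally show ?case .
  qed
qed

text \<open>For fixed \<tau> > 0 both sides are linear in f and bounded by its sup norm. They agree
  on cosine polynomials, which are dense by Stone-Weierstrass in the variable cos(\<pi> x /
  L).\<close>

lemma heat_series:
  assumes "\<epsilon> > 0" "L > 0" "\<tau> > 0" and f: "continuous_on {0..L} f"
  shows "(\<lambda>n. exp (- freq \<epsilon> L n * \<tau>) * fcoef L f n * cosb L n x) sums heat \<epsilon> L f \<tau> x"
proof -
  let ?E = "\<lambda>n. exp (- freq \<epsilon> L n * \<tau>)"
  have E: "summable ?E" by (intro summable_exp_freq assms)
  obtain B where B: "\<And>x. x \<in> {0..L} \<Longrightarrow> \<bar>f x\<bar> \<le> B" using continuous_on_Icc_bounded[OF f] by blast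
  have sf: "summable (\<lambda>n. ?E n * fcoef L f n * cosb L n x)"
    by (intro summable_series_terms[OF E, of _ "2 * B"] fcoef_bound f assms B) auto
  let ?S = "\<Sum>n. ?E n * fcoef L f n * cosb L n x"
  have close: "\<bar>heat \<epsilon> L f \<tau> x - ?S\<bar> \<le> e * (1 + 2 * suminf ?E)" if e: "e > 0" for e
  proof -
    have cf: "continuous_on {- 1..1} (\<lambda>y. f (L / pi * arccos y))"
    proof (rule continuous_on_compose2[OF f])
      show "continuous_on {- 1..1} (\<lambda>y. L / pi * arccos y)" by (intro continuous_intros) auto
      show "(\<lambda>y. L / pi * arccos y) ` {- 1..1} \<subseteq> {0..L}"
        using \<open>L > 0\<close> arccos_bounded by (auto simp: field_simps)
    qed
    obtain g where g: "real_polynomial_function g" "\<And>y. y \<in> {- 1..1} \<Longrightarrow> \<bar>f (L / pi * arccos y) - g y\<bar> < e"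
      using Stone_Weierstrass_real_polynomial_function[OF compact_Icc cf e] by blast
    obtain a N where gs: "g = (\<lambda>y. \<Sum>i\<le>N. a i * y ^ i)"
      using g(1) unfolding real_polynomial_function_iff_sum by blast
    define p where "p x = g (cos (pi / L * x))" for x
    have p: "cos_span L p" using cos_span_poly[of L a N] by (simp add: p_def[abs_def] gs)
    have cp: "continuous_on {0..L} p" by (rule cos_span_continuous[OF p])
    have d: "\<bar>f x - p x\<bar> \<le> e" if x: "x \<in> {0..L}" for x
    proof -
      have "pi / L * x \<le> pi" using \<open>L > 0\<close> x by (simp add: field_simps)
      then have "arccos (cos (pi / L * x)) = pi / L * x" using \<open>L > 0\<close> x by (intro arccos_cos) auto
      then show ?thesis using g(2)[of "cos (pi / L * x)"] \<open>L > 0\<close> by (simp add: p_def less_imp_le)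
    qed
    define h where "h x = f x + - 1 * p x" for x
    have ch: "continuous_on {0..L} h" unfolding h_def by (intro continuous_intros f cp)
    have dh: "\<bar>h x\<bar> \<le> e" if "x \<in> {0..L}" for x using d[OF that] by (simp add: h_def)
    have cm: "continuous_on {0..L} (\<lambda>x. - 1 * p x)" by (intro continuous_intros cp)
    have hh: "heat \<epsilon> L h \<tau> x = heat \<epsilon> L f \<tau> x - heat \<epsilon> L p \<tau> x"
      unfolding h_def[abs_def] heat_add[OF \<open>L > 0\<close> f cm] heat_cmult by simp
    have hc: "fcoef L h n = fcoef L f n - fcoef L p n" for n
      unfolding h_def[abs_def] fcoef_add[OF f cm] fcoef_cmult by simp
    have le: "\<bar>fcoef L h n\<bar> \<le> 2 * e" for n by (intro fcoef_bound ch dh assms)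
    have sh: "summable (\<lambda>n. ?E n * fcoef L h n * cosb L n x)"
      by (intro summable_series_terms[OF E le]) auto
    have "\<bar>\<Sum>n. ?E n * fcoef L h n * cosb L n x\<bar> \<le> (\<Sum>n. ?E n * (2 * e))"
      unfolding real_norm_def[symmetric]
    proof (rule norm_suminf_le)
      fix n
      have "\<bar>fcoef L h n\<bar> * \<bar>cosb L n x\<bar> \<le> 2 * e * 1"
        using le[of n] abs_cosb_le[of L n x] by (intro mult_mono) auto
      then show "norm (?E n * fcoef L h n * cosb L n x) \<le> ?E n * (2 * e)"
        by (simp add: abs_mult mult.assoc)
    qed (intro summable_mult2 E)
    also have "\<dots> = 2 * e * suminf ?E" by (subst suminf_mult2[OF E, symmetric]) (simp add: mult.commute)
    finally have 1: "\<bar>\<Sum>n. ?E n * fcoef L h n * cosb L n x\<bar> \<le> 2 * e * suminf ?E" .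
    have sp: "?S - (\<Sum>n. ?E n * fcoef L h n * cosb L n x) = heat \<epsilon> L p \<tau> x"
      by (subst suminf_diff[OF sf sh]) (simp add: heat_cos_span[OF p assms(1-3)] hc algebra_simps)
    have "\<bar>heat \<epsilon> L h \<tau> x\<bar> \<le> e" by (intro heat_abs_le dh assms)
    with 1 sp hh show ?thesis by (simp add: algebra_simps)
  qed
  have "suminf ?E \<ge> 0" by (intro suminf_nonneg E) simp
  then have pos: "1 + 2 * suminf ?E > 0" by simp
  have "\<bar>heat \<epsilon> L f \<tau> x - ?S\<bar> \<le> 0"
  proof (rule field_le_epsilon)
    fix e :: real assume "e > 0"
    then show "\<bar>heat \<epsilon> L f \<tau> x - ?S\<bar> \<le> 0 + e"
      using close[of "e / (1 + 2 * suminf ?E)"] pos by simp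
  qed
  then show ?thesis using summable_sums[OF sf] by simp
qed

text \<open>A continuous function with an absolutely convergent cosine series is its sum: let \<open>\<tau> \<rightarrow> 0\<close>
  in the heat flow.\<close>

lemma cosine_series:
  assumes "L > 0" and f: "continuous_on {0..L} f" and s: "summable A" "\<And>n. \<bar>fcoef L f n\<bar> \<le> A n"
    and x: "x \<in> {0..L}"
  shows "(\<lambda>n. fcoef L f n * cosb L n x) sums f x"
proof -
  let ?u = "\<lambda>\<tau> n. exp (- freq 1 L n * \<tau>) * fcoef L f n * cosb L n x"
  have fr: "freq 1 L n \<ge> 0" for n by (simp add: freq_def)
  have le: "\<bar>?u \<tau> n\<bar> \<le> A n" if "\<tau> \<in> {0..1}" for \<tau> n
  proof -
    have "exp (- freq 1 L n * \<tau>) * \<bar>fcoef L f n\<bar> * \<bar>cosb L n x\<bar> \<le> 1 * A n * 1"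
      using that fr[of n] s(2)[of n] abs_cosb_le[of L n x] by (intro mult_mono) auto
    then show ?thesis by (simp add: abs_mult)
  qed
  have "continuous_on {0..1} (\<lambda>\<tau>. \<Sum>n. ?u \<tau> n)"
  proof (rule uniform_limit_theorem[OF _ Weierstrass_m_test[OF _ s(1)]])
    show "\<forall>\<^sub>F N in sequentially. continuous_on {0..1} (\<lambda>\<tau>. \<Sum>n<N. ?u \<tau> n)"
      by (intro always_eventually allI continuous_intros)
  qed (use le in auto)
  moreover have "continuous_on {0..1} (\<lambda>\<tau>. heat 1 L f (max 0 \<tau>) x)"
  proof -
    have "continuous_on {0..1} (\<lambda>\<tau>. case (\<tau>, x) of (\<tau>, x) \<Rightarrow> heat 1 L f (max 0 \<tau>) x)"
      by (rule continuous_on_compose2[OF heat_continuous[OF \<open>L > 0\<close> f]]) (auto intro!: continuous_intros)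
    then show ?thesis by simp
  qed
  ultimately have "continuous_on {0..1} (\<lambda>\<tau>. heat 1 L f (max 0 \<tau>) x - (\<Sum>n. ?u \<tau> n))"
    by (intro continuous_intros)
  then have "\<forall>\<sigma>\<in>{0..1}. ((\<lambda>\<tau>. heat 1 L f (max 0 \<tau>) x - (\<Sum>n. ?u \<tau> n)) \<longlongrightarrow>
      heat 1 L f (max 0 \<sigma>) x - (\<Sum>n. ?u \<sigma> n)) (at \<sigma> within {0..1})"
    unfolding continuous_on_def .
  then have "((\<lambda>\<tau>. heat 1 L f (max 0 \<tau>) x - (\<Sum>n. ?u \<tau> n)) \<longlongrightarrow>
      heat 1 L f (max 0 0) x - (\<Sum>n. ?u 0 n)) (at 0 within {0..1})"
    by (rule bspec) simp
  moreover have "eventually (\<lambda>\<tau>. heat 1 L f (max 0 \<tau>) x - (\<Sum>n. ?u \<tau> n) = 0) (at 0 within {0..1})"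
    unfolding eventually_at_topological
  proof (intro exI[of _ UNIV] conjI ballI impI)
    fix \<tau> :: real assume "\<tau> \<noteq> 0" "\<tau> \<in> {0..1}"
    then have "0 < \<tau>" "max 0 \<tau> = \<tau>" by auto
    then show "heat 1 L f (max 0 \<tau>) x - (\<Sum>n. ?u \<tau> n) = 0"
      using heat_series[OF zero_less_one \<open>L > 0\<close> \<open>0 < \<tau>\<close> f, of x] by (simp only: sums_iff)
  qed auto
  ultimately have "((\<lambda>_::real. 0::real) \<longlongrightarrow> heat 1 L f (max 0 0) x - (\<Sum>n. ?u 0 n)) (at 0 within {0..1})"
    by (rule Lim_transform_eventually)
  then have "heat 1 L f (max 0 0) x - (\<Sum>n. ?u 0 n) = 0"
    by (subst (asm) tendsto_const_iff) (simp_all add: at_within_Icc_at_right)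
  moreover have "heat 1 L f (max 0 0) x = f x" using heat_0[OF \<open>L > 0\<close>] even_ext_eq[OF \<open>L > 0\<close> x] by simp
  moreover have "summable (\<lambda>n. fcoef L f n * cosb L n x)"
    by (rule summable_comparison_test'[OF s(1)]) (use le[of 0] in auto)
  ultimately show ?thesis by (simp add: sums_iff)
qed

section \<open>The truncated parabolic problem\<close>

definition duhamel :: "real \<Rightarrow> (real \<Rightarrow> real) \<Rightarrow> real \<Rightarrow> real" where
  "duhamel \<nu> g \<tau> = exp (- \<nu> * \<tau>) * integral {0..\<tau>} (\<lambda>s. exp (\<nu> * s) * g s)"

text \<open>In the norm weighted with e^(-\<beta>\<tau>) the time integral gains 1/(\<nu> +
  \<beta>). This is summable over the frequencies, and the sum is small for large \<beta>, which
  yields a contraction on the whole half line at once.\<close>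

lemma duhamel_bound:
  assumes \<tau>: "0 \<le> \<tau>" and g: "continuous_on {0..\<tau>} g"
    and le: "\<And>s. s \<in> {0..\<tau>} \<Longrightarrow> \<bar>g s\<bar> \<le> C * exp (\<beta> * s)" and pos: "\<nu> + \<beta> > 0"
  shows "exp (- \<beta> * \<tau>) * \<bar>duhamel \<nu> g \<tau>\<bar> \<le> C / (\<nu> + \<beta>)"
proof -
  let ?I = "integral {0..\<tau>} (\<lambda>s. exp (\<nu> * s) * g s)"
  have C: "C \<ge> 0" using le[of 0] \<tau> by simp
  have i: "((\<lambda>s. C * exp ((\<nu> + \<beta>) * s)) has_integral
      C / (\<nu> + \<beta>) * exp ((\<nu> + \<beta>) * \<tau>) - C / (\<nu> + \<beta>) * exp ((\<nu> + \<beta>) * 0)) {0..\<tau>}"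
    using pos by (intro fundamental_theorem_of_calculus \<tau>)
      (auto intro!: derivative_eq_intros simp flip: has_real_derivative_iff_has_vector_derivative)
  have "norm ?I \<le> integral {0..\<tau>} (\<lambda>s. C * exp ((\<nu> + \<beta>) * s))"
  proof (rule integral_norm_bound_integral)
    fix s assume "s \<in> {0..\<tau>}"
    from mult_left_mono[OF le[OF this], of "exp (\<nu> * s)"]
    show "norm (exp (\<nu> * s) * g s) \<le> C * exp ((\<nu> + \<beta>) * s)"
      unfolding distrib_right exp_add by (simp add: abs_mult mult_ac)
  qed (use i in \<open>auto intro!: integrable_continuous_real continuous_intros g\<close>)
  also have "\<dots> \<le> C / (\<nu> + \<beta>) * exp ((\<nu> + \<beta>) * \<tau>)"
    using integral_unique[OF i] C pos by simp
  finally have "exp (- \<beta> * \<tau>) * (exp (- \<nu> * \<tau>) * \<bar>?I\<bar>) \<le>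
      exp (- \<beta> * \<tau>) * (exp (- \<nu> * \<tau>) * (C / (\<nu> + \<beta>) * exp ((\<nu> + \<beta>) * \<tau>)))"
    by (intro mult_left_mono) auto
  also have "\<dots> = (exp (- \<beta> * \<tau>) * exp (- \<nu> * \<tau>) * exp ((\<nu> + \<beta>) * \<tau>)) * (C / (\<nu> + \<beta>))"
    by (simp only: mult_ac)
  also have "exp (- \<beta> * \<tau>) * exp (- \<nu> * \<tau>) * exp ((\<nu> + \<beta>) * \<tau>) = 1"
    unfolding exp_add[symmetric] by (simp add: algebra_simps)
  finally show ?thesis by (simp add: duhamel_def abs_mult)
qed

lemma duhamel_derivative_within:
  assumes g: "continuous_on {0..T} g" and \<tau>: "\<tau> \<in> {0..T}"
  shows "(duhamel \<nu> g has_real_derivative - \<nu> * duhamel \<nu> g \<tau> + g \<tau>) (at \<tau> within {0..T})"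
proof -
  have I: "((\<lambda>\<tau>. integral {0..\<tau>} (\<lambda>s. exp (\<nu> * s) * g s)) has_real_derivative exp (\<nu> * \<tau>) * g \<tau>) (at \<tau> within {0..T})"
    using \<tau> by (intro integral_has_real_derivative continuous_intros g)
  have "(duhamel \<nu> g has_real_derivative exp (- \<nu> * \<tau>) * - \<nu> * integral {0..\<tau>} (\<lambda>s. exp (\<nu> * s) * g s)
      + exp (- \<nu> * \<tau>) * (exp (\<nu> * \<tau>) * g \<tau>)) (at \<tau> within {0..T})"
    unfolding duhamel_def[abs_def] by (rule derivative_eq_intros I refl | simp)+
  also have "exp (- \<nu> * \<tau>) * - \<nu> * integral {0..\<tau>} (\<lambda>s. exp (\<nu> * s) * g s) + exp (- \<nu> * \<tau>) * (exp (\<nu> * \<tau>) * g \<tau>) =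
      - \<nu> * duhamel \<nu> g \<tau> + g \<tau>"
    by (simp add: duhamel_def mult.assoc[symmetric] flip: exp_add)
  finally show ?thesis .
qed

lemma duhamel_derivative:
  assumes g: "continuous_on {0..} g" and \<tau>: "\<tau> > 0"
  shows "(duhamel \<nu> g has_real_derivative - \<nu> * duhamel \<nu> g \<tau> + g \<tau>) (at \<tau>)"
  using duhamel_derivative_within[of "\<tau> + 1" g \<tau> \<nu>] \<tau> at_within_Icc_at[of 0 \<tau> "\<tau> + 1"]
    continuous_on_subset[OF g, of "{0..\<tau> + 1}"] by auto

lemma duhamel_continuous:
  assumes g: "continuous_on {0..} g"
  shows "continuous_on {0..} (duhamel \<nu> g)"
  unfolding continuous_on_eq_continuous_within
proof
  fix \<tau> :: real assume \<tau>: "\<tau> \<in> {0..}"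
  have "continuous_on {0..\<tau> + 1} g" by (rule continuous_on_subset[OF g]) auto
  then have "(duhamel \<nu> g has_real_derivative - \<nu> * duhamel \<nu> g \<tau> + g \<tau>) (at \<tau> within {0..\<tau> + 1})"
    by (rule duhamel_derivative_within) (use \<tau> in auto)
  then have "continuous (at \<tau> within {0..\<tau> + 1}) (duhamel \<nu> g)" by (rule DERIV_continuous)
  moreover have "at \<tau> within {0..\<tau> + 1} = at \<tau> within {0..}"
    by (rule at_within_nhd[of \<tau> "{..<\<tau> + 1}"]) auto
  ultimately show "continuous (at \<tau> within {0..}) (duhamel \<nu> g)" by simp
qed

lemma duhamel_diff:
  assumes "continuous_on {0..\<tau>} g" "continuous_on {0..\<tau>} h"
  shows "duhamel \<nu> (\<lambda>s. g s - h s) \<tau> = duhamel \<nu> g \<tau> - duhamel \<nu> h \<tau>"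
  unfolding duhamel_def right_diff_distrib
  by (subst integral_diff) (auto intro!: integrable_continuous_real continuous_intros assms simp: algebra_simps)

lemma freq_nonneg: "freq \<epsilon> L n \<ge> 0"
  by (simp add: freq_def)

lemma summable_inverse_freq:
  assumes "\<epsilon> > 0" "L > 0" "\<beta> \<ge> 0"
  shows "summable (\<lambda>n. 1 / (freq \<epsilon> L n + \<beta>))"
proof -
  define \<gamma> where "\<gamma> = \<epsilon>\<^sup>2 * (pi / L)\<^sup>2"
  have \<gamma>: "\<gamma> > 0" using assms by (simp add: \<gamma>_def)
  have fr: "freq \<epsilon> L n = \<gamma> * (real n)\<^sup>2" for n by (simp add: freq_def \<gamma>_def power_mult_distrib power_divide)
  have "summable (\<lambda>n. 1 / \<gamma> * inverse (real n ^ 2))"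
    by (intro summable_mult inverse_power_summable) simp
  then show ?thesis
  proof (rule summable_comparison_test'[where N = 1])
    fix n :: nat assume "1 \<le> n"
    then have "0 < \<gamma> * (real n)\<^sup>2" using \<gamma> by simp
    then have "1 / (\<gamma> * (real n)\<^sup>2 + \<beta>) \<le> 1 / (\<gamma> * (real n)\<^sup>2)"
      using assms by (intro divide_left_mono) auto
    also have "\<dots> = 1 / \<gamma> * inverse (real n ^ 2)" using \<gamma> by (simp add: divide_inverse)
    finally show "norm (1 / (freq \<epsilon> L n + \<beta>)) \<le> 1 / \<gamma> * inverse (real n ^ 2)"
      using \<gamma> assms by (simp add: fr)
  qed
qed

text \<open>The tail is small already for \<beta> = 0, and the finitely many remaining terms are at
  most 1/\<beta> each.\<close>

lemma suminf_inverse_freq_small: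
  assumes "\<epsilon> > 0" "L > 0" "e > 0"
  obtains \<beta> where "\<beta> > 0" "(\<Sum>n. 1 / (freq \<epsilon> L n + \<beta>)) \<le> e"
proof -
  have s0: "summable (\<lambda>n. 1 / (freq \<epsilon> L n + 0))" by (rule summable_inverse_freq) (use assms in auto)
  obtain N where N: "\<And>n. n \<ge> N \<Longrightarrow> norm (\<Sum>i. 1 / (freq \<epsilon> L (i + n) + 0)) < e / 2"
    using suminf_exist_split[OF _ s0, of "e / 2"] assms by auto
  \<comment> \<open>The successor keeps the zero frequency out of the tail, where the comparison
    with \<beta> = 0 would read 1/\<beta> <= 1/0 = 0.\<close>
  define K where "K = N + 1"
  define \<beta> where "\<beta> = 2 * real K / e"
  have \<beta>: "\<beta> > 0" using assms by (simp add: \<beta>_def K_def)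
  have s: "summable (\<lambda>n. 1 / (freq \<epsilon> L n + \<beta>))" by (rule summable_inverse_freq) (use assms \<beta> in auto)
  have "(\<Sum>n. 1 / (freq \<epsilon> L n + \<beta>)) = (\<Sum>n. 1 / (freq \<epsilon> L (n + K) + \<beta>)) + (\<Sum>n<K. 1 / (freq \<epsilon> L n + \<beta>))"
    by (rule suminf_split_initial_segment[OF s])
  moreover have "(\<Sum>n<K. 1 / (freq \<epsilon> L n + \<beta>)) \<le> (\<Sum>n<K. 1 / \<beta>)"
    using \<beta> freq_nonneg[of \<epsilon> L] by (intro sum_mono divide_left_mono) (auto intro!: mult_pos_pos add_nonneg_pos)
  moreover have "real K > 0" by (simp add: K_def)
  then have "(\<Sum>n<K. 1 / \<beta>) = e / 2" using assms by (simp add: \<beta>_def)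
  moreover have "(\<Sum>n. 1 / (freq \<epsilon> L (n + K) + \<beta>)) \<le> (\<Sum>n. 1 / (freq \<epsilon> L (n + K) + 0))"
  proof (rule suminf_le)
    fix n
    have "freq \<epsilon> L (n + K) > 0" using assms by (simp add: freq_def K_def)
    then show "1 / (freq \<epsilon> L (n + K) + \<beta>) \<le> 1 / (freq \<epsilon> L (n + K) + 0)"
      using \<beta> by (intro divide_left_mono) auto
  qed (rule summable_ignore_initial_segment[OF s] summable_ignore_initial_segment[OF s0])+
  moreover have "(\<Sum>n. 1 / (freq \<epsilon> L (n + K) + 0)) \<le> e / 2" using N[of K] by (simp add: K_def)
  ultimately have "(\<Sum>n. 1 / (freq \<epsilon> L n + \<beta>)) \<le> e" by linarith
  then show thesis using that \<beta> by blast
qed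

section \<open>Mild solutions for a bounded Lipschitz nonlinearity\<close>

locale truncated_problem =
  fixes \<epsilon> L M lip :: real and v0 :: "real \<Rightarrow> real" and G :: "real \<Rightarrow> real \<Rightarrow> real"
  assumes pos: "\<epsilon> > 0" "L > 0" and v0: "continuous_on {0..L} v0"
    and G: "continuous_on ({0..L} \<times> UNIV) (\<lambda>(x, v). G x v)"
    and M: "\<And>x v. x \<in> {0..L} \<Longrightarrow> \<bar>G x v\<bar> \<le> M"
    and lip: "lip > 0" "\<And>x u v. x \<in> {0..L} \<Longrightarrow> \<bar>G x u - G x v\<bar> \<le> lip * \<bar>u - v\<bar>"
begin

definition source :: "(real \<Rightarrow> real \<Rightarrow> real) \<Rightarrow> nat \<Rightarrow> real \<Rightarrow> real" where
  "source v n s = fcoef L (\<lambda>x. G x (v s x)) n"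

definition jcont :: "(real \<Rightarrow> real \<Rightarrow> real) \<Rightarrow> bool" where
  "jcont v \<longleftrightarrow> continuous_on ({0..} \<times> {0..L}) (\<lambda>(s, x). v s x)"

lemma M_nonneg: "M \<ge> 0"
  using M[of 0 0] pos by auto

lemma jcont_slice:
  assumes "jcont v" "s \<ge> 0"
  shows "continuous_on {0..L} (v s)"
proof -
  have "continuous_on {0..L} (\<lambda>x. case (s, x) of (s, x) \<Rightarrow> v s x)"
    using assms(1) unfolding jcont_def
    by (rule continuous_on_compose2) (use assms(2) in \<open>auto intro!: continuous_intros\<close>)
  then show ?thesis by simp
qed

lemma G_slice:
  assumes v: "continuous_on {0..L} v"
  shows "continuous_on {0..L} (\<lambda>x. G x (v x))"
proof -
  have "continuous_on {0..L} (\<lambda>x. case (x, v x) of (x, v) \<Rightarrow> G x v)"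
    by (rule continuous_on_compose2[OF G]) (auto intro!: continuous_intros v)
  then show ?thesis by simp
qed

lemma source_continuous:
  assumes v: "jcont v"
  shows "continuous_on {0..} (source v n)"
proof -
  have "continuous_on ({0..} \<times> cbox 0 L) (\<lambda>p. (\<lambda>(x, v). G x v) (snd p, (\<lambda>(s, x). v s x) p) * cosb L n (snd p))"
  proof (intro continuous_on_mult)
    show "continuous_on ({0..} \<times> cbox 0 L) (\<lambda>p. (\<lambda>(x, v). G x v) (snd p, (\<lambda>(s, x). v s x) p))"
      using v unfolding jcont_def
      by (intro continuous_on_compose2[OF G]) (auto intro!: continuous_intros)
    show "continuous_on ({0..} \<times> cbox 0 L) (\<lambda>p. cosb L n (snd p))"
      by (rule continuous_on_compose2[OF continuous_on_cosb[of UNIV]]) (auto intro!: continuous_intros)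
  qed
  then have "continuous_on ({0..} \<times> cbox 0 L) (\<lambda>(s, x). G x (v s x) * cosb L n x)"
    by (simp add: case_prod_unfold)
  then have "continuous_on {0..} (\<lambda>s. integral (cbox 0 L) (\<lambda>x. G x (v s x) * cosb L n x))"
    by (rule integral_continuous_on_param)
  then show ?thesis
    unfolding source_def fcoef_def fint_def using pos by (auto intro!: continuous_intros)
qed

lemma source_bound:
  assumes v: "jcont v" and s: "s \<ge> 0"
  shows "\<bar>source v n s\<bar> \<le> 2 * M"
  unfolding source_def by (rule fcoef_bound[OF pos(2) G_slice[OF jcont_slice[OF v s]] M])

lemma source_diff:
  assumes u: "jcont u" and v: "jcont v" and s: "s \<ge> 0" and D: "\<And>x. x \<in> {0..L} \<Longrightarrow> \<bar>u s x - v s x\<bar> \<le> D"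
  shows "\<bar>source u n s - source v n s\<bar> \<le> 2 * (lip * D)"
proof -
  note cu = G_slice[OF jcont_slice[OF u s]] and cv = G_slice[OF jcont_slice[OF v s]]
  have cm: "continuous_on {0..L} (\<lambda>x. - 1 * G x (v s x))" by (intro continuous_intros cv)
  have "source u n s - source v n s = fcoef L (\<lambda>x. G x (u s x) + - 1 * G x (v s x)) n"
    unfolding source_def fcoef_add[OF cu cm] fcoef_cmult by simp
  also have "\<bar>\<dots>\<bar> \<le> 2 * (lip * D)"
  proof (rule fcoef_bound[OF pos(2)])
    fix x assume x: "x \<in> {0..L}"
    have "\<bar>G x (u s x) - G x (v s x)\<bar> \<le> lip * \<bar>u s x - v s x\<bar>" by (rule lip(2)[OF x])
    also have "\<dots> \<le> lip * D" using D[OF x] lip(1) by (intro mult_left_mono) auto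
    finally show "\<bar>G x (u s x) + - 1 * G x (v s x)\<bar> \<le> lip * D" by simp
  qed (intro continuous_intros cu cm)
  finally show ?thesis .
qed

text \<open>Duhamel's formula. The semigroup is a Gaussian average on the initial value, which is
  merely continuous, and acts mode by mode on the source, whose time integrals make the series
  absolutely convergent down to \<tau> = 0.\<close>

definition mild :: "(real \<Rightarrow> real \<Rightarrow> real) \<Rightarrow> real \<Rightarrow> real \<Rightarrow> real" where
  "mild v \<tau> x = heat \<epsilon> L v0 \<tau> x + (\<Sum>n. duhamel (freq \<epsilon> L n) (source v n) \<tau> * cosb L n x)"

lemma mild_term_bound:
  assumes v: "jcont v" and \<tau>: "\<tau> \<ge> 0" and \<beta>: "\<beta> > 0"
  shows "exp (- \<beta> * \<tau>) * \<bar>duhamel (freq \<epsilon> L n) (source v n) \<tau> * cosb L n x\<bar> \<le> 2 * M * (1 / (freq \<epsilon> L n + \<beta>))"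
proof -
  let ?d = "duhamel (freq \<epsilon> L n) (source v n) \<tau>"
  have p: "freq \<epsilon> L n + \<beta> > 0" using freq_nonneg[of \<epsilon> L n] \<beta> by simp
  have c: "continuous_on {0..\<tau>} (source v n)" by (rule continuous_on_subset[OF source_continuous[OF v]]) auto
  have "exp (- \<beta> * \<tau>) * (\<bar>?d\<bar> * \<bar>cosb L n x\<bar>) \<le> exp (- \<beta> * \<tau>) * (\<bar>?d\<bar> * 1)"
    using abs_cosb_le[of L n x] by (intro mult_left_mono) auto
  also have "\<dots> \<le> 2 * M / (freq \<epsilon> L n + \<beta>)"
    unfolding mult_1_right
  proof (rule duhamel_bound[OF \<tau> c _ p])
    fix s assume s: "s \<in> {0..\<tau>}"
    have "\<bar>source v n s\<bar> \<le> 2 * M * 1" using source_bound[OF v, of s n] s by simp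
    also have "\<dots> \<le> 2 * M * exp (\<beta> * s)" using M_nonneg s \<beta> by (intro mult_left_mono) auto
    finally show "\<bar>source v n s\<bar> \<le> 2 * M * exp (\<beta> * s)" .
  qed
  finally show ?thesis by (simp add: abs_mult)
qed

lemma mild_summable:
  assumes v: "jcont v" and \<tau>: "\<tau> \<ge> 0"
  shows "summable (\<lambda>n. duhamel (freq \<epsilon> L n) (source v n) \<tau> * cosb L n x)"
proof (rule summable_comparison_test')
  show "summable (\<lambda>n. exp (1 * \<tau>) * (2 * M * (1 / (freq \<epsilon> L n + 1))))"
    by (intro summable_mult summable_inverse_freq) (use pos in auto)
  fix n
  have "exp (1 * \<tau>) * (exp (- 1 * \<tau>) * \<bar>duhamel (freq \<epsilon> L n) (source v n) \<tau> * cosb L n x\<bar>)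
      \<le> exp (1 * \<tau>) * (2 * M * (1 / (freq \<epsilon> L n + 1)))"
    by (intro mult_left_mono mild_term_bound[OF v \<tau>]) auto
  then show "norm (duhamel (freq \<epsilon> L n) (source v n) \<tau> * cosb L n x) \<le> exp (1 * \<tau>) * (2 * M * (1 / (freq \<epsilon> L n + 1)))"
    by (simp add: exp_minus mult.assoc[symmetric])
qed

text \<open>With \<open>mild_weighted_bound\<close>, this places the weighted image in the complete
  space of bounded continuous functions on the plane; the cut-offs max 0 serve only to extend it to
  negative times.\<close>

lemma mild_weighted_continuous:
  assumes v: "jcont v" and \<beta>: "\<beta> > 0"
  shows "continuous_on UNIV (\<lambda>p. exp (- \<beta> * max 0 (fst p)) * mild v (max 0 (fst p)) (snd p))"
proof -
  let ?f = "\<lambda>n p. exp (- \<beta> * max 0 (fst p)) * (duhamel (freq \<epsilon> L n) (source v n) (max 0 (fst p)) * cosb L n (snd p))"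
  have c: "continuous_on UNIV (?f n)" for n
  proof (intro continuous_on_mult)
    show "continuous_on UNIV (\<lambda>p::real \<times> real. exp (- \<beta> * max 0 (fst p)))" by (intro continuous_intros)
    show "continuous_on UNIV (\<lambda>p::real \<times> real. duhamel (freq \<epsilon> L n) (source v n) (max 0 (fst p)))"
      by (rule continuous_on_compose2[OF duhamel_continuous[OF source_continuous[OF v]]]) (auto intro!: continuous_intros)
    show "continuous_on UNIV (\<lambda>p::real \<times> real. cosb L n (snd p))"
      by (rule continuous_on_compose2[OF continuous_on_cosb[of UNIV]]) (auto intro!: continuous_intros)
  qed
  have s: "summable (\<lambda>n. 2 * M * (1 / (freq \<epsilon> L n + \<beta>)))"
    by (intro summable_mult summable_inverse_freq) (use pos \<beta> in auto)
  have "uniform_limit UNIV (\<lambda>N p. \<Sum>n<N. ?f n p) (\<lambda>p. \<Sum>n. ?f n p) sequentially"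
  proof (rule Weierstrass_m_test[OF _ s])
    fix n and p :: "real \<times> real"
    show "norm (?f n p) \<le> 2 * M * (1 / (freq \<epsilon> L n + \<beta>))"
      using mild_term_bound[OF v _ \<beta>, of "max 0 (fst p)" n "snd p"] by (simp add: abs_mult)
  qed
  then have "continuous_on UNIV (\<lambda>p. \<Sum>n. ?f n p)"
    by (rule uniform_limit_theorem[rotated]) (intro sequentially_bot always_eventually allI continuous_on_sum c)+
  moreover have "continuous_on UNIV (\<lambda>p. exp (- \<beta> * max 0 (fst p)) * heat \<epsilon> L v0 (max 0 (fst p)) (snd p))"
    using heat_continuous[OF pos(2) v0, of \<epsilon>] by (intro continuous_intros) (simp add: case_prod_unfold)
  ultimately have "continuous_on UNIV (\<lambda>p. exp (- \<beta> * max 0 (fst p)) * heat \<epsilon> L v0 (max 0 (fst p)) (snd p) + (\<Sum>n. ?f n p))"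
    by (rule continuous_on_add[rotated])
  moreover have "(\<Sum>n. ?f n p) = exp (- \<beta> * max 0 (fst p)) *
      (\<Sum>n. duhamel (freq \<epsilon> L n) (source v n) (max 0 (fst p)) * cosb L n (snd p))" for p
    by (rule suminf_mult) (rule mild_summable[OF v], simp)
  ultimately show ?thesis by (simp only: mild_def distrib_left)
qed

lemma mild_weighted_bound:
  assumes v: "jcont v" and \<beta>: "\<beta> > 0"
  obtains B where "\<And>p. \<bar>exp (- \<beta> * max 0 (fst p)) * mild v (max 0 (fst p)) (snd p)\<bar> \<le> B"
proof -
  obtain C where C: "\<And>x. x \<in> {0..L} \<Longrightarrow> \<bar>v0 x\<bar> \<le> C" using continuous_on_Icc_bounded[OF v0] by blast
  have s: "summable (\<lambda>n. 2 * M * (1 / (freq \<epsilon> L n + \<beta>)))"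
    by (intro summable_mult summable_inverse_freq) (use pos \<beta> in auto)
  have "\<bar>exp (- \<beta> * \<tau>) * mild v \<tau> x\<bar> \<le> C + (\<Sum>n. 2 * M * (1 / (freq \<epsilon> L n + \<beta>)))" if \<tau>: "\<tau> \<ge> 0" for \<tau> x
  proof -
    have "exp (- \<beta> * \<tau>) * \<bar>heat \<epsilon> L v0 \<tau> x\<bar> \<le> 1 * C"
      using heat_abs_le[OF pos(2) C] \<beta> \<tau> by (intro mult_mono) auto
    moreover have "\<bar>\<Sum>n. exp (- \<beta> * \<tau>) * (duhamel (freq \<epsilon> L n) (source v n) \<tau> * cosb L n x)\<bar> \<le>
        (\<Sum>n. 2 * M * (1 / (freq \<epsilon> L n + \<beta>)))"
      unfolding real_norm_def[symmetric]
      by (rule norm_suminf_le[OF _ s]) (use mild_term_bound[OF v \<tau> \<beta>] in \<open>simp add: abs_mult\<close>)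
    moreover have "(\<Sum>n. exp (- \<beta> * \<tau>) * (duhamel (freq \<epsilon> L n) (source v n) \<tau> * cosb L n x)) =
        exp (- \<beta> * \<tau>) * (\<Sum>n. duhamel (freq \<epsilon> L n) (source v n) \<tau> * cosb L n x)"
      by (rule suminf_mult[OF mild_summable[OF v \<tau>]])
    moreover have "\<bar>exp (- \<beta> * \<tau>) * mild v \<tau> x\<bar> \<le> exp (- \<beta> * \<tau>) * \<bar>heat \<epsilon> L v0 \<tau> x\<bar> +
        \<bar>exp (- \<beta> * \<tau>) * (\<Sum>n. duhamel (freq \<epsilon> L n) (source v n) \<tau> * cosb L n x)\<bar>"
      unfolding mild_def distrib_left by (rule order.trans[OF abs_triangle_ineq]) (simp add: abs_mult)
    ultimately show ?thesis by linarith
  qed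
  then have "\<bar>exp (- \<beta> * max 0 (fst p)) * mild v (max 0 (fst p)) (snd p)\<bar> \<le>
      C + (\<Sum>n. 2 * M * (1 / (freq \<epsilon> L n + \<beta>)))" for p
    by (meson max.cobounded1)
  then show thesis by (rule that)
qed

lemma mild_diff:
  assumes u: "jcont u" and v: "jcont v" and \<beta>: "\<beta> > 0" and \<tau>: "\<tau> \<ge> 0"
    and D: "\<And>s x. s \<ge> 0 \<Longrightarrow> x \<in> {0..L} \<Longrightarrow> \<bar>u s x - v s x\<bar> \<le> exp (\<beta> * s) * D"
  shows "exp (- \<beta> * \<tau>) * \<bar>mild u \<tau> x - mild v \<tau> x\<bar> \<le> 2 * lip * (\<Sum>n. 1 / (freq \<epsilon> L n + \<beta>)) * D"
proof -
  let ?d = "\<lambda>u n. duhamel (freq \<epsilon> L n) (source u n) \<tau>"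
  have s: "summable (\<lambda>n. 1 / (freq \<epsilon> L n + \<beta>))" by (rule summable_inverse_freq) (use pos \<beta> in auto)
  have c: "continuous_on {0..\<tau>} (source u n)" if "jcont u" for u n
    by (rule continuous_on_subset[OF source_continuous[OF that]]) auto
  have le: "norm (exp (- \<beta> * \<tau>) * (?d u n * cosb L n x - ?d v n * cosb L n x)) \<le> 2 * lip * D * (1 / (freq \<epsilon> L n + \<beta>))" for n
  proof -
    have p: "freq \<epsilon> L n + \<beta> > 0" using freq_nonneg[of \<epsilon> L n] \<beta> by simp
    have "exp (- \<beta> * \<tau>) * \<bar>duhamel (freq \<epsilon> L n) (\<lambda>s. source u n s - source v n s) \<tau>\<bar> \<le> 2 * lip * D / (freq \<epsilon> L n + \<beta>)"
    proof (rule duhamel_bound[OF \<tau> _ _ p])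
      fix s assume s: "s \<in> {0..\<tau>}"
      have "\<bar>source u n s - source v n s\<bar> \<le> 2 * (lip * (exp (\<beta> * s) * D))"
        by (rule source_diff[OF u v]) (use s D in auto)
      then show "\<bar>source u n s - source v n s\<bar> \<le> 2 * lip * D * exp (\<beta> * s)" by (simp add: mult_ac)
    qed (intro continuous_intros c u v)
    then have 1: "exp (- \<beta> * \<tau>) * \<bar>?d u n - ?d v n\<bar> \<le> 2 * lip * D / (freq \<epsilon> L n + \<beta>)"
      by (simp only: duhamel_diff[OF c[OF u] c[OF v]])
    have "exp (- \<beta> * \<tau>) * \<bar>?d u n - ?d v n\<bar> * \<bar>cosb L n x\<bar> \<le> exp (- \<beta> * \<tau>) * \<bar>?d u n - ?d v n\<bar> * 1"
      using abs_cosb_le[of L n x] by (intro mult_left_mono) auto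
    with 1 have "exp (- \<beta> * \<tau>) * \<bar>?d u n - ?d v n\<bar> * \<bar>cosb L n x\<bar> \<le> 2 * lip * D / (freq \<epsilon> L n + \<beta>)" by linarith
    then show ?thesis by (simp add: abs_mult mult.assoc flip: left_diff_distrib)
  qed
  have sd: "summable (\<lambda>n. ?d u n * cosb L n x - ?d v n * cosb L n x)"
    by (intro summable_diff mild_summable u v \<tau>)
  have "mild u \<tau> x - mild v \<tau> x = (\<Sum>n. ?d u n * cosb L n x - ?d v n * cosb L n x)"
    unfolding mild_def suminf_diff[OF mild_summable[OF u \<tau>] mild_summable[OF v \<tau>], symmetric] by simp
  then have "exp (- \<beta> * \<tau>) * \<bar>mild u \<tau> x - mild v \<tau> x\<bar> =
      norm (\<Sum>n. exp (- \<beta> * \<tau>) * (?d u n * cosb L n x - ?d v n * cosb L n x))"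
    unfolding suminf_mult[OF sd] by (simp add: abs_mult)
  also have "\<dots> \<le> (\<Sum>n. 2 * lip * D * (1 / (freq \<epsilon> L n + \<beta>)))"
    by (rule norm_suminf_le[OF le]) (intro summable_mult s)
  also have "\<dots> = 2 * lip * D * (\<Sum>n. 1 / (freq \<epsilon> L n + \<beta>))" by (rule suminf_mult[OF s])
  finally show ?thesis by (simp add: mult_ac)
qed

text \<open>The unknown of Banach's theorem is W = e^(-\<beta>\<tau>) v, and V undoes the weight.
  Once the sum of 1/(freq + \<beta>) is at most 1/(4 lip), \<open>mild_diff\<close> gives the
  contraction factor 1/2 without restriction on time.\<close>

lemma mild_solution_exists:
  obtains v where "jcont v" "\<And>\<tau> x. \<tau> \<ge> 0 \<Longrightarrow> v \<tau> x = mild v \<tau> x"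
proof -
  obtain \<beta> where \<beta>: "\<beta> > 0" and small: "(\<Sum>n. 1 / (freq \<epsilon> L n + \<beta>)) \<le> 1 / (4 * lip)"
    using suminf_inverse_freq_small[OF pos, of "1 / (4 * lip)"] lip(1) by auto
  define V where "V W s x = exp (\<beta> * s) * apply_bcontfun W (s, x)" for W :: "(real \<times> real) \<Rightarrow>\<^sub>C real" and s x
  have jV: "jcont (V W)" for W
    unfolding jcont_def V_def case_prod_unfold by (intro continuous_intros) auto
  define \<Psi> where "\<Psi> W = Bcontfun (\<lambda>p. exp (- \<beta> * max 0 (fst p)) * mild (V W) (max 0 (fst p)) (snd p))" for W
  have ap: "apply_bcontfun (\<Psi> W) p = exp (- \<beta> * max 0 (fst p)) * mild (V W) (max 0 (fst p)) (snd p)" for W p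
  proof -
    obtain B where "\<And>p. \<bar>exp (- \<beta> * max 0 (fst p)) * mild (V W) (max 0 (fst p)) (snd p)\<bar> \<le> B"
      using mild_weighted_bound[OF jV \<beta>] by blast
    then have "(\<lambda>p. exp (- \<beta> * max 0 (fst p)) * mild (V W) (max 0 (fst p)) (snd p)) \<in> bcontfun"
      by (intro bcontfun_normI[OF mild_weighted_continuous[OF jV \<beta>]]) simp
    then show ?thesis unfolding \<Psi>_def by (simp add: Bcontfun_inverse)
  qed
  have "dist (\<Psi> U) (\<Psi> W) \<le> 1 / 2 * dist U W" for U W
  proof (rule dist_bound)
    fix p :: "real \<times> real"
    let ?\<tau> = "max 0 (fst p)"
    have "exp (- \<beta> * ?\<tau>) * \<bar>mild (V U) ?\<tau> (snd p) - mild (V W) ?\<tau> (snd p)\<bar> \<le>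
        2 * lip * (\<Sum>n. 1 / (freq \<epsilon> L n + \<beta>)) * dist U W"
    proof (rule mild_diff[OF jV jV \<beta>])
      fix s x
      have "\<bar>apply_bcontfun U (s, x) - apply_bcontfun W (s, x)\<bar> \<le> dist U W"
        using dist_bounded[of U "(s, x)" W] by (simp add: dist_real_def)
      then show "\<bar>V U s x - V W s x\<bar> \<le> exp (\<beta> * s) * dist U W"
        by (simp add: V_def abs_mult flip: right_diff_distrib)
    qed simp
    also have "\<dots> \<le> 2 * lip * (1 / (4 * lip)) * dist U W"
      using small lip(1) by (intro mult_right_mono mult_left_mono) auto
    also have "\<dots> = 1 / 2 * dist U W" using lip(1) by simp
    finally show "dist (apply_bcontfun (\<Psi> U) p) (apply_bcontfun (\<Psi> W) p) \<le> 1 / 2 * dist U W"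
      by (simp add: ap dist_real_def abs_mult flip: right_diff_distrib)
  qed
  then obtain W where W: "\<Psi> W = W" using banach_fix_type[of "1 / 2" \<Psi>] by auto
  have "V W \<tau> x = mild (V W) \<tau> x" if "\<tau> \<ge> 0" for \<tau> x
  proof -
    have "V W \<tau> x = exp (\<beta> * \<tau>) * apply_bcontfun (\<Psi> W) (\<tau>, x)" by (simp add: V_def W)
    then show ?thesis using that by (simp add: ap exp_minus)
  qed
  then show thesis using that[OF jV] by blast
qed

end

section \<open>Regularity of mild solutions\<close>

definition classical_at :: "real \<Rightarrow> real \<Rightarrow> real \<Rightarrow> (real \<Rightarrow> real \<Rightarrow> real) \<Rightarrow> (real \<Rightarrow> real \<Rightarrow> real) \<Rightarrow> real \<Rightarrow> bool" where
  "classical_at \<Lambda> \<epsilon> L v vx \<tau> \<longleftrightarrow>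
     (\<forall>x\<in>{0..L}. (v \<tau> has_real_derivative vx \<tau> x) (at x within {0..L})) \<and>
     vx \<tau> 0 = 0 \<and> vx \<tau> L = 0 \<and>
     (\<forall>x\<in>{0<..<L}. \<exists>v\<^sub>\<tau> v\<^sub>x\<^sub>x.
         ((\<lambda>s. v s x) has_real_derivative v\<^sub>\<tau>) (at \<tau>) \<and>
         (vx \<tau> has_real_derivative v\<^sub>x\<^sub>x) (at x) \<and>
         v\<^sub>\<tau> = \<epsilon>\<^sup>2 * v\<^sub>x\<^sub>x - cubic \<Lambda> x (v \<tau> x))"

text \<open>The conditions are separated time by time because a truncated solution is at first known
  to satisfy the true equation only at times up to which a bound has held.\<close>

lemma parabolic_solution_iff:
  "parabolic_solution \<Lambda> \<epsilon> L v \<longleftrightarrow> continuous_on ({0..} \<times> {0..L}) (\<lambda>(\<tau>, x). v \<tau> x) \<and>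
     (\<exists>vx. \<forall>\<tau>>0. classical_at \<Lambda> \<epsilon> L v vx \<tau>)"
  unfolding parabolic_solution_def classical_at_def by blast

lemma mult_exp_minus_le:
  fixes \<nu> d :: real
  assumes "d > 0"
  shows "\<nu> * exp (- \<nu> * d) \<le> 1 / d"
proof -
  have "\<nu> * d \<le> exp (\<nu> * d)" using exp_ge_add_one_self[of "\<nu> * d"] by linarith
  then have "\<nu> * d * exp (- \<nu> * d) \<le> exp (\<nu> * d) * exp (- \<nu> * d)" by (intro mult_right_mono) auto
  also have "\<dots> = 1" by (simp flip: exp_add)
  finally show ?thesis using assms by (simp add: field_simps)
qed

text \<open>Parabolic smoothing for one mode: e^(\<nu>t)(\<nu> \<sigma> a - \<Gamma>) does not
  increase, and \<nu> e^(-\<nu>d) <= 1/d. The bound contains no factor \<nu>, so summable bounds for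
  amplitudes and sources carry over to frequency times amplitude.\<close>

lemma relaxation_bound:
  fixes a g :: "real \<Rightarrow> real"
  assumes a: "\<And>t. t \<in> {s..T} \<Longrightarrow> (a has_real_derivative - \<nu> * a t + g t) (at t)"
    and g: "\<And>t. t \<in> {s..T} \<Longrightarrow> \<bar>g t\<bar> \<le> \<Gamma>" and \<nu>: "\<nu> \<ge> 0" and t: "s < t" "t \<le> T"
  shows "\<nu> * \<bar>a t\<bar> \<le> \<bar>a s\<bar> / (t - s) + \<Gamma>"
proof -
  have \<Gamma>: "\<Gamma> \<ge> 0" using g[of t] t by auto
  have main: "\<nu> * (\<sigma> * a t) \<le> \<bar>a s\<bar> / (t - s) + \<Gamma>" if \<sigma>: "\<sigma> = 1 \<or> \<sigma> = - 1" for \<sigma>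
  proof -
    let ?h = "\<lambda>t. exp (\<nu> * t) * (\<nu> * (\<sigma> * a t) - \<Gamma>)"
    have "- ?h s \<le> - ?h t"
    proof (rule deriv_within_mono[where a = s and b = T and f = "\<lambda>t. - ?h t"
          and f' = "\<lambda>t. \<nu> * exp (\<nu> * t) * (\<Gamma> - \<sigma> * g t)"])
      fix t assume t: "t \<in> {s..T}"
      have "(?h has_real_derivative exp (\<nu> * t) * \<nu> * (\<nu> * (\<sigma> * a t) - \<Gamma>) +
          exp (\<nu> * t) * (\<nu> * (\<sigma> * (- \<nu> * a t + g t)))) (at t)"
        by (rule derivative_eq_intros a[OF t] refl | simp)+
      from DERIV_minus[OF this]
      have "((\<lambda>t. - ?h t) has_real_derivative - (exp (\<nu> * t) * \<nu> * (\<nu> * (\<sigma> * a t) - \<Gamma>) +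
          exp (\<nu> * t) * (\<nu> * (\<sigma> * (- \<nu> * a t + g t))))) (at t)" .
      also have "- (exp (\<nu> * t) * \<nu> * (\<nu> * (\<sigma> * a t) - \<Gamma>) + exp (\<nu> * t) * (\<nu> * (\<sigma> * (- \<nu> * a t + g t)))) =
          \<nu> * exp (\<nu> * t) * (\<Gamma> - \<sigma> * g t)" by (simp add: algebra_simps)
      finally show "((\<lambda>t. - ?h t) has_real_derivative \<nu> * exp (\<nu> * t) * (\<Gamma> - \<sigma> * g t)) (at t within {s..T})"
        by (rule has_field_derivative_at_within)
    next
      fix x assume x: "s < x" "x < t"
      have "\<bar>g x\<bar> \<le> \<Gamma>" by (rule g) (use x t in auto)
      then have "\<sigma> * g x \<le> \<Gamma>" using \<sigma> by auto
      then show "0 \<le> \<nu> * exp (\<nu> * x) * (\<Gamma> - \<sigma> * g x)" using \<nu> by simp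
    qed (use t in auto)
    then have "exp (\<nu> * t) * (\<nu> * (\<sigma> * a t) - \<Gamma>) \<le> exp (\<nu> * s) * (\<nu> * (\<sigma> * a s) - \<Gamma>)" by simp
    also have "\<dots> \<le> exp (\<nu> * s) * (\<nu> * \<bar>a s\<bar>)"
    proof (rule mult_left_mono)
      have "\<sigma> * a s \<le> \<bar>a s\<bar>" using \<sigma> by auto
      from mult_left_mono[OF this \<nu>] show "\<nu> * (\<sigma> * a s) - \<Gamma> \<le> \<nu> * \<bar>a s\<bar>" using \<Gamma> by linarith
    qed simp
    finally have "exp (- \<nu> * t) * (exp (\<nu> * t) * (\<nu> * (\<sigma> * a t) - \<Gamma>)) \<le>
        exp (- \<nu> * t) * (exp (\<nu> * s) * (\<nu> * \<bar>a s\<bar>))"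
      by (intro mult_left_mono) auto
    also have "exp (- \<nu> * t) * (exp (\<nu> * t) * (\<nu> * (\<sigma> * a t) - \<Gamma>)) = \<nu> * (\<sigma> * a t) - \<Gamma>"
      by (simp add: mult.assoc[symmetric] flip: exp_add)
    also have "exp (- \<nu> * t) * (exp (\<nu> * s) * (\<nu> * \<bar>a s\<bar>)) = \<nu> * exp (- \<nu> * (t - s)) * \<bar>a s\<bar>"
      by (simp add: right_diff_distrib exp_diff exp_minus field_simps)
    also have "\<dots> \<le> 1 / (t - s) * \<bar>a s\<bar>" using t by (intro mult_right_mono mult_exp_minus_le) auto
    finally show ?thesis by simp
  qed
  show ?thesis using main[of 1] main[of "- 1"] by (cases "a t \<ge> 0") auto
qed

context truncated_problem
begin

definition amp :: "(real \<Rightarrow> real \<Rightarrow> real) \<Rightarrow> nat \<Rightarrow> real \<Rightarrow> real" where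
  "amp v n \<tau> = exp (- freq \<epsilon> L n * \<tau>) * fcoef L v0 n + duhamel (freq \<epsilon> L n) (source v n) \<tau>"

definition grad :: "(real \<Rightarrow> real \<Rightarrow> real) \<Rightarrow> real \<Rightarrow> real \<Rightarrow> real" where
  "grad v \<tau> x = (\<Sum>n. amp v n \<tau> * - (real n * (pi / L) * sin (real n * (pi / L) * x)))"

lemma amp_sums:
  assumes v: "jcont v" "\<And>\<tau> x. \<tau> \<ge> 0 \<Longrightarrow> v \<tau> x = mild v \<tau> x" and \<tau>: "\<tau> > 0"
  shows "(\<lambda>n. amp v n \<tau> * cosb L n x) sums v \<tau> x"
proof -
  have "(\<lambda>n. exp (- freq \<epsilon> L n * \<tau>) * fcoef L v0 n * cosb L n x + duhamel (freq \<epsilon> L n) (source v n) \<tau> * cosb L n x)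
      sums mild v \<tau> x"
    unfolding mild_def
    by (rule sums_add[OF heat_series[OF pos \<tau> v0] summable_sums[OF mild_summable[OF v(1) less_imp_le[OF \<tau>]]]])
  then show ?thesis unfolding amp_def distrib_right v(2)[OF less_imp_le[OF \<tau>]] .
qed

lemma amp_derivative:
  assumes v: "jcont v" and \<tau>: "\<tau> > 0"
  shows "(amp v n has_real_derivative - freq \<epsilon> L n * amp v n \<tau> + source v n \<tau>) (at \<tau>)"
proof -
  have "((\<lambda>\<tau>. exp (- freq \<epsilon> L n * \<tau>) * fcoef L v0 n + duhamel (freq \<epsilon> L n) (source v n) \<tau>) has_real_derivative
      exp (- freq \<epsilon> L n * \<tau>) * - freq \<epsilon> L n * fcoef L v0 n +
      (- freq \<epsilon> L n * duhamel (freq \<epsilon> L n) (source v n) \<tau> + source v n \<tau>)) (at \<tau>)"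
    by (rule derivative_eq_intros duhamel_derivative[OF source_continuous[OF v] \<tau>] refl | simp)+
  then show ?thesis unfolding amp_def[abs_def] by (simp add: algebra_simps)
qed

text \<open>A positive starting time serves the part coming from v0, whose coefficients are merely
  bounded; the source part is summable through 1/(freq + 1).\<close>

lemma amp_bound:
  assumes v: "jcont v" and "\<tau>1 > 0"
  obtains A where "summable A" "\<And>n. A n \<ge> 0"
    "\<And>n \<tau>. \<tau>1 \<le> \<tau> \<Longrightarrow> \<tau> \<le> T \<Longrightarrow> \<bar>amp v n \<tau>\<bar> \<le> A n"
proof -
  obtain C where C: "\<And>x. x \<in> {0..L} \<Longrightarrow> \<bar>v0 x\<bar> \<le> C" using continuous_on_Icc_bounded[OF v0] by blast
  have C0: "C \<ge> 0" using C[of 0] pos by auto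
  define A where "A n = 2 * C * exp (- freq \<epsilon> L n * \<tau>1) + exp T * (2 * M) * (1 / (freq \<epsilon> L n + 1))" for n
  have "summable A"
    unfolding A_def using assms pos by (intro summable_add summable_mult summable_exp_freq summable_inverse_freq) auto
  moreover have "A n \<ge> 0" for n
    using C0 M_nonneg freq_nonneg[of \<epsilon> L n] by (simp add: A_def)
  moreover have "\<bar>amp v n \<tau>\<bar> \<le> A n" if \<tau>: "\<tau>1 \<le> \<tau>" "\<tau> \<le> T" for n \<tau>
  proof -
    have t: "\<tau> > 0" using \<tau> assms by simp
    have "\<bar>exp (- freq \<epsilon> L n * \<tau>) * fcoef L v0 n\<bar> \<le> exp (- freq \<epsilon> L n * \<tau>1) * (2 * C)"
      using fcoef_bound[OF pos(2) v0 C, of n] freq_nonneg[of \<epsilon> L n] \<tau>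
      by (auto simp: abs_mult intro!: mult_mono mult_left_mono)
    moreover have "\<bar>duhamel (freq \<epsilon> L n) (source v n) \<tau>\<bar> \<le> exp T * (2 * M * (1 / (freq \<epsilon> L n + 1)))"
    proof -
      have "exp (- 1 * \<tau>) * \<bar>duhamel (freq \<epsilon> L n) (source v n) \<tau>\<bar> \<le> 2 * M * (1 / (freq \<epsilon> L n + 1))"
        using mild_term_bound[OF v less_imp_le[OF t] zero_less_one, of n 0] by (simp add: cosb_def)
      then have "exp \<tau> * (exp (- 1 * \<tau>) * \<bar>duhamel (freq \<epsilon> L n) (source v n) \<tau>\<bar>) \<le>
          exp T * (2 * M * (1 / (freq \<epsilon> L n + 1)))"
        using \<tau> by (intro mult_mono[where a = "exp \<tau>"]) auto
      then show ?thesis by (simp add: mult.assoc[symmetric] flip: exp_add)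
    qed
    ultimately show ?thesis unfolding amp_def A_def
      using abs_triangle_ineq[of "exp (- freq \<epsilon> L n * \<tau>) * fcoef L v0 n" "duhamel (freq \<epsilon> L n) (source v n) \<tau>"]
      by (simp add: mult_ac)
  qed
  ultimately show thesis by (rule that)
qed

text \<open>Bootstrapping: the amplitudes are \<open>O(1/n\<^sup>2)\<close> because the source is bounded; hence the source,
  a polynomial in \<open>v\<close>, has summable amplitudes, and so have \<open>v\<^sub>x\<^sub>x\<close> and \<open>v\<^sub>\<tau>\<close>.\<close>

lemma source_summable_bound:
  assumes v: "jcont v" "\<And>\<tau> x. \<tau> \<ge> 0 \<Longrightarrow> v \<tau> x = mild v \<tau> x" and \<tau>1: "\<tau>1 > 0" and L: "L = real k * pi"
    and poly: "\<And>s x. s \<in> {0..T} \<Longrightarrow> x \<in> {0..L} \<Longrightarrow> G x (v s x) = - cubic \<Lambda> x (v s x)"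
  obtains \<Gamma> where "summable \<Gamma>" "\<And>n s. \<tau>1 \<le> s \<Longrightarrow> s \<le> T \<Longrightarrow> \<bar>source v n s\<bar> \<le> \<Gamma> n"
proof -
  obtain A where A: "summable A" "\<And>n. A n \<ge> 0" "\<And>n \<tau>. \<tau>1 \<le> \<tau> \<Longrightarrow> \<tau> \<le> T \<Longrightarrow> \<bar>amp v n \<tau>\<bar> \<le> A n"
    using amp_bound[OF v(1) \<tau>1] by blast
  have delta: "summable (\<lambda>n. if n = j then c else 0)" for j :: nat and c :: real
    using sums_single[of j "\<lambda>_. c"] by (auto simp: sums_iff)
  \<comment> \<open>B0 belongs to the constant 1 and Bk to cos x; B1, B2, B3 bound the cosine
    integrals of v, v^2 and v^3 through repeated multiplication by v.\<close>
  define B0 where "B0 n = (if n = 0 then L else 0)" for n :: nat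
  define Bk where "Bk n = (if n = k then L else 0)" for n :: nat
  define B1 where "B1 = conv_bound A B0"
  define B2 where "B2 = conv_bound A B1"
  define B3 where "B3 = conv_bound A B2"
  have B0: "summable B0" "\<And>n. B0 n \<ge> 0" using delta[of 0 L] pos by (auto simp: B0_def[abs_def])
  have Bk: "summable Bk" using delta[of k L] by (simp add: Bk_def[abs_def])
  have B1: "summable B1" "\<And>n. B1 n \<ge> 0"
    unfolding B1_def by (rule summable_conv_bound[OF A(1,2) B0])+
  have B2: "summable B2" "\<And>n. B2 n \<ge> 0"
    unfolding B2_def by (rule summable_conv_bound[OF A(1,2) B1])+
  have B3: "summable B3" unfolding B3_def by (rule summable_conv_bound[OF A(1,2) B2])
  define \<Gamma> where "\<Gamma> n = 2 / L * (B3 n + \<bar>\<Lambda>\<bar> * B1 n + Bk n)" for n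
  have "\<bar>source v n s\<bar> \<le> \<Gamma> n" if s: "\<tau>1 \<le> s" "s \<le> T" for n s
  proof -
    have s0: "s > 0" "s \<in> {0..T}" using s \<tau>1 by auto
    have vs: "(\<lambda>n. amp v n s * cosb L n x) sums v s x" for x by (rule amp_sums[OF v s0(1)])
    have a: "\<bar>amp v n s\<bar> \<le> A n" for n by (rule A(3)[OF s])
    have cv: "continuous_on {0..L} (v s)" by (rule jcont_slice[OF v(1) less_imp_le[OF s0(1)]])
    have f0: "\<bar>fint L (\<lambda>_. 1) n\<bar> \<le> B0 n" for n using fcoef_0_1[OF pos(2), of n] pos by (simp add: B0_def)
    have f1: "\<bar>fint L (v s) n\<bar> \<le> B1 n" for n
      using fint_mult_bound[OF pos(2) continuous_on_const B0(1) f0 A(1) a vs, of n] by (simp add: B1_def)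
    have f2: "\<bar>fint L (\<lambda>x. v s x * v s x) n\<bar> \<le> B2 n" for n
      using fint_mult_bound[OF pos(2) cv B1(1) f1 A(1) a vs, of n] by (simp add: B2_def)
    have cvv: "continuous_on {0..L} (\<lambda>x. v s x * v s x)" by (intro continuous_intros cv)
    have f3: "\<bar>fint L (\<lambda>x. v s x * (v s x * v s x)) n\<bar> \<le> B3 n" for n
      using fint_mult_bound[OF pos(2) cvv B2(1) f2 A(1) a vs, of n] by (simp add: B3_def)
    have "fint L (\<lambda>x. G x (v s x)) n =
        fint L (\<lambda>x. - 1 * (v s x * (v s x * v s x)) + (\<Lambda> * v s x + - 1 * cosb L k x)) n"
      unfolding fint_def
    proof (rule integral_cong)
      fix x assume x: "x \<in> {0..L}"
      \<comment> \<open>Here L = k \<pi> matters: cos x is the k-th mode, so the forcing has a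
        single nonzero coefficient.\<close>
      have k: "k \<noteq> 0" using L pos by (intro notI) simp
      then have "cosb L k x = cos x" unfolding cosb_def L by simp
      then show "G x (v s x) * cosb L n x =
          (- 1 * (v s x * (v s x * v s x)) + (\<Lambda> * v s x + - 1 * cosb L k x)) * cosb L n x"
        using poly[OF s0(2) x] by (simp add: cubic_def power3_eq_cube)
    qed
    also have "\<dots> = - 1 * fint L (\<lambda>x. v s x * (v s x * v s x)) n + (\<Lambda> * fint L (v s) n + - 1 * fint L (cosb L k) n)"
      by (subst fint_add fint_cmult; (intro continuous_intros cv)?)+ (rule refl)
    finally have "\<bar>fint L (\<lambda>x. G x (v s x)) n\<bar> \<le> B3 n + (\<bar>\<Lambda>\<bar> * B1 n + Bk n)"
    proof -
      assume e: "fint L (\<lambda>x. G x (v s x)) n = - 1 * fint L (\<lambda>x. v s x * (v s x * v s x)) n + (\<Lambda> * fint L (v s) n + - 1 * fint L (cosb L k) n)"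
      have "\<bar>\<Lambda> * fint L (v s) n\<bar> \<le> \<bar>\<Lambda>\<bar> * B1 n" unfolding abs_mult by (intro mult_left_mono f1) simp
      moreover have "\<bar>fint L (cosb L k) n\<bar> \<le> Bk n" using fint_cosb[OF pos(2), of k n] pos by (simp add: Bk_def)
      ultimately show ?thesis using e f3[of n] by linarith
    qed
    then have "2 / L * \<bar>fint L (\<lambda>x. G x (v s x)) n\<bar> \<le> \<Gamma> n"
      unfolding \<Gamma>_def using pos by (intro mult_left_mono) auto
    then show ?thesis using fcoef_le_fint[OF pos(2), of "\<lambda>x. G x (v s x)" n] unfolding source_def by linarith
  qed
  moreover have "summable \<Gamma>"
    unfolding \<Gamma>_def by (intro summable_mult summable_add B3 B1 Bk)
  ultimately show thesis using that by blast
qed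

text \<open>From \<tau>1 on, amplitudes and sources have summable bounds; from \<tau>2 on, after
  relaxation over \<tau>2 - \<tau>1, so has frequency times amplitude. This permits differentiating
  the series once in \<tau> and twice in x. T lies beyond \<tau> because the time derivative is
  two-sided.\<close>

lemma mild_classical:
  assumes v: "jcont v" "\<And>\<tau> x. \<tau> \<ge> 0 \<Longrightarrow> v \<tau> x = mild v \<tau> x" and \<tau>: "0 < \<tau>" "\<tau> < T" and L: "L = real k * pi"
    and poly: "\<And>s x. s \<in> {0..T} \<Longrightarrow> x \<in> {0..L} \<Longrightarrow> G x (v s x) = - cubic \<Lambda> x (v s x)"
  shows "classical_at \<Lambda> \<epsilon> L v (grad v) \<tau>"
proof -
  define \<tau>1 where "\<tau>1 = \<tau> / 3"
  define \<tau>2 where "\<tau>2 = 2 * \<tau> / 3"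
  have t12: "0 < \<tau>1" "\<tau>1 < \<tau>2" "\<tau>2 < \<tau>" using \<tau> by (auto simp: \<tau>1_def \<tau>2_def)
  obtain A where A: "summable A" "\<And>n. A n \<ge> 0" "\<And>n \<tau>. \<tau>1 \<le> \<tau> \<Longrightarrow> \<tau> \<le> T \<Longrightarrow> \<bar>amp v n \<tau>\<bar> \<le> A n"
    using amp_bound[OF v(1) t12(1)] by blast
  obtain \<Gamma> where \<Gamma>: "summable \<Gamma>" "\<And>n s. \<tau>1 \<le> s \<Longrightarrow> s \<le> T \<Longrightarrow> \<bar>source v n s\<bar> \<le> \<Gamma> n"
    using source_summable_bound[OF v t12(1) L poly] by blast
  define \<Theta> where "\<Theta> n = A n / (\<tau>2 - \<tau>1) + \<Gamma> n" for n
  have \<Theta>s: "summable \<Theta>" unfolding \<Theta>_def by (intro summable_add summable_divide A \<Gamma>)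
  have \<Theta>: "freq \<epsilon> L n * \<bar>amp v n t\<bar> \<le> \<Theta> n" if t: "\<tau>2 \<le> t" "t \<le> T" for n t
  proof -
    have "freq \<epsilon> L n * \<bar>amp v n t\<bar> \<le> \<bar>amp v n \<tau>1\<bar> / (t - \<tau>1) + \<Gamma> n"
    proof (rule relaxation_bound[where g = "source v n" and T = T])
      fix x assume "x \<in> {\<tau>1..T}"
      then show "(amp v n has_real_derivative - freq \<epsilon> L n * amp v n x + source v n x) (at x)"
        "\<bar>source v n x\<bar> \<le> \<Gamma> n"
        using amp_derivative[OF v(1), of x n] \<Gamma>(2)[of x n] t12 by auto
    qed (use t t12 freq_nonneg in auto)
    also have "\<bar>amp v n \<tau>1\<bar> / (t - \<tau>1) \<le> A n / (\<tau>2 - \<tau>1)"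
      using A(2)[of n] A(3)[of \<tau>1 n] t t12 \<tau> by (intro frac_le) auto
    finally show ?thesis by (simp add: \<Theta>_def)
  qed
  define q where "q n = real n * (pi / L)" for n
  have q: "\<bar>amp v n \<tau>\<bar> * (q n)\<^sup>2 \<le> \<Theta> n / \<epsilon>\<^sup>2" "\<bar>amp v n \<tau>\<bar> * q n \<le> A n + \<Theta> n / \<epsilon>\<^sup>2" "q n \<ge> 0" for n
  proof -
    show q0: "q n \<ge> 0" using pos by (simp add: q_def)
    have "\<epsilon>\<^sup>2 * (\<bar>amp v n \<tau>\<bar> * (q n)\<^sup>2) \<le> \<Theta> n"
      using \<Theta>[of \<tau> n] t12 \<tau> by (simp add: freq_def q_def mult_ac)
    then show 1: "\<bar>amp v n \<tau>\<bar> * (q n)\<^sup>2 \<le> \<Theta> n / \<epsilon>\<^sup>2" using pos by (simp add: field_simps)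
    have "q n \<le> 1 + (q n)\<^sup>2" using sum_squares_bound[of 1 "q n"] zero_le_power2[of "q n"] q0 by simp
    then have "\<bar>amp v n \<tau>\<bar> * q n \<le> \<bar>amp v n \<tau>\<bar> * (1 + (q n)\<^sup>2)" by (intro mult_left_mono) auto
    also have "\<dots> = \<bar>amp v n \<tau>\<bar> + \<bar>amp v n \<tau>\<bar> * (q n)\<^sup>2" by (simp add: distrib_left)
    also have "\<dots> \<le> A n + \<Theta> n / \<epsilon>\<^sup>2" using A(3)[of \<tau> n] 1 t12 \<tau> by (intro add_mono) auto
    finally show "\<bar>amp v n \<tau>\<bar> * q n \<le> A n + \<Theta> n / \<epsilon>\<^sup>2" .
  qed
  have sA: "summable (\<lambda>n. A n + \<Theta> n / \<epsilon>\<^sup>2)" and sT: "summable (\<lambda>n. \<Theta> n / \<epsilon>\<^sup>2)"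
    by (intro summable_add summable_divide A \<Theta>s)+
  let ?f = "\<lambda>n x. amp v n \<tau> * cosb L n x"
  let ?f1 = "\<lambda>n x. amp v n \<tau> * - (q n * sin (q n * x))"
  let ?f2 = "\<lambda>n x. amp v n \<tau> * - (q n * (q n * cos (q n * x)))"
  have df: "(?f n has_real_derivative ?f1 n x) (at x within S)" for n x S
  proof -
    have "cosb L n = (\<lambda>x. cos (q n * x))" by (simp add: cosb_def q_def fun_eq_iff)
    then show ?thesis by (auto intro!: derivative_eq_intros)
  qed
  have df1: "(?f1 n has_real_derivative ?f2 n x) (at x within S)" for n x S
    by (auto intro!: derivative_eq_intros)
  have u1: "uniformly_convergent_on UNIV (\<lambda>N x. \<Sum>n<N. ?f1 n x)"
  proof (rule Weierstrass_m_test'[OF _ sA])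
    fix n x
    have "\<bar>amp v n \<tau>\<bar> * q n * \<bar>sin (q n * x)\<bar> \<le> \<bar>amp v n \<tau>\<bar> * q n * 1"
      using q(3)[of n] by (intro mult_left_mono) auto
    then show "norm (?f1 n x) \<le> A n + \<Theta> n / \<epsilon>\<^sup>2" using q(2,3)[of n] by (simp add: abs_mult mult.assoc)
  qed
  have le2: "norm (?f2 n x) \<le> \<Theta> n / \<epsilon>\<^sup>2" for n x
  proof -
    have "\<bar>amp v n \<tau>\<bar> * (q n)\<^sup>2 * \<bar>cos (q n * x)\<bar> \<le> \<bar>amp v n \<tau>\<bar> * (q n)\<^sup>2 * 1"
      by (intro mult_left_mono) auto
    then show ?thesis using q(1,3)[of n] by (simp add: abs_mult mult.assoc power2_eq_square)
  qed
  have u2: "uniformly_convergent_on UNIV (\<lambda>N x. \<Sum>n<N. ?f2 n x)"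
    by (rule Weierstrass_m_test'[OF le2 sT])
  have vsum: "(\<Sum>n. ?f n x) = v \<tau> x" for x using amp_sums[OF v \<tau>(1), of x] by (simp add: sums_iff)
  have gr: "grad v \<tau> x = (\<Sum>n. ?f1 n x)" for x by (simp add: grad_def q_def)
  have s1: "summable (\<lambda>n. ?f1 n 0)" by simp
  have s0: "summable (\<lambda>n. ?f n 0)" using amp_sums[OF v \<tau>(1), of 0] by (rule sums_summable)
  have dv: "(v \<tau> has_real_derivative grad v \<tau> x) (at x)" for x
  proof -
    have "((\<lambda>x. \<Sum>n. ?f n x) has_real_derivative (\<Sum>n. ?f1 n x)) (at x)"
      by (rule has_field_derivative_series'(2)[OF convex_UNIV df u1 UNIV_I s0]) simp
    then show ?thesis unfolding vsum gr .
  qed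
  have dg: "(grad v \<tau> has_real_derivative (\<Sum>n. ?f2 n x)) (at x)" for x
  proof -
    have "((\<lambda>x. \<Sum>n. ?f1 n x) has_real_derivative (\<Sum>n. ?f2 n x)) (at x)"
      by (rule has_field_derivative_series'(2)[OF convex_UNIV df1 u2 UNIV_I s1]) simp
    then show ?thesis unfolding gr[abs_def] .
  qed
  have pde: "((\<lambda>s. v s x) has_real_derivative \<epsilon>\<^sup>2 * (\<Sum>n. ?f2 n x) - cubic \<Lambda> x (v \<tau> x)) (at \<tau>)"
    if x: "x \<in> {0..L}" for x
  proof -
    let ?g = "\<lambda>n t. amp v n t * cosb L n x"
    let ?g1 = "\<lambda>n t. (- freq \<epsilon> L n * amp v n t + source v n t) * cosb L n x"
    have int: "\<tau> \<in> interior {\<tau>2..T}" using t12 \<tau> by simp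
    have d0: "((\<lambda>t. \<Sum>n. ?g n t) has_real_derivative (\<Sum>n. ?g1 n \<tau>)) (at \<tau>)"
    proof (rule has_field_derivative_series'(2)[where S = "{\<tau>2..T}" and ?x0.0 = \<tau>])
      show "uniformly_convergent_on {\<tau>2..T} (\<lambda>N t. \<Sum>n<N. ?g1 n t)"
      proof (rule Weierstrass_m_test')
        show "summable (\<lambda>n. \<Theta> n + \<Gamma> n)" by (intro summable_add \<Theta>s \<Gamma>)
        fix n t assume t: "t \<in> {\<tau>2..T}"
        have "\<bar>- freq \<epsilon> L n * amp v n t + source v n t\<bar> \<le> \<bar>- freq \<epsilon> L n * amp v n t\<bar> + \<bar>source v n t\<bar>"
          by (rule abs_triangle_ineq)
        also have "\<bar>- freq \<epsilon> L n * amp v n t\<bar> = freq \<epsilon> L n * \<bar>amp v n t\<bar>"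
          using freq_nonneg[of \<epsilon> L n] by (simp add: abs_mult)
        also have "freq \<epsilon> L n * \<bar>amp v n t\<bar> + \<bar>source v n t\<bar> \<le> \<Theta> n + \<Gamma> n"
          using \<Theta>[of t n] \<Gamma>(2)[of t n] t t12 by (intro add_mono) auto
        finally have "\<bar>- freq \<epsilon> L n * amp v n t + source v n t\<bar> * \<bar>cosb L n x\<bar> \<le> (\<Theta> n + \<Gamma> n) * 1"
          using abs_cosb_le[of L n x] by (intro mult_mono) auto
        then show "norm (?g1 n t) \<le> \<Theta> n + \<Gamma> n" by (simp add: abs_mult)
      qed
      show "summable (\<lambda>n. ?g n \<tau>)" using amp_sums[OF v \<tau>(1), of x] by (rule sums_summable)
      fix n t assume t: "t \<in> {\<tau>2..T}"
      then have "(amp v n has_real_derivative - freq \<epsilon> L n * amp v n t + source v n t) (at t within {\<tau>2..T})"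
        using amp_derivative[OF v(1), of t n] t12 by (auto intro: has_field_derivative_at_within)
      then show "(?g n has_real_derivative ?g1 n t) (at t within {\<tau>2..T})" by (rule DERIV_cmult_right)
    qed (use t12 \<tau> int in auto)
    have d1: "(\<Sum>n. ?g n t) = v t x" if "t \<in> {0<..<T}" for t
      using amp_sums[OF v, of t x] that by (simp add: sums_iff)
    have d: "((\<lambda>s. v s x) has_real_derivative (\<Sum>n. ?g1 n \<tau>)) (at \<tau>)"
      by (rule has_field_derivative_transform_within_open[OF d0 open_greaterThanLessThan _ d1]) (use \<tau> in auto)
    have cG: "continuous_on {0..L} (\<lambda>x. G x (v \<tau> x))" by (rule G_slice[OF jcont_slice[OF v(1)]]) (use \<tau> in simp)
    \<comment> \<open>The source, entering so far through its coefficients only, is recovered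
      pointwise; this turns the differentiated series into the differential equation.\<close>
    have "(\<lambda>n. source v n \<tau> * cosb L n x) sums G x (v \<tau> x)"
      unfolding source_def
      by (rule cosine_series[OF pos(2) cG \<Gamma>(1) _ x]) (use \<Gamma>(2)[of \<tau>] t12 \<tau> in \<open>simp add: source_def\<close>)
    moreover have "summable (\<lambda>n. ?f2 n x)" by (rule summable_comparison_test'[OF sT]) (use le2 in auto)
    then have "(\<lambda>n. \<epsilon>\<^sup>2 * ?f2 n x) sums (\<epsilon>\<^sup>2 * (\<Sum>n. ?f2 n x))" by (intro sums_mult summable_sums)
    ultimately have "(\<lambda>n. \<epsilon>\<^sup>2 * ?f2 n x + source v n \<tau> * cosb L n x) sums (\<epsilon>\<^sup>2 * (\<Sum>n. ?f2 n x) + G x (v \<tau> x))"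
      by (rule sums_add[rotated])
    moreover have "\<epsilon>\<^sup>2 * ?f2 n x + source v n \<tau> * cosb L n x = ?g1 n \<tau>" for n
      by (simp add: freq_def q_def cosb_def power2_eq_square algebra_simps)
    ultimately have "(\<Sum>n. ?g1 n \<tau>) = \<epsilon>\<^sup>2 * (\<Sum>n. ?f2 n x) + G x (v \<tau> x)"
      by (simp only: sums_iff)
    moreover have "G x (v \<tau> x) = - cubic \<Lambda> x (v \<tau> x)" by (rule poly) (use \<tau> x in auto)
    ultimately show ?thesis using d by simp
  qed
  have "real n * (pi / L) * L = real n * pi" for n using pos by simp
  then have "grad v \<tau> L = 0" by (simp add: grad_def)
  moreover have "grad v \<tau> 0 = 0" by (simp add: grad_def)
  ultimately show ?thesis
    unfolding classical_at_def
  proof (intro conjI ballI)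
    fix x assume "x \<in> {0<..<L}"
    then have "x \<in> {0..L}" by simp
    from pde[OF this] dg[of x]
    show "\<exists>v\<^sub>\<tau> v\<^sub>x\<^sub>x. ((\<lambda>s. v s x) has_real_derivative v\<^sub>\<tau>) (at \<tau>) \<and>
        (grad v \<tau> has_real_derivative v\<^sub>x\<^sub>x) (at x) \<and> v\<^sub>\<tau> = \<epsilon>\<^sup>2 * v\<^sub>x\<^sub>x - cubic \<Lambda> x (v \<tau> x)"
      by blast
  qed (rule has_field_derivative_at_within[OF dv])
qed

end

section \<open>Stability\<close>

text \<open>\<open>\<Phi>\<close> may have concave kinks, but only at critical points of \<open>u\<close>. A function \<open>v(\<tau>, \<cdot>)\<close>
  satisfying the Neumann conditions cannot touch \<open>u \<plusminus> B e\<^sup>-\<^sup>\<gamma>\<^sup>\<tau> \<Phi>\<close> from inside at such a kink.\<close>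

definition strict_super ::
    "real \<Rightarrow> real \<Rightarrow> real \<Rightarrow> real \<Rightarrow> (real \<Rightarrow> real) \<Rightarrow> (real \<Rightarrow> real) \<Rightarrow> (real \<Rightarrow> real) \<Rightarrow> real \<Rightarrow> bool" where
  "strict_super \<Lambda> \<epsilon> L \<gamma>\<^sub>0 u w \<Phi> x \<longleftrightarrow>
      (\<exists>c d \<Phi>1 l. 0 \<le> c \<and> c < x \<and> x < d \<and> d \<le> L \<and>
         (\<forall>y\<in>{c<..<d}. (\<Phi> has_real_derivative \<Phi>1 y) (at y)) \<and> (\<Phi>1 has_real_derivative l) (at x) \<and>
         (3 * (u x)\<^sup>2 - \<Lambda>) * \<Phi> x - \<epsilon>\<^sup>2 * l \<ge> \<gamma>\<^sub>0) \<or>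
      (w x = 0 \<and> (x < L \<longrightarrow> (\<exists>l e. l < 0 \<and> e > 0 \<and> x + e \<le> L \<and> (\<Phi> has_real_derivative l) (at x within {x..x + e}))) \<and>
       (0 < x \<longrightarrow> (\<exists>l e. l > 0 \<and> e > 0 \<and> 0 \<le> x - e \<and> (\<Phi> has_real_derivative l) (at x within {x - e..x}))))"

lemma barrier:
  fixes u w \<Phi> :: "real \<Rightarrow> real" and v vx :: "real \<Rightarrow> real \<Rightarrow> real"
  assumes \<epsilon>: "\<epsilon> > 0" and L: "L > 0"
    and v: "continuous_on ({0..} \<times> {0..L}) (\<lambda>(\<tau>, x). v \<tau> x)"
    and du: "\<And>x. (u has_real_derivative w x) (at x)"
    and dw: "\<And>x. (w has_real_derivative cubic \<Lambda> x (u x) / \<epsilon>\<^sup>2) (at x)"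
    and ub: "\<And>x. x \<in> {0..L} \<Longrightarrow> \<bar>u x\<bar> \<le> b"
    and \<Phi>c: "continuous_on {0..L} \<Phi>" and \<Phi>pos: "\<And>x. x \<in> {0..L} \<Longrightarrow> \<Phi> x > 0"
    and super: "\<And>x. x \<in> {0..L} \<Longrightarrow> strict_super \<Lambda> \<epsilon> L \<gamma>\<^sub>0 u w \<Phi> x"
    and B: "B > 0" and \<gamma>: "\<gamma> > 0"
    and small: "\<And>x. x \<in> {0..L} \<Longrightarrow> \<gamma> * \<Phi> x + 3 * b * B * (\<Phi> x)\<^sup>2 < \<gamma>\<^sub>0"
    and classical: "\<And>\<tau>. \<tau> > 0 \<Longrightarrow> (\<And>s x. s \<in> {0..\<tau>} \<Longrightarrow> x \<in> {0..L} \<Longrightarrow> \<bar>v s x - u x\<bar> \<le> B * \<Phi> x) \<Longrightarrow>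
      classical_at \<Lambda> \<epsilon> L v vx \<tau>"
    and init: "\<And>x. x \<in> {0..L} \<Longrightarrow> \<bar>v 0 x - u x\<bar> < B * \<Phi> x"
    and \<tau>1: "\<tau>1 \<ge> 0" and x1: "x1 \<in> {0..L}"
  shows "\<bar>v \<tau>1 x1 - u x1\<bar> < B * exp (- \<gamma> * \<tau>1) * \<Phi> x1"
proof (rule ccontr)
  assume neg: "\<not> ?thesis"
  define E where "E \<tau> = B * exp (- \<gamma> * \<tau>)" for \<tau>
  define h where "h p = \<bar>v (fst p) (snd p) - u (snd p)\<bar> - E (fst p) * \<Phi> (snd p)" for p
  have E: "E \<tau> > 0" for \<tau> using B by (simp add: E_def)
  have cu: "continuous_on S u" for S
    by (rule DERIV_continuous_on[OF has_field_derivative_at_within[OF du]])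
  let ?K = "{0..\<tau>1} \<times> {0..L}"
  have ch: "continuous_on ?K h"
    unfolding h_def E_def
  proof (intro continuous_on_diff continuous_on_rabs continuous_on_mult)
    have "continuous_on ?K (\<lambda>(\<tau>, x). v \<tau> x)" by (rule continuous_on_subset[OF v]) auto
    then show "continuous_on ?K (\<lambda>p. v (fst p) (snd p))" by (simp add: case_prod_unfold)
    show "continuous_on ?K (\<lambda>p. u (snd p))"
      by (rule continuous_on_compose2[OF cu[of UNIV]]) (auto intro!: continuous_intros)
    show "continuous_on ?K (\<lambda>p. \<Phi> (snd p))"
      by (rule continuous_on_compose2[OF \<Phi>c]) (auto intro!: continuous_intros)
  qed (intro continuous_intros)+
  define Z where "Z = {p \<in> ?K. h p \<ge> 0}"
  have "compact ?K" by (intro compact_Times compact_Icc)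
  moreover have "closed Z" unfolding Z_def
    by (rule continuous_on_closed_Collect_le[OF continuous_on_const ch]) (intro closed_Times closed_atLeastAtMost)
  ultimately have "compact (?K \<inter> Z)" by (rule compact_Int_closed)
  then have cZ: "compact Z" by (simp add: Z_def Int_def)
  have "(\<tau>1, x1) \<in> Z" using neg \<tau>1 x1 by (simp add: Z_def h_def E_def)
  then have "Z \<noteq> {}" by blast
  then obtain p where p: "p \<in> Z" "\<And>r. r \<in> Z \<Longrightarrow> fst p \<le> fst r"
    using continuous_attains_inf[OF cZ _ continuous_on_fst[OF continuous_on_id]] by auto
  obtain \<tau> x where px: "p = (\<tau>, x)" by (cases p)
  have \<tau>: "0 \<le> \<tau>" "\<tau> \<le> \<tau>1" and x: "x \<in> {0..L}" and hp: "h (\<tau>, x) \<ge> 0"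
    using p(1) by (auto simp: Z_def px)
  have before: "h (s, y) < 0" if "0 \<le> s" "s < \<tau>" "y \<in> {0..L}" for s y
  proof (rule ccontr)
    assume "\<not> ?thesis"
    then have "(s, y) \<in> Z" using that \<tau> by (simp add: Z_def)
    then show False using p(2)[of "(s, y)"] that by (simp add: px)
  qed
  have init': "h (0, y) < 0" if "y \<in> {0..L}" for y using init[OF that] by (simp add: h_def E_def)
  have \<tau>0: "\<tau> > 0" using \<tau> hp init'[OF x] by (cases "\<tau> = 0") auto
  have le: "h (\<tau>, y) \<le> 0" if y: "y \<in> {0..L}" for y
  proof (rule ccontr)
    assume n: "\<not> ?thesis"
    have "continuous_on {0..\<tau>} (\<lambda>s. h (s, y))"
      by (rule continuous_on_compose2[OF ch]) (use \<tau> y in \<open>auto intro!: continuous_intros\<close>)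
    then obtain s where s: "0 \<le> s" "s \<le> \<tau>" "h (s, y) = 0"
      using IVT'[of "\<lambda>s. h (s, y)" 0 0 \<tau>] init'[OF y] n \<tau> by auto
    then show False using before[of s y] n y by (cases "s = \<tau>") auto
  qed
  have hx: "h (\<tau>, x) = 0" using le[OF x] hp by simp
  have h_le: "h (s, y) \<le> 0" if "0 \<le> s" "s \<le> \<tau>" "y \<in> {0..L}" for s y
    using that before[of s y] le[of y] by (cases "s = \<tau>") auto
  have cl: "classical_at \<Lambda> \<epsilon> L v vx \<tau>"
  proof (rule classical[OF \<tau>0])
    fix s y assume s: "s \<in> {0..\<tau>}" and y: "y \<in> {0..L}"
    have "E s * \<Phi> y \<le> B * \<Phi> y"
      using s y \<Phi>pos[OF y] B \<gamma> by (simp add: E_def)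
    then show "\<bar>v s y - u y\<bar> \<le> B * \<Phi> y" using h_le[of s y] s y by (simp add: h_def)
  qed
  have dv: "(v \<tau> has_real_derivative vx \<tau> y) (at y within {0..L})" if "y \<in> {0..L}" for y
    using cl that unfolding classical_at_def by blast
  have vxN: "vx \<tau> 0 = 0" "vx \<tau> L = 0" using cl unfolding classical_at_def by blast+
  \<comment> \<open>The sign selects the side of contact, so that upper and lower barrier are
    treated together.\<close>
  define \<sigma> :: real where "\<sigma> = (if v \<tau> x \<ge> u x then 1 else - 1)"
  have \<sigma>: "\<sigma> = 1 \<or> \<sigma> = - 1" "\<sigma> * \<sigma> = 1" by (auto simp: \<sigma>_def)
  define z where "z = E \<tau> * \<Phi> x"
  have z: "z > 0" using E \<Phi>pos[OF x] by (simp add: z_def)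
  have vz: "v \<tau> x = u x + \<sigma> * z" using hx by (auto simp: h_def \<sigma>_def z_def)
  have Dle: "\<sigma> * (v s y - u y) - E s * \<Phi> y \<le> 0" if "0 \<le> s" "s \<le> \<tau>" "y \<in> {0..L}" for s y
  proof -
    have "\<sigma> * (v s y - u y) \<le> \<bar>v s y - u y\<bar>" using \<sigma>(1) by auto
    then show ?thesis using h_le[OF that] by (simp add: h_def)
  qed
  have D0: "\<sigma> * (v \<tau> x - u x) - E \<tau> * \<Phi> x = 0" using vz \<sigma>(1) by (auto simp: z_def)
  let ?D = "\<lambda>y. \<sigma> * (v \<tau> y - u y) - E \<tau> * \<Phi> y"
  from super[OF x, unfolded strict_super_def] show False
  proof (elim disjE exE conjE)
    fix c d \<Phi>1 l
    assume cd: "0 \<le> c" "c < x" "x < d" "d \<le> L" and d\<Phi>: "\<forall>y\<in>{c<..<d}. (\<Phi> has_real_derivative \<Phi>1 y) (at y)"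
      and d\<Phi>1: "(\<Phi>1 has_real_derivative l) (at x)" and ineq: "(3 * (u x)\<^sup>2 - \<Lambda>) * \<Phi> x - \<epsilon>\<^sup>2 * l \<ge> \<gamma>\<^sub>0"
    have "x \<in> {0<..<L}" using cd by auto
    then obtain vt vxx where vt: "((\<lambda>s. v s x) has_real_derivative vt) (at \<tau>)"
      and vxx: "(vx \<tau> has_real_derivative vxx) (at x)" and pde: "vt = \<epsilon>\<^sup>2 * vxx - cubic \<Lambda> x (v \<tau> x)"
      using cl unfolding classical_at_def by blast
    have "\<sigma> * (vxx - cubic \<Lambda> x (u x) / \<epsilon>\<^sup>2) - E \<tau> * l \<le> 0"
    proof (rule second_derivative_max(2)[where f = ?D and a = c and b = d and c = x
          and ?f1.0 = "\<lambda>y. \<sigma> * (vx \<tau> y - w y) - E \<tau> * \<Phi>1 y"])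
      fix y assume y: "y \<in> {c<..<d}"
      then have "0 < y" "y < L" using cd by auto
      then have "(v \<tau> has_real_derivative vx \<tau> y) (at y)" using dv[of y] by (simp add: at_within_Icc_at)
      then show "(?D has_real_derivative \<sigma> * (vx \<tau> y - w y) - E \<tau> * \<Phi>1 y) (at y)"
        by (intro DERIV_diff DERIV_cmult du) (use d\<Phi> y in auto)
      show "?D y \<le> ?D x" using Dle[of \<tau> y] D0 \<tau> \<open>0 < y\<close> \<open>y < L\<close> by simp
    next
      show "((\<lambda>y. \<sigma> * (vx \<tau> y - w y) - E \<tau> * \<Phi>1 y) has_real_derivative
          \<sigma> * (vxx - cubic \<Lambda> x (u x) / \<epsilon>\<^sup>2) - E \<tau> * l) (at x)"
        by (intro DERIV_diff DERIV_cmult vxx dw d\<Phi>1)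
    qed (use cd in auto)
    from mult_left_mono[OF this, of "\<epsilon>\<^sup>2"]
    have space: "\<sigma> * (\<epsilon>\<^sup>2 * vxx) - \<sigma> * cubic \<Lambda> x (u x) \<le> \<epsilon>\<^sup>2 * (E \<tau> * l)"
      using \<epsilon> by (simp add: algebra_simps)
    have "- (\<sigma> * vt + \<gamma> * z) \<le> 0"
    proof (rule deriv_within_left_pos[where f = "\<lambda>s. - (\<sigma> * (v s x - u x) - E s * \<Phi> x)" and x = \<tau> and a = 0 and b = \<tau> and c = 0])
      have dE: "(E has_real_derivative E \<tau> * - \<gamma>) (at \<tau>)"
        unfolding E_def by (auto intro!: derivative_eq_intros)
      have "((\<lambda>s. - (\<sigma> * (v s x - u x) - E s * \<Phi> x)) has_real_derivative - (\<sigma> * (vt - 0) - E \<tau> * - \<gamma> * \<Phi> x)) (at \<tau>)"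
        by (intro DERIV_minus DERIV_diff DERIV_cmult DERIV_cmult_right vt DERIV_const dE)
      then have "((\<lambda>s. - (\<sigma> * (v s x - u x) - E s * \<Phi> x)) has_real_derivative - (\<sigma> * vt + \<gamma> * z)) (at \<tau>)"
        by (simp add: z_def mult_ac)
      then show "((\<lambda>s. - (\<sigma> * (v s x - u x) - E s * \<Phi> x)) has_real_derivative - (\<sigma> * vt + \<gamma> * z)) (at \<tau> within {0..\<tau>})"
        by (rule has_field_derivative_at_within)
      fix t assume "0 < t" "t < \<tau>"
      then show "- (\<sigma> * (v \<tau> x - u x) - E \<tau> * \<Phi> x) \<le> - (\<sigma> * (v t x - u x) - E t * \<Phi> x)"
        using Dle[of t x] D0 x by simp
    qed (use \<tau>0 in auto)
    then have time: "0 \<le> \<sigma> * vt + \<gamma> * z" by simp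
    \<comment> \<open>Exact Taylor expansion in the deviation; the last term has the good sign and
      is dropped below.\<close>
    have cub: "\<sigma> * (cubic \<Lambda> x (u x + \<sigma> * z) - cubic \<Lambda> x (u x)) = (3 * (u x)\<^sup>2 - \<Lambda>) * z + 3 * (\<sigma> * u x) * z\<^sup>2 + z ^ 3"
      using \<sigma>(1) by (auto simp: cubic_def power2_eq_square power3_eq_cube algebra_simps)
    have "- (\<sigma> * u x) \<le> b" using ub[OF x] \<sigma>(1) by auto
    then have "- (\<sigma> * u x) * (3 * z\<^sup>2) \<le> b * (3 * z\<^sup>2)" by (rule mult_right_mono) simp
    then have m3: "- (3 * (\<sigma> * u x) * z\<^sup>2) \<le> 3 * b * z\<^sup>2" by (simp only: mult_minus_left mult.commute mult.left_commute)
    have E1: "E \<tau> \<le> B" using \<gamma> \<tau> B by (simp add: E_def)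
    have b0: "b \<ge> 0" using ub[OF x] by simp
    have "\<sigma> * vt = \<sigma> * (\<epsilon>\<^sup>2 * vxx) - \<sigma> * cubic \<Lambda> x (u x + \<sigma> * z)" by (simp add: pde vz right_diff_distrib)
    also have "\<dots> = (\<sigma> * (\<epsilon>\<^sup>2 * vxx) - \<sigma> * cubic \<Lambda> x (u x)) - ((3 * (u x)\<^sup>2 - \<Lambda>) * z + 3 * (\<sigma> * u x) * z\<^sup>2 + z ^ 3)"
      using cub by (simp add: right_diff_distrib)
    also have "\<dots> \<le> \<epsilon>\<^sup>2 * (E \<tau> * l) - (3 * (u x)\<^sup>2 - \<Lambda>) * z + 3 * b * z\<^sup>2"
      using space m3 z zero_less_power[OF z, of 3] by linarith
    finally have "0 \<le> \<epsilon>\<^sup>2 * (E \<tau> * l) - (3 * (u x)\<^sup>2 - \<Lambda>) * z + 3 * b * z\<^sup>2 + \<gamma> * z" using time by linarith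
    also have "\<dots> = E \<tau> * (- ((3 * (u x)\<^sup>2 - \<Lambda>) * \<Phi> x - \<epsilon>\<^sup>2 * l) + (\<gamma> * \<Phi> x + 3 * b * E \<tau> * (\<Phi> x)\<^sup>2))"
      by (simp add: z_def power2_eq_square algebra_simps)
    finally have "0 \<le> - ((3 * (u x)\<^sup>2 - \<Lambda>) * \<Phi> x - \<epsilon>\<^sup>2 * l) + (\<gamma> * \<Phi> x + 3 * b * E \<tau> * (\<Phi> x)\<^sup>2)"
      using E[of \<tau>] by (simp add: zero_le_mult_iff)
    moreover have "3 * b * E \<tau> * (\<Phi> x)\<^sup>2 \<le> 3 * b * B * (\<Phi> x)\<^sup>2"
      using E1 b0 by (intro mult_right_mono mult_left_mono) auto
    ultimately show False using ineq small[OF x] by linarith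
  next
    assume w0: "w x = 0"
      and R: "x < L \<longrightarrow> (\<exists>l e. l < 0 \<and> e > 0 \<and> x + e \<le> L \<and> (\<Phi> has_real_derivative l) (at x within {x..x + e}))"
      and Lf: "0 < x \<longrightarrow> (\<exists>l e. l > 0 \<and> e > 0 \<and> 0 \<le> x - e \<and> (\<Phi> has_real_derivative l) (at x within {x - e..x}))"
    \<comment> \<open>As w x = 0, contact from inside bounds the slope of \<sigma> v from above by
      the right slope of the barrier, which is negative, and from below by its left slope, which is
      positive. At an end point only one of these applies, and it contradicts the Neumann
      condition.\<close>
    have right: "\<sigma> * vx \<tau> x < 0" if "x < L"
    proof -
      obtain l e where le: "l < 0" "e > 0" "x + e \<le> L" and d: "(\<Phi> has_real_derivative l) (at x within {x..x + e})"
        using R \<open>x < L\<close> by blast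
      have sub: "{x..x + e} \<subseteq> {0..L}" using le x by auto
      have "\<sigma> * (vx \<tau> x - w x) - E \<tau> * l \<le> 0"
      proof (rule deriv_within_right_neg[where f = ?D and x = x and a = x and b = "x + e" and c = "x + e"])
        show "(?D has_real_derivative \<sigma> * (vx \<tau> x - w x) - E \<tau> * l) (at x within {x..x + e})"
          by (intro DERIV_diff DERIV_cmult d DERIV_subset[OF dv[OF x] sub] has_field_derivative_at_within[OF du])
        fix t assume "x < t" "t < x + e"
        then show "?D t \<le> ?D x" using Dle[of \<tau> t] D0 \<tau> sub by auto
      qed (use le in auto)
      moreover have "E \<tau> * l < 0" using E le by (intro mult_pos_neg) auto
      ultimately show ?thesis using w0 by simp
    qed
    have left: "\<sigma> * vx \<tau> x > 0" if "0 < x"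
    proof -
      obtain l e where le: "l > 0" "e > 0" "0 \<le> x - e" and d: "(\<Phi> has_real_derivative l) (at x within {x - e..x})"
        using Lf \<open>0 < x\<close> by blast
      have sub: "{x - e..x} \<subseteq> {0..L}" using le x by auto
      have "- (\<sigma> * (vx \<tau> x - w x) - E \<tau> * l) \<le> 0"
      proof (rule deriv_within_left_pos[where f = "\<lambda>y. - ?D y" and x = x and a = "x - e" and b = x and c = "x - e"])
        show "((\<lambda>y. - ?D y) has_real_derivative - (\<sigma> * (vx \<tau> x - w x) - E \<tau> * l)) (at x within {x - e..x})"
          by (intro DERIV_minus DERIV_diff DERIV_cmult d DERIV_subset[OF dv[OF x] sub] has_field_derivative_at_within[OF du])
        fix t assume "x - e < t" "t < x"
        then show "- ?D x \<le> - ?D t" using Dle[of \<tau> t] D0 \<tau> sub by auto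
      qed (use le in auto)
      moreover have "E \<tau> * l > 0" using E le by simp
      ultimately show ?thesis using w0 by simp
    qed
    show False
      using right left vxN x L by (cases "x = 0"; cases "x = L") auto
  qed
qed

lemma fold_cell:
  assumes "x \<in> {real j * pi..real (Suc j) * pi}"
  shows "arccos (cos x) = (if even j then x - real j * pi else real (Suc j) * pi - x)"
proof (cases "even j")
  case True
  have "cos x = cos ((x - real j * pi) + real j * pi)" by simp
  also have "\<dots> = cos (x - real j * pi)" using True by (simp only: cos_add_npi) simp
  finally show ?thesis using assms True by (simp add: arccos_cos algebra_simps)
next
  case False
  have "cos x = cos (- x)" by simp
  also have "\<dots> = (- 1) ^ Suc j * cos (- x)" using False by simp
  also have "\<dots> = cos (- x + real (Suc j) * pi)" by (rule cos_add_npi[symmetric])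
  also have "\<dots> = cos (real (Suc j) * pi - x)" by (simp add: algebra_simps)
  finally show ?thesis using assms False by (simp add: arccos_cos algebra_simps)
qed

section \<open>A supersolution of the linearization on one half period and its continuation\<close>

context bistable
begin

text \<open>The correction to \<open>u\<^sub>p'\<close> carries a factor 1/sinh(k \<pi>/2), with k =
  \<kappa>/(2 \<epsilon>), and between the end regions its cosh is at most cosh(k(\<pi>/2 -
  \<rho>)). The quotient decays like e^(-k \<rho>), and the condition lets half of sin \<rho> absorb
  it.\<close>

definition super_small :: "real \<Rightarrow> bool" where
  "super_small \<epsilon> \<longleftrightarrow> 0 < \<epsilon> \<and>
     4 * K * (\<Lambda> + \<kappa>\<^sup>2) / (\<kappa> * \<epsilon>) * cosh (\<kappa> / (2 * \<epsilon>) * (pi / 2 - \<rho>)) \<le> sin \<rho> / 2 * sinh (\<kappa> / (2 * \<epsilon>) * (pi / 2))"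

lemma eventually_super_small: "eventually super_small (at_right 0)"
proof -
  define C where "C = 4 * K * (\<Lambda> + \<kappa>\<^sup>2) / \<kappa>"
  have sr: "sin \<rho> > 0" using \<rho> by (intro sin_gt_zero) auto
  have "eventually (\<lambda>\<epsilon>. 8 * C / sin \<rho> / \<epsilon> ^ 1 < exp (\<kappa> * \<rho> / 2 / \<epsilon>)) (at_right 0)"
    by (rule exp_inverse_dominates) (use \<kappa> \<rho> in simp)
  moreover have "eventually (\<lambda>\<epsilon>. 2 / \<epsilon> ^ 0 < exp (\<kappa> * pi / 2 / \<epsilon>)) (at_right 0)"
    by (rule exp_inverse_dominates) (use \<kappa> in simp)
  moreover have "eventually (\<lambda>\<epsilon>. \<epsilon> > (0::real)) (at_right 0)" by (rule eventually_at_right_less)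
  ultimately show ?thesis
  proof eventually_elim
    case (elim \<epsilon>)
    define x where "x = \<kappa> / (2 * \<epsilon>) * (pi / 2)"
    define y where "y = \<kappa> / (2 * \<epsilon>) * \<rho>"
    have yx: "y \<le> x" unfolding x_def y_def using \<kappa> \<rho> elim by (intro mult_left_mono) auto
    have ey: "8 * C / sin \<rho> / \<epsilon> < exp y" using elim(1) by (simp add: y_def)
    have "2 < exp (2 * x)" using elim(2) by (simp add: x_def mult.commute)
    then have "2 * exp (- x) \<le> exp (2 * x) * exp (- x)" by (intro mult_right_mono) auto
    also have "\<dots> = exp x" by (simp flip: exp_add)
    finally have sx: "exp x / 4 \<le> sinh x" by (simp add: sinh_def)
    have "exp (- (x - y)) \<le> exp (x - y)" using yx by simp
    then have cxy: "cosh (x - y) \<le> exp (x - y)" by (simp add: cosh_def)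
    have "C / \<epsilon> = sin \<rho> / 8 * (8 * C / sin \<rho> / \<epsilon>)" using sr by simp
    also have "\<dots> \<le> sin \<rho> / 8 * exp y" using ey sr by (intro mult_left_mono) auto
    finally have "C / \<epsilon> * cosh (x - y) \<le> sin \<rho> / 8 * exp y * exp (x - y)"
      using cxy sr by (intro mult_mono) (auto simp: cosh_real_nonneg)
    also have "\<dots> = sin \<rho> / 2 * (exp x / 4)" by (simp flip: exp_add add: mult.assoc)
    also have "\<dots> \<le> sin \<rho> / 2 * sinh x" using sx sr by (intro mult_left_mono) auto
    finally have "C / \<epsilon> * cosh (x - y) \<le> sin \<rho> / 2 * sinh x" .
    moreover have "C / \<epsilon> = 4 * K * (\<Lambda> + \<kappa>\<^sup>2) / (\<kappa> * \<epsilon>)" by (simp add: C_def)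
    moreover have "x - y = \<kappa> / (2 * \<epsilon>) * (pi / 2 - \<rho>)" by (simp add: x_def y_def right_diff_distrib)
    ultimately show ?case using elim by (simp only: super_small_def x_def[symmetric])
  qed
qed

text \<open>\<open>u\<^sub>p'\<close> is a positive supersolution of the linearized equation on \<open>[0, \<pi>]\<close>, since differentiating the
  equation produces \<open>sin t \<ge> 0\<close>. A small multiple of \<open>cosh (k (t - \<pi>/2))\<close> corrects its derivatives at the
  end points; there it is itself a supersolution, and in between it is exponentially small.\<close>

lemma supersolution_exists:
  assumes up: "up_profile \<epsilon> u w" and small: "up_small \<epsilon>" "super_small \<epsilon>"
  obtains \<phi> \<phi>1 \<phi>2 \<gamma>\<^sub>0 where
    "\<And>t. t \<in> {0..pi} \<Longrightarrow> (\<phi> has_real_derivative \<phi>1 t) (at t within {0..pi})"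
    "\<And>t. t \<in> {0..pi} \<Longrightarrow> (\<phi>1 has_real_derivative \<phi>2 t) (at t within {0..pi})"
    "\<And>t. t \<in> {0..pi} \<Longrightarrow> \<phi> t > 0" "\<phi>1 0 < 0" "\<phi>1 pi > 0"
    "\<And>t. t \<in> {0..pi} \<Longrightarrow> (3 * (u t)\<^sup>2 - \<Lambda>) * \<phi> t - \<epsilon>\<^sup>2 * \<phi>2 t \<ge> \<gamma>\<^sub>0"
    "\<gamma>\<^sub>0 > 0"
proof -
  interpret layer \<Lambda> b r \<delta> Ulo Umid Uup \<epsilon> u w by (rule up_profile_layer[OF up small(1)])
  note sym = up_profile_symmetries[OF up \<epsilon>]
  have w0: "w 0 = 0" and wl: "\<And>t. 0 < t \<Longrightarrow> t < pi / 2 \<Longrightarrow> w t > 0" using up by (auto simp: up_profile_def)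
  have wnn: "w t \<ge> 0" if t: "t \<in> {0..pi}" for t
  proof -
    have half: "w t \<ge> 0" if "0 \<le> t" "t \<le> pi / 2" for t
    proof -
      consider "t = 0" | "0 < t" "t < pi / 2" | "t = pi / 2" using \<open>0 \<le> t\<close> \<open>t \<le> pi / 2\<close> by linarith
      then show ?thesis
      proof cases
        case 3
        have "w (pi / 2) > 0" by (rule w_pos) (use \<rho> in linarith)+
        then show ?thesis unfolding 3 by (rule less_imp_le)
      qed (use w0 wl[of t] in auto)
    qed
    show ?thesis using half[of t] half[of "pi - t"] sym(3)[of t] t by (cases "t \<le> pi / 2") auto
  qed
  \<comment> \<open>Half of the rate \<kappa>/\<epsilon>: then \<epsilon>^2 k^2 = \<kappa>^2/4, and
    3/4 \<kappa>^2 is left as a strict gain in the end regions.\<close>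
  define k where "k = \<kappa> / (2 * \<epsilon>)"
  \<comment> \<open>This amplitude gives the cosh term end slopes of size 2K/\<epsilon>^2, twice the
    bound for |w'|, so that they determine the signs of \<phi>1 at both ends.\<close>
  define A where "A = 2 * K / (\<epsilon>\<^sup>2 * (k * sinh (k * (pi / 2))))"
  have k: "k > 0" "\<epsilon>\<^sup>2 * (k * k) = \<kappa>\<^sup>2 / 4" using \<kappa> \<epsilon> by (simp_all add: k_def power2_eq_square)
  have sh: "sinh (k * (pi / 2)) > 0" using k by simp
  have A: "A > 0" using K \<epsilon> k sh by (simp add: A_def)
  have Ak: "A * (k * sinh (k * (pi / 2))) = 2 * (K / \<epsilon>\<^sup>2)" using k sh \<epsilon> by (simp add: A_def)
  let ?\<theta> = "\<lambda>t. cosh (k * (t - pi / 2))"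
  define \<phi> where "\<phi> t = w t + A * ?\<theta> t" for t
  define \<phi>1 where "\<phi>1 t = cubic \<Lambda> t (u t) / \<epsilon>\<^sup>2 + A * (k * sinh (k * (t - pi / 2)))" for t
  define \<phi>2 where "\<phi>2 t = ((3 * (u t)\<^sup>2 - \<Lambda>) * w t - sin t) / \<epsilon>\<^sup>2 + A * (k * (k * ?\<theta> t))" for t
  have d1: "(\<phi> has_real_derivative \<phi>1 t) (at t within {0..pi})" if "t \<in> {0..pi}" for t
    unfolding \<phi>_def \<phi>1_def by (rule DERIV_add[OF dw[OF that]]) (auto intro!: derivative_eq_intros)
  have d2: "(\<phi>1 has_real_derivative \<phi>2 t) (at t within {0..pi})" if "t \<in> {0..pi}" for t
    unfolding \<phi>1_def \<phi>2_def by (rule DERIV_add[OF DERIV_cdivide[OF dz[OF that]]]) (auto intro!: derivative_eq_intros)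
  have \<phi>pos: "\<phi> t > 0" if "t \<in> {0..pi}" for t
    unfolding \<phi>_def using wnn[OF that] A by (intro add_nonneg_pos mult_pos_pos) (auto simp: cosh_real_pos)
  have cb: "\<bar>cubic \<Lambda> t (u t) / \<epsilon>\<^sup>2\<bar> \<le> K / \<epsilon>\<^sup>2" if "t \<in> {0..pi}" for t
    using cubic_bound[OF bounds[OF that]] by (simp add: K_def divide_right_mono)
  have Kp: "K / \<epsilon>\<^sup>2 > 0" using K \<epsilon> by simp
  have e0: "\<phi>1 0 = cubic \<Lambda> 0 (u 0) / \<epsilon>\<^sup>2 - 2 * (K / \<epsilon>\<^sup>2)"
  proof -
    have "sinh (k * (0 - pi / 2)) = - sinh (k * (pi / 2))" by (simp flip: sinh_minus)
    then show ?thesis unfolding \<phi>1_def Ak[symmetric] by simp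
  qed
  have e1: "\<phi>1 pi = cubic \<Lambda> pi (u pi) / \<epsilon>\<^sup>2 + 2 * (K / \<epsilon>\<^sup>2)"
  proof -
    have "pi - pi / 2 = pi / 2" by simp
    then show ?thesis unfolding \<phi>1_def Ak[symmetric] by simp
  qed
  have c01: "\<bar>cubic \<Lambda> 0 (u 0) / \<epsilon>\<^sup>2\<bar> \<le> K / \<epsilon>\<^sup>2" "\<bar>cubic \<Lambda> pi (u pi) / \<epsilon>\<^sup>2\<bar> \<le> K / \<epsilon>\<^sup>2"
    by (rule cb; simp)+
  have "\<phi>1 0 < 0" using e0 c01 Kp by linarith
  have "\<phi>1 pi > 0" using e1 c01 Kp by linarith
  define \<gamma>\<^sub>0 where "\<gamma>\<^sub>0 = min (A * (3 / 4 * \<kappa>\<^sup>2)) (sin \<rho> / 2)"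
  have sr: "sin \<rho> > 0" using \<rho> by (intro sin_gt_zero) auto
  have "3 / 4 * \<kappa>\<^sup>2 > 0" using zero_less_power[OF \<kappa>(1), of 2] by linarith
  then have "A * (3 / 4 * \<kappa>\<^sup>2) > 0" by (rule mult_pos_pos[OF A])
  then have "\<gamma>\<^sub>0 > 0" using sr unfolding \<gamma>\<^sub>0_def by linarith
  \<comment> \<open>The sine is all that w contributes, by the differentiated equation; the rest
    comes from the cosh term.\<close>
  have L\<phi>: "(3 * (u t)\<^sup>2 - \<Lambda>) * \<phi> t - \<epsilon>\<^sup>2 * \<phi>2 t = sin t + A * ((3 * (u t)\<^sup>2 - \<Lambda> - \<kappa>\<^sup>2 / 4) * ?\<theta> t)" for t
  proof -
    have "\<epsilon>\<^sup>2 * \<phi>2 t = ((3 * (u t)\<^sup>2 - \<Lambda>) * w t - sin t) + A * ((\<epsilon>\<^sup>2 * (k * k)) * ?\<theta> t)"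
      using \<epsilon> by (simp add: \<phi>2_def distrib_left mult_ac)
    then show ?thesis unfolding k(2) by (simp add: \<phi>_def algebra_simps)
  qed
  have "(3 * (u t)\<^sup>2 - \<Lambda>) * \<phi> t - \<epsilon>\<^sup>2 * \<phi>2 t \<ge> \<gamma>\<^sub>0" if t: "t \<in> {0..pi}" for t
  proof (cases "t \<le> \<rho> \<or> pi - \<rho> \<le> t")
    case True
    then have "(u t \<le> - m' \<and> u t \<le> - m') \<or> (m' \<le> u t \<and> m' \<le> u t)" using left'[of t] right'[of t] t by auto
    from quotient_ge[OF this] have "\<kappa>\<^sup>2 \<le> 3 * (u t)\<^sup>2 - \<Lambda>" unfolding power2_eq_square[of "u t"] by linarith
    then have q: "3 / 4 * \<kappa>\<^sup>2 \<le> 3 * (u t)\<^sup>2 - \<Lambda> - \<kappa>\<^sup>2 / 4" by linarith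
    have "3 / 4 * \<kappa>\<^sup>2 * 1 \<le> (3 * (u t)\<^sup>2 - \<Lambda> - \<kappa>\<^sup>2 / 4) * ?\<theta> t"
      by (rule mult_mono) (use q zero_le_power2[of \<kappa>] in \<open>linarith | simp add: cosh_real_ge_1\<close>)+
    then have "A * (3 / 4 * \<kappa>\<^sup>2) \<le> A * ((3 * (u t)\<^sup>2 - \<Lambda> - \<kappa>\<^sup>2 / 4) * ?\<theta> t)"
      using A by (intro mult_left_mono) auto
    moreover have "sin t \<ge> 0" using t by (intro sin_ge_zero) auto
    ultimately show ?thesis unfolding L\<phi> \<gamma>\<^sub>0_def by linarith
  next
    case False
    have st: "sin \<rho> \<le> sin t" using False \<rho> by (intro sin_ge_sin_of_mid) auto
    have kt: "\<bar>k * (t - pi / 2)\<bar> \<le> k * (pi / 2 - \<rho>)"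
      using False k by (auto simp: abs_mult intro!: mult_left_mono)
    then have "cosh \<bar>k * (t - pi / 2)\<bar> \<le> cosh (k * (pi / 2 - \<rho>))"
      using cosh_real_nonneg_le_iff[OF abs_ge_zero order_trans[OF abs_ge_zero kt]] by blast
    then have "?\<theta> t \<le> cosh (k * (pi / 2 - \<rho>))" by simp
    then have "(\<Lambda> + \<kappa>\<^sup>2) * ?\<theta> t \<le> (\<Lambda> + \<kappa>\<^sup>2) * cosh (k * (pi / 2 - \<rho>))"
      using \<Lambda>_pos by (intro mult_left_mono) auto
    moreover have "- ((\<Lambda> + \<kappa>\<^sup>2) * ?\<theta> t) \<le> (3 * (u t)\<^sup>2 - \<Lambda> - \<kappa>\<^sup>2 / 4) * ?\<theta> t"
    proof -
      have "- (\<Lambda> + \<kappa>\<^sup>2) \<le> 3 * (u t)\<^sup>2 - \<Lambda> - \<kappa>\<^sup>2 / 4"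
        using zero_le_power2[of \<kappa>] zero_le_power2[of "u t"] by linarith
      then have "- (\<Lambda> + \<kappa>\<^sup>2) * ?\<theta> t \<le> (3 * (u t)\<^sup>2 - \<Lambda> - \<kappa>\<^sup>2 / 4) * ?\<theta> t"
        by (rule mult_right_mono) (rule cosh_real_nonneg)
      then show ?thesis by (simp only: mult_minus_left)
    qed
    ultimately have "- ((\<Lambda> + \<kappa>\<^sup>2) * cosh (k * (pi / 2 - \<rho>))) \<le> (3 * (u t)\<^sup>2 - \<Lambda> - \<kappa>\<^sup>2 / 4) * ?\<theta> t" by linarith
    from mult_left_mono[OF this less_imp_le[OF A]]
    have 1: "- (A * ((\<Lambda> + \<kappa>\<^sup>2) * cosh (k * (pi / 2 - \<rho>)))) \<le> A * ((3 * (u t)\<^sup>2 - \<Lambda> - \<kappa>\<^sup>2 / 4) * ?\<theta> t)"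
      by (simp only: mult_minus_right)
    have "A * ((\<Lambda> + \<kappa>\<^sup>2) * cosh (k * (pi / 2 - \<rho>))) \<le> sin \<rho> / 2"
    proof -
      have e: "\<epsilon>\<^sup>2 * k = \<kappa> * \<epsilon> / 2" using \<epsilon> by (simp add: k_def power2_eq_square)
      have "A = 2 * K / ((\<epsilon>\<^sup>2 * k) * sinh (k * (pi / 2)))" by (simp add: A_def mult.assoc)
      also have "\<dots> = 4 * K / (\<kappa> * \<epsilon>) / sinh (k * (pi / 2))" unfolding e by simp
      finally have "A * ((\<Lambda> + \<kappa>\<^sup>2) * cosh (k * (pi / 2 - \<rho>))) =
          4 * K * (\<Lambda> + \<kappa>\<^sup>2) / (\<kappa> * \<epsilon>) * cosh (k * (pi / 2 - \<rho>)) / sinh (k * (pi / 2))"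
        by simp
      also have "\<dots> \<le> sin \<rho> / 2"
        unfolding pos_divide_le_eq[OF sh] using small(2) unfolding super_small_def k_def[symmetric] by blast
      finally show ?thesis .
    qed
    then show ?thesis using 1 st unfolding L\<phi> \<gamma>\<^sub>0_def by linarith
  qed
  then show thesis using that[of \<phi> \<phi>1 \<phi>2 \<gamma>\<^sub>0] d1 d2 \<phi>pos \<open>\<phi>1 0 < 0\<close> \<open>\<phi>1 pi > 0\<close> \<open>\<gamma>\<^sub>0 > 0\<close> by blast
qed

text \<open>u is even and 2\<pi>-periodic, so the inequality for \<phi> carries over to its even
  periodic continuation inside each cell. At the nodes j \<pi> the signs of \<phi>1 make \<Phi> fall
  away on both sides, and w vanishes there, which is the second alternative of
  \<open>strict_super\<close>.\<close>

lemma extended_supersolution: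
  assumes up: "up_profile \<epsilon> u w" and small: "up_small \<epsilon>" "super_small \<epsilon>" and L: "L = real k * pi"
  obtains \<Phi> \<gamma>\<^sub>0 where "\<gamma>\<^sub>0 > 0" "continuous_on {0..L} \<Phi>" "\<And>x. \<Phi> x > 0"
    "\<And>x. x \<in> {0..L} \<Longrightarrow> strict_super \<Lambda> \<epsilon> L \<gamma>\<^sub>0 u w \<Phi> x"
proof -
  obtain \<phi> \<phi>1 \<phi>2 \<gamma>\<^sub>0 where
        d1: "\<And>t. t \<in> {0..pi} \<Longrightarrow> (\<phi> has_real_derivative \<phi>1 t) (at t within {0..pi})"
    and d2: "\<And>t. t \<in> {0..pi} \<Longrightarrow> (\<phi>1 has_real_derivative \<phi>2 t) (at t within {0..pi})"
    and pos: "\<And>t. t \<in> {0..pi} \<Longrightarrow> \<phi> t > 0" and ends: "\<phi>1 0 < 0" "\<phi>1 pi > 0"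
    and ineq: "\<And>t. t \<in> {0..pi} \<Longrightarrow> (3 * (u t)\<^sup>2 - \<Lambda>) * \<phi> t - \<epsilon>\<^sup>2 * \<phi>2 t \<ge> \<gamma>\<^sub>0"
    and \<gamma>\<^sub>0: "\<gamma>\<^sub>0 > 0"
    by (rule supersolution_exists[OF up small], rule that, assumption+)
  have \<epsilon>: "\<epsilon> > 0" using small by (simp add: up_small_def)
  have even: "u (- t) = u t" for t by (rule up_profile_symmetries(1)[OF up \<epsilon>])
  have per: "u (t + 2 * pi) = u t" for t using up by (simp add: up_profile_def)
  define \<Phi> where "\<Phi> x = \<phi> (arccos (cos x))" for x
  have s: "arccos (cos x) \<in> {0..pi}" for x :: real by (simp add: arccos_lbound arccos_ubound)
  have us: "u (arccos (cos x)) = u x" if x: "x \<in> {real j * pi..real (Suc j) * pi}" for x j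
  proof (cases "even j")
    case True
    then obtain n where n: "j = 2 * n" by blast
    have "arccos (cos x) = x - 2 * pi * real n" using fold_cell[OF x] n by simp
    then show ?thesis using periodic_nat[of u "x - 2 * pi * real n" n, OF per] by simp
  next
    case False
    then obtain n where n: "j = 2 * n + 1" by (elim oddE)
    have "arccos (cos x) = - x + 2 * pi * real (Suc n)" using fold_cell[OF x] n by (simp add: algebra_simps)
    then show ?thesis using periodic_nat[of u "- x" "Suc n", OF per] even[of x] by simp
  qed
  define \<sigma> :: "nat \<Rightarrow> real" where "\<sigma> j = (if even j then 1 else - 1)" for j
  define a where "a j = (if even j then - (real j * pi) else real (Suc j) * pi)" for j
  have cell: "arccos (cos x) = a j + \<sigma> j * x" if "x \<in> {real j * pi..real (Suc j) * pi}" for x j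
    using fold_cell[OF that] by (simp add: a_def \<sigma>_def)
  have \<sigma>: "\<sigma> j * \<sigma> j = 1" for j by (simp add: \<sigma>_def)
  have d\<Phi>: "(\<Phi> has_real_derivative \<sigma> j * \<phi>1 (a j + \<sigma> j * x)) (at x within {real j * pi..real (Suc j) * pi})"
    if x: "x \<in> {real j * pi..real (Suc j) * pi}" for x j
  proof -
    let ?C = "{real j * pi..real (Suc j) * pi}"
    have im: "(\<lambda>y. a j + \<sigma> j * y) ` ?C \<subseteq> {0..pi}" using s cell[of _ j] by (metis image_subsetI)
    have "(\<phi> has_real_derivative \<phi>1 (a j + \<sigma> j * x)) (at (a j + \<sigma> j * x) within (\<lambda>y. a j + \<sigma> j * y) ` ?C)"
      by (rule DERIV_subset[OF d1 im]) (use im x in blast)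
    moreover have "((\<lambda>y. a j + \<sigma> j * y) has_real_derivative \<sigma> j) (at x within ?C)"
      by (auto intro!: derivative_eq_intros)
    ultimately have "((\<phi> \<circ> (\<lambda>y. a j + \<sigma> j * y)) has_real_derivative \<phi>1 (a j + \<sigma> j * x) * \<sigma> j) (at x within ?C)"
      by (rule DERIV_image_chain)
    then have "((\<phi> \<circ> (\<lambda>y. a j + \<sigma> j * y)) has_real_derivative \<sigma> j * \<phi>1 (a j + \<sigma> j * x)) (at x within ?C)"
      by (simp only: mult.commute)
    then show ?thesis
      by (rule has_field_derivative_transform_within[OF _ zero_less_one x]) (simp add: \<Phi>_def cell)
  qed
  have nodes: "a j + \<sigma> j * (real j * pi) = (if even j then 0 else pi)"
    "a j + \<sigma> j * (real (Suc j) * pi) = (if even j then pi else 0)" for j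
    by (simp_all add: a_def \<sigma>_def algebra_simps)
  have "continuous_on {0..L} \<Phi>" unfolding \<Phi>_def
    by (rule continuous_on_compose2[OF DERIV_continuous_on[OF d1]]) (use s in \<open>auto intro!: continuous_intros\<close>)
  moreover have "\<Phi> x > 0" for x unfolding \<Phi>_def by (rule pos[OF s])
  moreover have "strict_super \<Lambda> \<epsilon> L \<gamma>\<^sub>0 u w \<Phi> x" if x: "x \<in> {0..L}" for x
  proof -
    define j where "j = nat \<lfloor>x / pi\<rfloor>"
    have "real j = \<lfloor>x / pi\<rfloor>" using x by (simp add: j_def)
    then have "real j \<le> x / pi" "x / pi < real j + 1" by linarith+
    then have jx: "real j * pi \<le> x" "x < real (Suc j) * pi" by (simp_all add: field_simps)
    have "x \<le> real k * pi" using x L by simp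
    then have "real j * pi \<le> real k * pi" using jx(1) by linarith
    then have jk: "j \<le> k" by simp
    have Lc: "real (Suc i) * pi \<le> L" if "i < k" for i
      unfolding L using that by (intro mult_right_mono) auto
    show ?thesis
    proof (cases "x = real j * pi")
      case False
      have cx: "real j * pi < x" using False jx by simp
      have "j \<noteq> k" using x cx L by auto
      then have jk': "j < k" using jk by simp
      have xc: "x \<in> {real j * pi..real (Suc j) * pi}" using jx by simp
      have t: "a j + \<sigma> j * y \<in> {0..pi}" if "y \<in> {real j * pi..real (Suc j) * pi}" for y
        using s[of y] cell[OF that] by simp
      have 1: "(\<Phi> has_real_derivative \<sigma> j * \<phi>1 (a j + \<sigma> j * y)) (at y)" if "y \<in> {real j * pi<..<real (Suc j) * pi}" for y
        using d\<Phi>[of y j] that by (simp add: at_within_Icc_at del: of_nat_Suc)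
      have "a j + \<sigma> j * x \<in> {0<..<pi}"
        using cx jx by (auto simp: a_def \<sigma>_def algebra_simps)
      then have "(\<phi>1 has_real_derivative \<phi>2 (a j + \<sigma> j * x)) (at (a j + \<sigma> j * x))"
        using d2[of "a j + \<sigma> j * x"] by (simp add: at_within_Icc_at)
      then have "((\<lambda>y. \<phi>1 (a j + \<sigma> j * y)) has_real_derivative \<phi>2 (a j + \<sigma> j * x) * \<sigma> j) (at x)"
        by (rule DERIV_chain2) (auto intro!: derivative_eq_intros)
      then have "((\<lambda>y. \<sigma> j * \<phi>1 (a j + \<sigma> j * y)) has_real_derivative \<sigma> j * (\<phi>2 (a j + \<sigma> j * x) * \<sigma> j)) (at x)"
        by (rule DERIV_cmult)
      moreover have "\<sigma> j * (\<phi>2 (a j + \<sigma> j * x) * \<sigma> j) = \<phi>2 (a j + \<sigma> j * x)"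
        using \<sigma>[of j] by (simp add: mult_ac)
      ultimately have 2: "((\<lambda>y. \<sigma> j * \<phi>1 (a j + \<sigma> j * y)) has_real_derivative \<phi>2 (a j + \<sigma> j * x)) (at x)"
        by (simp only:)
      have 3: "(3 * (u x)\<^sup>2 - \<Lambda>) * \<Phi> x - \<epsilon>\<^sup>2 * \<phi>2 (a j + \<sigma> j * x) \<ge> \<gamma>\<^sub>0"
        using ineq[OF s[of x]] unfolding us[OF xc] unfolding \<Phi>_def cell[OF xc] .
      show ?thesis unfolding strict_super_def
        by (rule disjI1, rule exI[of _ "real j * pi"], rule exI[of _ "real (Suc j) * pi"])
           (use 1 2 3 cx jx Lc[OF jk'] in \<open>force simp del: of_nat_Suc\<close>)
    next
      case True
      have "w x = 0" unfolding True by (rule up_profile_extended(2)[OF up small(1)])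
      moreover have "\<exists>l e. l < 0 \<and> e > 0 \<and> x + e \<le> L \<and> (\<Phi> has_real_derivative l) (at x within {x..x + e})" if "x < L"
      proof -
        have "j \<noteq> k" using that True L by auto
        then have jk': "j < k" using jk by simp
        have e: "x + pi = real (Suc j) * pi" using True by (simp add: algebra_simps)
        have xc: "x \<in> {real j * pi..real (Suc j) * pi}" using jx by simp
        have n: "a j + \<sigma> j * x = (if even j then 0 else pi)" unfolding True by (rule nodes)
        have "(\<Phi> has_real_derivative \<sigma> j * \<phi>1 (if even j then 0 else pi)) (at x within {x..x + pi})"
          using d\<Phi>[OF xc] unfolding n e[symmetric] True[symmetric] .
        moreover have "\<sigma> j * \<phi>1 (if even j then 0 else pi) < 0" using ends by (simp add: \<sigma>_def)
        moreover have "x + pi \<le> L" unfolding e by (rule Lc[OF jk'])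
        ultimately show ?thesis using pi_gt_zero by blast
      qed
      moreover have "\<exists>l e. l > 0 \<and> e > 0 \<and> 0 \<le> x - e \<and> (\<Phi> has_real_derivative l) (at x within {x - e..x})" if "0 < x"
      proof -
        obtain i where i: "j = Suc i" using \<open>0 < x\<close> True by (cases j) auto
        have e: "x - pi = real i * pi" using True i by (simp add: algebra_simps)
        have x': "x = real (Suc i) * pi" using True i by simp
        have xc: "x \<in> {real i * pi..real (Suc i) * pi}" unfolding x' by simp
        have n: "a i + \<sigma> i * x = (if even i then pi else 0)" unfolding x' by (rule nodes)
        have "(\<Phi> has_real_derivative \<sigma> i * \<phi>1 (if even i then pi else 0)) (at x within {x - pi..x})"
          using d\<Phi>[OF xc] unfolding n e[symmetric] x'[symmetric] .
        moreover have "\<sigma> i * \<phi>1 (if even i then pi else 0) > 0" using ends by (simp add: \<sigma>_def)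
        moreover have "0 \<le> x - pi" unfolding e by simp
        ultimately show ?thesis using pi_gt_zero by blast
      qed
      ultimately show ?thesis unfolding strict_super_def by blast
    qed
  qed
  ultimately show thesis using that \<gamma>\<^sub>0 by blast
qed

end

section \<open>Global existence and asymptotic stability\<close>

lemma clamp_lipschitz: "\<bar>max (- R) (min R u) - max (- R) (min R v)\<bar> \<le> \<bar>u - v\<bar>" for u v R :: real
  by linarith

lemma cubic_lipschitz:
  assumes "\<bar>u\<bar> \<le> R" "\<bar>v\<bar> \<le> R"
  shows "\<bar>cubic \<Lambda> t u - cubic \<Lambda> t v\<bar> \<le> (3 * R\<^sup>2 + \<bar>\<Lambda>\<bar>) * \<bar>u - v\<bar>"
proof -
  have "u\<^sup>2 \<le> R\<^sup>2" "v\<^sup>2 \<le> R\<^sup>2" using assms by (simp_all add: abs_le_square_iff[symmetric])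
  moreover have "\<bar>u * v\<bar> \<le> R * R" unfolding abs_mult using assms by (intro mult_mono) auto
  ultimately have "\<bar>u\<^sup>2 + u * v + v\<^sup>2 - \<Lambda>\<bar> \<le> 3 * R\<^sup>2 + \<bar>\<Lambda>\<bar>"
    using zero_le_power2[of u] zero_le_power2[of v] unfolding power2_eq_square[of R] by linarith
  then show ?thesis unfolding cubic_diff abs_mult by (rule mult_right_mono) simp
qed

text \<open>The truncated solution satisfies the true equation only while it stays within the
  barrier, and the barrier argument needs the equation. The conditional premise of
  \<open>barrier\<close> breaks this circle: it remains to check that the bound up to \<tau> yields
  the equation at \<tau>.\<close>

lemma parabolic_solution_below_barrier:
  fixes u w \<Phi> v0 :: "real \<Rightarrow> real"
  assumes \<epsilon>: "\<epsilon> > 0" and L: "L = real k * pi" "k > 0"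
    and du: "\<And>x. (u has_real_derivative w x) (at x)"
    and dw: "\<And>x. (w has_real_derivative cubic \<Lambda> x (u x) / \<epsilon>\<^sup>2) (at x)"
    and ub: "\<And>x. x \<in> {0..L} \<Longrightarrow> \<bar>u x\<bar> \<le> b"
    and \<Phi>c: "continuous_on {0..L} \<Phi>" and \<Phi>pos: "\<And>x. x \<in> {0..L} \<Longrightarrow> \<Phi> x > 0"
    and \<Phi>max: "\<And>x. x \<in> {0..L} \<Longrightarrow> \<Phi> x \<le> \<Phi>max"
    and super: "\<And>x. x \<in> {0..L} \<Longrightarrow> strict_super \<Lambda> \<epsilon> L \<gamma>\<^sub>0 u w \<Phi> x"
    and B: "B > 0" and \<gamma>: "\<gamma> > 0"
    and small: "\<And>x. x \<in> {0..L} \<Longrightarrow> \<gamma> * \<Phi> x + 3 * b * B * (\<Phi> x)\<^sup>2 < \<gamma>\<^sub>0"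
    and v0: "continuous_on {0..L} v0" "\<And>x. x \<in> {0..L} \<Longrightarrow> \<bar>v0 x - u x\<bar> < B * \<Phi> x"
  shows "\<exists>v. parabolic_solution \<Lambda> \<epsilon> L v \<and> (\<forall>x\<in>{0..L}. v 0 x = v0 x)"
proof -
  have Lpos: "L > 0" using L by simp
  have L0: "0 \<in> {0..L}" using Lpos by simp
  define R where "R = b + B * \<Phi>max + 1"
  have "0 < \<Phi>max" using \<Phi>pos[OF L0] \<Phi>max[OF L0] by linarith
  then have "B * \<Phi>max > 0" using B by simp
  then have R: "R \<ge> 1" using ub[OF L0] by (simp add: R_def)
  define clamp where "clamp = (\<lambda>v. max (- R) (min R v))"
  have cR: "\<bar>clamp v\<bar> \<le> R" for v using R unfolding clamp_def by linarith
  define G where "G x v = - cubic \<Lambda> x (clamp v)" for x v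
  interpret tp: truncated_problem \<epsilon> L "R ^ 3 + \<bar>\<Lambda>\<bar> * R + 1" "3 * R\<^sup>2 + \<bar>\<Lambda>\<bar>" v0 G
  proof
    show "continuous_on ({0..L} \<times> UNIV) (\<lambda>(x, v). G x v)"
      unfolding G_def cubic_def clamp_def case_prod_unfold by (intro continuous_intros)
    show "\<bar>G x v\<bar> \<le> R ^ 3 + \<bar>\<Lambda>\<bar> * R + 1" for x v
      unfolding G_def abs_minus_cancel by (rule cubic_bound[OF cR])
    have "R\<^sup>2 > 0" using R by simp
    then show "3 * R\<^sup>2 + \<bar>\<Lambda>\<bar> > 0" by linarith
    show "\<bar>G x p - G x q\<bar> \<le> (3 * R\<^sup>2 + \<bar>\<Lambda>\<bar>) * \<bar>p - q\<bar>" for x p q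
    proof -
      have "\<bar>G x p - G x q\<bar> = \<bar>cubic \<Lambda> x (clamp p) - cubic \<Lambda> x (clamp q)\<bar>" unfolding G_def by linarith
      also have "\<dots> \<le> (3 * R\<^sup>2 + \<bar>\<Lambda>\<bar>) * \<bar>clamp p - clamp q\<bar>" by (rule cubic_lipschitz[OF cR cR])
      also have "\<dots> \<le> (3 * R\<^sup>2 + \<bar>\<Lambda>\<bar>) * \<bar>p - q\<bar>"
        unfolding clamp_def by (intro mult_left_mono clamp_lipschitz) simp
      finally show ?thesis .
    qed
  qed (use \<epsilon> Lpos v0 in auto)
  obtain v where jc: "tp.jcont v" and mv: "\<And>\<tau> x. \<tau> \<ge> 0 \<Longrightarrow> v \<tau> x = tp.mild v \<tau> x"
    using tp.mild_solution_exists by blast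
  have vc: "continuous_on ({0..} \<times> {0..L}) (\<lambda>(\<tau>, x). v \<tau> x)" using jc by (simp add: tp.jcont_def)
  have vinit: "v 0 x = v0 x" if x: "x \<in> {0..L}" for x
  proof -
    have "v 0 x = heat \<epsilon> L v0 0 x" using mv[of 0 x] by (simp add: tp.mild_def duhamel_def)
    then show ?thesis by (simp only: heat_0[OF Lpos] even_ext_eq[OF Lpos x])
  qed
  have GR: "G x y = - cubic \<Lambda> x y" if "\<bar>y\<bar> \<le> R" for x y
  proof -
    have "clamp y = y" using that unfolding clamp_def by linarith
    then show ?thesis by (simp only: G_def)
  qed
  have cl: "classical_at \<Lambda> \<epsilon> L v (tp.grad v) \<tau>"
    if \<tau>: "\<tau> > 0" and bd: "\<And>s x. s \<in> {0..\<tau>} \<Longrightarrow> x \<in> {0..L} \<Longrightarrow> \<bar>v s x - u x\<bar> \<le> B * \<Phi> x" for \<tau>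
  proof -
    let ?K = "{0..\<tau> + 1} \<times> {0..L}"
    have vR: "\<bar>v s x\<bar> \<le> R - 1" if "s \<in> {0..\<tau>}" "x \<in> {0..L}" for s x
    proof -
      have "B * \<Phi> x \<le> B * \<Phi>max" using B \<Phi>max[OF that(2)] by simp
      then show ?thesis using bd[OF that] ub[OF that(2)] unfolding R_def by linarith
    qed
    have "compact ?K" by (intro compact_Times compact_Icc)
    moreover have "continuous_on ?K (\<lambda>(\<tau>, x). v \<tau> x)" by (rule continuous_on_subset[OF vc]) auto
    ultimately have "uniformly_continuous_on ?K (\<lambda>(\<tau>, x). v \<tau> x)" by (intro compact_uniformly_continuous)
    then obtain d where d: "d > 0" "\<And>p q. p \<in> ?K \<Longrightarrow> q \<in> ?K \<Longrightarrow> dist q p < d \<Longrightarrow>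
        dist ((\<lambda>(\<tau>, x). v \<tau> x) q) ((\<lambda>(\<tau>, x). v \<tau> x) p) < 1"
      unfolding uniformly_continuous_on_def using zero_less_one by meson
    define T where "T = \<tau> + min (d / 2) 1"
    have T: "\<tau> < T" "T \<le> \<tau> + 1" "T - \<tau> < d" using d(1) by (auto simp: T_def)
    show ?thesis
    proof (rule tp.mild_classical[OF jc mv \<tau> T(1) L(1)])
      fix s x assume s: "s \<in> {0..T}" and x: "x \<in> {0..L}"
      have "\<bar>v s x\<bar> \<le> R"
      proof (cases "s \<le> \<tau>")
        case True
        then show ?thesis using vR[of s x] s x by simp
      next
        case False
        have "dist (s, x) (\<tau>, x) = s - \<tau>" using False by (simp add: dist_prod_def dist_real_def)
        then have "dist ((\<lambda>(\<tau>, x). v \<tau> x) (s, x)) ((\<lambda>(\<tau>, x). v \<tau> x) (\<tau>, x)) < 1"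
          using s x T \<tau> False by (intro d(2)) auto
        then have "\<bar>v s x - v \<tau> x\<bar> < 1" by (simp add: dist_real_def)
        moreover have "\<bar>v \<tau> x\<bar> \<le> R - 1" using \<tau> x by (intro vR) auto
        ultimately show ?thesis by linarith
      qed
      then show "G x (v s x) = - cubic \<Lambda> x (v s x)" by (rule GR)
    qed
  qed
  have "classical_at \<Lambda> \<epsilon> L v (tp.grad v) \<tau>" if "\<tau> > 0" for \<tau>
  proof (rule cl[OF that])
    fix s x assume s: "s \<in> {0..\<tau>}" and x: "x \<in> {0..L}"
    have "\<bar>v s x - u x\<bar> < B * exp (- \<gamma> * s) * \<Phi> x"
      by (rule barrier[OF \<epsilon> Lpos vc du dw ub \<Phi>c \<Phi>pos super B \<gamma> small cl])
         (use s x v0 vinit in auto)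
    also have "\<dots> \<le> B * \<Phi> x" using B \<Phi>pos[OF x] \<gamma> s by simp
    finally show "\<bar>v s x - u x\<bar> \<le> B * \<Phi> x" by simp
  qed
  then have "parabolic_solution \<Lambda> \<epsilon> L v" unfolding parabolic_solution_iff using vc by blast
  then show ?thesis using vinit by blast
qed

context bistable
begin

lemma up_profile_stable:
  assumes up: "up_profile \<epsilon> u w" and small: "up_small \<epsilon>" "super_small \<epsilon>" and k: "k > 0"
  shows "stable_attractor \<Lambda> \<epsilon> (real k * pi) u"
proof -
  define L where "L = real k * pi"
  have L: "L > 0" using k by (simp add: L_def)
  have \<epsilon>: "\<epsilon> > 0" using small by (simp add: up_small_def)
  have ode: "ode_solution_on \<Lambda> \<epsilon> UNIV u w" and w0: "w 0 = 0" using up by (auto simp: up_profile_def)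
  have wL: "w L = 0" unfolding L_def by (rule up_profile_extended(2)[OF up small(1)])
  have ode': "(u has_real_derivative w x) (at x)" "(w has_real_derivative cubic \<Lambda> x (u x) / \<epsilon>\<^sup>2) (at x)" for x
    using ode \<epsilon> by (simp_all add: ode_solution_on_iff)
  have N: "neumann_solution \<Lambda> \<epsilon> L u"
    unfolding neumann_solution_def using ode_solution_on_subset[OF ode subset_UNIV] w0 wL by blast
  have ub: "\<bar>u x\<bar> \<le> b" if "x \<in> {0..L}" for x
  proof -
    have "(x, u x) \<in> extend_set (S\<^sub>\<delta> Ulo Uup b r \<delta>)"
      using up_profile_extended(1)[OF up small(1), of k] that unfolding graph_in_def L_def by blast
    then have "- b \<le> u x \<and> u x \<le> b" unfolding extend_set_def S\<^sub>\<delta>_def by auto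
    then show ?thesis by linarith
  qed
  obtain \<Phi> \<gamma>\<^sub>0 where \<gamma>\<^sub>0: "\<gamma>\<^sub>0 > 0" and \<Phi>c: "continuous_on {0..L} \<Phi>" and \<Phi>pos: "\<And>x. \<Phi> x > 0"
    and super: "\<And>x. x \<in> {0..L} \<Longrightarrow> strict_super \<Lambda> \<epsilon> L \<gamma>\<^sub>0 u w \<Phi> x"
    using extended_supersolution[OF up small L_def] by metis
  have ne: "{0..L} \<noteq> {}" using L by simp
  obtain xm where xm: "\<And>x. x \<in> {0..L} \<Longrightarrow> \<Phi> xm \<le> \<Phi> x"
    using continuous_attains_inf[OF compact_Icc ne \<Phi>c] by blast
  obtain xM where xM: "\<And>x. x \<in> {0..L} \<Longrightarrow> \<Phi> x \<le> \<Phi> xM"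
    using continuous_attains_sup[OF compact_Icc ne \<Phi>c] by blast
  define P where "P = \<Phi> xM"
  define p where "p = \<Phi> xm"
  have P: "P > 0" and p: "p > 0" using \<Phi>pos by (simp_all add: P_def p_def)
  \<comment> \<open>Decay and quadratic error get at most a third of \<open>\<gamma>\<^sub>0\<close>
    each. A smaller amplitude C then works with the same \<gamma>, which is what stability
    uses.\<close>
  define \<gamma> where "\<gamma> = \<gamma>\<^sub>0 / (3 * P)"
  define B where "B = \<gamma>\<^sub>0 / (9 * b * P\<^sup>2)"
  have \<gamma>: "\<gamma> > 0" using \<gamma>\<^sub>0 P by (simp add: \<gamma>_def)
  have B: "B > 0" using \<gamma>\<^sub>0 P b by (simp add: B_def)
  have rate: "\<gamma> * \<Phi> x + 3 * b * C * (\<Phi> x)\<^sup>2 < \<gamma>\<^sub>0" if "x \<in> {0..L}" "0 < C" "C \<le> B" for x C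
  proof -
    have le: "\<Phi> x \<le> P" using xM[OF that(1)] by (simp add: P_def)
    have "\<gamma> * \<Phi> x \<le> \<gamma> * P" using le \<gamma> by simp
    moreover have "\<gamma> * P = \<gamma>\<^sub>0 / 3" using P by (simp add: \<gamma>_def)
    moreover have "3 * b * C * (\<Phi> x)\<^sup>2 \<le> 3 * b * B * P\<^sup>2"
      using b that le \<Phi>pos[of x] B by (intro mult_mono power_mono) auto
    moreover have "3 * b * B * P\<^sup>2 = \<gamma>\<^sub>0 / 3" using P b by (simp add: B_def)
    ultimately show ?thesis using \<gamma>\<^sub>0 by linarith
  qed
  have decay: "\<bar>v \<tau> x - u x\<bar> < C * P * exp (- \<gamma> * \<tau>)"
    if v: "parabolic_solution \<Lambda> \<epsilon> L v" and C: "0 < C" "C \<le> B"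
      and init: "\<And>x. x \<in> {0..L} \<Longrightarrow> \<bar>v 0 x - u x\<bar> < C * p" and \<tau>: "\<tau> \<ge> 0" and x: "x \<in> {0..L}" for v C \<tau> x
  proof -
    have vc: "continuous_on ({0..} \<times> {0..L}) (\<lambda>(\<tau>, x). v \<tau> x)" and "\<exists>vx. \<forall>\<tau>>0. classical_at \<Lambda> \<epsilon> L v vx \<tau>"
      using v unfolding parabolic_solution_iff by blast+
    then obtain vx where vx: "\<And>\<tau>. \<tau> > 0 \<Longrightarrow> classical_at \<Lambda> \<epsilon> L v vx \<tau>" by blast
    have init': "\<bar>v 0 y - u y\<bar> < C * \<Phi> y" if "y \<in> {0..L}" for y
    proof -
      have "C * p \<le> C * \<Phi> y" using xm[OF that] C by (simp add: p_def)
      then show ?thesis using init[OF that] by linarith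
    qed
    have "\<bar>v \<tau> x - u x\<bar> < C * exp (- \<gamma> * \<tau>) * \<Phi> x"
      by (rule barrier[OF \<epsilon> L vc ode' ub \<Phi>c \<Phi>pos super C(1) \<gamma> rate[OF _ C] vx init' \<tau> x])
    also have "\<dots> \<le> C * exp (- \<gamma> * \<tau>) * P" using xM[OF x] C by (simp add: P_def)
    finally show ?thesis by (simp only: mult.commute mult.left_commute)
  qed
  have "\<exists>\<rho>>0. \<forall>v\<^sub>0. continuous_on {0..L} v\<^sub>0 \<and> (\<forall>x\<in>{0..L}. \<bar>v\<^sub>0 x - u x\<bar> < \<rho>) \<longrightarrow>
        (\<exists>v. parabolic_solution \<Lambda> \<epsilon> L v \<and> (\<forall>x\<in>{0..L}. v 0 x = v\<^sub>0 x))"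
  proof (rule exI[of _ "B * p"], intro conjI allI impI)
    fix v0 assume v0: "continuous_on {0..L} v0 \<and> (\<forall>x\<in>{0..L}. \<bar>v0 x - u x\<bar> < B * p)"
    show "\<exists>v. parabolic_solution \<Lambda> \<epsilon> L v \<and> (\<forall>x\<in>{0..L}. v 0 x = v0 x)"
    proof (rule parabolic_solution_below_barrier[OF \<epsilon> L_def k ode' ub \<Phi>c \<Phi>pos xM super B \<gamma> rate[OF _ B order_refl]])
      show "continuous_on {0..L} v0" using v0 by blast
      fix x assume x: "x \<in> {0..L}"
      have "B * p \<le> B * \<Phi> x" using xm[OF x] B by (simp add: p_def)
      moreover have "\<bar>v0 x - u x\<bar> < B * p" using v0 x by blast
      ultimately show "\<bar>v0 x - u x\<bar> < B * \<Phi> x" by linarith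
    qed
  qed (use B p in simp)
  moreover have "\<exists>\<rho>>0. \<forall>v. parabolic_solution \<Lambda> \<epsilon> L v \<and>
        (\<forall>x\<in>{0..L}. \<bar>v 0 x - u x\<bar> < \<rho>) \<longrightarrow> (\<forall>\<tau>\<ge>0. \<forall>x\<in>{0..L}. \<bar>v \<tau> x - u x\<bar> < \<eta>)" if \<eta>: "\<eta> > 0" for \<eta>
  proof -
    define C where "C = min B (\<eta> / P)"
    have C: "0 < C" "C \<le> B" "C \<le> \<eta> / P" using B \<eta> P by (simp_all add: C_def)
    have CP: "C * P \<le> \<eta>" using C(3) P by (simp add: pos_le_divide_eq)
    show ?thesis
    proof (rule exI[of _ "C * p"], intro conjI allI impI ballI)
      fix v :: "real \<Rightarrow> real \<Rightarrow> real" and \<tau> x :: real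
      assume v: "parabolic_solution \<Lambda> \<epsilon> L v \<and> (\<forall>x\<in>{0..L}. \<bar>v 0 x - u x\<bar> < C * p)"
        and \<tau>: "0 \<le> \<tau>" and x: "x \<in> {0..L}"
      have "\<bar>v \<tau> x - u x\<bar> < C * P * exp (- \<gamma> * \<tau>)" by (rule decay[OF _ C(1,2) _ \<tau> x]) (use v in auto)
      also have "\<dots> \<le> C * P" using C P \<gamma> \<tau> by simp
      finally show "\<bar>v \<tau> x - u x\<bar> < \<eta>" using CP by linarith
    qed (use C p in simp)
  qed
  moreover have "\<exists>\<rho>>0. \<forall>v. parabolic_solution \<Lambda> \<epsilon> L v \<and>
        (\<forall>x\<in>{0..L}. \<bar>v 0 x - u x\<bar> < \<rho>) \<longrightarrow> uniform_limit {0..L} v u at_top"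
  proof (rule exI[of _ "B * p"], intro conjI allI impI)
    fix v assume v: "parabolic_solution \<Lambda> \<epsilon> L v \<and> (\<forall>x\<in>{0..L}. \<bar>v 0 x - u x\<bar> < B * p)"
    show "uniform_limit {0..L} v u at_top"
    proof (rule uniform_limitI)
      fix e :: real assume e: "e > 0"
      have "((\<lambda>\<tau>. B * P * exp (- \<gamma> * \<tau>)) \<longlongrightarrow> 0) at_top" using \<gamma> by real_asymp
      then have "\<forall>\<^sub>F \<tau> in at_top. B * P * exp (- \<gamma> * \<tau>) < e" using e by (rule order_tendstoD)
      then show "\<forall>\<^sub>F \<tau> in at_top. \<forall>x\<in>{0..L}. dist (v \<tau> x) (u x) < e"
        using eventually_ge_at_top[of 0]
      proof eventually_elim
        case (elim \<tau>)
        show ?case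
        proof
          fix x assume x: "x \<in> {0..L}"
          have "\<bar>v \<tau> x - u x\<bar> < B * P * exp (- \<gamma> * \<tau>)"
            by (rule decay[OF _ B order_refl _ elim(2) x]) (use v in auto)
          then show "dist (v \<tau> x) (u x) < e" using elim(1) by (simp only: dist_real_def)
        qed
      qed
    qed
  qed (use B p in simp)
  ultimately show ?thesis unfolding stable_attractor_def L_def[symmetric] using N by blast
qed

end

theorem theorem34:
  fixes \<Lambda> b r\<^sub>1 \<mu> \<delta> :: real and Ulo Umid Uup :: "real \<Rightarrow> real"
  assumes "\<Lambda> > 3 / 2 powr (2 / 3)"
    and "\<And>t. Ulo t < Umid t \<and> Umid t < Uup t"
    and "\<And>t. cubic \<Lambda> t (Ulo t) = 0 \<and> cubic \<Lambda> t (Umid t) = 0 \<and> cubic \<Lambda> t (Uup t) = 0"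
    and "b > 0" and "b ^ 3 - \<Lambda> * b - 1 > 0"
    and "0 < r\<^sub>1" and "r\<^sub>1 < 1 / 2"
    and "\<mu> = integral {(1 - r\<^sub>1) * pi .. (1 - r\<^sub>1 / 2) * pi} sin"
    and "\<delta> > 0"
    and "\<delta> < Ulo (r\<^sub>1 / 2 * pi) - Ulo 0"
    and "\<And>t u. Uup t - \<delta> < u \<Longrightarrow> u < Uup t \<Longrightarrow> \<bar>cubic \<Lambda> t u\<bar> < \<mu>"
  shows "\<exists>\<epsilon>\<^sub>0>0. \<forall>\<epsilon>. 0 < \<epsilon> \<and> \<epsilon> < \<epsilon>\<^sub>0 \<longrightarrow>
    (\<forall>v. periodic_neumann_solution \<Lambda> \<epsilon> v \<and> graph_in pi v (S\<^sub>\<delta> Ulo Uup b r\<^sub>1 \<delta>)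
         \<longleftrightarrow> v = u\<^sub>p \<Lambda> \<epsilon>) \<and>
    stable_attractor \<Lambda> \<epsilon> pi (u\<^sub>p \<Lambda> \<epsilon>) \<and>
    (\<forall>k::nat. k > 0 \<longrightarrow>
      (\<forall>v. neumann_solution \<Lambda> \<epsilon> (real k * pi) v \<and>
           graph_in (real k * pi) v (extend_set (S\<^sub>\<delta> Ulo Uup b r\<^sub>1 \<delta>))
           \<longleftrightarrow> (\<forall>t\<in>{0..real k * pi}. v t = u\<^sub>p \<Lambda> \<epsilon> t)) \<and>
      stable_attractor \<Lambda> \<epsilon> (real k * pi) (u\<^sub>p \<Lambda> \<epsilon>))"
proof -
  interpret bistable \<Lambda> b r\<^sub>1 \<delta> Ulo Umid Uup
    by unfold_locales (use assms in blast)+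
  \<comment> \<open>None of the three smallness conditions involves k, so one threshold serves all
    lengths.\<close>
  have "\<forall>\<^sub>F \<epsilon> in at_right 0. eps_small \<epsilon> \<and> up_small \<epsilon> \<and> super_small \<epsilon>"
    using eventually_eps_small eventually_up_small eventually_super_small by eventually_elim blast
  then obtain \<epsilon>\<^sub>0 where \<epsilon>\<^sub>0: "\<epsilon>\<^sub>0 > 0" "\<And>\<epsilon>. 0 < \<epsilon> \<Longrightarrow> \<epsilon> < \<epsilon>\<^sub>0 \<Longrightarrow> eps_small \<epsilon> \<and> up_small \<epsilon> \<and> super_small \<epsilon>"
    unfolding eventually_at_right_field by blast
  show ?thesis
  proof (rule exI[of _ \<epsilon>\<^sub>0], intro conjI allI impI \<epsilon>\<^sub>0(1))
    fix \<epsilon> assume e: "0 < \<epsilon> \<and> \<epsilon> < \<epsilon>\<^sub>0"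
    have \<epsilon>: "0 < \<epsilon>" using e by blast
    have small: "eps_small \<epsilon>" "up_small \<epsilon>" "super_small \<epsilon>" using \<epsilon>\<^sub>0(2)[of \<epsilon>] e by blast+
    obtain u w where "up_profile \<epsilon> u w" using up_profile_exists[OF \<epsilon>] .
    then have up: "up_profile \<epsilon> (u\<^sub>p \<Lambda> \<epsilon>) w" by (rule u\<^sub>p_profile[OF small(1,2)])
    then have ode: "ode_solution_on \<Lambda> \<epsilon> UNIV (u\<^sub>p \<Lambda> \<epsilon>) w" and w0: "w 0 = 0"
      and per: "\<And>t. u\<^sub>p \<Lambda> \<epsilon> (t + 2 * pi) = u\<^sub>p \<Lambda> \<epsilon> t" by (auto simp: up_profile_def)
    note ext = up_profile_extended[OF up small(2)]
    show "periodic_neumann_solution \<Lambda> \<epsilon> v \<and> graph_in pi v (S\<^sub>\<delta> Ulo Uup b r\<^sub>1 \<delta>) \<longleftrightarrow> v = u\<^sub>p \<Lambda> \<epsilon>" for v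
    proof
      assume "periodic_neumann_solution \<Lambda> \<epsilon> v \<and> graph_in pi v (S\<^sub>\<delta> Ulo Uup b r\<^sub>1 \<delta>)"
      then obtain x where "ode_solution_on \<Lambda> \<epsilon> UNIV v x" "graph_in pi v (S\<^sub>\<delta> Ulo Uup b r\<^sub>1 \<delta>)" "x 0 = 0" "x pi = 0"
        unfolding periodic_neumann_solution_def by blast
      then show "v = u\<^sub>p \<Lambda> \<epsilon>" by (rule up_eqI[OF small(1,2) up])
    next
      assume v: "v = u\<^sub>p \<Lambda> \<epsilon>"
      have "w pi = 0" using ext(2)[of 1] by simp
      then have "periodic_neumann_solution \<Lambda> \<epsilon> v"
        unfolding periodic_neumann_solution_def v using ode per w0 by blast
      moreover have "graph_in pi v (S\<^sub>\<delta> Ulo Uup b r\<^sub>1 \<delta>)"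
        unfolding v by (rule layer.graph[OF up_profile_layer[OF up small(2)]])
      ultimately show "periodic_neumann_solution \<Lambda> \<epsilon> v \<and> graph_in pi v (S\<^sub>\<delta> Ulo Uup b r\<^sub>1 \<delta>)" ..
    qed
    show st: "stable_attractor \<Lambda> \<epsilon> (real k * pi) (u\<^sub>p \<Lambda> \<epsilon>)" if "k > 0" for k
      by (rule up_profile_stable[OF up small(2,3) that])
    show "stable_attractor \<Lambda> \<epsilon> pi (u\<^sub>p \<Lambda> \<epsilon>)" using st[of 1] by simp
    fix k :: nat and v assume k: "k > 0"
    let ?I = "{0..real k * pi}"
    have odek: "ode_solution_on \<Lambda> \<epsilon> ?I (u\<^sub>p \<Lambda> \<epsilon>) w" by (rule ode_solution_on_subset[OF ode]) simp
    show "neumann_solution \<Lambda> \<epsilon> (real k * pi) v \<and> graph_in (real k * pi) v (extend_set (S\<^sub>\<delta> Ulo Uup b r\<^sub>1 \<delta>))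
      \<longleftrightarrow> (\<forall>t\<in>?I. v t = u\<^sub>p \<Lambda> \<epsilon> t)"
    proof
      assume v: "neumann_solution \<Lambda> \<epsilon> (real k * pi) v \<and> graph_in (real k * pi) v (extend_set (S\<^sub>\<delta> Ulo Uup b r\<^sub>1 \<delta>))"
      then obtain x where x: "ode_solution_on \<Lambda> \<epsilon> ?I v x" "x 0 = 0" "x (real k * pi) = 0"
        unfolding neumann_solution_def by blast
      show "\<forall>t\<in>?I. v t = u\<^sub>p \<Lambda> \<epsilon> t"
        by (intro ballI, rule neumann_unique[OF x(1) odek small(1) k _ ext(1) x(2) w0 x(3) ext(2)]) (use v in blast)+
    next
      assume v: "\<forall>t\<in>?I. v t = u\<^sub>p \<Lambda> \<epsilon> t"
      have "ode_solution_on \<Lambda> \<epsilon> ?I v w" by (rule ode_solution_on_cong[OF odek]) (use v in auto)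
      then have "neumann_solution \<Lambda> \<epsilon> (real k * pi) v"
        unfolding neumann_solution_def using w0 ext(2)[of k] by blast
      moreover have "graph_in (real k * pi) v (extend_set (S\<^sub>\<delta> Ulo Uup b r\<^sub>1 \<delta>))"
        using ext(1)[of k] v unfolding graph_in_def by simp
      ultimately show "neumann_solution \<Lambda> \<epsilon> (real k * pi) v \<and> graph_in (real k * pi) v (extend_set (S\<^sub>\<delta> Ulo Uup b r\<^sub>1 \<delta>))" ..
    qed
  qed
qed

end
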